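(* Let $k$ be a field of characteristic different from $2$ and $3$. For a $3$-graded Lie algebra $L=L_{-1}\oplus L_0\oplus L_1$ over $k$ (with an anti-graded involution) such that $L$ is $0$-perfect, the following two conditions are equivalent: (i) $H_2^{\rm gr}(L)=0$; (ii) $H^2_{\rm gr}(L,M)=0$ for every graded $L$-module $M$ with the trivial grading $M=M_0$. Moreover, the category of Jordan triple systems over $k$ is equivalent to the category whose objects are the $3$-graded Lie algebras $L=L_{-1}\oplus L_0\oplus L_1$ over $k$ with a fixed anti-graded involution such that $L$ is $0$-perfect and satisfies one of the equivalent conditions (i), (ii), and whose morphisms are the graded involutary homomorphisms.
   Context: All modules and algebras are over $k$. A Jordan triple system is a $k$-module $T$ with a trilinear map $\{\,,\,,\,\}:T\times T\times T\to T$ such that, writing $V_{a,b}c=\{a,b,c\}$, one has $\{a,b,c\}=\{c,b,a\}$ and $[V_{a,b},V_{c,d}]=V_{V_{a,b}c,d}-V_{c,V_{b,a}d}$ for all $a,b,c,d\in T$. Homomorphisms are linear maps preserving the triple product. A $3$-graded Lie algebra is a Lie algebra $L=L_{-1}\oplus L_0\oplus L_1$ with $[L_i,L_j]\subseteq L_{i+j}$ ($L_i=0$ for $|i|>1$). It is $0$-perfect if $L_0=[L_{-1},L_1]$ (span of commutators). A homomorphism $\alpha:L\to K$ is graded if $\alpha(L_i)\subseteq K_i$. An anti-graded involution of $L$ is a Lie algebra homomorphism $\varepsilon:L\to L$ with $\varepsilon^2=\mathrm{id}_L$ and $\varepsilon(L_i)\subseteq L_{-i}$. A homomorphism $\alpha:(L,\varepsilon_L)\to(K,\varepsilon_K)$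 is involutary if $\alpha\varepsilon_L=\varepsilon_K\alpha$. A graded $L$-module is $M=\bigoplus_{i\in\mathbb Z}M_i$ with $L_iM_j\subseteq M_{i+j}$. Graded (co)homology. Let $\delta_n:\wedge^{n+1}L\to\wedge^nL$ be $\delta_n(x_1\wedge\dots\wedge x_{n+1})=\sum_{1\le i<j\le n+1}(-1)^{i+j}[x_i,x_j]\wedge x_1\wedge\dots\wedge\widehat{x_i}\wedge\dots\wedge\widehat{x_j}\wedge\dots\wedge x_{n+1}$. Let $(\wedge^nL)_i=\sum_{i_1+\dots+i_n=i}L_{i_1}\wedge\dots\wedge L_{i_n}$; the maps $\delta_n$ preserve this grading. $H_*^{\rm gr}(L)$ is the homology of the degree-$0$ complex $\cdots\to(\wedge^{n+1}L)_0\xrightarrow{\delta_n}(\wedge^nL)_0\to\cdots$; so $H_2^{\rm gr}(L)=\ker(\delta_1|_{(\wedge^2L)_0})/\delta_2((\wedge^3L)_0)$. For a graded $L$-module $M$ on which $L$ acts trivially (this is automatic if $M=M_0$ and $L$ is $0$-perfect), let $(\mathrm{Hom}_k(\wedge^nL,M))_0$ be the space of linear $f$ with $f(L_{i_1}\wedge\dots\wedge L_{i_n})\subseteq M_{i_1+\dots+i_n}$. $H^*_{\rm gr}(L,M)$ is the cohomology of the complex $\cdots\to(\mathrm{Hom}_k(\wedge^nL,M))_0\xrightarrow{\delta^n}(\mathrm{Hom}_k(\wedge^{n+1}L,M))_0\to\cdots$ with $\delta^n(f)=f\circ\delta_n$; $H^2_{\rm gr}(L,M)$ is the cohomology at $n=2$.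 *)

theory Defs
  imports
    "HOL-Algebra.Module"
    "HOL-Algebra.AbelCoset"
    "HOL-Algebra.Multiplicative_Group"
    "HOL-Library.Equipollence"
begin

section \<open>Linear algebra over a commutative ring\<close>

text \<open>The additive order of the unit, which is 0 if that order is infinite.\<close>

definition characteristic :: "('k, 'r) ring_scheme \<Rightarrow> nat" where
  "characteristic R = group.ord (add_monoid R) \<one>\<^bsub>R\<^esub>"

definition linear_map ::
  "('k, 'r) ring_scheme \<Rightarrow> ('k, 'a, 'x) module_scheme \<Rightarrow> ('k, 'b, 'y) module_scheme
     \<Rightarrow> ('a \<Rightarrow> 'b) \<Rightarrow> bool" where
  "linear_map R M N f \<longleftrightarrow>
     f \<in> carrier M \<rightarrow> carrier N \<and>
     (\<forall>x\<in>carrier M. \<forall>y\<in>carrier M. f (x \<oplus>\<^bsub>M\<^esub> y) = f x \<oplus>\<^bsub>N\<^esub> f y) \<and>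
     (\<forall>a\<in>carrier R. \<forall>x\<in>carrier M. f (a \<odot>\<^bsub>M\<^esub> x) = a \<odot>\<^bsub>N\<^esub> f x)"

text \<open>Maps between carriers are made \<open>undefined\<close> off the carrier, so that equality of functions is
  equality of maps.\<close>

definition linear_hom ::
  "('k, 'r) ring_scheme \<Rightarrow> ('k, 'a, 'x) module_scheme \<Rightarrow> ('k, 'b, 'y) module_scheme
     \<Rightarrow> ('a \<Rightarrow> 'b) set" where
  "linear_hom R M N = {f \<in> extensional (carrier M). linear_map R M N f}"

definition lin_span ::
  "('k, 'r) ring_scheme \<Rightarrow> ('k, 'a, 'x) module_scheme \<Rightarrow> 'a set \<Rightarrow> 'a set" where
  "lin_span R M S = \<Inter>{N. submodule N R M \<and> S \<subseteq> N}"

text \<open>The multiplicative part of a module record carries no meaning and is left \<open>undefined\<close>.\<close>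

definition quot_module ::
  "('k, 'a, 'x) module_scheme \<Rightarrow> 'a set \<Rightarrow> ('k, 'a set) module" where
  "quot_module M N =
     \<lparr>carrier = a_rcosets\<^bsub>M\<^esub> N, mult = undefined, one = undefined,
      zero = N, add = set_add M,
      smult = (\<lambda>a X. \<Union>x\<in>X. N +>\<^bsub>M\<^esub> (a \<odot>\<^bsub>M\<^esub> x))\<rparr>"

definition zero_module :: "('k, 'a, 'x) module_scheme \<Rightarrow> bool" where
  "zero_module M \<longleftrightarrow> carrier M = {\<zero>\<^bsub>M\<^esub>}"

definition free_module :: "('k, 'r) ring_scheme \<Rightarrow> 'b set \<Rightarrow> ('k, 'b \<Rightarrow> 'k) module" where
  "free_module R B =
     \<lparr>carrier = {f. (\<forall>b. f b \<in> carrier R) \<and> (\<forall>b. b \<notin> B \<longrightarrow> f b = \<zero>\<^bsub>R\<^esub>)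
                    \<and> finite {b. f b \<noteq> \<zero>\<^bsub>R\<^esub>}},
      mult = undefined, one = undefined,
      zero = (\<lambda>b. \<zero>\<^bsub>R\<^esub>), add = (\<lambda>f g b. f b \<oplus>\<^bsub>R\<^esub> g b),
      smult = (\<lambda>a f b. a \<otimes>\<^bsub>R\<^esub> f b)\<rparr>"

definition basis_vec :: "('k, 'r) ring_scheme \<Rightarrow> 'b \<Rightarrow> 'b \<Rightarrow> 'k" where
  "basis_vec R b = (\<lambda>c. if c = b then \<one>\<^bsub>R\<^esub> else \<zero>\<^bsub>R\<^esub>)"

text \<open>\<open>M\<close> is the internal direct sum of the family \<open>G\<close>.\<close>

definition graded_module ::
  "('k, 'r) ring_scheme \<Rightarrow> ('k, 'a, 'x) module_scheme \<Rightarrow> (int \<Rightarrow> 'a set) \<Rightarrow> bool" where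
  "graded_module R M G \<longleftrightarrow>
     module R M \<and> (\<forall>i. submodule (G i) R M) \<and>
     (\<forall>x\<in>carrier M. \<exists>!c. (\<forall>i. c i \<in> G i) \<and> finite {i. c i \<noteq> \<zero>\<^bsub>M\<^esub>} \<and>
        x = (\<Oplus>\<^bsub>M\<^esub>i\<in>{i. c i \<noteq> \<zero>\<^bsub>M\<^esub>}. c i))"


section \<open>Jordan triple systems\<close>

record ('k, 'a) jordan_triple = "('k, 'a) module" +
  triple :: "'a \<Rightarrow> 'a \<Rightarrow> 'a \<Rightarrow> 'a"

definition V_op :: "('k, 'a, 'x) jordan_triple_scheme \<Rightarrow> 'a \<Rightarrow> 'a \<Rightarrow> 'a \<Rightarrow> 'a" where
  "V_op T a b c = triple T a b c"

locale jordan_triple_system = module R T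
  for R :: "('k, 'r) ring_scheme" and T :: "('k, 'a, 'x) jordan_triple_scheme" +
  assumes triple_linear1:
      "\<lbrakk>b \<in> carrier T; c \<in> carrier T\<rbrakk> \<Longrightarrow> linear_map R T T (\<lambda>a. triple T a b c)"
    and triple_linear2:
      "\<lbrakk>a \<in> carrier T; c \<in> carrier T\<rbrakk> \<Longrightarrow> linear_map R T T (\<lambda>b. triple T a b c)"
    and triple_linear3:
      "\<lbrakk>a \<in> carrier T; b \<in> carrier T\<rbrakk> \<Longrightarrow> linear_map R T T (\<lambda>c. triple T a b c)"
    and triple_sym:
      "\<lbrakk>a \<in> carrier T; b \<in> carrier T; c \<in> carrier T\<rbrakk> \<Longrightarrow> triple T a b c = triple T c b a"
    and V_commutator:
      "\<lbrakk>a \<in> carrier T; b \<in> carrier T; c \<in> carrier T; d \<in> carrier T; e \<in> carrier T\<rbrakk> \<Longrightarrow>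
         V_op T a b (V_op T c d e) \<ominus>\<^bsub>T\<^esub> V_op T c d (V_op T a b e)
         = V_op T (V_op T a b c) d e \<ominus>\<^bsub>T\<^esub> V_op T c (V_op T b a d) e"

definition jts_hom ::
  "('k, 'r) ring_scheme \<Rightarrow> ('k, 'a, 'x) jordan_triple_scheme
     \<Rightarrow> ('k, 'b, 'y) jordan_triple_scheme \<Rightarrow> ('a \<Rightarrow> 'b) set" where
  "jts_hom R S T =
     {f \<in> linear_hom R S T. \<forall>a\<in>carrier S. \<forall>b\<in>carrier S. \<forall>c\<in>carrier S.
        f (triple S a b c) = triple T (f a) (f b) (f c)}"


section \<open>Graded Lie algebras and graded modules\<close>

record ('k, 'a) graded_lie = "('k, 'a) module" +
  bracket :: "'a \<Rightarrow> 'a \<Rightarrow> 'a"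
  grade :: "int \<Rightarrow> 'a set"

record ('k, 'a) inv_graded_lie = "('k, 'a) graded_lie" +
  invol :: "'a \<Rightarrow> 'a"

locale lie_algebra = module R L
  for R :: "('k, 'r) ring_scheme" and L :: "('k, 'a, 'x) graded_lie_scheme" +
  assumes bracket_linear1: "y \<in> carrier L \<Longrightarrow> linear_map R L L (\<lambda>x. bracket L x y)"
    and bracket_linear2: "x \<in> carrier L \<Longrightarrow> linear_map R L L (\<lambda>y. bracket L x y)"
    and bracket_alt: "x \<in> carrier L \<Longrightarrow> bracket L x x = \<zero>\<^bsub>L\<^esub>"
    and jacobi: "\<lbrakk>x \<in> carrier L; y \<in> carrier L; z \<in> carrier L\<rbrakk> \<Longrightarrow>
        bracket L x (bracket L y z) \<oplus>\<^bsub>L\<^esub> bracket L y (bracket L z x)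
          \<oplus>\<^bsub>L\<^esub> bracket L z (bracket L x y) = \<zero>\<^bsub>L\<^esub>"

locale three_graded_lie_algebra = lie_algebra R L
  for R :: "('k, 'r) ring_scheme" and L :: "('k, 'a, 'x) graded_lie_scheme" +
  assumes graded: "graded_module R L (grade L)"
    and bracket_grade:
      "\<lbrakk>x \<in> grade L i; y \<in> grade L j\<rbrakk> \<Longrightarrow> bracket L x y \<in> grade L (i + j)"
    and three_graded: "\<bar>i\<bar> > 1 \<Longrightarrow> grade L i = {\<zero>\<^bsub>L\<^esub>}"

definition zero_perfect ::
  "('k, 'r) ring_scheme \<Rightarrow> ('k, 'a, 'x) graded_lie_scheme \<Rightarrow> bool" where
  "zero_perfect R L \<longleftrightarrow>
     grade L 0 = lin_span R L {bracket L x y | x y. x \<in> grade L (- 1) \<and> y \<in> grade L 1}"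

definition lie_hom ::
  "('k, 'r) ring_scheme \<Rightarrow> ('k, 'a, 'x) graded_lie_scheme \<Rightarrow> ('k, 'b, 'y) graded_lie_scheme
     \<Rightarrow> ('a \<Rightarrow> 'b) \<Rightarrow> bool" where
  "lie_hom R L K f \<longleftrightarrow> linear_map R L K f \<and>
     (\<forall>x\<in>carrier L. \<forall>y\<in>carrier L. f (bracket L x y) = bracket K (f x) (f y))"

definition anti_graded_involution ::
  "('k, 'r) ring_scheme \<Rightarrow> ('k, 'a, 'x) graded_lie_scheme \<Rightarrow> ('a \<Rightarrow> 'a) \<Rightarrow> bool" where
  "anti_graded_involution R L e \<longleftrightarrow>
     lie_hom R L L e \<and> (\<forall>x\<in>carrier L. e (e x) = x) \<and> (\<forall>i. e ` grade L i \<subseteq> grade L (- i))"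

definition graded_involutary_hom ::
  "('k, 'r) ring_scheme \<Rightarrow> ('k, 'a, 'x) inv_graded_lie_scheme
     \<Rightarrow> ('k, 'b, 'y) inv_graded_lie_scheme \<Rightarrow> ('a \<Rightarrow> 'b) set" where
  "graded_involutary_hom R L K =
     {f \<in> extensional (carrier L). lie_hom R L K f \<and>
        (\<forall>i. f ` grade L i \<subseteq> grade K i) \<and>
        (\<forall>x\<in>carrier L. f (invol L x) = invol K (f x))}"

record ('k, 'a, 'm) graded_lie_mod = "('k, 'm) module" +
  act :: "'a \<Rightarrow> 'm \<Rightarrow> 'm"
  mgrade :: "int \<Rightarrow> 'm set"

locale graded_lie_module = module R M
  for R :: "('k, 'r) ring_scheme" and L :: "('k, 'a, 'x) graded_lie_scheme"
    and M :: "('k, 'a, 'm, 'y) graded_lie_mod_scheme" +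
  assumes act_linear1: "m \<in> carrier M \<Longrightarrow> linear_map R L M (\<lambda>x. act M x m)"
    and act_linear2: "x \<in> carrier L \<Longrightarrow> linear_map R M M (\<lambda>m. act M x m)"
    and act_bracket: "\<lbrakk>x \<in> carrier L; y \<in> carrier L; m \<in> carrier M\<rbrakk> \<Longrightarrow>
        act M (bracket L x y) m = act M x (act M y m) \<ominus>\<^bsub>M\<^esub> act M y (act M x m)"
    and mgraded: "graded_module R M (mgrade M)"
    and act_grade: "\<lbrakk>x \<in> grade L i; m \<in> mgrade M j\<rbrakk> \<Longrightarrow> act M x m \<in> mgrade M (i + j)"


section \<open>Exterior powers\<close>

text \<open>The exterior power is the free module on the lists of length \<open>n\<close>, modulo multilinearity in
  each entry and modulo the lists with a repeated entry.\<close>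

definition tuples :: "('k, 'a, 'x) module_scheme \<Rightarrow> nat \<Rightarrow> 'a list set" where
  "tuples L n = {xs. length xs = n \<and> set xs \<subseteq> carrier L}"

definition tuple_module ::
  "('k, 'r) ring_scheme \<Rightarrow> ('k, 'a, 'x) module_scheme \<Rightarrow> nat \<Rightarrow> ('k, 'a list \<Rightarrow> 'k) module" where
  "tuple_module R L n = free_module R (tuples L n)"

definition ext_relations ::
  "('k, 'r) ring_scheme \<Rightarrow> ('k, 'a, 'x) module_scheme \<Rightarrow> nat \<Rightarrow> ('a list \<Rightarrow> 'k) set" where
  "ext_relations R L n = lin_span R (tuple_module R L n)
     ({basis_vec R (xs[i := x \<oplus>\<^bsub>L\<^esub> y]) \<ominus>\<^bsub>tuple_module R L n\<^esub>
         (basis_vec R (xs[i := x]) \<oplus>\<^bsub>tuple_module R L n\<^esub> basis_vec R (xs[i := y]))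
        | xs i x y. xs \<in> tuples L n \<and> i < n \<and> x \<in> carrier L \<and> y \<in> carrier L} \<union>
      {basis_vec R (xs[i := a \<odot>\<^bsub>L\<^esub> x]) \<ominus>\<^bsub>tuple_module R L n\<^esub>
         (a \<odot>\<^bsub>tuple_module R L n\<^esub> basis_vec R (xs[i := x]))
        | xs i a x. xs \<in> tuples L n \<and> i < n \<and> a \<in> carrier R \<and> x \<in> carrier L} \<union>
      {basis_vec R xs | xs. xs \<in> tuples L n \<and> \<not> distinct xs})"

definition ext_power ::
  "('k, 'r) ring_scheme \<Rightarrow> ('k, 'a, 'x) module_scheme \<Rightarrow> nat
     \<Rightarrow> ('k, ('a list \<Rightarrow> 'k) set) module" where
  "ext_power R L n = quot_module (tuple_module R L n) (ext_relations R L n)"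

definition wedge ::
  "('k, 'r) ring_scheme \<Rightarrow> ('k, 'a, 'x) module_scheme \<Rightarrow> 'a list \<Rightarrow> ('a list \<Rightarrow> 'k) set" where
  "wedge R L xs =
     ext_relations R L (length xs) +>\<^bsub>tuple_module R L (length xs)\<^esub> basis_vec R xs"

text \<open>\<open>L\<^bsub>i1\<^esub> \<and> \<dots> \<and> L\<^bsub>in\<^esub>\<close>, for the list \<open>ds = [i1, \<dots>, in]\<close> of degrees.\<close>

definition wedge_of_degrees ::
  "('k, 'r) ring_scheme \<Rightarrow> ('k, 'a, 'x) graded_lie_scheme \<Rightarrow> int list
     \<Rightarrow> ('a list \<Rightarrow> 'k) set set" where
  "wedge_of_degrees R L ds = lin_span R (ext_power R L (length ds))
     {wedge R L xs | xs. list_all2 (\<lambda>x i. x \<in> grade L i) xs ds}"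

definition ext_grade ::
  "('k, 'r) ring_scheme \<Rightarrow> ('k, 'a, 'x) graded_lie_scheme \<Rightarrow> nat \<Rightarrow> int
     \<Rightarrow> ('a list \<Rightarrow> 'k) set set" where
  "ext_grade R L n i = lin_span R (ext_power R L n)
     (\<Union>ds\<in>{ds. length ds = n \<and> sum_list ds = i}. wedge_of_degrees R L ds)"

text \<open>The linear map from the exterior power of degree \<open>n + 1\<close> to that of degree \<open>n\<close>, determined
  by its values on the generators. List positions start at 0 rather than 1, which does not change
  the parity of \<open>i + j\<close>.\<close>

definition ext_delta ::
  "('k, 'r) ring_scheme \<Rightarrow> ('k, 'a, 'x) graded_lie_scheme \<Rightarrow> nat
     \<Rightarrow> ('a list \<Rightarrow> 'k) set \<Rightarrow> ('a list \<Rightarrow> 'k) set" where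
  "ext_delta R L n = (THE d. d \<in> linear_hom R (ext_power R L (Suc n)) (ext_power R L n) \<and>
     (\<forall>xs\<in>tuples L (Suc n). d (wedge R L xs) =
        (\<Oplus>\<^bsub>ext_power R L n\<^esub>p\<in>{(i, j). i < j \<and> j < Suc n}.
           ((\<ominus>\<^bsub>R\<^esub> \<one>\<^bsub>R\<^esub>) [^]\<^bsub>R\<^esub> (fst p + snd p)) \<odot>\<^bsub>ext_power R L n\<^esub>
             wedge R L (bracket L (xs ! fst p) (xs ! snd p) # nths xs (- {fst p, snd p})))))"


section \<open>Graded homology and cohomology in degree 2\<close>

definition H2_gr_homology ::
  "('k, 'r) ring_scheme \<Rightarrow> ('k, 'a, 'x) graded_lie_scheme
     \<Rightarrow> ('k, ('a list \<Rightarrow> 'k) set set) module" where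
  "H2_gr_homology R L = quot_module
     ((ext_power R L 2)\<lparr>carrier :=
        {c \<in> ext_grade R L 2 0. ext_delta R L 1 c = \<zero>\<^bsub>ext_power R L 1\<^esub>}\<rparr>)
     (ext_delta R L 2 ` ext_grade R L 3 0)"

text \<open>The degree-preserving linear maps from the exterior power to \<open>M\<close>. The action on \<open>M\<close> does
  not enter, as it is assumed to be trivial.\<close>

definition gr_cochains ::
  "('k, 'r) ring_scheme \<Rightarrow> ('k, 'a, 'x) graded_lie_scheme
     \<Rightarrow> ('k, 'a, 'm, 'y) graded_lie_mod_scheme \<Rightarrow> nat
     \<Rightarrow> ('k, ('a list \<Rightarrow> 'k) set \<Rightarrow> 'm) module" where
  "gr_cochains R L M n =
     \<lparr>carrier = {f \<in> linear_hom R (ext_power R L n) M.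
        \<forall>ds. length ds = n \<longrightarrow> f ` wedge_of_degrees R L ds \<subseteq> mgrade M (sum_list ds)},
      mult = undefined, one = undefined,
      zero = (\<lambda>x\<in>carrier (ext_power R L n). \<zero>\<^bsub>M\<^esub>),
      add = (\<lambda>f g. \<lambda>x\<in>carrier (ext_power R L n). f x \<oplus>\<^bsub>M\<^esub> g x),
      smult = (\<lambda>a f. \<lambda>x\<in>carrier (ext_power R L n). a \<odot>\<^bsub>M\<^esub> f x)\<rparr>"

definition gr_coboundary ::
  "('k, 'r) ring_scheme \<Rightarrow> ('k, 'a, 'x) graded_lie_scheme \<Rightarrow> nat
     \<Rightarrow> (('a list \<Rightarrow> 'k) set \<Rightarrow> 'm) \<Rightarrow> (('a list \<Rightarrow> 'k) set \<Rightarrow> 'm)" where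
  "gr_coboundary R L n f = compose (carrier (ext_power R L (Suc n))) f (ext_delta R L n)"

definition H2_gr_cohomology ::
  "('k, 'r) ring_scheme \<Rightarrow> ('k, 'a, 'x) graded_lie_scheme
     \<Rightarrow> ('k, 'a, 'm, 'y) graded_lie_mod_scheme
     \<Rightarrow> ('k, (('a list \<Rightarrow> 'k) set \<Rightarrow> 'm) set) module" where
  "H2_gr_cohomology R L M = quot_module
     ((gr_cochains R L M 2)\<lparr>carrier :=
        {f \<in> carrier (gr_cochains R L M 2). gr_coboundary R L 2 f = \<zero>\<^bsub>gr_cochains R L M 3\<^esub>}\<rparr>)
     (gr_coboundary R L 1 ` carrier (gr_cochains R L M 1))"


section \<open>Categories\<close>

text \<open>Composition is \<open>Comp C X Y Z g f\<close> for \<open>f\<close> from \<open>X\<close> to \<open>Y\<close> and \<open>g\<close> from \<open>Y\<close> to \<open>Z\<close>.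
  The sets \<open>Hom C X Y\<close> need not be disjoint, so operations on morphisms take the objects as
  arguments.\<close>

record ('o, 'f) category =
  Obj :: "'o set"
  Hom :: "'o \<Rightarrow> 'o \<Rightarrow> 'f set"
  Ident :: "'o \<Rightarrow> 'f"
  Comp :: "'o \<Rightarrow> 'o \<Rightarrow> 'o \<Rightarrow> 'f \<Rightarrow> 'f \<Rightarrow> 'f"

locale is_category =
  fixes C :: "('o, 'f) category"
  assumes Ident_in_Hom: "X \<in> Obj C \<Longrightarrow> Ident C X \<in> Hom C X X"
    and Comp_in_Hom: "\<lbrakk>X \<in> Obj C; Y \<in> Obj C; Z \<in> Obj C; f \<in> Hom C X Y; g \<in> Hom C Y Z\<rbrakk>
      \<Longrightarrow> Comp C X Y Z g f \<in> Hom C X Z"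
    and Comp_Ident_right: "\<lbrakk>X \<in> Obj C; Y \<in> Obj C; f \<in> Hom C X Y\<rbrakk>
      \<Longrightarrow> Comp C X X Y f (Ident C X) = f"
    and Comp_Ident_left: "\<lbrakk>X \<in> Obj C; Y \<in> Obj C; f \<in> Hom C X Y\<rbrakk>
      \<Longrightarrow> Comp C X Y Y (Ident C Y) f = f"
    and Comp_assoc: "\<lbrakk>W \<in> Obj C; X \<in> Obj C; Y \<in> Obj C; Z \<in> Obj C;
        f \<in> Hom C W X; g \<in> Hom C X Y; h \<in> Hom C Y Z\<rbrakk>
      \<Longrightarrow> Comp C W Y Z h (Comp C W X Y g f) = Comp C W X Z (Comp C X Y Z h g) f"

locale cat_functor =
  fixes C :: "('o, 'f) category" and D :: "('p, 'g) category"
    and F_ob :: "'o \<Rightarrow> 'p" and F_mor :: "'o \<Rightarrow> 'o \<Rightarrow> 'f \<Rightarrow> 'g"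
  assumes F_Obj: "X \<in> Obj C \<Longrightarrow> F_ob X \<in> Obj D"
    and F_Hom: "\<lbrakk>X \<in> Obj C; Y \<in> Obj C; f \<in> Hom C X Y\<rbrakk>
      \<Longrightarrow> F_mor X Y f \<in> Hom D (F_ob X) (F_ob Y)"
    and F_Ident: "X \<in> Obj C \<Longrightarrow> F_mor X X (Ident C X) = Ident D (F_ob X)"
    and F_Comp: "\<lbrakk>X \<in> Obj C; Y \<in> Obj C; Z \<in> Obj C; f \<in> Hom C X Y; g \<in> Hom C Y Z\<rbrakk>
      \<Longrightarrow> F_mor X Z (Comp C X Y Z g f)
          = Comp D (F_ob X) (F_ob Y) (F_ob Z) (F_mor Y Z g) (F_mor X Y f)"

definition is_iso :: "('o, 'f) category \<Rightarrow> 'o \<Rightarrow> 'o \<Rightarrow> 'f \<Rightarrow> bool" where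
  "is_iso C X Y f \<longleftrightarrow> f \<in> Hom C X Y \<and>
     (\<exists>g\<in>Hom C Y X. Comp C X Y X g f = Ident C X \<and> Comp C Y X Y f g = Ident C Y)"

locale natural_iso =
  fixes C :: "('o, 'f) category" and D :: "('p, 'g) category"
    and F_ob :: "'o \<Rightarrow> 'p" and F_mor :: "'o \<Rightarrow> 'o \<Rightarrow> 'f \<Rightarrow> 'g"
    and G_ob :: "'o \<Rightarrow> 'p" and G_mor :: "'o \<Rightarrow> 'o \<Rightarrow> 'f \<Rightarrow> 'g"
    and t :: "'o \<Rightarrow> 'g"
  assumes component_iso: "X \<in> Obj C \<Longrightarrow> is_iso D (F_ob X) (G_ob X) (t X)"
    and naturality: "\<lbrakk>X \<in> Obj C; Y \<in> Obj C; f \<in> Hom C X Y\<rbrakk> \<Longrightarrow>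
        Comp D (F_ob X) (F_ob Y) (G_ob Y) (t Y) (F_mor X Y f)
        = Comp D (F_ob X) (G_ob X) (G_ob Y) (G_mor X Y f) (t X)"

definition equivalent_categories :: "('o, 'f) category \<Rightarrow> ('p, 'g) category \<Rightarrow> bool" where
  "equivalent_categories C D \<longleftrightarrow> is_category C \<and> is_category D \<and>
     (\<exists>F_ob F_mor G_ob G_mor s t.
        cat_functor C D F_ob F_mor \<and> cat_functor D C G_ob G_mor \<and>
        natural_iso C C (\<lambda>X. X) (\<lambda>X Y f. f)
          (\<lambda>X. G_ob (F_ob X)) (\<lambda>X Y f. G_mor (F_ob X) (F_ob Y) (F_mor X Y f)) s \<and>
        natural_iso D D (\<lambda>X. F_ob (G_ob X)) (\<lambda>X Y f. F_mor (G_ob X) (G_ob Y) (G_mor X Y f))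
          (\<lambda>X. X) (\<lambda>X Y f. f) t)"

text \<open>The type \<open>'u\<close> serves as the universe: objects are structures on subsets of \<open>'u\<close>.\<close>

definition jts_category ::
  "('k, 'r) ring_scheme \<Rightarrow> (('k, 'u) jordan_triple, 'u \<Rightarrow> 'u) category" where
  "jts_category R =
     \<lparr>Obj = {T. jordan_triple_system R T},
      Hom = jts_hom R,
      Ident = (\<lambda>T. \<lambda>x\<in>carrier T. x),
      Comp = (\<lambda>S T U g f. compose (carrier S) g f)\<rparr>"

definition lie_category ::
  "('k, 'r) ring_scheme \<Rightarrow> (('k, 'u) inv_graded_lie, 'u \<Rightarrow> 'u) category" where
  "lie_category R =
     \<lparr>Obj = {L. three_graded_lie_algebra R L \<and> anti_graded_involution R L (invol L) \<and>
                zero_perfect R L \<and> zero_module (H2_gr_homology R L)},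
      Hom = graded_involutary_hom R,
      Ident = (\<lambda>L. \<lambda>x\<in>carrier L. x),
      Comp = (\<lambda>L K N g f. compose (carrier L) g f)\<rparr>"

end

theory Submission
  imports Defs
begin

text \<open>
  Why the theorem holds. Let \<open>L\<close> be a \<open>0\<close>-perfect \<open>3\<close>-graded Lie algebra with anti-graded
  involution \<open>\<epsilon>\<close>, and let \<open>\<Lambda>\<close> stand for the exterior algebra of \<open>L\<close>.

  \<^emph>\<open>Homology and cohomology.\<close> Up to sign, the first boundary map sends \<open>x \<and> y\<close> to \<open>[x, y]\<close>, so by
  \<open>0\<close>-perfectness every element of \<open>L\<^sub>0\<close> is the boundary of an element of degree \<open>0\<close>. If the homology
  vanishes, a degree \<open>0\<close> cocycle \<open>f\<close> vanishes on all cycles of degree \<open>0\<close>, because these are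
  boundaries. Hence \<open>f\<close> factors through the boundary map, which says that it is a coboundary
  (\<open>H2_cohomology_vanishes\<close>). Conversely, over a field a cycle that is not a boundary is separated
  from the boundaries by a linear functional (\<open>field_linear_separation\<close>). Composed with the
  projection of the exterior square onto its part of degree \<open>0\<close>, the functional becomes a cocycle
  with values in a line that cannot be a coboundary (\<open>H2_homology_vanishes\<close>).

  \<^emph>\<open>The functor.\<close> It sends \<open>L\<close> to \<open>L\<^sub>-\<^sub>1\<close> with the product \<open>{a, b, c} = [[a, \<epsilon> b], c]\<close>, and
  morphisms to their restrictions. It is shown to be fully faithful and essentially surjective,
  which suffices (\<open>equivalent_categories_if_fully_faithful\<close>). It is faithful because \<open>L\<close> is generated
  by \<open>L\<^sub>-\<^sub>1\<close> and \<open>\<epsilon> L\<^sub>-\<^sub>1 = L\<^sub>1\<close>.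

  It is full by an argument about central extensions. Given a triple homomorphism \<open>f\<close> from \<open>L\<^sub>-\<^sub>1\<close> to
  \<open>N\<^sub>-\<^sub>1\<close>, let \<open>E\<close> be the subalgebra of \<open>L \<times> N\<close> generated by the pairs \<open>(a, f a)\<close> and \<open>(\<epsilon> a, \<epsilon> (f a))\<close>.
  The projection from \<open>E\<close> to \<open>L\<close> is onto, and its kernel is central in \<open>E\<close>, because \<open>f\<close> preserves
  triple products. Therefore the bracket of two lifts depends only on the elements that are lifted,
  and defines a linear map on the exterior square of \<open>L\<close> with values in \<open>N\<close>. By the Jacobi identity
  this map kills boundaries (\<open>central_relation_cocycle\<close>). A kernel element is the value of this map
  at some cycle of degree \<open>0\<close>, and thus \<open>0\<close> if the homology of \<open>L\<close> vanishes. So \<open>E\<close> is the graph of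
  a homomorphism, and this homomorphism extends \<open>f\<close> (\<open>jts_hom_extends\<close>).

  It is essentially surjective because a triple system \<open>T\<close> is the part of degree \<open>-1\<close> of the
  universal Lie algebra \<open>T \<oplus> U \<oplus> T\<close>. Here \<open>U\<close> is the quotient of \<open>T \<otimes> T\<close> by the relations which say
  that the only possible bracket on \<open>U\<close> is skew-symmetric. The same relations hold between the
  elements \<open>a \<and> b\<close> of the exterior square modulo boundaries, so the class of a degree \<open>0\<close> element
  depends only on its boundary, and the homology vanishes (\<open>H2_zero_criterion\<close>, \<open>lie_H2\<close>). A
  counting argument puts this Lie algebra on a subset of the universe of \<open>T\<close>.
\<close>

section \<open>Linear maps, spans and quotients\<close>

lemma (in abelian_group) a_inv_zero [simp]: "\<ominus> \<zero> = \<zero>"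
  using r_neg[OF zero_closed] by simp

text \<open>The normalisation method \<open>algebra\<close> is set up for rings. This makes it work on the sums of elements
  of a module as well.\<close>

lemmas (in abelian_group) abelian_group_simprules
  [algebra abelian_group "zero G" "add G" "a_inv G" "a_minus G"] =
  a_closed zero_closed a_inv_closed minus_closed
  a_assoc l_zero l_neg a_comm minus_eq r_zero r_neg r_neg2 r_neg1
  minus_add minus_minus a_inv_zero a_lcomm

lemma (in abelian_group) minus_zero_iff:
  assumes "x \<in> carrier G" "y \<in> carrier G"
  shows "x \<ominus> y = \<zero> \<longleftrightarrow> x = y"
proof
  assume "x \<ominus> y = \<zero>"
  then have "(x \<ominus> y) \<oplus> y = y" using assms by simp
  then show "x = y" using assms by algebra
qed (use assms in \<open>simp add: minus_eq r_neg\<close>)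

lemma linear_mapI:
  assumes "\<And>x. x \<in> carrier M \<Longrightarrow> f x \<in> carrier N"
    and "\<And>x y. \<lbrakk>x \<in> carrier M; y \<in> carrier M\<rbrakk> \<Longrightarrow> f (x \<oplus>\<^bsub>M\<^esub> y) = f x \<oplus>\<^bsub>N\<^esub> f y"
    and "\<And>a x. \<lbrakk>a \<in> carrier R; x \<in> carrier M\<rbrakk> \<Longrightarrow> f (a \<odot>\<^bsub>M\<^esub> x) = a \<odot>\<^bsub>N\<^esub> f x"
  shows "linear_map R M N f"
  using assms by (auto simp: linear_map_def)

lemma linear_map_closed: "\<lbrakk>linear_map R M N f; x \<in> carrier M\<rbrakk> \<Longrightarrow> f x \<in> carrier N"
  and linear_map_add: "\<lbrakk>linear_map R M N f; x \<in> carrier M; y \<in> carrier M\<rbrakk>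
    \<Longrightarrow> f (x \<oplus>\<^bsub>M\<^esub> y) = f x \<oplus>\<^bsub>N\<^esub> f y"
  and linear_map_smult: "\<lbrakk>linear_map R M N f; a \<in> carrier R; x \<in> carrier M\<rbrakk>
    \<Longrightarrow> f (a \<odot>\<^bsub>M\<^esub> x) = a \<odot>\<^bsub>N\<^esub> f x"
  by (auto simp: linear_map_def)

lemma linear_map_zero:
  assumes "module R M" "module R N" "linear_map R M N f"
  shows "f \<zero>\<^bsub>M\<^esub> = \<zero>\<^bsub>N\<^esub>"
proof -
  interpret M: module R M by fact
  interpret N: module R N by fact
  have "f (\<zero>\<^bsub>R\<^esub> \<odot>\<^bsub>M\<^esub> \<zero>\<^bsub>M\<^esub>) = \<zero>\<^bsub>R\<^esub> \<odot>\<^bsub>N\<^esub> f \<zero>\<^bsub>M\<^esub>"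
    by (rule linear_map_smult[OF assms(3)]) auto
  then show ?thesis using linear_map_closed[OF assms(3)] by simp
qed

lemma linear_map_inv:
  assumes "module R M" "module R N" "linear_map R M N f" "x \<in> carrier M"
  shows "f (\<ominus>\<^bsub>M\<^esub> x) = \<ominus>\<^bsub>N\<^esub> f x"
proof -
  interpret M: module R M by fact
  interpret N: module R N by fact
  have "f ((\<ominus>\<^bsub>R\<^esub> \<one>\<^bsub>R\<^esub>) \<odot>\<^bsub>M\<^esub> x) = (\<ominus>\<^bsub>R\<^esub> \<one>\<^bsub>R\<^esub>) \<odot>\<^bsub>N\<^esub> f x"
    by (rule linear_map_smult[OF assms(3)]) (use assms(4) in auto)
  then show ?thesis using linear_map_closed[OF assms(3)] assms(4)
    by (simp add: M.smult_l_minus N.smult_l_minus)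
qed

lemma linear_map_minus:
  assumes "module R M" "module R N" "linear_map R M N f" "x \<in> carrier M" "y \<in> carrier M"
  shows "f (x \<ominus>\<^bsub>M\<^esub> y) = f x \<ominus>\<^bsub>N\<^esub> f y"
proof -
  interpret M: module R M by fact
  show ?thesis using assms
    by (simp add: a_minus_def linear_map_add linear_map_inv)
qed

lemma linear_map_comp:
  assumes "linear_map R M N f" "linear_map R N P g"
  shows "linear_map R M P (\<lambda>x. g (f x))"
  using assms by (auto simp: linear_map_def Pi_iff)

lemma linear_map_cong:
  assumes "module R M" "linear_map R M N f" "\<And>x. x \<in> carrier M \<Longrightarrow> g x = f x"
  shows "linear_map R M N g"
proof -
  interpret M: module R M by fact
  show ?thesis using assms by (auto simp: linear_map_def Pi_iff)
qed

lemma linear_map_restrict: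
  assumes "module R M" "linear_map R M N f"
  shows "restrict f (carrier M) \<in> linear_hom R M N"
  using linear_map_cong[OF assms, of "restrict f (carrier M)"] by (auto simp: linear_hom_def)

lemma linear_homD: "f \<in> linear_hom R M N \<Longrightarrow> linear_map R M N f"
  by (auto simp: linear_hom_def)

lemma linear_map_plus:
  assumes "module R M" "module R N" "linear_map R M N f" "linear_map R M N g"
  shows "linear_map R M N (\<lambda>x. f x \<oplus>\<^bsub>N\<^esub> g x)"
proof -
  interpret M: module R M by fact
  interpret N: module R N by fact
  note c = linear_map_closed[OF assms(3)] linear_map_closed[OF assms(4)]
  show ?thesis
    using c by (intro linear_mapI) (simp_all add: linear_map_add[OF assms(3)] linear_map_add[OF assms(4)]
       linear_map_smult[OF assms(3)] linear_map_smult[OF assms(4)] N.smult_r_distr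
       N.a_assoc N.a_lcomm)
qed

lemma linear_map_uminus:
  assumes "module R M" "module R N" "linear_map R M N f"
  shows "linear_map R M N (\<lambda>x. \<ominus>\<^bsub>N\<^esub> f x)"
proof -
  interpret M: module R M by fact
  interpret N: module R N by fact
  note c = linear_map_closed[OF assms(3)]
  show ?thesis
    using c by (intro linear_mapI) (simp_all add: linear_map_add[OF assms(3)] 
       linear_map_smult[OF assms(3)] N.smult_r_minus N.minus_add N.a_comm)
qed

lemma linear_map_diff:
  assumes "module R M" "module R N" "linear_map R M N f" "linear_map R M N g"
  shows "linear_map R M N (\<lambda>x. f x \<ominus>\<^bsub>N\<^esub> g x)"
  unfolding a_minus_def
  by (intro linear_map_plus linear_map_uminus assms)

lemma linear_map_const_zero:
  assumes "module R N"
  shows "linear_map R M N (\<lambda>x. \<zero>\<^bsub>N\<^esub>)"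
proof -
  interpret N: module R N by fact
  show ?thesis by (intro linear_mapI) auto
qed

lemma lin_span_incl: "x \<in> S \<Longrightarrow> x \<in> lin_span R M S"
  by (auto simp: lin_span_def)

lemma lin_span_least: "\<lbrakk>submodule N R M; S \<subseteq> N\<rbrakk> \<Longrightarrow> lin_span R M S \<subseteq> N"
  by (auto simp: lin_span_def)

lemma submodule_closed:
  assumes "submodule N R M"
  shows "N \<subseteq> carrier M" "\<zero>\<^bsub>M\<^esub> \<in> N"
    "\<And>x y. \<lbrakk>x \<in> N; y \<in> N\<rbrakk> \<Longrightarrow> x \<oplus>\<^bsub>M\<^esub> y \<in> N"
    "\<And>a x. \<lbrakk>a \<in> carrier R; x \<in> N\<rbrakk> \<Longrightarrow> a \<odot>\<^bsub>M\<^esub> x \<in> N"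
    "\<And>x. x \<in> N \<Longrightarrow> \<ominus>\<^bsub>M\<^esub> x \<in> N"
    "\<And>x y. \<lbrakk>x \<in> N; y \<in> N\<rbrakk> \<Longrightarrow> x \<ominus>\<^bsub>M\<^esub> y \<in> N"
proof -
  interpret submodule N R M by fact
  show "N \<subseteq> carrier M" "\<zero>\<^bsub>M\<^esub> \<in> N"
    "\<And>x y. \<lbrakk>x \<in> N; y \<in> N\<rbrakk> \<Longrightarrow> x \<oplus>\<^bsub>M\<^esub> y \<in> N"
    "\<And>a x. \<lbrakk>a \<in> carrier R; x \<in> N\<rbrakk> \<Longrightarrow> a \<odot>\<^bsub>M\<^esub> x \<in> N"
    "\<And>x. x \<in> N \<Longrightarrow> \<ominus>\<^bsub>M\<^esub> x \<in> N"
    "\<And>x y. \<lbrakk>x \<in> N; y \<in> N\<rbrakk> \<Longrightarrow> x \<ominus>\<^bsub>M\<^esub> y \<in> N"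
    using subset one_closed m_closed m_inv_closed smult_closed
    by (auto simp: a_inv_def a_minus_def)
qed

lemma (in module) submoduleI2:
  assumes "H \<subseteq> carrier M" "\<zero>\<^bsub>M\<^esub> \<in> H"
    and "\<And>x y. \<lbrakk>x \<in> H; y \<in> H\<rbrakk> \<Longrightarrow> x \<oplus>\<^bsub>M\<^esub> y \<in> H"
    and smult: "\<And>a x. \<lbrakk>a \<in> carrier R; x \<in> H\<rbrakk> \<Longrightarrow> a \<odot>\<^bsub>M\<^esub> x \<in> H"
  shows "submodule H R M"
proof (rule submoduleI)
  fix x assume "x \<in> H"
  then show "\<ominus>\<^bsub>M\<^esub> x \<in> H"
    using smult[of "\<ominus> \<one>" x] assms(1) by (auto simp: smult_l_minus)
qed (use assms in auto)

lemma lin_span_submodule: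
  assumes "module R M" "S \<subseteq> carrier M"
  shows "submodule (lin_span R M S) R M"
proof -
  interpret M: module R M by fact
  show ?thesis
    unfolding lin_span_def
  proof (rule M.submoduleI2)
    show "\<Inter>{N. submodule N R M \<and> S \<subseteq> N} \<subseteq> carrier M"
      using M.carrier_is_submodule assms(2) by blast
  qed (auto intro: submodule_closed(2-4))
qed

lemma lin_span_induct [consumes 3, case_names incl zero add smult]:
  assumes "module R M" "S \<subseteq> carrier M" "x \<in> lin_span R M S"
    and "\<And>x. x \<in> S \<Longrightarrow> P x"
    and "P \<zero>\<^bsub>M\<^esub>"
    and "\<And>x y. \<lbrakk>x \<in> lin_span R M S; y \<in> lin_span R M S; P x; P y\<rbrakk> \<Longrightarrow> P (x \<oplus>\<^bsub>M\<^esub> y)"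
    and "\<And>a x. \<lbrakk>a \<in> carrier R; x \<in> lin_span R M S; P x\<rbrakk> \<Longrightarrow> P (a \<odot>\<^bsub>M\<^esub> x)"
  shows "P x"
proof -
  interpret M: module R M by fact
  note sub = submodule_closed[OF lin_span_submodule[OF assms(1,2)]]
  have "submodule {x \<in> lin_span R M S. P x} R M"
    by (rule M.submoduleI2) (use sub assms(5-) in auto)
  moreover have "S \<subseteq> {x \<in> lin_span R M S. P x}"
    using assms(4) by (auto intro: lin_span_incl)
  ultimately show ?thesis using assms(3) lin_span_least by blast
qed

lemma lin_span_mono: "S \<subseteq> S' \<Longrightarrow> lin_span R M S \<subseteq> lin_span R M S'"
  unfolding lin_span_def by blast

text \<open>Together with the next lemmas on preimages and images of submodules, this reduces all claims about
  elements of a span to the generators.\<close>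

lemma linear_map_eq_on_span:
  assumes "module R M" "module R N" "linear_map R M N f" "linear_map R M N g" "S \<subseteq> carrier M"
    and "\<And>x. x \<in> S \<Longrightarrow> f x = g x" "x \<in> lin_span R M S"
  shows "f x = g x"
proof -
  note sub = submodule_closed[OF lin_span_submodule[OF assms(1,5)]]
  show ?thesis
    using assms(1,5,7)
  proof (induct rule: lin_span_induct)
    case (add x y)
    then show ?case using sub(1)
      by (simp add: linear_map_add[OF assms(3)] linear_map_add[OF assms(4)] subset_iff)
  next
    case (smult a x)
    then show ?case using sub(1)
      by (simp add: linear_map_smult[OF assms(3)] linear_map_smult[OF assms(4)] subset_iff)
  next
    case zero
    show ?case by (simp add: linear_map_zero[OF assms(1,2,3)] linear_map_zero[OF assms(1,2,4)])
  qed (rule assms(6))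
qed

lemma linear_map_vimage_submodule:
  assumes "module R M" "module R N" "linear_map R M N f" "submodule N' R N"
  shows "submodule {x \<in> carrier M. f x \<in> N'} R M"
proof -
  interpret M: module R M by fact
  note sub = submodule_closed[OF assms(4)]
  show ?thesis
    by (rule M.submoduleI2)
       (use sub in \<open>auto simp: linear_map_add[OF assms(3)] linear_map_smult[OF assms(3)]
          linear_map_zero[OF assms(1-3)]\<close>)
qed

lemma linear_map_image_submodule:
  assumes "module R M" "module R N" "linear_map R M N f" "submodule M' R M"
  shows "submodule (f ` M') R N"
proof -
  interpret N: module R N by fact
  note sub = submodule_closed[OF assms(4)]
  have c: "\<And>x. x \<in> M' \<Longrightarrow> x \<in> carrier M" using sub(1) by auto
  show ?thesis
  proof (rule N.submoduleI2)
    show "f ` M' \<subseteq> carrier N" using c linear_map_closed[OF assms(3)] by auto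
    show "\<zero>\<^bsub>N\<^esub> \<in> f ` M'" using sub(2) linear_map_zero[OF assms(1-3)] by (metis imageI)
    show "x \<oplus>\<^bsub>N\<^esub> y \<in> f ` M'" if "x \<in> f ` M'" "y \<in> f ` M'" for x y
      using that sub(3) c by (auto simp: linear_map_add[OF assms(3), symmetric])
    show "a \<odot>\<^bsub>N\<^esub> x \<in> f ` M'" if "a \<in> carrier R" "x \<in> f ` M'" for a x
      using that sub(4) c by (auto simp: linear_map_smult[OF assms(3), symmetric])
  qed
qed

lemma linear_map_span_subset:
  assumes "module R M" "module R N" "linear_map R M N f" "submodule N' R N"
    and "S \<subseteq> carrier M" "\<And>x. x \<in> S \<Longrightarrow> f x \<in> N'" "x \<in> lin_span R M S"
  shows "f x \<in> N'"
  using lin_span_least[OF linear_map_vimage_submodule[OF assms(1-4)], of S] assms(5-7) by auto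

lemma linear_map_on_submodule:
  assumes "submodule S R M" "linear_map R M N f"
  shows "linear_map R (M\<lparr>carrier := S\<rparr>) N f"
  using submodule_closed(1)[OF assms(1)] assms(2)
  by (intro linear_mapI) (simp_all add: linear_map_def subset_iff Pi_iff)

lemma linear_map_into_submodule:
  assumes "linear_map R M N f" "f ` carrier M \<subseteq> S"
  shows "linear_map R M (N\<lparr>carrier := S\<rparr>) f"
  using assms by (intro linear_mapI) (auto simp: linear_map_def)

text \<open>The choice of a preimage in \<open>S\<close> under \<open>d\<close> does not matter, as two preimages differ by an element
  of the kernel of \<open>d\<close>. For \<open>d\<close> the projection onto a quotient this is the universal property of the
  quotient; for \<open>d\<close> a boundary map it turns a cocycle that vanishes on cycles into a coboundary.\<close>

lemma linear_map_factor:
  assumes "module R M" "module R N" "module R P" "submodule S R M"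
    and d: "linear_map R M N d" and f: "linear_map R M P f"
    and ker: "\<And>x. \<lbrakk>x \<in> S; d x = \<zero>\<^bsub>N\<^esub>\<rbrakk> \<Longrightarrow> f x = \<zero>\<^bsub>P\<^esub>"
  obtains h where "linear_map R (N\<lparr>carrier := d ` S\<rparr>) P h" "\<And>x. x \<in> S \<Longrightarrow> h (d x) = f x"
proof -
  interpret M: module R M by fact
  interpret N: module R N by fact
  interpret P: module R P by fact
  note sub = submodule_closed[OF assms(4)]
  have c: "\<And>x. x \<in> S \<Longrightarrow> x \<in> carrier M" using sub(1) by auto
  define h where "h y = f (SOME x. x \<in> S \<and> d x = y)" for y
  have h: "h (d x) = f x" if x: "x \<in> S" for x
  proof -
    define x' where "x' = (SOME x'. x' \<in> S \<and> d x' = d x)"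
    have x': "x' \<in> S \<and> d x' = d x"
      unfolding x'_def using x by (rule_tac someI[where x=x]) auto
    have "d (x' \<ominus>\<^bsub>M\<^esub> x) = \<zero>\<^bsub>N\<^esub>"
      using x x' c linear_map_closed[OF d, of x]
      by (simp add: linear_map_minus[OF assms(1,2) d] N.r_neg N.minus_eq)
    then have "f (x' \<ominus>\<^bsub>M\<^esub> x) = \<zero>\<^bsub>P\<^esub>" using ker x x' sub by auto
    then have "f x' \<ominus>\<^bsub>P\<^esub> f x = \<zero>\<^bsub>P\<^esub>"
      using x x' c by (simp add: linear_map_minus[OF assms(1,3) f])
    then have "f x' = f x"
      using x x' c linear_map_closed[OF f] by (simp add: P.minus_zero_iff)
    then show ?thesis unfolding h_def x'_def .
  qed
  have "linear_map R (N\<lparr>carrier := d ` S\<rparr>) P h"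
  proof (rule linear_mapI; simp)
    fix y assume "y \<in> d ` S"
    then show "h y \<in> carrier P" using h c linear_map_closed[OF f] by auto
    fix z assume "z \<in> d ` S"
    with \<open>y \<in> d ` S\<close> obtain x x' where x: "x \<in> S" "y = d x" "x' \<in> S" "z = d x'" by blast
    then have "y \<oplus>\<^bsub>N\<^esub> z = d (x \<oplus>\<^bsub>M\<^esub> x')" using c by (simp add: linear_map_add[OF d])
    then show "h (y \<oplus>\<^bsub>N\<^esub> z) = h y \<oplus>\<^bsub>P\<^esub> h z"
      using x c sub h by (simp add: linear_map_add[OF f])
  next
    fix a y assume a: "a \<in> carrier R" "y \<in> d ` S"
    then obtain x where x: "x \<in> S" "y = d x" by blast
    then have "a \<odot>\<^bsub>N\<^esub> y = d (a \<odot>\<^bsub>M\<^esub> x)" using c a by (simp add: linear_map_smult[OF d])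
    then show "h (a \<odot>\<^bsub>N\<^esub> y) = a \<odot>\<^bsub>P\<^esub> h y"
      using x c sub h a by (simp add: linear_map_smult[OF f])
  qed
  with h show ?thesis by (rule that[rotated]) 
qed

text \<open>The module axioms are identities, so they pass to the image of any map that respects the
  operations, whether or not it is injective. Quotients and modules transported along a bijection are
  both obtained in this way.\<close>

lemma module_surjective_image:
  assumes "module R M" "f ` carrier M = carrier N"
    and add: "\<And>x y. \<lbrakk>x \<in> carrier M; y \<in> carrier M\<rbrakk> \<Longrightarrow> f (x \<oplus>\<^bsub>M\<^esub> y) = f x \<oplus>\<^bsub>N\<^esub> f y"
    and smult: "\<And>a x. \<lbrakk>a \<in> carrier R; x \<in> carrier M\<rbrakk> \<Longrightarrow> f (a \<odot>\<^bsub>M\<^esub> x) = a \<odot>\<^bsub>N\<^esub> f x"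
    and zero: "f \<zero>\<^bsub>M\<^esub> = \<zero>\<^bsub>N\<^esub>"
  shows "module R N" "linear_map R M N f"
proof -
  interpret M: module R M by fact
  note car = assms(2)[symmetric]
  have ex: "\<And>y. y \<in> carrier N \<Longrightarrow> \<exists>x. x \<in> carrier M \<and> y = f x" using assms(2) by blast
  have cl: "\<And>x. x \<in> carrier M \<Longrightarrow> f x \<in> carrier N" using assms(2) by blast
  have "abelian_group N"
  proof (rule abelian_groupI)
    fix x assume "x \<in> carrier N"
    then obtain x' where x: "x' \<in> carrier M" "x = f x'" using ex by blast
    show "\<zero>\<^bsub>N\<^esub> \<oplus>\<^bsub>N\<^esub> x = x" using x by (simp add: add[symmetric] zero[symmetric])
    show "\<exists>y\<in>carrier N. y \<oplus>\<^bsub>N\<^esub> x = \<zero>\<^bsub>N\<^esub>"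
      using x by (intro bexI[of _ "f (\<ominus>\<^bsub>M\<^esub> x')"]) (simp_all add: add[symmetric] zero[symmetric] cl M.l_neg)
    fix y assume "y \<in> carrier N"
    then obtain y' where y: "y' \<in> carrier M" "y = f y'" using ex by blast
    show "x \<oplus>\<^bsub>N\<^esub> y \<in> carrier N" "x \<oplus>\<^bsub>N\<^esub> y = y \<oplus>\<^bsub>N\<^esub> x"
      using x y by (simp_all add: add[symmetric] cl M.a_comm)
    fix z assume "z \<in> carrier N"
    then obtain z' where z: "z' \<in> carrier M" "z = f z'" using ex by blast
    show "x \<oplus>\<^bsub>N\<^esub> y \<oplus>\<^bsub>N\<^esub> z = x \<oplus>\<^bsub>N\<^esub> (y \<oplus>\<^bsub>N\<^esub> z)"
      using x y z by (simp add: add[symmetric] M.a_assoc)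
  qed (use zero cl[of "\<zero>\<^bsub>M\<^esub>"] in auto)
  then show "module R N"
    by (intro moduleI; (simp add: M.R.is_cring)?)
       (auto dest!: ex simp: smult[symmetric] add[symmetric] cl M.smult_l_distr M.smult_r_distr
          M.smult_assoc1)
  show "linear_map R M N f" by (intro linear_mapI cl add smult)
qed

lemma quot_module_simps:
  "zero (quot_module M N) = N"
  "add (quot_module M N) = set_add M"
  "carrier (quot_module M N) = (\<lambda>x. N +>\<^bsub>M\<^esub> x) ` carrier M"
  by (auto simp: quot_module_def A_RCOSETS_def' )

lemma submodule_abelian_subgroup:
  assumes "module R M" "submodule N R M"
  shows "abelian_subgroup N M"
proof -
  interpret M: module R M by fact
  show ?thesis
    by (rule abelian_subgroupI3)
       (use assms(2) M.abelian_group_axioms in \<open>auto simp: submodule_def additive_subgroup_def\<close>)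
qed

lemma coset_eq_self_iff:
  assumes "module R M" "submodule N R M" "x \<in> carrier M"
  shows "N +>\<^bsub>M\<^esub> x = N \<longleftrightarrow> x \<in> N"
proof -
  interpret M: module R M by fact
  interpret N: abelian_subgroup N M by (rule submodule_abelian_subgroup[OF assms(1,2)])
  show ?thesis
    using assms(3) N.a_subgroup N.a_subset M.a_coset_join2[of x N] N.a_rcos_self[of x] by blast
qed

lemma quot_module_module:
  assumes "module R M" "submodule N R M"
  shows "module R (quot_module M N)" "linear_map R M (quot_module M N) (\<lambda>x. N +>\<^bsub>M\<^esub> x)"
proof -
  interpret M: module R M by fact
  interpret N: abelian_subgroup N M by (rule submodule_abelian_subgroup[OF assms])
  note sub = submodule_closed[OF assms(2)]
  have sm: "N +>\<^bsub>M\<^esub> (a \<odot>\<^bsub>M\<^esub> x) = a \<odot>\<^bsub>quot_module M N\<^esub> (N +>\<^bsub>M\<^esub> x)"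
    if a: "a \<in> carrier R" "x \<in> carrier M" for a x
  proof -
    have "N +>\<^bsub>M\<^esub> (a \<odot>\<^bsub>M\<^esub> z) = N +>\<^bsub>M\<^esub> (a \<odot>\<^bsub>M\<^esub> x)" if z: "z \<in> N +>\<^bsub>M\<^esub> x" for z
    proof -
      obtain n where n: "n \<in> N" "z = n \<oplus>\<^bsub>M\<^esub> x" using z by (auto simp: a_r_coset_def')
      then have "a \<odot>\<^bsub>M\<^esub> z = a \<odot>\<^bsub>M\<^esub> n \<oplus>\<^bsub>M\<^esub> a \<odot>\<^bsub>M\<^esub> x" 
        using a sub(1) by (auto intro: M.smult_r_distr)
      then have "a \<odot>\<^bsub>M\<^esub> z \<in> N +>\<^bsub>M\<^esub> (a \<odot>\<^bsub>M\<^esub> x)"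
        using n a sub by (auto simp: a_r_coset_def')
      then show ?thesis using a N.a_subgroup by (metis M.a_repr_independence M.smult_closed)
    qed
    moreover have "x \<in> N +>\<^bsub>M\<^esub> x" using a by (rule_tac N.a_rcos_self)
    ultimately have "(\<Union>z\<in>N +>\<^bsub>M\<^esub> x. N +>\<^bsub>M\<^esub> (a \<odot>\<^bsub>M\<^esub> z)) = N +>\<^bsub>M\<^esub> (a \<odot>\<^bsub>M\<^esub> x)"
      by blast
    then show ?thesis unfolding quot_module_def by simp
  qed
  have z: "N +>\<^bsub>M\<^esub> \<zero>\<^bsub>M\<^esub> = \<zero>\<^bsub>quot_module M N\<^esub>"
    using coset_eq_self_iff[OF assms M.zero_closed] sub(2) by (simp add: quot_module_simps)
  have ad: "N +>\<^bsub>M\<^esub> (x \<oplus>\<^bsub>M\<^esub> y) = (N +>\<^bsub>M\<^esub> x) \<oplus>\<^bsub>quot_module M N\<^esub> (N +>\<^bsub>M\<^esub> y)"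
    if "x \<in> carrier M" "y \<in> carrier M" for x y
    using N.a_rcos_sum[OF that] by (simp add: quot_module_simps)
  show "module R (quot_module M N)" "linear_map R M (quot_module M N) (\<lambda>x. N +>\<^bsub>M\<^esub> x)"
    by (rule module_surjective_image[OF assms(1) quot_module_simps(3)[symmetric] ad sm z]; assumption)+
qed

lemma quot_module_universal:
  assumes "module R M" "submodule N R M" "module R P" "linear_map R M P f"
    and ker: "\<And>x. x \<in> N \<Longrightarrow> f x = \<zero>\<^bsub>P\<^esub>"
  obtains h where "linear_map R (quot_module M N) P h" "\<And>x. x \<in> carrier M \<Longrightarrow> h (N +>\<^bsub>M\<^esub> x) = f x"
proof -
  interpret M: module R M by fact
  note q = quot_module_module[OF assms(1,2)]
  have k: "f x = \<zero>\<^bsub>P\<^esub>" if "x \<in> carrier M" "N +>\<^bsub>M\<^esub> x = \<zero>\<^bsub>quot_module M N\<^esub>" for x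
    using that ker coset_eq_self_iff[OF assms(1,2)] by (auto simp: quot_module_simps)
  obtain h where h: "linear_map R ((quot_module M N)\<lparr>carrier := (\<lambda>x. N +>\<^bsub>M\<^esub> x) ` carrier M\<rparr>) P h"
     "\<And>x. x \<in> carrier M \<Longrightarrow> h (N +>\<^bsub>M\<^esub> x) = f x"
    by (rule linear_map_factor[OF assms(1) q(1) assms(3) M.carrier_is_submodule q(2) assms(4)])
       (use k in auto)
  have "linear_map R (quot_module M N) P h"
    using h(1) by (simp add: linear_map_def quot_module_simps)
  with h(2) show ?thesis by (rule that[rotated])
qed

section \<open>Free modules and presentations\<close>

lemma free_module_simps:
  "f \<in> carrier (free_module R B) \<longleftrightarrow> (\<forall>b. f b \<in> carrier R) \<and> (\<forall>b. b \<notin> B \<longrightarrow> f b = \<zero>\<^bsub>R\<^esub>)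
     \<and> finite {b. f b \<noteq> \<zero>\<^bsub>R\<^esub>}"
  "zero (free_module R B) = (\<lambda>b. \<zero>\<^bsub>R\<^esub>)"
  "f \<oplus>\<^bsub>free_module R B\<^esub> g = (\<lambda>b. f b \<oplus>\<^bsub>R\<^esub> g b)"
  "a \<odot>\<^bsub>free_module R B\<^esub> f = (\<lambda>b. a \<otimes>\<^bsub>R\<^esub> f b)"
  by (auto simp: free_module_def)

lemma free_module_module:
  assumes "cring R"
  shows "module R (free_module R B)"
proof -
  interpret cring R by fact
  have fin: "finite {b. f b \<oplus>\<^bsub>R\<^esub> g b \<noteq> \<zero>\<^bsub>R\<^esub>}"
    if "finite {b. f b \<noteq> \<zero>\<^bsub>R\<^esub>}" "finite {b. g b \<noteq> \<zero>\<^bsub>R\<^esub>}" for f g :: "'c \<Rightarrow> 'a"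
  proof (rule finite_subset[OF _ finite_UnI[OF that]], rule subsetI, rule ccontr)
    fix b assume "b \<in> {b. f b \<oplus>\<^bsub>R\<^esub> g b \<noteq> \<zero>\<^bsub>R\<^esub>}"
      "b \<notin> {b. f b \<noteq> \<zero>\<^bsub>R\<^esub>} \<union> {b. g b \<noteq> \<zero>\<^bsub>R\<^esub>}"
    then show False by simp
  qed
  have fin2: "finite {b. a \<otimes>\<^bsub>R\<^esub> f b \<noteq> \<zero>\<^bsub>R\<^esub>}"
    if "finite {b. f b \<noteq> \<zero>\<^bsub>R\<^esub>}" "a \<in> carrier R" for f :: "'c \<Rightarrow> 'a" and a
    by (rule finite_subset[OF _ that(1)]) (use that in auto)
  show ?thesis
  proof (rule moduleI[OF assms])
    show "abelian_group (free_module R B)"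
    proof (rule abelian_groupI)
      fix f assume f: "f \<in> carrier (free_module R B)"
      have "{b. \<ominus>\<^bsub>R\<^esub> f b \<noteq> \<zero>\<^bsub>R\<^esub>} \<subseteq> {b. f b \<noteq> \<zero>\<^bsub>R\<^esub>}" using f by (auto simp: free_module_simps)
      moreover have "finite {b. f b \<noteq> \<zero>\<^bsub>R\<^esub>}" using f by (simp add: free_module_simps)
      ultimately have "finite {b. \<ominus>\<^bsub>R\<^esub> f b \<noteq> \<zero>\<^bsub>R\<^esub>}" by (rule finite_subset)
      with f show "\<exists>y\<in>carrier (free_module R B). y \<oplus>\<^bsub>free_module R B\<^esub> f = \<zero>\<^bsub>free_module R B\<^esub>"
        by (intro bexI[of _ "\<lambda>b. \<ominus>\<^bsub>R\<^esub> f b"]) (auto simp: free_module_simps l_neg)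
    qed (auto simp: free_module_simps fin a_ac)
  qed (simp_all add: free_module_simps fin2 m_assoc l_distr r_distr)
qed

lemma basis_vec_in_free_module:
  assumes "cring R" "b \<in> B"
  shows "basis_vec R b \<in> carrier (free_module R B)"
proof -
  interpret cring R by fact
  have "finite {c. basis_vec R b c \<noteq> \<zero>\<^bsub>R\<^esub>}"
    by (rule finite_subset[of _ "{b}"]) (auto simp: basis_vec_def)
  then show ?thesis using assms(2) by (auto simp: free_module_simps basis_vec_def)
qed

lemma free_module_span:
  assumes "cring R"
  shows "carrier (free_module R B) \<subseteq> lin_span R (free_module R B) (basis_vec R ` B)"
proof
  let ?F = "free_module R B" and ?S = "basis_vec R ` B"
  interpret cring R by fact
  have "?S \<subseteq> carrier ?F" using basis_vec_in_free_module[OF assms] by auto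
  note sub = submodule_closed[OF lin_span_submodule[OF free_module_module[OF assms] this]]
  have *: "f \<in> lin_span R ?F ?S"
    if "finite A" "f \<in> carrier ?F" "{b. f b \<noteq> \<zero>\<^bsub>R\<^esub>} \<subseteq> A" for A f
    using that
  proof (induct A arbitrary: f)
    case empty
    then have "f = \<zero>\<^bsub>?F\<^esub>" by (auto simp: free_module_simps)
    then show ?case using sub(2) by simp
  next
    case (insert b A)
    show ?case
    proof (cases "f b = \<zero>\<^bsub>R\<^esub>")
      case True
      then show ?thesis using insert by blast
    next
      case False
      then have b: "b \<in> B" "f b \<in> carrier R" using insert(4) by (auto simp: free_module_simps)
      define g where "g = f(b := \<zero>\<^bsub>R\<^esub>)"
      have "{c. g c \<noteq> \<zero>\<^bsub>R\<^esub>} \<subseteq> {c. f c \<noteq> \<zero>\<^bsub>R\<^esub>}" by (auto simp: g_def)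
      moreover have "finite {c. f c \<noteq> \<zero>\<^bsub>R\<^esub>}" using insert(4) by (simp add: free_module_simps)
      ultimately have "finite {c. g c \<noteq> \<zero>\<^bsub>R\<^esub>}" using finite_subset by blast
      then have g: "g \<in> carrier ?F" using insert(4) unfolding free_module_simps g_def by auto
      have "{c. g c \<noteq> \<zero>\<^bsub>R\<^esub>} \<subseteq> A" using insert(5) by (auto simp: g_def)
      then have "g \<in> lin_span R ?F ?S" using insert(3) g by blast
      moreover have "f b \<odot>\<^bsub>?F\<^esub> basis_vec R b \<in> lin_span R ?F ?S"
        using b by (intro sub(4) lin_span_incl) auto
      moreover have "f = g \<oplus>\<^bsub>?F\<^esub> f b \<odot>\<^bsub>?F\<^esub> basis_vec R b"
        using insert(4) by (auto simp: free_module_simps g_def basis_vec_def)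
      ultimately show ?thesis using sub(3) by metis
    qed
  qed
  fix f assume "f \<in> carrier ?F"
  then show "f \<in> lin_span R ?F ?S" using * by (auto simp: free_module_simps)
qed

lemma free_module_universal:
  assumes "module R M" "g \<in> B \<rightarrow> carrier M"
  obtains h where "linear_map R (free_module R B) M h" "\<And>b. b \<in> B \<Longrightarrow> h (basis_vec R b) = g b"
proof -
  interpret M: module R M by fact
  let ?F = "free_module R B"
  interpret F: module R ?F by (rule free_module_module) (rule M.R.is_cring)
  define h where "h f = (\<Oplus>\<^bsub>M\<^esub>b\<in>{b. f b \<noteq> \<zero>\<^bsub>R\<^esub>}. f b \<odot>\<^bsub>M\<^esub> g b)" for f
  have gc: "g b \<in> carrier M" if "b \<in> B" for b using assms(2) that by auto
  have h: "h f = (\<Oplus>\<^bsub>M\<^esub>b\<in>A. f b \<odot>\<^bsub>M\<^esub> g b)"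
    if "f \<in> carrier ?F" "finite A" "A \<subseteq> B" "{b. f b \<noteq> \<zero>\<^bsub>R\<^esub>} \<subseteq> A" for f A
    unfolding h_def
    by (rule M.add.finprod_mono_neutral_cong_left)
       (use that gc in \<open>auto simp: free_module_simps subset_iff\<close>)
  have supp: "finite {b. f b \<noteq> \<zero>\<^bsub>R\<^esub>} \<and> {b. f b \<noteq> \<zero>\<^bsub>R\<^esub>} \<subseteq> B \<and> (\<forall>b. f b \<in> carrier R)"
    if "f \<in> carrier ?F" for f
    using that by (auto simp: free_module_simps)
  have "linear_map R ?F M h"
  proof (rule linear_mapI)
    fix f assume f: "f \<in> carrier ?F"
    note sf = supp[OF f]
    show "h f \<in> carrier M" unfolding h_def
      by (rule M.finsum_closed) (use sf gc in auto)
    { fix g' assume g': "g' \<in> carrier ?F"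
      note sg = supp[OF g']
      define A where "A = {b. f b \<noteq> \<zero>\<^bsub>R\<^esub>} \<union> {b. g' b \<noteq> \<zero>\<^bsub>R\<^esub>}"
      have A: "finite A" "A \<subseteq> B" using sf sg by (auto simp: A_def)
      have "h (f \<oplus>\<^bsub>?F\<^esub> g') = (\<Oplus>\<^bsub>M\<^esub>b\<in>A. (f \<oplus>\<^bsub>?F\<^esub> g') b \<odot>\<^bsub>M\<^esub> g b)"
        by (rule h[OF F.a_closed[OF f g'] A]) (auto simp: A_def free_module_simps(2-))
      also have "\<dots> = (\<Oplus>\<^bsub>M\<^esub>b\<in>A. f b \<odot>\<^bsub>M\<^esub> g b \<oplus>\<^bsub>M\<^esub> g' b \<odot>\<^bsub>M\<^esub> g b)"
        by (rule M.finsum_cong) (use A sf sg gc in \<open>auto simp: free_module_simps(2-) simp_implies_def M.smult_l_distr subset_iff\<close>)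
      also have "\<dots> = h f \<oplus>\<^bsub>M\<^esub> h g'"
        using A sf sg gc by (subst M.finsum_addf) (auto simp: h[OF f A] h[OF g' A] A_def subset_iff)
      finally show "h (f \<oplus>\<^bsub>?F\<^esub> g') = h f \<oplus>\<^bsub>M\<^esub> h g'" . }
    fix a assume a: "a \<in> carrier R"
    define A where "A = {b. f b \<noteq> \<zero>\<^bsub>R\<^esub>}"
    have A: "finite A" "A \<subseteq> B" using sf by (auto simp: A_def)
    have "h (a \<odot>\<^bsub>?F\<^esub> f) = (\<Oplus>\<^bsub>M\<^esub>b\<in>A. (a \<odot>\<^bsub>?F\<^esub> f) b \<odot>\<^bsub>M\<^esub> g b)"
      by (rule h[OF F.smult_closed[OF a f] A]) (use a in \<open>auto simp: A_def free_module_simps(2-)\<close>)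
    also have "\<dots> = (\<Oplus>\<^bsub>M\<^esub>b\<in>A. a \<odot>\<^bsub>M\<^esub> (f b \<odot>\<^bsub>M\<^esub> g b))"
      by (rule M.finsum_cong) (use A sf a gc in \<open>auto simp: free_module_simps(2-) simp_implies_def M.smult_assoc1 subset_iff\<close>)
    also have "\<dots> = a \<odot>\<^bsub>M\<^esub> h f"
      using A sf a gc by (subst M.finsum_smult_ldistr[symmetric]) (auto simp: h[OF f A] A_def subset_iff)
    finally show "h (a \<odot>\<^bsub>?F\<^esub> f) = a \<odot>\<^bsub>M\<^esub> h f" .
  qed
  moreover have "h (basis_vec R b) = g b" if b: "b \<in> B" for b
  proof -
    have "h (basis_vec R b) = (\<Oplus>\<^bsub>M\<^esub>c\<in>{b}. basis_vec R b c \<odot>\<^bsub>M\<^esub> g c)"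
      by (rule h[OF basis_vec_in_free_module[OF M.R.is_cring b]]) (use b in \<open>auto simp: basis_vec_def\<close>)
    also have "\<dots> = g b" using gc[OF b] by (simp add: basis_vec_def)
    finally show ?thesis .
  qed
  ultimately show ?thesis by (rule that)
qed

text \<open>Exterior powers, and later the middle component of the universal Lie algebra, are all given by
  generators and relations, so their universal properties are instances of a single one.\<close>

definition presented_module ::
  "('k, 'r) ring_scheme \<Rightarrow> 'b set \<Rightarrow> ('b \<Rightarrow> 'k) set \<Rightarrow> ('k, ('b \<Rightarrow> 'k) set) module" where
  "presented_module R B S = quot_module (free_module R B) (lin_span R (free_module R B) S)"

definition presented_gen ::
  "('k, 'r) ring_scheme \<Rightarrow> 'b set \<Rightarrow> ('b \<Rightarrow> 'k) set \<Rightarrow> 'b \<Rightarrow> ('b \<Rightarrow> 'k) set" where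
  "presented_gen R B S b = lin_span R (free_module R B) S +>\<^bsub>free_module R B\<^esub> basis_vec R b"

context
  fixes R :: "('k, 'r) ring_scheme" and B :: "'b set" and S :: "('b \<Rightarrow> 'k) set"
  assumes R: "cring R" and S: "S \<subseteq> carrier (free_module R B)"
begin

interpretation F: module R "free_module R B" by (rule free_module_module[OF R])

lemma presented_module_module: "module R (presented_module R B S)"
  and presented_proj_linear: "linear_map R (free_module R B) (presented_module R B S)
     (\<lambda>x. lin_span R (free_module R B) S +>\<^bsub>free_module R B\<^esub> x)"
  unfolding presented_module_def
  by (rule quot_module_module[OF F.module_axioms lin_span_submodule[OF F.module_axioms S]])+

lemma presented_gen_closed: "b \<in> B \<Longrightarrow> presented_gen R B S b \<in> carrier (presented_module R B S)"
  unfolding presented_gen_def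
  by (rule linear_map_closed[OF presented_proj_linear basis_vec_in_free_module[OF R]])

lemma presented_module_span:
  "carrier (presented_module R B S)
     \<subseteq> lin_span R (presented_module R B S) (presented_gen R B S ` B)"
proof
  let ?P = "presented_module R B S"
  fix x assume "x \<in> carrier ?P"
  then obtain f where f: "f \<in> carrier (free_module R B)"
    "x = lin_span R (free_module R B) S +>\<^bsub>free_module R B\<^esub> f"
    by (auto simp: presented_module_def quot_module_simps)
  have "presented_gen R B S ` B \<subseteq> carrier ?P" using presented_gen_closed by auto
  note sub = lin_span_submodule[OF presented_module_module this]
  show "x \<in> lin_span R ?P (presented_gen R B S ` B)"
    unfolding f(2)
    by (rule linear_map_span_subset[OF F.module_axioms presented_module_module presented_proj_linear sub,
          where S = "basis_vec R ` B"])
       (use f(1) free_module_span[OF R, of B] basis_vec_in_free_module[OF R, of _ B] in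
         \<open>auto simp: presented_gen_def[symmetric] intro: lin_span_incl\<close>)
qed

lemma presented_relation:
  assumes "linear_map R (free_module R B) (presented_module R B S) h"
    and "\<And>b. b \<in> B \<Longrightarrow> h (basis_vec R b) = presented_gen R B S b" "s \<in> S"
  shows "h s = \<zero>\<^bsub>presented_module R B S\<^esub>"
proof -
  have "h s = lin_span R (free_module R B) S +>\<^bsub>free_module R B\<^esub> s"
    by (rule linear_map_eq_on_span[OF F.module_axioms presented_module_module assms(1)
          presented_proj_linear, of "basis_vec R ` B"])
       (use assms S free_module_span[OF R, of B] basis_vec_in_free_module[OF R, of _ B] in
         \<open>auto simp: presented_gen_def\<close>)
  also have "\<dots> = lin_span R (free_module R B) S"
    using coset_eq_self_iff[OF F.module_axioms lin_span_submodule[OF F.module_axioms S]]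
      assms(3) S by (auto intro: lin_span_incl)
  finally show ?thesis by (simp add: presented_module_def quot_module_simps)
qed

lemma presented_module_universal:
  assumes "module R M" "g \<in> B \<rightarrow> carrier M"
    and rel: "\<And>h s. \<lbrakk>linear_map R (free_module R B) M h; \<And>b. b \<in> B \<Longrightarrow> h (basis_vec R b) = g b; s \<in> S\<rbrakk>
       \<Longrightarrow> h s = \<zero>\<^bsub>M\<^esub>"
  obtains h where "linear_map R (presented_module R B S) M h"
    "\<And>b. b \<in> B \<Longrightarrow> h (presented_gen R B S b) = g b"
proof -
  interpret M: module R M by fact
  obtain h where h: "linear_map R (free_module R B) M h" "\<And>b. b \<in> B \<Longrightarrow> h (basis_vec R b) = g b"
    using free_module_universal[OF assms(1,2)] by blast
  have z: "submodule {\<zero>\<^bsub>M\<^esub>} R M" by (rule M.submoduleI2) auto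
  have "h x = \<zero>\<^bsub>M\<^esub>" if "x \<in> lin_span R (free_module R B) S" for x
    using linear_map_span_subset[OF F.module_axioms assms(1) h(1) z S _ that] rel[OF h] by blast
  then obtain h' where h': "linear_map R (presented_module R B S) M h'"
    "\<And>x. x \<in> carrier (free_module R B) \<Longrightarrow>
       h' (lin_span R (free_module R B) S +>\<^bsub>free_module R B\<^esub> x) = h x"
    unfolding presented_module_def
    using quot_module_universal[OF F.module_axioms lin_span_submodule[OF F.module_axioms S] assms(1) h(1)]
    by blast
  show ?thesis
    by (rule that[OF h'(1)])
       (use h'(2) h(2) basis_vec_in_free_module[OF R, of _ B] in \<open>auto simp: presented_gen_def\<close>)
qed

end

section \<open>Separation of a vector from a subspace\<close>

text \<open>By Zorn's lemma there is a largest submodule \<open>W\<close> that contains \<open>N\<close> but not \<open>c\<close>. Maximality makes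
  it a complement of the line through \<open>c\<close>, and \<open>f\<close> is the projection onto that line along \<open>W\<close>,
  followed by the map that sends \<open>c\<close> to \<open>p\<close>.\<close>

lemma field_linear_separation:
  assumes "field K" "module K M" "module K P" "submodule N K M"
    and c: "c \<in> carrier M" "c \<notin> N" and p: "p \<in> carrier P"
  obtains f where "linear_map K M P f" "\<And>x. x \<in> N \<Longrightarrow> f x = \<zero>\<^bsub>P\<^esub>" "f c = p"
proof -
  interpret K: field K by fact
  interpret M: module K M by fact
  interpret P: module K P by fact
  let ?A = "{W. submodule W K M \<and> N \<subseteq> W \<and> c \<notin> W}"
  have "\<exists>W\<in>?A. \<forall>X\<in>?A. W \<subseteq> X \<longrightarrow> X = W"
  proof (rule subset_Zorn_nonempty)
    show "?A \<noteq> {}" using assms(4) c by auto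
    fix \<C> assume C: "\<C> \<noteq> {}" "subset.chain ?A \<C>"
    then have CA: "\<And>W. W \<in> \<C> \<Longrightarrow> submodule W K M \<and> N \<subseteq> W \<and> c \<notin> W"
      and comp: "\<And>X Y. \<lbrakk>X \<in> \<C>; Y \<in> \<C>\<rbrakk> \<Longrightarrow> X \<subseteq> Y \<or> Y \<subseteq> X"
      by (auto simp: subset.chain_def)
    have "submodule (\<Union>\<C>) K M"
    proof (rule M.submoduleI2)
      show "\<Union>\<C> \<subseteq> carrier M" using CA submodule_closed(1) by fast
      show "\<zero>\<^bsub>M\<^esub> \<in> \<Union>\<C>" using CA C(1) submodule_closed(2) by fast
      show "x \<oplus>\<^bsub>M\<^esub> y \<in> \<Union>\<C>" if xy: "x \<in> \<Union>\<C>" "y \<in> \<Union>\<C>" for x y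
      proof -
        obtain X Y where XY: "X \<in> \<C>" "Y \<in> \<C>" "x \<in> X" "y \<in> Y" using xy by blast
        then obtain Z where "Z \<in> \<C>" "x \<in> Z" "y \<in> Z" using comp[OF XY(1,2)] by blast
        then show ?thesis using CA submodule_closed(3)[of Z K M x y] by auto
      qed
      show "a \<odot>\<^bsub>M\<^esub> x \<in> \<Union>\<C>" if a: "a \<in> carrier K" and x: "x \<in> \<Union>\<C>" for a x
      proof -
        obtain X where "X \<in> \<C>" "x \<in> X" using x by blast
        then show ?thesis using CA submodule_closed(4)[of X K M a x] a by auto
      qed
    qed
    then show "\<Union>\<C> \<in> ?A" using CA C(1) by blast
  qed
  then obtain W where W: "submodule W K M" "N \<subseteq> W" "c \<notin> W"
    and max': "\<forall>X\<in>?A. W \<subseteq> X \<longrightarrow> X = W"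
    by blast
  have max: "X = W" if "submodule X K M" "W \<subseteq> X" "c \<notin> X" for X
    using max' that W(2) by blast
  note sub = submodule_closed[OF W(1)]
  have Wc: "w \<in> carrier M" if "w \<in> W" for w using sub(1) that by auto
  have ex: "\<exists>a\<in>carrier K. x \<ominus>\<^bsub>M\<^esub> a \<odot>\<^bsub>M\<^esub> c \<in> W" if x: "x \<in> carrier M" for x
  proof (cases "x \<in> W")
    case True
    then show ?thesis using x c by (intro bexI[of _ "\<zero>\<^bsub>K\<^esub>"]) (simp_all add: M.minus_eq)
  next
    case False
    let ?X = "{w \<oplus>\<^bsub>M\<^esub> b \<odot>\<^bsub>M\<^esub> x | w b. w \<in> W \<and> b \<in> carrier K}"
    have "submodule ?X K M"
    proof (rule M.submoduleI2)
      show "?X \<subseteq> carrier M" using Wc x by auto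
      show "\<zero>\<^bsub>M\<^esub> \<in> ?X" using sub(2) x by (auto intro!: exI[of _ "\<zero>\<^bsub>M\<^esub>"] exI[of _ "\<zero>\<^bsub>K\<^esub>"])
      fix y z assume "y \<in> ?X" "z \<in> ?X"
      then obtain w b w' b' where *: "w \<in> W" "b \<in> carrier K" "y = w \<oplus>\<^bsub>M\<^esub> b \<odot>\<^bsub>M\<^esub> x"
         "w' \<in> W" "b' \<in> carrier K" "z = w' \<oplus>\<^bsub>M\<^esub> b' \<odot>\<^bsub>M\<^esub> x" by blast
      then have "y \<oplus>\<^bsub>M\<^esub> z = (w \<oplus>\<^bsub>M\<^esub> w') \<oplus>\<^bsub>M\<^esub> (b \<oplus>\<^bsub>K\<^esub> b') \<odot>\<^bsub>M\<^esub> x"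
        using Wc x by (simp add: M.smult_l_distr M.a_ac)
      then show "y \<oplus>\<^bsub>M\<^esub> z \<in> ?X" using * sub by blast
    next
      fix a y assume a: "a \<in> carrier K" and "y \<in> ?X"
      then obtain w b where *: "w \<in> W" "b \<in> carrier K" "y = w \<oplus>\<^bsub>M\<^esub> b \<odot>\<^bsub>M\<^esub> x" by blast
      then have "a \<odot>\<^bsub>M\<^esub> y = a \<odot>\<^bsub>M\<^esub> w \<oplus>\<^bsub>M\<^esub> (a \<otimes>\<^bsub>K\<^esub> b) \<odot>\<^bsub>M\<^esub> x"
        using Wc x a by (simp add: M.smult_r_distr M.smult_assoc1)
      then show "a \<odot>\<^bsub>M\<^esub> y \<in> ?X" using * a sub by blast
    qed
    moreover have "W \<subseteq> ?X"
    proof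
      fix w assume "w \<in> W"
      then show "w \<in> ?X" using Wc x by (auto intro!: exI[of _ w] exI[of _ "\<zero>\<^bsub>K\<^esub>"])
    qed
    moreover have "x \<in> ?X"
      using x sub(2) by (auto intro!: exI[of _ "\<zero>\<^bsub>M\<^esub>"] exI[of _ "\<one>\<^bsub>K\<^esub>"])
    ultimately have "c \<in> ?X" using max[of ?X] False by blast
    then obtain w b where wb: "w \<in> W" "b \<in> carrier K" "c = w \<oplus>\<^bsub>M\<^esub> b \<odot>\<^bsub>M\<^esub> x" by blast
    have "b \<noteq> \<zero>\<^bsub>K\<^esub>" using wb W(3) Wc x by auto
    then have b: "b \<in> Units K" using wb(2) by (simp add: K.field_Units)
    then have ib: "inv\<^bsub>K\<^esub> b \<in> carrier K" by simp
    have "inv\<^bsub>K\<^esub> b \<odot>\<^bsub>M\<^esub> c = inv\<^bsub>K\<^esub> b \<odot>\<^bsub>M\<^esub> w \<oplus>\<^bsub>M\<^esub> (inv\<^bsub>K\<^esub> b \<otimes>\<^bsub>K\<^esub> b) \<odot>\<^bsub>M\<^esub> x"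
      using wb Wc x ib by (simp add: M.smult_r_distr M.smult_assoc1)
    also have "\<dots> = inv\<^bsub>K\<^esub> b \<odot>\<^bsub>M\<^esub> w \<oplus>\<^bsub>M\<^esub> x" using b x by (simp add: K.Units_l_inv)
    finally have "x \<ominus>\<^bsub>M\<^esub> inv\<^bsub>K\<^esub> b \<odot>\<^bsub>M\<^esub> c = \<ominus>\<^bsub>M\<^esub> (inv\<^bsub>K\<^esub> b \<odot>\<^bsub>M\<^esub> w)"
      using Wc[OF wb(1)] x ib M.smult_closed[OF ib Wc[OF wb(1)]] by algebra
    then show ?thesis using ib wb sub by (intro bexI[of _ "inv\<^bsub>K\<^esub> b"]) auto
  qed
  have uniq: "a = a'" if a: "a \<in> carrier K" "a' \<in> carrier K" "x \<in> carrier M"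
     "x \<ominus>\<^bsub>M\<^esub> a \<odot>\<^bsub>M\<^esub> c \<in> W" "x \<ominus>\<^bsub>M\<^esub> a' \<odot>\<^bsub>M\<^esub> c \<in> W" for x a a'
  proof (rule ccontr)
    assume ne: "a \<noteq> a'"
    have "(x \<ominus>\<^bsub>M\<^esub> a' \<odot>\<^bsub>M\<^esub> c) \<ominus>\<^bsub>M\<^esub> (x \<ominus>\<^bsub>M\<^esub> a \<odot>\<^bsub>M\<^esub> c) = a \<odot>\<^bsub>M\<^esub> c \<ominus>\<^bsub>M\<^esub> a' \<odot>\<^bsub>M\<^esub> c"
      using a(3) M.smult_closed[OF a(1) c(1)] M.smult_closed[OF a(2) c(1)] by algebra
    also have "\<dots> = (a \<ominus>\<^bsub>K\<^esub> a') \<odot>\<^bsub>M\<^esub> c"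
      using a c by (simp add: M.smult_l_distr M.smult_l_minus K.minus_eq M.minus_eq)
    finally have *: "(a \<ominus>\<^bsub>K\<^esub> a') \<odot>\<^bsub>M\<^esub> c \<in> W" using a sub(6) by metis
    have "a \<ominus>\<^bsub>K\<^esub> a' \<in> Units K" using ne a by (simp add: K.field_Units)
    then have "inv\<^bsub>K\<^esub> (a \<ominus>\<^bsub>K\<^esub> a') \<odot>\<^bsub>M\<^esub> ((a \<ominus>\<^bsub>K\<^esub> a') \<odot>\<^bsub>M\<^esub> c) = c"
      using a c by (simp add: M.smult_assoc1[symmetric] K.Units_l_inv)
    then show False using * sub(4) W(3) \<open>a \<ominus>\<^bsub>K\<^esub> a' \<in> Units K\<close> by (metis K.Units_inv_closed)
  qed
  define q where "q x = (THE a. a \<in> carrier K \<and> x \<ominus>\<^bsub>M\<^esub> a \<odot>\<^bsub>M\<^esub> c \<in> W)" for x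
  have q: "q x = a" if "a \<in> carrier K" "x \<in> carrier M" "x \<ominus>\<^bsub>M\<^esub> a \<odot>\<^bsub>M\<^esub> c \<in> W" for x a
    unfolding q_def using that uniq by blast
  have qW: "q x \<in> carrier K" "x \<ominus>\<^bsub>M\<^esub> q x \<odot>\<^bsub>M\<^esub> c \<in> W" if "x \<in> carrier M" for x
    using ex[OF that] q[OF _ that] by auto
  have "linear_map K M P (\<lambda>x. q x \<odot>\<^bsub>P\<^esub> p)"
  proof (rule linear_mapI)
    fix x assume x: "x \<in> carrier M"
    show "q x \<odot>\<^bsub>P\<^esub> p \<in> carrier P" using qW[OF x] p by simp
    { fix y assume y: "y \<in> carrier M"
      have "(x \<oplus>\<^bsub>M\<^esub> y) \<ominus>\<^bsub>M\<^esub> (q x \<oplus>\<^bsub>K\<^esub> q y) \<odot>\<^bsub>M\<^esub> c = (x \<ominus>\<^bsub>M\<^esub> q x \<odot>\<^bsub>M\<^esub> c) \<oplus>\<^bsub>M\<^esub> (y \<ominus>\<^bsub>M\<^esub> q y \<odot>\<^bsub>M\<^esub> c)"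
        using x y qW[OF x] qW[OF y] c by (simp add: M.smult_l_distr M.minus_eq M.minus_add M.a_ac)
      then have "q (x \<oplus>\<^bsub>M\<^esub> y) = q x \<oplus>\<^bsub>K\<^esub> q y"
        using x y qW[OF x] qW[OF y] sub(3) by (intro q) auto
      then show "q (x \<oplus>\<^bsub>M\<^esub> y) \<odot>\<^bsub>P\<^esub> p = q x \<odot>\<^bsub>P\<^esub> p \<oplus>\<^bsub>P\<^esub> q y \<odot>\<^bsub>P\<^esub> p"
        using qW[OF x] qW[OF y] p by (simp add: P.smult_l_distr) }
    fix a assume a: "a \<in> carrier K"
    have "a \<odot>\<^bsub>M\<^esub> x \<ominus>\<^bsub>M\<^esub> (a \<otimes>\<^bsub>K\<^esub> q x) \<odot>\<^bsub>M\<^esub> c = a \<odot>\<^bsub>M\<^esub> (x \<ominus>\<^bsub>M\<^esub> q x \<odot>\<^bsub>M\<^esub> c)"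
      using x qW[OF x] c a by (simp add: M.smult_r_distr M.minus_eq M.smult_r_minus M.smult_assoc1)
    then have "q (a \<odot>\<^bsub>M\<^esub> x) = a \<otimes>\<^bsub>K\<^esub> q x"
      using x qW[OF x] a sub(4) by (intro q) auto
    then show "q (a \<odot>\<^bsub>M\<^esub> x) \<odot>\<^bsub>P\<^esub> p = a \<odot>\<^bsub>P\<^esub> (q x \<odot>\<^bsub>P\<^esub> p)"
      using qW[OF x] a p by (simp add: P.smult_assoc1)
  qed
  moreover have "q x \<odot>\<^bsub>P\<^esub> p = \<zero>\<^bsub>P\<^esub>" if "x \<in> N" for x
  proof -
    have "q x = \<zero>\<^bsub>K\<^esub>" using that W(2) Wc c by (intro q) (auto simp: M.minus_eq subset_iff)
    then show ?thesis using p by simp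
  qed
  moreover have "q c \<odot>\<^bsub>P\<^esub> p = p"
  proof -
    have "q c = \<one>\<^bsub>K\<^esub>" using c sub(2) by (intro q) (auto simp: M.minus_eq M.r_neg)
    then show ?thesis using p by simp
  qed
  ultimately show ?thesis by (rule that)
qed

section \<open>Exterior powers\<close>

text \<open>The generating set of the span \<^const>\<open>ext_relations\<close>, named in order to view an exterior power as
  a presented module.\<close>

definition ext_rels ::
  "('k, 'r) ring_scheme \<Rightarrow> ('k, 'a, 'x) module_scheme \<Rightarrow> nat \<Rightarrow> ('a list \<Rightarrow> 'k) set" where
  "ext_rels R L n =
     {basis_vec R (xs[i := x \<oplus>\<^bsub>L\<^esub> y]) \<ominus>\<^bsub>tuple_module R L n\<^esub>
         (basis_vec R (xs[i := x]) \<oplus>\<^bsub>tuple_module R L n\<^esub> basis_vec R (xs[i := y]))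
        | xs i x y. xs \<in> tuples L n \<and> i < n \<and> x \<in> carrier L \<and> y \<in> carrier L} \<union>
      {basis_vec R (xs[i := a \<odot>\<^bsub>L\<^esub> x]) \<ominus>\<^bsub>tuple_module R L n\<^esub>
         (a \<odot>\<^bsub>tuple_module R L n\<^esub> basis_vec R (xs[i := x]))
        | xs i a x. xs \<in> tuples L n \<and> i < n \<and> a \<in> carrier R \<and> x \<in> carrier L} \<union>
      {basis_vec R xs | xs. xs \<in> tuples L n \<and> \<not> distinct xs}"

lemma ext_power_presented: "ext_power R L n = presented_module R (tuples L n) (ext_rels R L n)"
  by (simp add: ext_power_def presented_module_def ext_relations_def ext_rels_def tuple_module_def)

lemma wedge_presented:
  "xs \<in> tuples L n \<Longrightarrow> wedge R L xs = presented_gen R (tuples L n) (ext_rels R L n) xs"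
  by (simp add: wedge_def presented_gen_def ext_relations_def ext_rels_def tuple_module_def tuples_def)

lemma tuples_update: "\<lbrakk>xs \<in> tuples L n; x \<in> carrier L\<rbrakk> \<Longrightarrow> xs[i := x] \<in> tuples L n"
  using set_update_subset_insert[of xs i x] by (auto simp: tuples_def)

definition bilinear_map ::
  "('k, 'r) ring_scheme \<Rightarrow> ('k, 'a, 'x) module_scheme \<Rightarrow> ('k, 'b, 'y) module_scheme
     \<Rightarrow> ('k, 'c, 'z) module_scheme \<Rightarrow> ('a \<Rightarrow> 'b \<Rightarrow> 'c) \<Rightarrow> bool" where
  "bilinear_map R M N P \<phi> \<longleftrightarrow> (\<forall>y\<in>carrier N. linear_map R M P (\<lambda>x. \<phi> x y)) \<and>
     (\<forall>x\<in>carrier M. linear_map R N P (\<phi> x))"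

lemma bilinear_mapD:
  assumes "bilinear_map R M N P \<phi>"
  shows "y \<in> carrier N \<Longrightarrow> linear_map R M P (\<lambda>x. \<phi> x y)"
    "x \<in> carrier M \<Longrightarrow> linear_map R N P (\<lambda>y. \<phi> x y)"
  using assms by (auto simp: bilinear_map_def)

lemma (in abelian_monoid) finsum_1: "f a \<in> carrier G \<Longrightarrow> (\<Oplus>p\<in>{a}. f p) = f a"
  by simp

lemma (in abelian_monoid) finsum_3:
  assumes "distinct [a, b, c]" "f a \<in> carrier G" "f b \<in> carrier G" "f c \<in> carrier G"
  shows "(\<Oplus>p\<in>{a, b, c}. f p) = f a \<oplus> f b \<oplus> f c"
  using assms by (simp add: a_assoc)

context module
begin

lemma ext_rels_closed: "ext_rels R M n \<subseteq> carrier (free_module R (tuples M n))"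
proof -
  interpret F: module R "free_module R (tuples M n)" by (rule free_module_module[OF R.is_cring])
  note b = basis_vec_in_free_module[OF R.is_cring, of _ "tuples M n"]
  show ?thesis
    unfolding ext_rels_def tuple_module_def
    by (auto intro!: F.minus_closed F.a_closed F.smult_closed b tuples_update)
qed

lemma ext_power_module: "module R (ext_power R M n)"
  unfolding ext_power_presented by (rule presented_module_module[OF R.is_cring ext_rels_closed])

lemma wedge_closed: "xs \<in> tuples M n \<Longrightarrow> wedge R M xs \<in> carrier (ext_power R M n)"
  unfolding ext_power_presented wedge_presented
  by (rule presented_gen_closed[OF R.is_cring ext_rels_closed])

lemma ext_power_span:
  "carrier (ext_power R M n) \<subseteq> lin_span R (ext_power R M n) (wedge R M ` tuples M n)"
proof -
  have "wedge R M ` tuples M n = presented_gen R (tuples M n) (ext_rels R M n) ` tuples M n"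
    by (rule image_cong) (auto simp: wedge_presented)
  then show ?thesis
    using presented_module_span[OF R.is_cring ext_rels_closed] by (simp add: ext_power_presented)
qed

lemma ext_power_eqI:
  assumes "module R N" "linear_map R (ext_power R M n) N f" "linear_map R (ext_power R M n) N g"
    and "\<And>xs. xs \<in> tuples M n \<Longrightarrow> f (wedge R M xs) = g (wedge R M xs)"
    and "x \<in> carrier (ext_power R M n)"
  shows "f x = g x"
  by (rule linear_map_eq_on_span[OF ext_power_module assms(1-3), of "wedge R M ` tuples M n"])
     (use assms(4,5) wedge_closed ext_power_span[of n] in auto)

lemma wedge_relations:
  assumes "xs \<in> tuples M n" "i < n" "x \<in> carrier M" "y \<in> carrier M" "a \<in> carrier R"
  shows "wedge R M (xs[i := x \<oplus>\<^bsub>M\<^esub> y])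
       = wedge R M (xs[i := x]) \<oplus>\<^bsub>ext_power R M n\<^esub> wedge R M (xs[i := y])"
    "wedge R M (xs[i := a \<odot>\<^bsub>M\<^esub> x]) = a \<odot>\<^bsub>ext_power R M n\<^esub> wedge R M (xs[i := x])"
    "\<not> distinct xs \<Longrightarrow> wedge R M xs = \<zero>\<^bsub>ext_power R M n\<^esub>"
proof -
  let ?F = "free_module R (tuples M n)"
  interpret F: module R ?F by (rule free_module_module[OF R.is_cring])
  interpret E: module R "ext_power R M n" by (rule ext_power_module)
  note b = basis_vec_in_free_module[OF R.is_cring, of _ "tuples M n"]
  note p = presented_proj_linear[OF R.is_cring ext_rels_closed, of n, folded ext_power_presented]
  note rel = presented_relation[OF R.is_cring ext_rels_closed, of n, folded ext_power_presented, OF p]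
  define h where "h x = lin_span R ?F (ext_rels R M n) +>\<^bsub>?F\<^esub> x" for x
  have h: "linear_map R ?F (ext_power R M n) h" unfolding h_def by (rule p)
  have hw: "h (basis_vec R ys) = wedge R M ys" if "ys \<in> tuples M n" for ys
    unfolding h_def using that by (simp add: wedge_presented presented_gen_def)
  have hr: "h s = \<zero>\<^bsub>ext_power R M n\<^esub>" if "s \<in> ext_rels R M n" for s
    unfolding h_def by (rule rel) (use that in \<open>auto simp: presented_gen_def\<close>)
  note t = tuples_update[OF assms(1)]
  note hs = linear_map_minus[OF F.module_axioms E.module_axioms h] linear_map_add[OF h]
     linear_map_smult[OF h] hw t b wedge_closed
  have "h (basis_vec R (xs[i := x \<oplus>\<^bsub>M\<^esub> y]) \<ominus>\<^bsub>?F\<^esub>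
         (basis_vec R (xs[i := x]) \<oplus>\<^bsub>?F\<^esub> basis_vec R (xs[i := y]))) = \<zero>\<^bsub>ext_power R M n\<^esub>"
    by (rule hr) (use assms in \<open>auto simp: ext_rels_def tuple_module_def\<close>)
  then show "wedge R M (xs[i := x \<oplus>\<^bsub>M\<^esub> y])
       = wedge R M (xs[i := x]) \<oplus>\<^bsub>ext_power R M n\<^esub> wedge R M (xs[i := y])"
    using assms by (simp add: hs E.minus_zero_iff)
  have "h (basis_vec R (xs[i := a \<odot>\<^bsub>M\<^esub> x]) \<ominus>\<^bsub>?F\<^esub>
         (a \<odot>\<^bsub>?F\<^esub> basis_vec R (xs[i := x]))) = \<zero>\<^bsub>ext_power R M n\<^esub>"
    by (rule hr) (use assms in \<open>auto simp: ext_rels_def tuple_module_def\<close>)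
  then show "wedge R M (xs[i := a \<odot>\<^bsub>M\<^esub> x]) = a \<odot>\<^bsub>ext_power R M n\<^esub> wedge R M (xs[i := x])"
    using assms by (simp add: hs E.minus_zero_iff)
  show "wedge R M xs = \<zero>\<^bsub>ext_power R M n\<^esub>" if "\<not> distinct xs"
  proof -
    have "basis_vec R xs \<in> ext_rels R M n" unfolding ext_rels_def using that assms(1) by blast
    then show ?thesis using hr hw[OF assms(1)] by simp
  qed
qed

lemma ext_power_universal:
  assumes "module R N"
    and closed: "\<And>xs. xs \<in> tuples M n \<Longrightarrow> g xs \<in> carrier N"
    and add: "\<And>xs i x y. \<lbrakk>xs \<in> tuples M n; i < n; x \<in> carrier M; y \<in> carrier M\<rbrakk> \<Longrightarrow>
      g (xs[i := x \<oplus>\<^bsub>M\<^esub> y]) = g (xs[i := x]) \<oplus>\<^bsub>N\<^esub> g (xs[i := y])"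
    and smult: "\<And>xs i a x. \<lbrakk>xs \<in> tuples M n; i < n; a \<in> carrier R; x \<in> carrier M\<rbrakk> \<Longrightarrow>
      g (xs[i := a \<odot>\<^bsub>M\<^esub> x]) = a \<odot>\<^bsub>N\<^esub> g (xs[i := x])"
    and alt: "\<And>xs. \<lbrakk>xs \<in> tuples M n; \<not> distinct xs\<rbrakk> \<Longrightarrow> g xs = \<zero>\<^bsub>N\<^esub>"
  obtains h where "linear_map R (ext_power R M n) N h"
    "\<And>xs. xs \<in> tuples M n \<Longrightarrow> h (wedge R M xs) = g xs"
proof -
  let ?F = "free_module R (tuples M n)"
  interpret F: module R ?F by (rule free_module_module[OF R.is_cring])
  interpret N: module R N by fact
  note b = basis_vec_in_free_module[OF R.is_cring, of _ "tuples M n"]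
  have g: "g \<in> tuples M n \<rightarrow> carrier N" using closed by auto
  obtain h where h: "linear_map R (ext_power R M n) N h"
    "\<And>xs. xs \<in> tuples M n \<Longrightarrow> h (presented_gen R (tuples M n) (ext_rels R M n) xs) = g xs"
    unfolding ext_power_presented
  proof (rule presented_module_universal[OF R.is_cring ext_rels_closed assms(1) g])
    fix h s
    assume h: "linear_map R ?F N h" and hb: "\<And>xs. xs \<in> tuples M n \<Longrightarrow> h (basis_vec R xs) = g xs"
      and s: "s \<in> ext_rels R M n"
    note hs = linear_map_minus[OF F.module_axioms N.module_axioms h] linear_map_add[OF h]
      linear_map_smult[OF h] hb tuples_update b closed
    from s show "h s = \<zero>\<^bsub>N\<^esub>"
      unfolding ext_rels_def tuple_module_def
      by (auto simp: hs add smult alt N.minus_zero_iff)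
  qed blast
  then show ?thesis by (intro that[of h]) (simp_all add: wedge_presented)
qed

lemma tuples_1: "tuples M (Suc 0) = {[x] | x. x \<in> carrier M}"
  by (auto simp: tuples_def length_Suc_conv)

lemma tuples_2: "tuples M 2 = {[x, y] | x y. x \<in> carrier M \<and> y \<in> carrier M}"
  by (auto simp: tuples_def length_Suc_conv numeral_2_eq_2)

lemma tuples_3: "tuples M 3 = {[x, y, z] | x y z. x \<in> carrier M \<and> y \<in> carrier M \<and> z \<in> carrier M}"
  by (auto simp: tuples_def length_Suc_conv numeral_3_eq_3)

text \<open>The relations of the exterior power, in the form in which they compose with other linear maps.\<close>

lemma wedge_multilinear:
  assumes "xs \<in> tuples M n" "i < n"
  shows "linear_map R M (ext_power R M n) (\<lambda>x. wedge R M (xs[i := x]))"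
  using wedge_relations(1)[OF assms _ _ R.zero_closed] wedge_relations(2)[OF assms _ M.zero_closed]
    wedge_closed tuples_update[OF assms(1)]
  by (intro linear_mapI) simp_all

lemma wedge1_linear: "linear_map R M (ext_power R M (Suc 0)) (\<lambda>x. wedge R M [x])"
  using wedge_multilinear[of "[\<zero>\<^bsub>M\<^esub>]" "Suc 0" 0] by (simp add: tuples_1)

lemma wedge2_bilinear: "bilinear_map R M M (ext_power R M 2) (\<lambda>x y. wedge R M [x, y])"
  using wedge_multilinear[of "[z, z]" 2 0 for z] wedge_multilinear[of "[z, z]" 2 1 for z]
  by (simp add: bilinear_map_def tuples_2)

lemma wedge3_linear:
  assumes "x \<in> carrier M" "y \<in> carrier M"
  shows "linear_map R M (ext_power R M 3) (\<lambda>z. wedge R M [z, x, y])"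
    "linear_map R M (ext_power R M 3) (\<lambda>z. wedge R M [x, z, y])"
    "linear_map R M (ext_power R M 3) (\<lambda>z. wedge R M [x, y, z])"
  using assms wedge_multilinear[of "[x, x, y]" 3 0] wedge_multilinear[of "[x, x, y]" 3 1]
    wedge_multilinear[of "[x, y, y]" 3 2]
  by (simp_all add: tuples_3)

lemma wedge2_alt: "x \<in> carrier M \<Longrightarrow> wedge R M [x, x] = \<zero>\<^bsub>ext_power R M 2\<^esub>"
  using wedge_relations(3)[of "[x,x]" 2 0 x x "\<zero>\<^bsub>R\<^esub>"] by (auto simp: tuples_2)

lemma alternating_antisym:
  assumes "module R N" "bilinear_map R M M N \<phi>" "\<And>x. x \<in> carrier M \<Longrightarrow> \<phi> x x = \<zero>\<^bsub>N\<^esub>"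
    and x: "x \<in> carrier M" and y: "y \<in> carrier M"
  shows "\<phi> x y = \<ominus>\<^bsub>N\<^esub> \<phi> y x"
proof -
  interpret N: module R N by fact
  note b = bilinear_mapD[OF assms(2)]
  have c: "\<phi> u v \<in> carrier N" if "u \<in> carrier M" "v \<in> carrier M" for u v
    using linear_map_closed[OF b(2)] that by blast
  have xy: "x \<oplus>\<^bsub>M\<^esub> y \<in> carrier M" using x y by simp
  have "\<phi> (x \<oplus>\<^bsub>M\<^esub> y) (x \<oplus>\<^bsub>M\<^esub> y) = (\<phi> x x \<oplus>\<^bsub>N\<^esub> \<phi> y x) \<oplus>\<^bsub>N\<^esub> (\<phi> x y \<oplus>\<^bsub>N\<^esub> \<phi> y y)"
    using x y xy by (simp add: linear_map_add[OF b(1)] linear_map_add[OF b(2)])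
  then have "\<phi> x y \<oplus>\<^bsub>N\<^esub> \<phi> y x = \<zero>\<^bsub>N\<^esub>"
    using x y xy c by (simp add: assms(3) N.a_comm)
  then show ?thesis using c x y by (simp add: N.add.inv_equality N.minus_equality)
qed

lemma ext_power_2_universal:
  assumes "module R N" "bilinear_map R M M N \<phi>" "\<And>x. x \<in> carrier M \<Longrightarrow> \<phi> x x = \<zero>\<^bsub>N\<^esub>"
  obtains h where "linear_map R (ext_power R M 2) N h"
    "\<And>x y. \<lbrakk>x \<in> carrier M; y \<in> carrier M\<rbrakk> \<Longrightarrow> h (wedge R M [x, y]) = \<phi> x y"
proof -
  interpret N: module R N by fact
  note b = bilinear_mapD[OF assms(2)]
  obtain h where h: "linear_map R (ext_power R M 2) N h"
    "\<And>xs. xs \<in> tuples M 2 \<Longrightarrow> h (wedge R M xs) = \<phi> (xs ! 0) (xs ! 1)"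
  proof (rule ext_power_universal[OF assms(1), of 2 "\<lambda>xs. \<phi> (xs ! 0) (xs ! 1)"])
    fix xs :: "'c list" and i x y
    assume "xs \<in> tuples M 2" "i < (2::nat)" "x \<in> carrier M" "y \<in> carrier M"
    then show "\<phi> (xs[i := x \<oplus>\<^bsub>M\<^esub> y] ! 0) (xs[i := x \<oplus>\<^bsub>M\<^esub> y] ! 1)
      = \<phi> (xs[i := x] ! 0) (xs[i := x] ! 1) \<oplus>\<^bsub>N\<^esub> \<phi> (xs[i := y] ! 0) (xs[i := y] ! 1)"
      by (auto simp: tuples_2 less_2_cases_iff linear_map_add[OF b(1)] linear_map_add[OF b(2)])
  next
    fix xs :: "'c list" and i a x
    assume "xs \<in> tuples M 2" "i < (2::nat)" "a \<in> carrier R" "x \<in> carrier M"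
    then show "\<phi> (xs[i := a \<odot>\<^bsub>M\<^esub> x] ! 0) (xs[i := a \<odot>\<^bsub>M\<^esub> x] ! 1)
      = a \<odot>\<^bsub>N\<^esub> \<phi> (xs[i := x] ! 0) (xs[i := x] ! 1)"
      by (auto simp: tuples_2 less_2_cases_iff linear_map_smult[OF b(1)] linear_map_smult[OF b(2)])
  qed (auto simp: tuples_2 assms(3) linear_map_closed[OF b(1)])
  show ?thesis
    by (rule that[OF h(1)]) (use h(2) in \<open>force simp: tuples_2\<close>)
qed

lemma ext_power_3_universal:
  assumes "module R N"
    and b1: "\<And>y z. \<lbrakk>y \<in> carrier M; z \<in> carrier M\<rbrakk> \<Longrightarrow> linear_map R M N (\<lambda>x. \<phi> x y z)"
    and b2: "\<And>x z. \<lbrakk>x \<in> carrier M; z \<in> carrier M\<rbrakk> \<Longrightarrow> linear_map R M N (\<lambda>y. \<phi> x y z)"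
    and b3: "\<And>x y. \<lbrakk>x \<in> carrier M; y \<in> carrier M\<rbrakk> \<Longrightarrow> linear_map R M N (\<lambda>z. \<phi> x y z)"
    and alt: "\<And>x y. \<lbrakk>x \<in> carrier M; y \<in> carrier M\<rbrakk> \<Longrightarrow> \<phi> x x y = \<zero>\<^bsub>N\<^esub>"
     "\<And>x y. \<lbrakk>x \<in> carrier M; y \<in> carrier M\<rbrakk> \<Longrightarrow> \<phi> x y x = \<zero>\<^bsub>N\<^esub>"
     "\<And>x y. \<lbrakk>x \<in> carrier M; y \<in> carrier M\<rbrakk> \<Longrightarrow> \<phi> x y y = \<zero>\<^bsub>N\<^esub>"
  obtains h where "linear_map R (ext_power R M 3) N h"
    "\<And>x y z. \<lbrakk>x \<in> carrier M; y \<in> carrier M; z \<in> carrier M\<rbrakk> \<Longrightarrow> h (wedge R M [x, y, z]) = \<phi> x y z"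
proof -
  interpret N: module R N by fact
  have three: "i < 3 \<Longrightarrow> i = 0 \<or> i = 1 \<or> i = 2" for i :: nat by auto
  obtain h where h: "linear_map R (ext_power R M 3) N h"
    "\<And>xs. xs \<in> tuples M 3 \<Longrightarrow> h (wedge R M xs) = \<phi> (xs ! 0) (xs ! 1) (xs ! 2)"
  proof (rule ext_power_universal[OF assms(1), of 3 "\<lambda>xs. \<phi> (xs ! 0) (xs ! 1) (xs ! 2)"])
    fix xs :: "'c list" and i x y
    assume "xs \<in> tuples M 3" "i < (3::nat)" "x \<in> carrier M" "y \<in> carrier M"
    then show "\<phi> (xs[i := x \<oplus>\<^bsub>M\<^esub> y] ! 0) (xs[i := x \<oplus>\<^bsub>M\<^esub> y] ! 1) (xs[i := x \<oplus>\<^bsub>M\<^esub> y] ! 2)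
      = \<phi> (xs[i := x] ! 0) (xs[i := x] ! 1) (xs[i := x] ! 2)
        \<oplus>\<^bsub>N\<^esub> \<phi> (xs[i := y] ! 0) (xs[i := y] ! 1) (xs[i := y] ! 2)"
      by (auto simp: tuples_3 dest!: three
         simp: linear_map_add[OF b1] linear_map_add[OF b2] linear_map_add[OF b3])
  next
    fix xs :: "'c list" and i a x
    assume "xs \<in> tuples M 3" "i < (3::nat)" "a \<in> carrier R" "x \<in> carrier M"
    then show "\<phi> (xs[i := a \<odot>\<^bsub>M\<^esub> x] ! 0) (xs[i := a \<odot>\<^bsub>M\<^esub> x] ! 1) (xs[i := a \<odot>\<^bsub>M\<^esub> x] ! 2)
      = a \<odot>\<^bsub>N\<^esub> \<phi> (xs[i := x] ! 0) (xs[i := x] ! 1) (xs[i := x] ! 2)"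
      by (auto simp: tuples_3 dest!: three
         simp: linear_map_smult[OF b1] linear_map_smult[OF b2] linear_map_smult[OF b3])
  qed (auto simp: tuples_3 alt linear_map_closed[OF b1])
  show ?thesis
    by (rule that[OF h(1)]) (use h(2) in \<open>force simp: tuples_3\<close>)
qed

end

context lie_algebra
begin

text \<open>The boundary map is defined by a unique description. Uniqueness holds because the wedges span, so it
  remains to exhibit a linear map with the right values; in low degrees this is done below by
  checking that these values are alternating.\<close>

lemma ext_delta_eq:
  assumes d: "linear_map R (ext_power R L (Suc n)) (ext_power R L n) d"
    and dw: "\<And>xs. xs \<in> tuples L (Suc n) \<Longrightarrow> d (wedge R L xs) =
        (\<Oplus>\<^bsub>ext_power R L n\<^esub>p\<in>{(i, j). i < j \<and> j < Suc n}.
           ((\<ominus>\<^bsub>R\<^esub> \<one>\<^bsub>R\<^esub>) [^]\<^bsub>R\<^esub> (fst p + snd p)) \<odot>\<^bsub>ext_power R L n\<^esub>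
             wedge R L (bracket L (xs ! fst p) (xs ! snd p) # nths xs (- {fst p, snd p})))"
  shows "ext_delta R L n = restrict d (carrier (ext_power R L (Suc n)))"
  unfolding ext_delta_def
proof (rule the_equality)
  let ?E = "ext_power R L (Suc n)"
  show "restrict d (carrier ?E) \<in> linear_hom R ?E (ext_power R L n) \<and>
    (\<forall>xs\<in>tuples L (Suc n). restrict d (carrier ?E) (wedge R L xs) =
        (\<Oplus>\<^bsub>ext_power R L n\<^esub>p\<in>{(i, j). i < j \<and> j < Suc n}.
           ((\<ominus>\<^bsub>R\<^esub> \<one>\<^bsub>R\<^esub>) [^]\<^bsub>R\<^esub> (fst p + snd p)) \<odot>\<^bsub>ext_power R L n\<^esub>
             wedge R L (bracket L (xs ! fst p) (xs ! snd p) # nths xs (- {fst p, snd p}))))"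
    using linear_map_restrict[OF ext_power_module d] dw wedge_closed by auto
  fix d'
  assume *: "d' \<in> linear_hom R ?E (ext_power R L n) \<and>
    (\<forall>xs\<in>tuples L (Suc n). d' (wedge R L xs) =
        (\<Oplus>\<^bsub>ext_power R L n\<^esub>p\<in>{(i, j). i < j \<and> j < Suc n}.
           ((\<ominus>\<^bsub>R\<^esub> \<one>\<^bsub>R\<^esub>) [^]\<^bsub>R\<^esub> (fst p + snd p)) \<odot>\<^bsub>ext_power R L n\<^esub>
             wedge R L (bracket L (xs ! fst p) (xs ! snd p) # nths xs (- {fst p, snd p}))))"
  then have "d' x = d x" if "x \<in> carrier ?E" for x
    using ext_power_eqI[OF ext_power_module linear_homD d, of d' x] dw that by auto
  then show "d' = restrict d (carrier ?E)"
    using * by (intro extensionalityI[of _ "carrier ?E"]) (auto simp: linear_hom_def)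
qed

lemma bracket_bilinear: "bilinear_map R L L L (bracket L)"
  using bracket_linear1 bracket_linear2 by (auto simp: bilinear_map_def)

lemma bracket_closed: "\<lbrakk>x \<in> carrier L; y \<in> carrier L\<rbrakk> \<Longrightarrow> bracket L x y \<in> carrier L"
  using linear_map_closed[OF bracket_linear1] by blast

lemma bracket_antisym:
  "\<lbrakk>x \<in> carrier L; y \<in> carrier L\<rbrakk> \<Longrightarrow> bracket L x y = \<ominus>\<^bsub>L\<^esub> bracket L y x"
  by (rule alternating_antisym[OF module_axioms bracket_bilinear bracket_alt])

lemma wedge2_closed:
  "\<lbrakk>x \<in> carrier L; y \<in> carrier L\<rbrakk> \<Longrightarrow> wedge R L [x, y] \<in> carrier (ext_power R L 2)"
  by (rule wedge_closed) (auto simp: tuples_2)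

lemma wedge2_antisym: "\<lbrakk>x \<in> carrier L; y \<in> carrier L\<rbrakk> \<Longrightarrow>
    wedge R L [x, y] = \<ominus>\<^bsub>ext_power R L 2\<^esub> wedge R L [y, x]"
  by (rule alternating_antisym[OF ext_power_module[of 2] wedge2_bilinear wedge2_alt])

lemma ext_delta_1:
  shows "linear_map R (ext_power R L 2) (ext_power R L (Suc 0)) (ext_delta R L (Suc 0))" (is ?A)
    and "\<And>x y. \<lbrakk>x \<in> carrier L; y \<in> carrier L\<rbrakk> \<Longrightarrow>
      ext_delta R L (Suc 0) (wedge R L [x, y]) = \<ominus>\<^bsub>ext_power R L (Suc 0)\<^esub> wedge R L [bracket L x y]"
proof -
  interpret E1: module R "ext_power R L (Suc 0)" by (rule ext_power_module)
  have w1: "wedge R L [x] \<in> carrier (ext_power R L (Suc 0))" if "x \<in> carrier L" for x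
    using wedge_closed[of "[x]" "Suc 0"] that by (auto simp: tuples_1)
  have lin: "linear_map R L (ext_power R L (Suc 0)) (\<lambda>x. \<ominus>\<^bsub>ext_power R L (Suc 0)\<^esub> wedge R L [x])"
    by (rule linear_map_uminus[OF module_axioms ext_power_module]) (simp add: wedge1_linear)
  have "bilinear_map R L L (ext_power R L (Suc 0)) (\<lambda>x y. \<ominus>\<^bsub>ext_power R L (Suc 0)\<^esub> wedge R L [bracket L x y])"
    unfolding bilinear_map_def
    using linear_map_comp[OF bracket_linear1 lin] linear_map_comp[OF bracket_linear2 lin] by blast
  moreover have "\<ominus>\<^bsub>ext_power R L (Suc 0)\<^esub> wedge R L [bracket L x x] = \<zero>\<^bsub>ext_power R L (Suc 0)\<^esub>"
    if "x \<in> carrier L" for x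
    using linear_map_zero[OF module_axioms E1.module_axioms lin] that by (simp add: bracket_alt)
  ultimately obtain d where d: "linear_map R (ext_power R L 2) (ext_power R L (Suc 0)) d"
    "\<And>x y. \<lbrakk>x \<in> carrier L; y \<in> carrier L\<rbrakk> \<Longrightarrow>
       d (wedge R L [x, y]) = \<ominus>\<^bsub>ext_power R L (Suc 0)\<^esub> wedge R L [bracket L x y]"
    using ext_power_2_universal[OF E1.module_axioms] by blast
  have idx: "{(i, j). i < j \<and> j < Suc (Suc 0)} = {(0, 1 :: nat)}" by auto
  have eq: "ext_delta R L (Suc 0) = restrict d (carrier (ext_power R L (Suc (Suc 0))))"
  proof (rule ext_delta_eq)
    show "linear_map R (ext_power R L (Suc (Suc 0))) (ext_power R L (Suc 0)) d"
      using d(1) by (simp add: numeral_2_eq_2)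
    fix xs assume "xs \<in> tuples L (Suc (Suc 0))"
    then obtain x y where xs: "xs = [x, y]" "x \<in> carrier L" "y \<in> carrier L"
      using tuples_2 by (auto simp: numeral_2_eq_2)
    then show "d (wedge R L xs) =
        (\<Oplus>\<^bsub>ext_power R L (Suc 0)\<^esub>p\<in>{(i, j). i < j \<and> j < Suc (Suc 0)}.
           ((\<ominus>\<^bsub>R\<^esub> \<one>\<^bsub>R\<^esub>) [^]\<^bsub>R\<^esub> (fst p + snd p)) \<odot>\<^bsub>ext_power R L (Suc 0)\<^esub>
             wedge R L (bracket L (xs ! fst p) (xs ! snd p) # nths xs (- {fst p, snd p})))"
      unfolding idx using w1[OF bracket_closed[OF xs(2,3)]]
      by (subst E1.finsum_1) (simp_all add: d(2) nths_Cons E1.smult_l_minus)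
  qed
  then show ?A using linear_homD[OF linear_map_restrict[OF ext_power_module d(1)]]
    by (simp add: numeral_2_eq_2)
  fix x y assume "x \<in> carrier L" "y \<in> carrier L"
  then show "ext_delta R L (Suc 0) (wedge R L [x, y]) = \<ominus>\<^bsub>ext_power R L (Suc 0)\<^esub> wedge R L [bracket L x y]"
    using eq d(2) wedge2_closed by (simp add: numeral_2_eq_2)
qed

lemma ext_delta_2:
  shows "linear_map R (ext_power R L 3) (ext_power R L 2) (ext_delta R L 2)" (is ?A)
    and "\<And>x y z. \<lbrakk>x \<in> carrier L; y \<in> carrier L; z \<in> carrier L\<rbrakk> \<Longrightarrow>
      ext_delta R L 2 (wedge R L [x, y, z])
       = \<ominus>\<^bsub>ext_power R L 2\<^esub> wedge R L [bracket L x y, z]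
          \<oplus>\<^bsub>ext_power R L 2\<^esub> wedge R L [bracket L x z, y]
          \<ominus>\<^bsub>ext_power R L 2\<^esub> wedge R L [bracket L y z, x]"
proof -
  let ?E = "ext_power R L 2"
  interpret E: module R ?E by (rule ext_power_module)
  note bl = bracket_linear1 bracket_linear2
  note w = bilinear_mapD[OF wedge2_bilinear]
  note wl = linear_map_comp[OF _ w(1)] linear_map_comp[OF _ w(2)]
  note wz = linear_map_zero[OF module_axioms E.module_axioms w(1)]
  define \<phi> where "\<phi> x y z = \<ominus>\<^bsub>?E\<^esub> wedge R L [bracket L x y, z]
     \<oplus>\<^bsub>?E\<^esub> wedge R L [bracket L x z, y] \<ominus>\<^bsub>?E\<^esub> wedge R L [bracket L y z, x]" for x y z
  have minus_wedge: "wedge R L [\<ominus>\<^bsub>L\<^esub> x, y] = \<ominus>\<^bsub>?E\<^esub> wedge R L [x, y]"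
    if "x \<in> carrier L" "y \<in> carrier L" for x y
    using linear_map_inv[OF module_axioms E.module_axioms w(1)] that by blast
  note c = wedge2_closed bracket_closed
  obtain d where d: "linear_map R (ext_power R L 3) ?E d"
    "\<And>x y z. \<lbrakk>x \<in> carrier L; y \<in> carrier L; z \<in> carrier L\<rbrakk> \<Longrightarrow> d (wedge R L [x, y, z]) = \<phi> x y z"
  proof (rule ext_power_3_universal[OF E.module_axioms, of \<phi>])
    fix y z assume yz: "y \<in> carrier L" "z \<in> carrier L"
    show "linear_map R L ?E (\<lambda>x. \<phi> x y z)" "linear_map R L ?E (\<lambda>x. \<phi> y x z)"
      "linear_map R L ?E (\<lambda>x. \<phi> y z x)"
      unfolding \<phi>_def
      by (intro linear_map_diff linear_map_plus linear_map_uminus module_axioms ext_power_module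
           wl(1) bl w(2) bracket_closed yz)+
    show "\<phi> y y z = \<zero>\<^bsub>?E\<^esub>" using yz c[OF bracket_closed] unfolding \<phi>_def
      by (simp add: bracket_alt wz E.minus_eq E.r_neg)
    show "\<phi> y z y = \<zero>\<^bsub>?E\<^esub>" using yz c(1)[OF bracket_closed] unfolding \<phi>_def
      by (simp add: bracket_alt wz bracket_antisym[of z y] minus_wedge bracket_closed E.minus_eq E.l_neg)
    show "\<phi> y z z = \<zero>\<^bsub>?E\<^esub>" using yz c(1)[OF bracket_closed] unfolding \<phi>_def
      by (simp add: bracket_alt wz E.minus_eq E.l_neg)
  qed blast
  have idx: "{(i, j). i < j \<and> j < Suc 2} = {(0, 1), (0, 2), (1, 2 :: nat)}" by auto
  have eq: "ext_delta R L 2 = restrict d (carrier (ext_power R L (Suc 2)))"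
  proof (rule ext_delta_eq)
    show "linear_map R (ext_power R L (Suc 2)) ?E d"
      using d(1) by (simp add: numeral_3_eq_3 numeral_2_eq_2)
    fix xs assume "xs \<in> tuples L (Suc 2)"
    then obtain x y z where xs: "xs = [x, y, z]" "x \<in> carrier L" "y \<in> carrier L" "z \<in> carrier L"
      using tuples_3 by (auto simp: numeral_3_eq_3 numeral_2_eq_2)
    have pow: "(\<ominus>\<^bsub>R\<^esub> \<one>\<^bsub>R\<^esub>) [^]\<^bsub>R\<^esub> (2::nat) = \<one>\<^bsub>R\<^esub>" "(\<ominus>\<^bsub>R\<^esub> \<one>\<^bsub>R\<^esub>) [^]\<^bsub>R\<^esub> (3::nat) = \<ominus>\<^bsub>R\<^esub> \<one>\<^bsub>R\<^esub>"
      by (simp_all add: numeral_2_eq_2 numeral_3_eq_3 R.l_minus)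
    show "d (wedge R L xs) =
        (\<Oplus>\<^bsub>?E\<^esub>p\<in>{(i, j). i < j \<and> j < Suc 2}.
           ((\<ominus>\<^bsub>R\<^esub> \<one>\<^bsub>R\<^esub>) [^]\<^bsub>R\<^esub> (fst p + snd p)) \<odot>\<^bsub>?E\<^esub>
             wedge R L (bracket L (xs ! fst p) (xs ! snd p) # nths xs (- {fst p, snd p})))"
      unfolding idx using xs c
      by (subst E.finsum_3)
        (simp_all add: d(2) nths_Cons E.smult_l_minus \<phi>_def pow numeral_2_eq_2[symmetric]
         E.minus_eq R.l_minus)
  qed
  then have eq: "ext_delta R L 2 = restrict d (carrier (ext_power R L 3))" by simp
  show ?A unfolding eq by (rule linear_homD[OF linear_map_restrict[OF ext_power_module d(1)]])
  fix x y z assume xyz: "x \<in> carrier L" "y \<in> carrier L" "z \<in> carrier L"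
  then have "wedge R L [x, y, z] \<in> carrier (ext_power R L 3)"
    by (intro wedge_closed) (auto simp: tuples_3)
  then show "ext_delta R L 2 (wedge R L [x, y, z])
       = \<ominus>\<^bsub>?E\<^esub> wedge R L [bracket L x y, z] \<oplus>\<^bsub>?E\<^esub> wedge R L [bracket L x z, y]
          \<ominus>\<^bsub>?E\<^esub> wedge R L [bracket L y z, x]"
    unfolding eq using d(2)[OF xyz] by (simp add: \<phi>_def)
qed

end

section \<open>Gradings\<close>

definition homogeneous_part :: "('k, 'a, 'x) module_scheme \<Rightarrow> (int \<Rightarrow> 'a set) \<Rightarrow> 'a \<Rightarrow> int \<Rightarrow> 'a" where
  "homogeneous_part M G x = (THE c. (\<forall>i. c i \<in> G i) \<and> finite {i. c i \<noteq> \<zero>\<^bsub>M\<^esub>} \<and>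
        x = (\<Oplus>\<^bsub>M\<^esub>i\<in>{i. c i \<noteq> \<zero>\<^bsub>M\<^esub>}. c i))"

context
  fixes R :: "('k, 'r) ring_scheme" and M :: "('k, 'a, 'x) module_scheme" and G :: "int \<Rightarrow> 'a set"
  assumes gr: "graded_module R M G"
begin

interpretation M: module R M using gr by (simp add: graded_module_def)

lemma graded_submodule: "submodule (G i) R M"
  using gr by (simp add: graded_module_def)

lemma grade_subset: "x \<in> G i \<Longrightarrow> x \<in> carrier M"
  using submodule_closed(1)[OF graded_submodule] by blast

lemma finsum_support:
  assumes "\<And>i. c i \<in> G i" "finite A" "\<And>i. i \<notin> A \<Longrightarrow> c i = \<zero>\<^bsub>M\<^esub>"
  shows "(\<Oplus>\<^bsub>M\<^esub>i\<in>{i. c i \<noteq> \<zero>\<^bsub>M\<^esub>}. c i) = (\<Oplus>\<^bsub>M\<^esub>i\<in>A. c i)"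
  by (rule M.add.finprod_mono_neutral_cong_left) (use assms grade_subset in auto)

text \<open>The index set \<open>A\<close> may be larger than the support, so that decompositions with different supports
  can be added over a common index set.\<close>

lemma homogeneous_part_unique:
  assumes "\<And>i. c i \<in> G i" "finite A" "\<And>i. i \<notin> A \<Longrightarrow> c i = \<zero>\<^bsub>M\<^esub>" "x = (\<Oplus>\<^bsub>M\<^esub>i\<in>A. c i)"
  shows "homogeneous_part M G x = c"
proof -
  have fin: "finite {i. c i \<noteq> \<zero>\<^bsub>M\<^esub>}"
    by (rule finite_subset[OF _ assms(2)]) (use assms(3) in auto)
  have sum: "x = (\<Oplus>\<^bsub>M\<^esub>i\<in>{i. c i \<noteq> \<zero>\<^bsub>M\<^esub>}. c i)"
    using finsum_support[OF assms(1-3)] assms(4) by simp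
  have "x \<in> carrier M" unfolding assms(4) by (rule M.finsum_closed) (use assms(1) grade_subset in auto)
  then have ex: "\<exists>!c. (\<forall>i. c i \<in> G i) \<and> finite {i. c i \<noteq> \<zero>\<^bsub>M\<^esub>} \<and>
        x = (\<Oplus>\<^bsub>M\<^esub>i\<in>{i. c i \<noteq> \<zero>\<^bsub>M\<^esub>}. c i)"
    using gr by (simp add: graded_module_def)
  show ?thesis unfolding homogeneous_part_def
    by (rule the1_equality[OF ex]) (use assms(1) fin sum in blast)
qed

lemma homogeneous_part:
  assumes "x \<in> carrier M"
  shows "homogeneous_part M G x i \<in> G i" "finite {i. homogeneous_part M G x i \<noteq> \<zero>\<^bsub>M\<^esub>}"
    "x = (\<Oplus>\<^bsub>M\<^esub>i\<in>{i. homogeneous_part M G x i \<noteq> \<zero>\<^bsub>M\<^esub>}. homogeneous_part M G x i)"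
proof -
  have "\<exists>!c. (\<forall>i. c i \<in> G i) \<and> finite {i. c i \<noteq> \<zero>\<^bsub>M\<^esub>} \<and>
        x = (\<Oplus>\<^bsub>M\<^esub>i\<in>{i. c i \<noteq> \<zero>\<^bsub>M\<^esub>}. c i)"
    using gr assms by (simp add: graded_module_def)
  from theI'[OF this, folded homogeneous_part_def]
  show "homogeneous_part M G x i \<in> G i" "finite {i. homogeneous_part M G x i \<noteq> \<zero>\<^bsub>M\<^esub>}"
    "x = (\<Oplus>\<^bsub>M\<^esub>i\<in>{i. homogeneous_part M G x i \<noteq> \<zero>\<^bsub>M\<^esub>}. homogeneous_part M G x i)"
    by blast+
qed

lemma homogeneous_part_sum:
  assumes "x \<in> carrier M" "finite A" "\<And>i. i \<notin> A \<Longrightarrow> homogeneous_part M G x i = \<zero>\<^bsub>M\<^esub>"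
  shows "x = (\<Oplus>\<^bsub>M\<^esub>i\<in>A. homogeneous_part M G x i)"
  using finsum_support[OF homogeneous_part(1)[OF assms(1)] assms(2,3)]
    homogeneous_part(3)[OF assms(1)] by simp

lemma homogeneous_part_linear: "linear_map R M M (\<lambda>x. homogeneous_part M G x i)"
proof (rule linear_mapI)
  let ?h = "homogeneous_part M G"
  fix x assume x: "x \<in> carrier M"
  have hx: "?h x i \<in> carrier M" for i using homogeneous_part(1)[OF x] grade_subset by blast
  then show "?h x i \<in> carrier M" .
  { fix y assume y: "y \<in> carrier M"
    have hy: "?h y i \<in> carrier M" for i using homogeneous_part(1)[OF y] grade_subset by blast
    define A where "A = {i. ?h x i \<noteq> \<zero>\<^bsub>M\<^esub>} \<union> {i. ?h y i \<noteq> \<zero>\<^bsub>M\<^esub>}"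
    have A: "finite A" using homogeneous_part(2)[OF x] homogeneous_part(2)[OF y] by (simp add: A_def)
    have "?h (x \<oplus>\<^bsub>M\<^esub> y) = (\<lambda>i. ?h x i \<oplus>\<^bsub>M\<^esub> ?h y i)"
    proof (rule homogeneous_part_unique[OF _ A])
      have "x = (\<Oplus>\<^bsub>M\<^esub>i\<in>A. ?h x i)" "y = (\<Oplus>\<^bsub>M\<^esub>i\<in>A. ?h y i)"
        by (rule homogeneous_part_sum; use x y A in \<open>simp add: A_def\<close>)+
      then show "x \<oplus>\<^bsub>M\<^esub> y = (\<Oplus>\<^bsub>M\<^esub>i\<in>A. ?h x i \<oplus>\<^bsub>M\<^esub> ?h y i)"
        using hx hy by (simp add: M.finsum_addf)
    qed (use homogeneous_part(1)[OF x] homogeneous_part(1)[OF y]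
          submodule_closed(3)[OF graded_submodule] in \<open>auto simp: A_def\<close>)
    then show "?h (x \<oplus>\<^bsub>M\<^esub> y) i = ?h x i \<oplus>\<^bsub>M\<^esub> ?h y i" by simp }
  fix a assume a: "a \<in> carrier R"
  define A where "A = {i. ?h x i \<noteq> \<zero>\<^bsub>M\<^esub>}"
  have A: "finite A" using homogeneous_part(2)[OF x] by (simp add: A_def)
  have "?h (a \<odot>\<^bsub>M\<^esub> x) = (\<lambda>i. a \<odot>\<^bsub>M\<^esub> ?h x i)"
  proof (rule homogeneous_part_unique[OF _ A])
    have "x = (\<Oplus>\<^bsub>M\<^esub>i\<in>A. ?h x i)"
      by (rule homogeneous_part_sum) (use x A in \<open>auto simp: A_def\<close>)
    then show "a \<odot>\<^bsub>M\<^esub> x = (\<Oplus>\<^bsub>M\<^esub>i\<in>A. a \<odot>\<^bsub>M\<^esub> ?h x i)"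
      using hx a A M.finsum_smult_ldistr[of A a "?h x"] by simp
  qed (use homogeneous_part(1)[OF x] a
        submodule_closed(4)[OF graded_submodule] in \<open>auto simp: A_def\<close>)
  then show "?h (a \<odot>\<^bsub>M\<^esub> x) i = a \<odot>\<^bsub>M\<^esub> ?h x i" by simp
qed

lemma homogeneous_part_homogeneous:
  assumes "x \<in> G i"
  shows "homogeneous_part M G x k = (if k = i then x else \<zero>\<^bsub>M\<^esub>)"
proof -
  have "homogeneous_part M G x = (\<lambda>k. if k = i then x else \<zero>\<^bsub>M\<^esub>)"
    by (rule homogeneous_part_unique[of _ "{i}"])
       (use assms grade_subset[OF assms] submodule_closed(2)[OF graded_submodule] in auto)
  then show ?thesis by simp
qed

lemma grades_disjoint:
  assumes "x \<in> G i" "x \<in> G j" "i \<noteq> j"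
  shows "x = \<zero>\<^bsub>M\<^esub>"
  using homogeneous_part_homogeneous[OF assms(1), of i] homogeneous_part_homogeneous[OF assms(2), of i] assms(3)
  by simp

end

text \<open>A family \<open>c\<close> with values in the components is determined by three of its members, since all others
  vanish. So it suffices to decompose elements into triples.\<close>

lemma graded_module_threeI:
  assumes "module R M" "\<And>i. submodule (G i) R M" "\<And>i. \<bar>i\<bar> > 1 \<Longrightarrow> G i = {\<zero>\<^bsub>M\<^esub>}"
    and ex: "\<And>x. x \<in> carrier M \<Longrightarrow> \<exists>a\<in>G (-1). \<exists>b\<in>G 0. \<exists>c\<in>G 1. x = a \<oplus>\<^bsub>M\<^esub> b \<oplus>\<^bsub>M\<^esub> c"
    and uniq: "\<And>a b c a' b' c'. \<lbrakk>a \<in> G (-1); b \<in> G 0; c \<in> G 1; a' \<in> G (-1); b' \<in> G 0; c' \<in> G 1;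
       a \<oplus>\<^bsub>M\<^esub> b \<oplus>\<^bsub>M\<^esub> c = a' \<oplus>\<^bsub>M\<^esub> b' \<oplus>\<^bsub>M\<^esub> c'\<rbrakk> \<Longrightarrow> a = a' \<and> b = b' \<and> c = c'"
  shows "graded_module R M G"
  unfolding graded_module_def
proof (intro conjI ballI allI)
  interpret M: module R M by fact
  have sub: "x \<in> carrier M" if "x \<in> G i" for x i
    using submodule_closed(1)[OF assms(2)] that by blast
  have supp: "finite {i. c i \<noteq> \<zero>\<^bsub>M\<^esub>} \<and> (\<Oplus>\<^bsub>M\<^esub>i\<in>{i. c i \<noteq> \<zero>\<^bsub>M\<^esub>}. c i) = c (-1) \<oplus>\<^bsub>M\<^esub> c 0 \<oplus>\<^bsub>M\<^esub> c 1"
    if "\<forall>i. c i \<in> G i" for c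
  proof -
    have ss: "{i. c i \<noteq> \<zero>\<^bsub>M\<^esub>} \<subseteq> {-1, 0, 1}"
    proof
      fix i assume i: "i \<in> {i. c i \<noteq> \<zero>\<^bsub>M\<^esub>}"
      have "\<not> \<bar>i\<bar> > 1" using assms(3)[of i] that i by (metis mem_Collect_eq singletonD)
      then show "i \<in> {-1, 0, 1}" by auto
    qed
    have "(\<Oplus>\<^bsub>M\<^esub>i\<in>{i. c i \<noteq> \<zero>\<^bsub>M\<^esub>}. c i) = (\<Oplus>\<^bsub>M\<^esub>i\<in>{-1, 0, 1}. c i)"
      by (rule M.add.finprod_mono_neutral_cong_left) (use ss that sub in auto)
    also have "\<dots> = c (-1) \<oplus>\<^bsub>M\<^esub> c 0 \<oplus>\<^bsub>M\<^esub> c 1"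
      by (rule M.finsum_3) (use that sub in auto)
    finally show ?thesis using finite_subset[OF ss] by simp
  qed
  fix x assume "x \<in> carrier M"
  then obtain a b c where abc: "a \<in> G (-1)" "b \<in> G 0" "c \<in> G 1" "x = a \<oplus>\<^bsub>M\<^esub> b \<oplus>\<^bsub>M\<^esub> c"
    using ex by blast
  define f where "f i = (if i = -1 then a else if i = 0 then b else if i = 1 then c else \<zero>\<^bsub>M\<^esub>)" for i :: int
  have f: "\<forall>i. f i \<in> G i" "f (-1) = a" "f 0 = b" "f 1 = c"
    using abc submodule_closed(2)[OF assms(2)] by (auto simp: f_def)
  show "\<exists>!c. (\<forall>i. c i \<in> G i) \<and> finite {i. c i \<noteq> \<zero>\<^bsub>M\<^esub>} \<and>
        x = (\<Oplus>\<^bsub>M\<^esub>i\<in>{i. c i \<noteq> \<zero>\<^bsub>M\<^esub>}. c i)"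
  proof (rule ex1I[of _ f])
    show "(\<forall>i. f i \<in> G i) \<and> finite {i. f i \<noteq> \<zero>\<^bsub>M\<^esub>} \<and> x = (\<Oplus>\<^bsub>M\<^esub>i\<in>{i. f i \<noteq> \<zero>\<^bsub>M\<^esub>}. f i)"
      using supp[OF f(1)] f abc(4) by simp
    fix g assume g: "(\<forall>i. g i \<in> G i) \<and> finite {i. g i \<noteq> \<zero>\<^bsub>M\<^esub>} \<and> x = (\<Oplus>\<^bsub>M\<^esub>i\<in>{i. g i \<noteq> \<zero>\<^bsub>M\<^esub>}. g i)"
    then have "g (-1) \<oplus>\<^bsub>M\<^esub> g 0 \<oplus>\<^bsub>M\<^esub> g 1 = a \<oplus>\<^bsub>M\<^esub> b \<oplus>\<^bsub>M\<^esub> c"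
      using supp[of g] abc(4) by simp
    then have e: "g (-1) = a \<and> g 0 = b \<and> g 1 = c"
      by (intro uniq) (use g abc in auto)
    have z: "g i = \<zero>\<^bsub>M\<^esub>" if "\<bar>i\<bar> > 1" for i using g assms(3)[OF that] by auto
    show "g = f"
    proof
      fix i :: int
      consider "i = -1" | "i = 0" | "i = 1" | "\<bar>i\<bar> > 1" by linarith
      then show "g i = f i" using e z by cases (auto simp: f_def)
    qed
  qed
qed (use assms in auto)

text \<open>Stated for an arbitrary \<open>f\<close>: the wedges to which this is applied are themselves sets, which
  would mislead automatic proofs of the equality.\<close>

lemma setcompr_list2_eq:
  assumes "\<And>xs. (\<exists>ds. Q xs ds) \<longleftrightarrow> (\<exists>x y i j. xs = [x, y] \<and> P x y i j)"
  shows "{f xs | xs ds. Q xs ds} = {f [x, y] | x y i j. P x y i j}"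
proof -
  have "{f xs | xs ds. Q xs ds} = f ` {xs. \<exists>ds. Q xs ds}" by blast
  also have "\<dots> = {f [x, y] | x y i j. P x y i j}" unfolding assms by blast
  finally show ?thesis .
qed

lemma setcompr_list3_eq:
  assumes "\<And>xs. (\<exists>ds. Q xs ds) \<longleftrightarrow> (\<exists>x y z i j k. xs = [x, y, z] \<and> P x y z i j k)"
  shows "{f xs | xs ds. Q xs ds} = {f [x, y, z] | x y z i j k. P x y z i j k}"
proof -
  have "{f xs | xs ds. Q xs ds} = f ` {xs. \<exists>ds. Q xs ds}" by blast
  also have "\<dots> = {f [x, y, z] | x y z i j k. P x y z i j k}" unfolding assms by blast
  finally show ?thesis .
qed

context three_graded_lie_algebra
begin

abbreviation part :: "int \<Rightarrow> 'a \<Rightarrow> 'a" where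
  "part i x \<equiv> homogeneous_part L (grade L) x i"

lemma grade_closed: "x \<in> grade L i \<Longrightarrow> x \<in> carrier L"
  by (rule grade_subset[OF graded])

lemma grade_submodule: "submodule (grade L i) R L"
  by (rule graded_submodule[OF graded])

lemmas part_in_grade = homogeneous_part(1)[OF graded]
lemmas part_linear = homogeneous_part_linear[OF graded]
lemmas part_homogeneous = homogeneous_part_homogeneous[OF graded]

lemma part_closed: "x \<in> carrier L \<Longrightarrow> part i x \<in> carrier L"
  using part_in_grade grade_closed by blast

lemma part_sum: "x \<in> carrier L \<Longrightarrow> x = part (-1) x \<oplus>\<^bsub>L\<^esub> part 0 x \<oplus>\<^bsub>L\<^esub> part 1 x"
proof -
  assume x: "x \<in> carrier L"
  have "x = (\<Oplus>\<^bsub>L\<^esub>i\<in>{-1, 0, 1}. part i x)"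
  proof (rule homogeneous_part_sum[OF graded x])
    fix i :: int assume "i \<notin> {-1, 0, 1}"
    then have "\<bar>i\<bar> > 1" by auto
    then show "part i x = \<zero>\<^bsub>L\<^esub>" using part_in_grade[OF x, of i] three_graded by auto
  qed simp
  also have "\<dots> = part (-1) x \<oplus>\<^bsub>L\<^esub> part 0 x \<oplus>\<^bsub>L\<^esub> part 1 x"
    by (rule M.finsum_3) (use x part_closed in auto)
  finally show ?thesis .
qed

lemma part_triple:
  assumes "a \<in> grade L (-1)" "b \<in> grade L 0" "c \<in> grade L 1"
  shows "part (-1) (a \<oplus>\<^bsub>L\<^esub> b \<oplus>\<^bsub>L\<^esub> c) = a" "part 0 (a \<oplus>\<^bsub>L\<^esub> b \<oplus>\<^bsub>L\<^esub> c) = b" "part 1 (a \<oplus>\<^bsub>L\<^esub> b \<oplus>\<^bsub>L\<^esub> c) = c"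
  using assms grade_closed[OF assms(1)] grade_closed[OF assms(2)] grade_closed[OF assms(3)]
  by (simp_all add: linear_map_add[OF part_linear] part_homogeneous[OF assms(1)]
     part_homogeneous[OF assms(2)] part_homogeneous[OF assms(3)])

lemma degree_cases:
  assumes "x \<in> grade L i"
  obtains "i = -1" | "i = 0" | "i = 1" | "x = \<zero>\<^bsub>L\<^esub>"
proof -
  consider "i = -1" | "i = 0" | "i = 1" | "\<bar>i\<bar> > 1" by linarith
  then show ?thesis by cases (use that assms three_graded in auto)
qed

lemma linear_map_eq_homogeneous:
  assumes "module R N" "linear_map R L N f" "linear_map R L N g"
    and "\<And>i x. x \<in> grade L i \<Longrightarrow> f x = g x" "x \<in> carrier L"
  shows "f x = g x"
proof -
  have "f (part (-1) x \<oplus>\<^bsub>L\<^esub> part 0 x \<oplus>\<^bsub>L\<^esub> part 1 x) = g (part (-1) x \<oplus>\<^bsub>L\<^esub> part 0 x \<oplus>\<^bsub>L\<^esub> part 1 x)"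
    using assms(5) assms(4)[OF part_in_grade[OF assms(5)]] part_closed
    by (simp add: linear_map_add[OF assms(2)] linear_map_add[OF assms(3)])
  then show ?thesis using part_sum[OF assms(5)] by simp
qed

text \<open>Linear maps on exterior powers are compared on wedges of homogeneous elements, by splitting one
  entry at a time into its parts.\<close>

lemma ext_power_2_eq_homogeneous:
  assumes N: "module R N" and f: "linear_map R (ext_power R L 2) N f"
    and g: "linear_map R (ext_power R L 2) N g"
    and eq: "\<And>i j x y. \<lbrakk>x \<in> grade L i; y \<in> grade L j\<rbrakk> \<Longrightarrow> f (wedge R L [x, y]) = g (wedge R L [x, y])"
    and w: "w \<in> carrier (ext_power R L 2)"
  shows "f w = g w"
proof (rule ext_power_eqI[OF N f g _ w])
  note b = bilinear_mapD[OF wedge2_bilinear]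
  fix xs assume "xs \<in> tuples L 2"
  then obtain x y where xs: "xs = [x, y]" and x: "x \<in> carrier L" and y: "y \<in> carrier L"
    by (auto simp: tuples_2)
  have "f (wedge R L [x, y]) = g (wedge R L [x, y])"
  proof (rule linear_map_eq_homogeneous[OF N, of "\<lambda>x. f (wedge R L [x, y])" "\<lambda>x. g (wedge R L [x, y])"])
    fix i x assume x: "x \<in> grade L i"
    show "f (wedge R L [x, y]) = g (wedge R L [x, y])"
      by (rule linear_map_eq_homogeneous[OF N linear_map_comp[OF b(2) f] linear_map_comp[OF b(2) g]])
         (use x y grade_closed eq in auto)
  qed (use x y linear_map_comp[OF b(1) f] linear_map_comp[OF b(1) g] in auto)
  then show "f (wedge R L xs) = g (wedge R L xs)" by (simp add: xs)
qed

lemma ext_power_3_eq_homogeneous: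
  assumes N: "module R N" and f: "linear_map R (ext_power R L 3) N f"
    and g: "linear_map R (ext_power R L 3) N g"
    and eq: "\<And>i j k x y z. \<lbrakk>x \<in> grade L i; y \<in> grade L j; z \<in> grade L k\<rbrakk>
        \<Longrightarrow> f (wedge R L [x, y, z]) = g (wedge R L [x, y, z])"
    and w: "w \<in> carrier (ext_power R L 3)"
  shows "f w = g w"
proof (rule ext_power_eqI[OF N f g _ w])
  note b = wedge3_linear
  fix xs assume "xs \<in> tuples L 3"
  then obtain x y z where xs: "xs = [x, y, z]" and xyz: "x \<in> carrier L" "y \<in> carrier L" "z \<in> carrier L"
    by (auto simp: tuples_3)
  have 1: "f (wedge R L [x, y, z]) = g (wedge R L [x, y, z])"
    if "x \<in> grade L i" "y \<in> grade L j" "z \<in> carrier L" for x y z i j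
    by (rule linear_map_eq_homogeneous[OF N linear_map_comp[OF b(3) f] linear_map_comp[OF b(3) g]])
       (use that grade_closed eq in auto)
  have 2: "f (wedge R L [x, y, z]) = g (wedge R L [x, y, z])"
    if "x \<in> grade L i" "y \<in> carrier L" "z \<in> carrier L" for x y z i
    by (rule linear_map_eq_homogeneous[OF N linear_map_comp[OF b(2) f] linear_map_comp[OF b(2) g]])
       (use that grade_closed 1 in auto)
  have "f (wedge R L [x, y, z]) = g (wedge R L [x, y, z])"
    by (rule linear_map_eq_homogeneous[OF N linear_map_comp[OF b(1) f] linear_map_comp[OF b(1) g]])
       (use xyz 2 in auto)
  then show "f (wedge R L xs) = g (wedge R L xs)" by (simp add: xs)
qed

lemma homogeneous_tuple:
  "list_all2 (\<lambda>x i. x \<in> grade L i) xs ds \<Longrightarrow> xs \<in> tuples L (length ds)"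
  unfolding tuples_def list_all2_conv_all_nth by (force simp: in_set_conv_nth dest: grade_closed)

lemma ext_grade_eq:
  "ext_grade R L n d = lin_span R (ext_power R L n)
     {wedge R L xs | xs ds. list_all2 (\<lambda>x i. x \<in> grade L i) xs ds \<and> length ds = n \<and> sum_list ds = d}"
  (is "_ = lin_span R ?E ?S")
proof -
  have S: "?S \<subseteq> carrier ?E" using homogeneous_tuple wedge_closed by auto
  have "wedge_of_degrees R L ds \<subseteq> lin_span R ?E ?S" if "length ds = n" "sum_list ds = d" for ds
    unfolding wedge_of_degrees_def that(1)
    by (rule lin_span_mono) (use that in blast)
  moreover have "?S \<subseteq> (\<Union>ds\<in>{ds. length ds = n \<and> sum_list ds = d}. wedge_of_degrees R L ds)"
    unfolding wedge_of_degrees_def by (blast intro: lin_span_incl)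
  ultimately show ?thesis
    unfolding ext_grade_def
    by (intro equalityI lin_span_mono lin_span_least[OF lin_span_submodule[OF ext_power_module S]] UN_least)
       auto
qed

lemma ext_grade_2: "ext_grade R L 2 d = lin_span R (ext_power R L 2)
     {wedge R L [x, y] | x y i j. x \<in> grade L i \<and> y \<in> grade L j \<and> i + j = d}"
proof -
  have "(\<exists>ds. list_all2 (\<lambda>x i. x \<in> grade L i) xs ds \<and> length ds = 2 \<and> sum_list ds = d) \<longleftrightarrow>
    (\<exists>x y i j. xs = [x, y] \<and> x \<in> grade L i \<and> y \<in> grade L j \<and> i + j = d)" (is "?l = ?r") for xs
  proof
    assume ?l
    then obtain i j where "list_all2 (\<lambda>x i. x \<in> grade L i) xs [i, j]" "i + j = d"
      by (auto simp: length_Suc_conv numeral_2_eq_2)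
    then show ?r by (auto simp: list_all2_Cons2)
  next
    assume ?r
    then obtain x y i j where "xs = [x, y]" "x \<in> grade L i" "y \<in> grade L j" "i + j = d" by blast
    then show ?l by (intro exI[of _ "[i, j]"]) simp
  qed
  then show ?thesis
    unfolding ext_grade_eq by (intro arg_cong[of _ _ "lin_span R (ext_power R L 2)"] setcompr_list2_eq)
qed

lemma ext_grade_3: "ext_grade R L 3 d = lin_span R (ext_power R L 3)
     {wedge R L [x, y, z] | x y z i j k. x \<in> grade L i \<and> y \<in> grade L j \<and> z \<in> grade L k \<and> i + j + k = d}"
proof -
  have "(\<exists>ds. list_all2 (\<lambda>x i. x \<in> grade L i) xs ds \<and> length ds = 3 \<and> sum_list ds = d) \<longleftrightarrow>
    (\<exists>x y z i j k. xs = [x, y, z] \<and> x \<in> grade L i \<and> y \<in> grade L j \<and> z \<in> grade L k \<and> i + j + k = d)"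
    (is "?l = ?r") for xs
  proof
    assume ?l
    then obtain i j k where "list_all2 (\<lambda>x i. x \<in> grade L i) xs [i, j, k]" "i + j + k = d"
      by (auto simp: length_Suc_conv numeral_3_eq_3 add.assoc)
    moreover from this obtain x y z where "xs = [x, y, z]" "x \<in> grade L i" "y \<in> grade L j" "z \<in> grade L k"
      by (auto simp: list_all2_Cons2)
    ultimately show ?r by blast
  next
    assume ?r
    then obtain x y z i j k where "xs = [x, y, z]" "x \<in> grade L i" "y \<in> grade L j" "z \<in> grade L k"
      "i + j + k = d" by blast
    then show ?l by (intro exI[of _ "[i, j, k]"]) simp
  qed
  then show ?thesis
    unfolding ext_grade_eq by (intro arg_cong[of _ _ "lin_span R (ext_power R L 3)"] setcompr_list3_eq)
qed

lemma ext_grade_submodule: "submodule (ext_grade R L n d) R (ext_power R L n)"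
  unfolding ext_grade_eq
  by (rule lin_span_submodule[OF ext_power_module]) (use homogeneous_tuple wedge_closed in auto)

lemma wedge2_in_ext_grade: "\<lbrakk>x \<in> grade L i; y \<in> grade L j; i + j = d\<rbrakk> \<Longrightarrow> wedge R L [x, y] \<in> ext_grade R L 2 d"
  unfolding ext_grade_2 by (rule lin_span_incl) blast

lemma wedge3_in_ext_grade: "\<lbrakk>x \<in> grade L i; y \<in> grade L j; z \<in> grade L k; i + j + k = d\<rbrakk>
    \<Longrightarrow> wedge R L [x, y, z] \<in> ext_grade R L 3 d"
  unfolding ext_grade_3 by (rule lin_span_incl) blast

lemma ext_grade_2_span_subset:
  assumes "module R N" "linear_map R (ext_power R L 2) N f" "submodule N' R N"
    and "\<And>x y i j. \<lbrakk>x \<in> grade L i; y \<in> grade L j; i + j = d\<rbrakk> \<Longrightarrow> f (wedge R L [x, y]) \<in> N'"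
    and "w \<in> ext_grade R L 2 d"
  shows "f w \<in> N'"
  using assms(5) unfolding ext_grade_2
  by (rule linear_map_span_subset[OF ext_power_module assms(1-3), rotated -1])
     (use assms(4) wedge2_closed grade_closed in auto)

lemma ext_delta_2_grade:
  assumes "w \<in> ext_grade R L 3 d"
  shows "ext_delta R L 2 w \<in> ext_grade R L 2 d"
  using assms unfolding ext_grade_3
proof (rule linear_map_span_subset[OF ext_power_module ext_power_module ext_delta_2(1)
      ext_grade_submodule, rotated -1])
  show "{wedge R L [x, y, z] | x y z i j k. x \<in> grade L i \<and> y \<in> grade L j \<and> z \<in> grade L k \<and> i + j + k = d}
    \<subseteq> carrier (ext_power R L 3)"
    using grade_closed wedge_closed[of _ 3] by (auto simp: tuples_3)
  fix w assume "w \<in> {wedge R L [x, y, z] | x y z i j k. x \<in> grade L i \<and> y \<in> grade L j \<and> z \<in> grade L k \<and> i + j + k = d}"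
  then obtain x y z i j k where *: "w = wedge R L [x, y, z]" "x \<in> grade L i" "y \<in> grade L j" "z \<in> grade L k"
     "i + j + k = d" by blast
  note sub = submodule_closed[OF ext_grade_submodule]
  have "wedge R L [bracket L x y, z] \<in> ext_grade R L 2 d"
    by (rule wedge2_in_ext_grade[of _ "i + j" _ k]) (use * bracket_grade in auto)
  moreover have "wedge R L [bracket L x z, y] \<in> ext_grade R L 2 d"
    by (rule wedge2_in_ext_grade[of _ "i + k" _ j]) (use * bracket_grade in auto)
  moreover have "wedge R L [bracket L y z, x] \<in> ext_grade R L 2 d"
    by (rule wedge2_in_ext_grade[of _ "j + k" _ i]) (use * bracket_grade in auto)
  ultimately show "ext_delta R L 2 w \<in> ext_grade R L 2 d"
    using * grade_closed by (simp add: ext_delta_2(2) sub)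
qed

lemma image_eq_singleton: "A \<noteq> {} \<Longrightarrow> f ` A = {b} \<longleftrightarrow> (\<forall>x\<in>A. f x = b)"
  by auto

text \<open>A quotient consists of a single coset if and only if every element lies in the submodule that is
  factored out.\<close>

lemma zero_module_H2_iff:
  "zero_module (H2_gr_homology R L) \<longleftrightarrow>
   (\<forall>c\<in>ext_grade R L 2 0. ext_delta R L (Suc 0) c = \<zero>\<^bsub>ext_power R L (Suc 0)\<^esub>
      \<longrightarrow> c \<in> ext_delta R L 2 ` ext_grade R L 3 0)"
proof -
  let ?E = "ext_power R L 2" and ?B = "ext_delta R L 2 ` ext_grade R L 3 0"
  let ?Z = "{c \<in> ext_grade R L 2 0. ext_delta R L 1 c = \<zero>\<^bsub>ext_power R L 1\<^esub>}"
  interpret E: module R ?E by (rule ext_power_module)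
  have B: "submodule ?B R ?E"
    by (rule linear_map_image_submodule[OF ext_power_module E.module_axioms ext_delta_2(1) ext_grade_submodule])
  have coset: "?B +>\<^bsub>?E\<lparr>carrier := ?Z\<rparr>\<^esub> x = ?B +>\<^bsub>?E\<^esub> x" for x
    by (simp add: a_r_coset_def r_coset_def)
  have Zc: "?Z \<subseteq> carrier ?E" using submodule_closed(1)[OF ext_grade_submodule] by auto
  have "\<zero>\<^bsub>?E\<^esub> \<in> ?Z"
    using submodule_closed(2)[OF ext_grade_submodule]
      linear_map_zero[OF E.module_axioms ext_power_module ext_delta_1(1)] by simp
  then have ne: "?Z \<noteq> {}" by blast
  have "zero_module (H2_gr_homology R L) \<longleftrightarrow> (\<lambda>x. ?B +>\<^bsub>?E\<^esub> x) ` ?Z = {?B}"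
    unfolding zero_module_def H2_gr_homology_def quot_module_simps coset by simp
  also have "\<dots> \<longleftrightarrow> (\<forall>x\<in>?Z. ?B +>\<^bsub>?E\<^esub> x = ?B)"
    by (rule image_eq_singleton[OF ne])
  also have "\<dots> \<longleftrightarrow> (\<forall>x\<in>?Z. x \<in> ?B)"
    using coset_eq_self_iff[OF E.module_axioms B] Zc by (metis (no_types, lifting) subsetD)
  finally show ?thesis by auto
qed

end

section \<open>Homology and cohomology in degree two\<close>

context module
begin

lemma ext_power_1_inverse:
  obtains e where "linear_map R (ext_power R M (Suc 0)) M e"
    "\<And>x. x \<in> carrier M \<Longrightarrow> e (wedge R M [x]) = x"
proof -
  obtain e where e: "linear_map R (ext_power R M (Suc 0)) M e"
    "\<And>xs. xs \<in> tuples M (Suc 0) \<Longrightarrow> e (wedge R M xs) = xs ! 0"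
    by (rule ext_power_universal[OF module_axioms, of "Suc 0" "\<lambda>xs. xs ! 0"]) (auto simp: tuples_1)
  show ?thesis by (rule that[OF e(1)]) (simp add: e(2) tuples_1)
qed

end

context three_graded_lie_algebra
begin

lemma ext_grade_1_span_subset:
  assumes "module R N" "linear_map R (ext_power R L (Suc 0)) N f" "submodule N' R N"
    and "\<And>x. x \<in> grade L i \<Longrightarrow> f (wedge R L [x]) \<in> N'"
    and "w \<in> wedge_of_degrees R L [i]"
  shows "f w \<in> N'"
proof (rule linear_map_span_subset[OF ext_power_module assms(1-3)])
  show "w \<in> lin_span R (ext_power R L (Suc 0)) {wedge R L [x] | x. x \<in> grade L i}"
    using assms(5) by (simp add: wedge_of_degrees_def list_all2_Cons2 ex_simps[symmetric] del: ex_simps)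
  show "{wedge R L [x] | x. x \<in> grade L i} \<subseteq> carrier (ext_power R L (Suc 0))"
    using wedge_closed[of _ "Suc 0"] grade_closed by (auto simp: tuples_1)
qed (use assms(4) in auto)

lemma wedge_of_degrees_2_span_subset:
  assumes "module R N" "linear_map R (ext_power R L 2) N f" "submodule N' R N"
    and "\<And>x y. \<lbrakk>x \<in> grade L i; y \<in> grade L j\<rbrakk> \<Longrightarrow> f (wedge R L [x, y]) \<in> N'"
    and "w \<in> wedge_of_degrees R L [i, j]"
  shows "f w \<in> N'"
proof (rule linear_map_span_subset[OF ext_power_module assms(1-3)])
  have "{wedge R L xs |xs. list_all2 (\<lambda>x i. x \<in> grade L i) xs [i, j]}
    = {wedge R L [x, y] | x y. x \<in> grade L i \<and> y \<in> grade L j}" (is "?l = ?r")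
  proof -
    have "?l = wedge R L ` {xs. list_all2 (\<lambda>x i. x \<in> grade L i) xs [i, j]}" by (rule setcompr_eq_image)
    also have "{xs. list_all2 (\<lambda>x i. x \<in> grade L i) xs [i, j]} = {[x, y] | x y. x \<in> grade L i \<and> y \<in> grade L j}"
      by (auto simp: list_all2_Cons2)
    also have "wedge R L ` {[x, y] | x y. x \<in> grade L i \<and> y \<in> grade L j} = ?r" by blast
    finally show ?thesis .
  qed
  then show "w \<in> lin_span R (ext_power R L 2) {wedge R L [x, y] | x y. x \<in> grade L i \<and> y \<in> grade L j}"
    using assms(5) by (simp add: wedge_of_degrees_def numeral_2_eq_2)
  show "{wedge R L [x, y] | x y. x \<in> grade L i \<and> y \<in> grade L j} \<subseteq> carrier (ext_power R L 2)"
    using wedge2_closed grade_closed by auto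
qed (use assms(4) in auto)

text \<open>The analogue of \<open>zero_module_H2_iff\<close> for cochains. The coset of a cochain is computed directly from
  the closure of the coboundaries under sums and negatives.\<close>

lemma zero_module_H2_cohomology_iff:
  assumes "graded_lie_module R L M"
  shows "zero_module (H2_gr_cohomology R L M) \<longleftrightarrow>
    (\<forall>f\<in>carrier (gr_cochains R L M 2).
       gr_coboundary R L 2 f = (\<lambda>x\<in>carrier (ext_power R L 3). \<zero>\<^bsub>M\<^esub>)
       \<longrightarrow> f \<in> gr_coboundary R L 1 ` carrier (gr_cochains R L M 1))"
proof -
  interpret N: graded_lie_module R L M by fact
  let ?C1 = "gr_cochains R L M 1" and ?C2 = "gr_cochains R L M 2"
  let ?E1 = "ext_power R L 1" and ?E2 = "ext_power R L 2" and ?d = "gr_coboundary R L 1"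
  let ?N = "?d ` carrier ?C1"
  let ?Z = "{f \<in> carrier ?C2. gr_coboundary R L 2 f = \<zero>\<^bsub>gr_cochains R L M 3\<^esub>}"
  have zero3: "\<zero>\<^bsub>gr_cochains R L M 3\<^esub> = (\<lambda>x\<in>carrier (ext_power R L 3). \<zero>\<^bsub>M\<^esub>)"
    by (simp add: gr_cochains_def)
  have coset: "?N +>\<^bsub>?C2\<lparr>carrier := ?Z\<rparr>\<^esub> x = {n \<oplus>\<^bsub>?C2\<^esub> x | n. n \<in> ?N}" for x
    by (auto simp: a_r_coset_def r_coset_def)
  note msub = graded_submodule[OF N.mgraded]
  have d1: "ext_delta R L 1 x \<in> carrier ?E1" if "x \<in> carrier ?E2" for x
    using linear_map_closed[OF ext_delta_1(1)] that by simp
  have C1I: "restrict f (carrier ?E1) \<in> carrier ?C1"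
    if "linear_map R ?E1 M f" "\<And>ds w. length ds = 1 \<Longrightarrow> w \<in> wedge_of_degrees R L ds \<Longrightarrow> f w \<in> mgrade M (sum_list ds)" for f
  proof -
    have "w \<in> carrier ?E1" if w: "length ds = 1" "w \<in> wedge_of_degrees R L ds" for ds w
    proof -
      obtain i where i: "ds = [i]" using w(1) by (auto simp: length_Suc_conv)
      interpret E1: module R "ext_power R L (Suc 0)" by (rule ext_power_module)
      have "id w \<in> carrier (ext_power R L (Suc 0))"
        by (rule ext_grade_1_span_subset[OF ext_power_module _ E1.carrier_is_submodule, of id])
           (use w i wedge_closed[of _ "Suc 0"] grade_closed in \<open>auto simp: linear_map_def tuples_1\<close>)
      then show ?thesis by simp
    qed
    then show ?thesis
      using that linear_map_restrict[OF ext_power_module that(1)] by (auto simp: gr_cochains_def)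
  qed
  have C1D: "linear_map R ?E1 M g" "\<And>ds w. \<lbrakk>length ds = 1; w \<in> wedge_of_degrees R L ds\<rbrakk> \<Longrightarrow> g w \<in> mgrade M (sum_list ds)"
    if "g \<in> carrier ?C1" for g
    using that by (auto simp: gr_cochains_def linear_hom_def image_subset_iff)
  have C2_ext: "f \<in> extensional (carrier ?E2)" "linear_map R ?E2 M f" if "f \<in> carrier ?C2" for f
    using that by (auto simp: gr_cochains_def linear_hom_def)
  have d_ext: "?d g \<in> extensional (carrier ?E2)" for g
    unfolding gr_coboundary_def compose_def by (simp add: numeral_2_eq_2)
  have d_app: "?d g x = g (ext_delta R L 1 x)" if "x \<in> carrier ?E2" for g x
    unfolding gr_coboundary_def compose_def using that by (simp add: numeral_2_eq_2)
  have add_app: "(f \<oplus>\<^bsub>?C2\<^esub> g) = (\<lambda>x\<in>carrier ?E2. f x \<oplus>\<^bsub>M\<^esub> g x)" for f g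
    by (simp add: gr_cochains_def)
  have d_zero: "(\<lambda>x\<in>carrier ?E2. \<zero>\<^bsub>M\<^esub>) \<in> ?N"
  proof -
    have 1: "restrict (\<lambda>x. \<zero>\<^bsub>M\<^esub>) (carrier ?E1) \<in> carrier ?C1"
      by (rule C1I) (use linear_map_const_zero[OF N.module_axioms] submodule_closed(2)[OF msub] in auto)
    have eq: "?d (restrict (\<lambda>x. \<zero>\<^bsub>M\<^esub>) (carrier ?E1)) = (\<lambda>x\<in>carrier ?E2. \<zero>\<^bsub>M\<^esub>)"
      by (rule extensionalityI[OF d_ext]) (auto simp: d_app d1 simp del: One_nat_def)
    show ?thesis by (rule image_eqI[where f="?d", OF eq[symmetric] 1])
  qed
  have N_add: "f \<oplus>\<^bsub>?C2\<^esub> f' \<in> ?N" if f: "f \<in> ?N" "f' \<in> ?N" for f f'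
  proof -
    obtain g g' where g: "g \<in> carrier ?C1" "f = ?d g" "g' \<in> carrier ?C1" "f' = ?d g'" using f by blast
    have 1: "restrict (\<lambda>x. g x \<oplus>\<^bsub>M\<^esub> g' x) (carrier ?E1) \<in> carrier ?C1"
      by (rule C1I) (use C1D[OF g(1)] C1D[OF g(3)] submodule_closed(3)[OF msub]
          linear_map_plus[OF ext_power_module N.module_axioms] in auto)
    have eq: "?d (restrict (\<lambda>x. g x \<oplus>\<^bsub>M\<^esub> g' x) (carrier ?E1)) = f \<oplus>\<^bsub>?C2\<^esub> f'"
      unfolding add_app by (rule extensionalityI[OF d_ext]) (auto simp: d_app d1 g simp del: One_nat_def)
    show ?thesis by (rule image_eqI[where f="?d", OF eq[symmetric] 1])
  qed
  have N_neg: "(\<lambda>x\<in>carrier ?E2. \<ominus>\<^bsub>M\<^esub> f x) \<in> ?N" if f: "f \<in> ?N" for f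
  proof -
    obtain g where g: "g \<in> carrier ?C1" "f = ?d g" using f by blast
    have 1: "restrict (\<lambda>x. \<ominus>\<^bsub>M\<^esub> g x) (carrier ?E1) \<in> carrier ?C1"
      by (rule C1I) (use C1D[OF g(1)] submodule_closed(5)[OF msub]
          linear_map_uminus[OF ext_power_module N.module_axioms] in auto)
    have eq: "?d (restrict (\<lambda>x. \<ominus>\<^bsub>M\<^esub> g x) (carrier ?E1)) = (\<lambda>x\<in>carrier ?E2. \<ominus>\<^bsub>M\<^esub> f x)"
      by (rule extensionalityI[OF d_ext]) (auto simp: d_app d1 g simp del: One_nat_def)
    show ?thesis by (rule image_eqI[where f="?d", OF eq[symmetric] 1])
  qed
  have N_ext: "f \<in> extensional (carrier ?E2)" if "f \<in> ?N" for f using that d_ext by auto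
  have N_cl: "f x \<in> carrier M" if f: "f \<in> ?N" "x \<in> carrier ?E2" for f x
  proof -
    obtain g where "g \<in> carrier ?C1" "f = ?d g" using f(1) by blast
    then show ?thesis
      by (simp add: d_app[OF f(2)] linear_map_closed[OF C1D(1)] d1[OF f(2)] del: One_nat_def)
  qed
  have coset_iff: "{n \<oplus>\<^bsub>?C2\<^esub> f | n. n \<in> ?N} = ?N \<longleftrightarrow> f \<in> ?N" if f: "f \<in> carrier ?C2" for f
  proof
    assume eq: "{n \<oplus>\<^bsub>?C2\<^esub> f | n. n \<in> ?N} = ?N"
    have "(\<lambda>x\<in>carrier ?E2. \<zero>\<^bsub>M\<^esub>) \<oplus>\<^bsub>?C2\<^esub> f = f"
      unfolding add_app
      by (rule extensionalityI[OF _ C2_ext(1)[OF f]]) (use linear_map_closed[OF C2_ext(2)[OF f]] in auto)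
    moreover have "(\<lambda>x\<in>carrier ?E2. \<zero>\<^bsub>M\<^esub>) \<oplus>\<^bsub>?C2\<^esub> f \<in> {n \<oplus>\<^bsub>?C2\<^esub> f | n. n \<in> ?N}"
      by (rule CollectI, rule exI, rule conjI[OF refl d_zero])
    ultimately show "f \<in> ?N" by (simp only: eq)
  next
    assume fN: "f \<in> ?N"
    have "n \<in> {n \<oplus>\<^bsub>?C2\<^esub> f | n. n \<in> ?N}" if n: "n \<in> ?N" for n
    proof -
      have e: "n = (n \<oplus>\<^bsub>?C2\<^esub> (\<lambda>x\<in>carrier ?E2. \<ominus>\<^bsub>M\<^esub> f x)) \<oplus>\<^bsub>?C2\<^esub> f"
        unfolding add_app
      proof (rule extensionalityI[OF N_ext[OF n] restrict_extensional])
        fix x assume x: "x \<in> carrier ?E2"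
        have "(n x \<oplus>\<^bsub>M\<^esub> \<ominus>\<^bsub>M\<^esub> f x) \<oplus>\<^bsub>M\<^esub> f x = n x"
          using N_cl[OF n x] N_cl[OF fN x]
          by (metis N.M.a_assoc N.M.a_inv_closed N.M.l_neg N.M.r_zero)
        then show "n x = (\<lambda>x\<in>carrier ?E2. (\<lambda>x\<in>carrier ?E2. n x \<oplus>\<^bsub>M\<^esub> (\<lambda>x\<in>carrier ?E2. \<ominus>\<^bsub>M\<^esub> f x) x) x
             \<oplus>\<^bsub>M\<^esub> f x) x"
          using x by (simp only: restrict_apply if_True)
      qed
      show ?thesis by (rule CollectI, rule exI, rule conjI[OF e N_add[OF n N_neg[OF fN]]])
    qed
    moreover have "n \<in> ?N" if "n \<in> {n \<oplus>\<^bsub>?C2\<^esub> f | n. n \<in> ?N}" for n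
      using that by (elim CollectE exE conjE) (simp only: N_add[OF _ fN])
    ultimately show "{n \<oplus>\<^bsub>?C2\<^esub> f | n. n \<in> ?N} = ?N" by (intro subset_antisym subsetI)
  qed
  have "\<zero>\<^bsub>?C2\<^esub> \<in> ?Z"
  proof -
    have z: "\<zero>\<^bsub>?C2\<^esub> = (\<lambda>x\<in>carrier ?E2. \<zero>\<^bsub>M\<^esub>)" by (simp add: gr_cochains_def)
    have c: "w \<in> carrier ?E2" if w: "length ds = 2" "w \<in> wedge_of_degrees R L ds" for ds w
    proof -
      obtain i j where i: "ds = [i, j]" using w(1) by (auto simp: length_Suc_conv numeral_2_eq_2)
      interpret E2: module R ?E2 by (rule ext_power_module)
      have "id w \<in> carrier ?E2"
        by (rule wedge_of_degrees_2_span_subset[OF ext_power_module _ E2.carrier_is_submodule, of id])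
           (use w i wedge2_closed grade_closed in \<open>auto simp: linear_map_def\<close>)
      then show ?thesis by simp
    qed
    have "\<zero>\<^bsub>?C2\<^esub> \<in> carrier ?C2" unfolding z
      using linear_map_restrict[OF ext_power_module linear_map_const_zero[OF N.module_axioms], of 2]
        submodule_closed(2)[OF msub] c by (auto simp: gr_cochains_def)
    moreover have "gr_coboundary R L 2 \<zero>\<^bsub>?C2\<^esub> = \<zero>\<^bsub>gr_cochains R L M 3\<^esub>"
      unfolding zero3 z gr_coboundary_def compose_def
      using linear_map_closed[OF ext_delta_2(1)] by (auto simp: numeral_3_eq_3 numeral_2_eq_2)
    ultimately show ?thesis by simp
  qed
  then have ne: "?Z \<noteq> {}" by blast
  have "zero_module (H2_gr_cohomology R L M) \<longleftrightarrow> (\<lambda>x. {n \<oplus>\<^bsub>?C2\<^esub> x | n. n \<in> ?N}) ` ?Z = {?N}"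
    unfolding zero_module_def H2_gr_cohomology_def quot_module_simps coset by simp
  also have "\<dots> \<longleftrightarrow> (\<forall>x\<in>?Z. {n \<oplus>\<^bsub>?C2\<^esub> x | n. n \<in> ?N} = ?N)" by (rule image_eq_singleton[OF ne])
  also have "\<dots> \<longleftrightarrow> (\<forall>x\<in>?Z. x \<in> ?N)"
    by (rule ball_cong[OF refl], rule coset_iff, erule CollectE, erule conjunct1)
  finally show ?thesis unfolding zero3 by blast
qed

end

context three_graded_lie_algebra
begin

lemma zero_perfectD:
  assumes "zero_perfect R L" "x \<in> grade L 0"
  shows "x \<in> lin_span R L {bracket L x y | x y. x \<in> grade L (- 1) \<and> y \<in> grade L 1}"
  using assms unfolding zero_perfect_def by blast

lemma zero_perfect_span_subset:
  assumes "zero_perfect R L" "module R N" "linear_map R L N f" "submodule N' R N"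
    and "\<And>a b. \<lbrakk>a \<in> grade L (-1); b \<in> grade L 1\<rbrakk> \<Longrightarrow> f (bracket L a b) \<in> N'"
    and "x \<in> grade L 0"
  shows "f x \<in> N'"
  by (rule linear_map_span_subset[OF module_axioms assms(2-4) _ _ zero_perfectD[OF assms(1,6)]])
     (use assms(5) bracket_closed grade_closed in auto)

text \<open>A cocycle \<open>f\<close> vanishes on the cycles of degree \<open>0\<close>, which are boundaries, and therefore equals \<open>h \<circ> d\<close>
  in degree \<open>0\<close>, where \<open>d\<close> is the boundary map. Since \<open>L\<close> is \<open>0\<close>-perfect, the values of \<open>d\<close> in degree
  \<open>0\<close> exhaust \<open>L\<^sub>0\<close>, so \<open>h\<close> is defined on all of \<open>L\<^sub>0\<close>. Extended by \<open>0\<close> to the other components, it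
  is a cochain with coboundary \<open>f\<close>.\<close>

lemma H2_cohomology_vanishes:
  assumes "zero_perfect R L"
    and H2: "zero_module (H2_gr_homology R L)"
    and M: "graded_lie_module R L M" "mgrade M 0 = carrier M"
  shows "zero_module (H2_gr_cohomology R L M)"
  unfolding zero_module_H2_cohomology_iff[OF M(1)]
proof (intro ballI impI)
  interpret N: graded_lie_module R L M by (rule M(1))
  let ?E1 = "ext_power R L (Suc 0)" and ?E2 = "ext_power R L 2" and ?E3 = "ext_power R L 3"
  let ?d1 = "ext_delta R L (Suc 0)" and ?d2 = "ext_delta R L 2" and ?S = "ext_grade R L 2 0"
  interpret E1: module R ?E1 by (rule ext_power_module)
  interpret E2: module R ?E2 by (rule ext_power_module)
  note d1 = ext_delta_1(1)[unfolded One_nat_def] and d2 = ext_delta_2(1)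
  fix f assume f: "f \<in> carrier (gr_cochains R L M 2)"
    and cocycle: "gr_coboundary R L 2 f = (\<lambda>x\<in>carrier ?E3. \<zero>\<^bsub>M\<^esub>)"
  have f_lin: "linear_map R ?E2 M f" and f_ext: "f \<in> extensional (carrier ?E2)"
    and f_deg: "\<And>ds w. \<lbrakk>length ds = 2; w \<in> wedge_of_degrees R L ds\<rbrakk> \<Longrightarrow> f w \<in> mgrade M (sum_list ds)"
    using f by (auto simp: gr_cochains_def linear_hom_def image_subset_iff)
  have f_d2: "f (?d2 w) = \<zero>\<^bsub>M\<^esub>" if "w \<in> carrier ?E3" for w
    using fun_cong[OF cocycle, of w] that
    by (simp add: gr_coboundary_def compose_def numeral_2_eq_2 numeral_3_eq_3)
  have S_sub: "submodule ?S R ?E2" by (rule ext_grade_submodule)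
  have f_ker: "f c = \<zero>\<^bsub>M\<^esub>" if c: "c \<in> ?S" "?d1 c = \<zero>\<^bsub>?E1\<^esub>" for c
  proof -
    obtain w where "w \<in> ext_grade R L 3 0" "c = ?d2 w"
      using H2 c unfolding zero_module_H2_iff by blast
    then show ?thesis using f_d2 submodule_closed(1)[OF ext_grade_submodule] by blast
  qed
  obtain h where h: "linear_map R (?E1\<lparr>carrier := ?d1 ` ?S\<rparr>) M h" "\<And>x. x \<in> ?S \<Longrightarrow> h (?d1 x) = f x"
    by (rule linear_map_factor[OF E2.module_axioms E1.module_axioms N.module_axioms S_sub d1 f_lin f_ker])
       (assumption, assumption, erule that, simp)
  obtain e where e: "linear_map R ?E1 L e" "\<And>x. x \<in> carrier L \<Longrightarrow> e (wedge R L [x]) = x"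
    using ext_power_1_inverse by blast
  define \<pi> where "\<pi> y = wedge R L [part 0 (e y)]" for y
  have \<pi>: "linear_map R ?E1 ?E1 \<pi>"
    unfolding \<pi>_def by (rule linear_map_comp[OF linear_map_comp[OF e(1) part_linear] wedge1_linear])
  have dS: "submodule (?d1 ` ?S) R ?E1"
    by (rule linear_map_image_submodule[OF E2.module_axioms E1.module_axioms d1 S_sub])
  have \<pi>_im: "\<pi> y \<in> ?d1 ` ?S" if "y \<in> carrier ?E1" for y
    unfolding \<pi>_def
  proof (rule zero_perfect_span_subset[OF assms(1) E1.module_axioms wedge1_linear dS])
    show "part 0 (e y) \<in> grade L 0" using part_in_grade linear_map_closed[OF e(1) that] by blast
    fix a b assume ab: "a \<in> grade L (-1)" "b \<in> grade L 1"
    have w: "wedge R L [a, b] \<in> ?S" by (rule wedge2_in_ext_grade[OF ab]) simp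
    have "?d1 (wedge R L [a, b]) = \<ominus>\<^bsub>?E1\<^esub> wedge R L [bracket L a b]"
      using ext_delta_1(2) ab grade_closed by simp
    then have "wedge R L [bracket L a b] = \<ominus>\<^bsub>?E1\<^esub> ?d1 (wedge R L [a, b])"
      using linear_map_closed[OF wedge1_linear] bracket_closed ab grade_closed by simp
    then show "wedge R L [bracket L a b] \<in> ?d1 ` ?S"
      using w submodule_closed(5)[OF dS] by auto
  qed
  have g_lin: "linear_map R ?E1 M (\<lambda>y. h (\<pi> y))"
    by (rule linear_map_comp[OF linear_map_into_submodule[OF \<pi>] h(1)]) (use \<pi>_im in auto)
  have h0: "h \<zero>\<^bsub>?E1\<^esub> = \<zero>\<^bsub>M\<^esub>"
    using linear_map_zero[OF submodule.submodule_is_module[OF dS E1.module_axioms] N.module_axioms h(1)] by simp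
  have \<pi>_wedge: "\<pi> (wedge R L [x]) = (if i = 0 then wedge R L [x] else \<zero>\<^bsub>?E1\<^esub>)" if "x \<in> grade L i" for x i
    unfolding \<pi>_def using that grade_closed part_homogeneous[OF that, of 0]
      linear_map_zero[OF module_axioms E1.module_axioms wedge1_linear]
    by (simp add: e(2))
  have msub: "submodule (mgrade M i) R M" for i by (rule graded_submodule[OF N.mgraded])
  define g where "g = restrict (\<lambda>y. h (\<pi> y)) (carrier ?E1)"
  have c1: "w \<in> carrier ?E1" if "w \<in> wedge_of_degrees R L [i]" for w i
  proof -
    have "id w \<in> carrier ?E1"
      by (rule ext_grade_1_span_subset[OF E1.module_axioms _ E1.carrier_is_submodule _ that])
         (auto simp: linear_map_def intro: linear_map_closed[OF wedge1_linear] grade_closed)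
    then show ?thesis by simp
  qed
  have "g \<in> carrier (gr_cochains R L M 1)"
  proof -
    have "g w \<in> mgrade M (sum_list ds)" if ds: "length ds = 1" "w \<in> wedge_of_degrees R L ds" for ds w
    proof -
      obtain i where i: "ds = [i]" using ds(1) by (auto simp: length_Suc_conv)
      have "h (\<pi> w) \<in> mgrade M i"
      proof (rule ext_grade_1_span_subset[OF N.module_axioms g_lin msub])
        show "w \<in> wedge_of_degrees R L [i]" using ds i by simp
        fix x assume x: "x \<in> grade L i"
        show "h (\<pi> (wedge R L [x])) \<in> mgrade M i"
        proof (cases "i = 0")
          case True
          then show ?thesis
            using M(2) linear_map_closed[OF g_lin linear_map_closed[OF wedge1_linear grade_closed[OF x]]] by simp
        next
          case False
          then show ?thesis using \<pi>_wedge[OF x] h0 submodule_closed(2)[OF msub] by simp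
        qed
      qed
      then show ?thesis using c1 ds i by (simp add: g_def)
    qed
    then show ?thesis
      using linear_map_restrict[OF ext_power_module g_lin, folded g_def]
      by (simp add: gr_cochains_def image_subset_iff)
  qed
  moreover have "f = gr_coboundary R L 1 g"
  proof (rule extensionalityI[OF f_ext])
    show "gr_coboundary R L 1 g \<in> extensional (carrier ?E2)"
      by (simp add: gr_coboundary_def compose_def numeral_2_eq_2)
    fix w assume w: "w \<in> carrier ?E2"
    have "f w = h (\<pi> (?d1 w))"
    proof (rule ext_power_2_eq_homogeneous[OF N.module_axioms f_lin linear_map_comp[OF d1 g_lin] _ w])
      fix i j x y assume x: "x \<in> grade L i" and y: "y \<in> grade L j"
      have c: "x \<in> carrier L" "y \<in> carrier L" using x y grade_closed by auto
      have br: "bracket L x y \<in> grade L (i + j)" using bracket_grade x y by blast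
      have d1w: "?d1 (wedge R L [x, y]) = \<ominus>\<^bsub>?E1\<^esub> wedge R L [bracket L x y]"
        using ext_delta_1(2)[OF c] by simp
      then have \<pi>d: "\<pi> (?d1 (wedge R L [x, y])) = \<ominus>\<^bsub>?E1\<^esub> \<pi> (wedge R L [bracket L x y])"
        using linear_map_inv[OF E1.module_axioms E1.module_axioms \<pi>]
          linear_map_closed[OF wedge1_linear bracket_closed[OF c]] by simp
      show "f (wedge R L [x, y]) = h (\<pi> (?d1 (wedge R L [x, y])))"
      proof (cases "i + j = 0")
        case True
        then have "wedge R L [x, y] \<in> ?S" by (rule wedge2_in_ext_grade[OF x y])
        from h(2)[OF this] show ?thesis unfolding \<pi>d using d1w \<pi>_wedge[OF br] True by simp
      next
        case False
        have "wedge R L [x, y] \<in> wedge_of_degrees R L [i, j]"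
          unfolding wedge_of_degrees_def by (rule lin_span_incl) (use x y in auto)
        then have "f (wedge R L [x, y]) \<in> mgrade M (i + j)" using f_deg[of "[i, j]"] by simp
        moreover from this have "f (wedge R L [x, y]) \<in> mgrade M 0"
          using M(2) submodule_closed(1)[OF msub] by blast
        ultimately have "f (wedge R L [x, y]) = \<zero>\<^bsub>M\<^esub>"
          using grades_disjoint[OF N.mgraded] False by blast
        then show ?thesis using \<pi>d \<pi>_wedge[OF br] False h0 by simp
      qed
    qed
    then show "f w = gr_coboundary R L 1 g w"
      using w linear_map_closed[OF d1 w] by (simp add: gr_coboundary_def compose_def numeral_2_eq_2 g_def)
  qed
  ultimately show "f \<in> gr_coboundary R L 1 ` carrier (gr_cochains R L M 1)" by blast
qed

text \<open>In terms of homogeneous parts it sends \<open>x \<and> y\<close> to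
  \<open>x\<^sub>-\<^sub>1 \<and> y\<^sub>1 + x\<^sub>0 \<and> y\<^sub>0 + x\<^sub>1 \<and> y\<^sub>-\<^sub>1\<close>, which is alternating.\<close>

lemma degree_zero_projection:
  obtains p where "linear_map R (ext_power R L 2) (ext_power R L 2) p"
    "\<And>w. w \<in> ext_grade R L 2 0 \<Longrightarrow> p w = w"
    "\<And>d w. \<lbrakk>w \<in> ext_grade R L 2 d; d \<noteq> 0\<rbrakk> \<Longrightarrow> p w = \<zero>\<^bsub>ext_power R L 2\<^esub>"
proof -
  let ?E2 = "ext_power R L 2"
  interpret E2: module R ?E2 by (rule ext_power_module)
  note b = bilinear_mapD[OF wedge2_bilinear]
  note bp = linear_map_comp[OF part_linear b(1)] linear_map_comp[OF part_linear b(2)]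
  define \<phi> where "\<phi> x y = wedge R L [part (-1) x, part 1 y] \<oplus>\<^bsub>?E2\<^esub> wedge R L [part 0 x, part 0 y]
    \<oplus>\<^bsub>?E2\<^esub> wedge R L [part 1 x, part (-1) y]" for x y
  have "bilinear_map R L L ?E2 \<phi>"
    unfolding bilinear_map_def \<phi>_def
    by (intro conjI ballI linear_map_plus module_axioms ext_power_module bp part_closed)
  moreover have "\<phi> x x = \<zero>\<^bsub>?E2\<^esub>" if "x \<in> carrier L" for x
    using that part_closed[OF that] wedge2_antisym[of "part (-1) x" "part 1 x"] wedge2_closed
    unfolding \<phi>_def by (simp add: wedge2_alt E2.l_neg)
  ultimately obtain p where p: "linear_map R ?E2 ?E2 p"
    "\<And>x y. \<lbrakk>x \<in> carrier L; y \<in> carrier L\<rbrakk> \<Longrightarrow> p (wedge R L [x, y]) = \<phi> x y"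
    using ext_power_2_universal[OF E2.module_axioms] by blast
  have w0: "wedge R L [\<zero>\<^bsub>L\<^esub>, y] = \<zero>\<^bsub>?E2\<^esub>" "wedge R L [y, \<zero>\<^bsub>L\<^esub>] = \<zero>\<^bsub>?E2\<^esub>" if "y \<in> carrier L" for y
    using linear_map_zero[OF module_axioms E2.module_axioms b(1)[OF that]]
      linear_map_zero[OF module_axioms E2.module_axioms b(2)[OF that]] by auto
  have pw: "p (wedge R L [x, y]) = (if i + j = 0 then wedge R L [x, y] else \<zero>\<^bsub>?E2\<^esub>)"
    if "x \<in> grade L i" "y \<in> grade L j" for x y i j
  proof -
    have c: "x \<in> carrier L" "y \<in> carrier L" using that grade_closed by auto
    note ph = part_homogeneous[OF that(1)] part_homogeneous[OF that(2)]
    show ?thesis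
      using degree_cases[OF that(1)]
    proof cases
      case 1
      then show ?thesis using c w0 wedge2_closed
        by (cases "j = 1") (simp_all add: p(2) \<phi>_def ph)
    next
      case 2
      then show ?thesis using c w0 wedge2_closed
        by (cases "j = 0") (simp_all add: p(2) \<phi>_def ph)
    next
      case 3
      then show ?thesis using c w0 wedge2_closed
        by (cases "j = -1") (simp_all add: p(2) \<phi>_def ph)
    next
      case 4
      then show ?thesis using w0[OF c(2)] linear_map_zero[OF E2.module_axioms E2.module_axioms p(1)] by simp
    qed
  qed
  have z: "submodule {\<zero>\<^bsub>?E2\<^esub>} R ?E2" by (rule E2.submoduleI2) auto
  show ?thesis
  proof (rule that[OF p(1)])
    fix w assume w: "w \<in> ext_grade R L 2 0"
    have "p w \<ominus>\<^bsub>?E2\<^esub> id w \<in> {\<zero>\<^bsub>?E2\<^esub>}"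
    proof (rule ext_grade_2_span_subset[OF E2.module_axioms _ z _ w])
      show "linear_map R ?E2 ?E2 (\<lambda>w. p w \<ominus>\<^bsub>?E2\<^esub> id w)"
        by (rule linear_map_diff[OF E2.module_axioms E2.module_axioms p(1)]) (simp add: linear_map_def)
      fix x y i j assume "x \<in> grade L i" "y \<in> grade L j" "i + j = (0::int)"
      then show "p (wedge R L [x, y]) \<ominus>\<^bsub>?E2\<^esub> id (wedge R L [x, y]) \<in> {\<zero>\<^bsub>?E2\<^esub>}"
        using pw wedge2_closed grade_closed by (simp add: E2.minus_zero_iff)
    qed
    then show "p w = w"
      using w submodule_closed(1)[OF ext_grade_submodule, of 2 0] linear_map_closed[OF p(1), of w]
      by (auto simp: E2.minus_zero_iff subset_iff)
  next
    fix d w assume w: "w \<in> ext_grade R L 2 d" "d \<noteq> 0"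
    have "p w \<in> {\<zero>\<^bsub>?E2\<^esub>}"
      by (rule ext_grade_2_span_subset[OF E2.module_axioms p(1) z _ w(1)]) (use pw w(2) in simp)
    then show "p w = \<zero>\<^bsub>?E2\<^esub>" by simp
  qed
qed

end

text \<open>The field as a module over itself with trivial action, carried over to another type along \<open>j\<close>.\<close>

definition line_module :: "('k, 'r) ring_scheme \<Rightarrow> ('k \<Rightarrow> 'm) \<Rightarrow> ('k, 'a, 'm) graded_lie_mod" where
  "line_module K j = \<lparr>carrier = j ` carrier K, mult = undefined, one = undefined, zero = j \<zero>\<^bsub>K\<^esub>,
     add = (\<lambda>x y. j (inv_into (carrier K) j x \<oplus>\<^bsub>K\<^esub> inv_into (carrier K) j y)),
     smult = (\<lambda>a x. j (a \<otimes>\<^bsub>K\<^esub> inv_into (carrier K) j x)),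
     act = (\<lambda>_ _. j \<zero>\<^bsub>K\<^esub>), mgrade = (\<lambda>i. if i = 0 then j ` carrier K else {j \<zero>\<^bsub>K\<^esub>})\<rparr>"

lemma line_module:
  fixes K :: "('k, 'r) ring_scheme" and L :: "('k, 'a, 'x) graded_lie_scheme" and j :: "'k \<Rightarrow> 'm"
  assumes "cring K" "inj_on j (carrier K)" "three_graded_lie_algebra K L"
  shows "graded_lie_module K L (line_module K j :: ('k, 'a, 'm) graded_lie_mod)"
proof -
  interpret K: cring K by fact
  interpret L: three_graded_lie_algebra K L by fact
  let ?M = "line_module K j :: ('k, 'a, 'm) graded_lie_mod"
  let ?KM = "\<lparr>carrier = carrier K, mult = undefined, one = undefined, zero = \<zero>\<^bsub>K\<^esub>,
     add = add K, smult = mult K\<rparr> :: ('k, 'k) module"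
  have KM: "module K ?KM"
  proof (rule moduleI[OF assms(1)])
    show "abelian_group ?KM"
      by (rule abelian_groupI) (auto simp: K.a_ac intro: bexI[of _ "\<ominus>\<^bsub>K\<^esub> x" for x] K.l_neg)
  qed (auto simp: K.l_distr K.r_distr K.m_assoc)
  have M: "module K ?M"
    by (rule module_surjective_image(1)[OF KM, of j]) (auto simp: line_module_def assms(2))
  interpret M: module K ?M by (rule M)
  have z: "\<zero>\<^bsub>?M\<^esub> = j \<zero>\<^bsub>K\<^esub>" "carrier ?M = j ` carrier K" by (simp_all add: line_module_def)
  have g: "mgrade ?M i = (if i = 0 then carrier ?M else {\<zero>\<^bsub>?M\<^esub>})" for i by (simp add: line_module_def)
  have a: "act ?M x m = \<zero>\<^bsub>?M\<^esub>" for x m by (simp add: line_module_def)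
  have zs: "submodule {\<zero>\<^bsub>?M\<^esub>} K ?M" by (rule M.submoduleI2) auto
  have gm: "graded_module K ?M (mgrade ?M)"
    by (rule graded_module_threeI[OF M]) (auto simp: g M.carrier_is_submodule zs)
  show ?thesis
    by (intro graded_lie_module.intro graded_lie_module_axioms.intro M gm)
       (auto simp: a g M.minus_eq intro: linear_map_const_zero[OF M])
qed

text \<open>A cycle \<open>c\<close> that is not a boundary would be separated from the boundaries of degree \<open>0\<close> by a
  functional \<open>f\<close>. Then \<open>f \<circ> p\<close>, with \<open>p\<close> the projection onto degree \<open>0\<close>, kills all boundaries, since
  \<open>p\<close> kills those of other degrees. A coboundary vanishes on every cycle, but \<open>f (p c) \<noteq> 0\<close>.\<close>

lemma (in three_graded_lie_algebra) H2_homology_vanishes: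
  fixes j :: "'k \<Rightarrow> 'm"
  assumes "field R" "inj_on j (carrier R)"
    and H2: "\<And>M :: ('k, 'a, 'm) graded_lie_mod. \<lbrakk>graded_lie_module R L M; mgrade M 0 = carrier M\<rbrakk>
       \<Longrightarrow> zero_module (H2_gr_cohomology R L M)"
  shows "zero_module (H2_gr_homology R L)"
  unfolding zero_module_H2_iff
proof (intro ballI impI, rule ccontr)
  interpret K: field R by fact
  let ?M = "line_module R j :: ('k, 'a, 'm) graded_lie_mod"
  have M: "graded_lie_module R L ?M"
    by (rule line_module[OF R.is_cring assms(2) three_graded_lie_algebra_axioms])
  interpret N: graded_lie_module R L ?M by (rule M)
  let ?E1 = "ext_power R L (Suc 0)" and ?E2 = "ext_power R L 2" and ?E3 = "ext_power R L 3"
  let ?d1 = "ext_delta R L (Suc 0)" and ?d2 = "ext_delta R L 2" and ?B = "ext_delta R L 2 ` ext_grade R L 3 0"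
  interpret E1: module R ?E1 by (rule ext_power_module)
  interpret E2: module R ?E2 by (rule ext_power_module)
  interpret E3: module R ?E3 by (rule ext_power_module)
  note d1 = ext_delta_1(1)[unfolded One_nat_def] and d2 = ext_delta_2(1)
  fix c assume c: "c \<in> ext_grade R L 2 0" "?d1 c = \<zero>\<^bsub>?E1\<^esub>" "c \<notin> ?B"
  have cc: "c \<in> carrier ?E2" using c(1) submodule_closed(1)[OF ext_grade_submodule] by blast
  have B: "submodule ?B R ?E2"
    by (rule linear_map_image_submodule[OF E3.module_axioms E2.module_axioms d2 ext_grade_submodule])
  have m1: "j \<one>\<^bsub>R\<^esub> \<in> carrier ?M" "j \<one>\<^bsub>R\<^esub> \<noteq> \<zero>\<^bsub>?M\<^esub>"
    using assms(2) by (auto simp: line_module_def inj_on_eq_iff)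
  obtain f where f: "linear_map R ?E2 ?M f" "\<And>x. x \<in> ?B \<Longrightarrow> f x = \<zero>\<^bsub>?M\<^esub>" "f c = j \<one>\<^bsub>R\<^esub>"
    using field_linear_separation[OF assms(1) E2.module_axioms N.module_axioms B cc c(3) m1(1)] by blast
  obtain p where p: "linear_map R ?E2 ?E2 p"
    "\<And>w. w \<in> ext_grade R L 2 0 \<Longrightarrow> p w = w"
    "\<And>d w. \<lbrakk>w \<in> ext_grade R L 2 d; d \<noteq> 0\<rbrakk> \<Longrightarrow> p w = \<zero>\<^bsub>?E2\<^esub>"
    using degree_zero_projection by blast
  have fp: "linear_map R ?E2 ?M (\<lambda>w. f (p w))" by (rule linear_map_comp[OF p(1) f(1)])
  have f0: "f \<zero>\<^bsub>?E2\<^esub> = \<zero>\<^bsub>?M\<^esub>" by (rule linear_map_zero[OF E2.module_axioms N.module_axioms f(1)])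
  have mg: "mgrade ?M i = (if i = 0 then carrier ?M else {\<zero>\<^bsub>?M\<^esub>})" for i by (simp add: line_module_def)
  have msub: "submodule (mgrade ?M i) R ?M" for i by (rule graded_submodule[OF N.mgraded])
  define F where "F = restrict (\<lambda>w. f (p w)) (carrier ?E2)"
  have c2: "w \<in> carrier ?E2" if "w \<in> wedge_of_degrees R L [i, j]" for w i j
  proof -
    have "id w \<in> carrier ?E2"
      by (rule wedge_of_degrees_2_span_subset[OF E2.module_axioms _ E2.carrier_is_submodule _ that])
         (auto simp: linear_map_def intro: wedge2_closed grade_closed)
    then show ?thesis by simp
  qed
  have FC: "F \<in> carrier (gr_cochains R L ?M 2)"
  proof -
    have "F w \<in> mgrade ?M (sum_list ds)" if ds: "length ds = 2" "w \<in> wedge_of_degrees R L ds" for ds w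
    proof -
      obtain i k where i: "ds = [i, k]" using ds(1) by (auto simp: length_Suc_conv numeral_2_eq_2)
      have "f (p w) \<in> mgrade ?M (i + k)"
      proof (rule wedge_of_degrees_2_span_subset[OF N.module_axioms fp msub])
        show "w \<in> wedge_of_degrees R L [i, k]" using ds i by simp
        fix x y assume xy: "x \<in> grade L i" "y \<in> grade L k"
        have "wedge R L [x, y] \<in> ext_grade R L 2 (i + k)" by (rule wedge2_in_ext_grade[OF xy refl])
        then show "f (p (wedge R L [x, y])) \<in> mgrade ?M (i + k)"
          using p(3) f0 linear_map_closed[OF fp] wedge2_closed xy grade_closed by (simp add: mg)
      qed
      then show ?thesis using c2 ds i by (simp add: F_def)
    qed
    then show ?thesis
      using linear_map_restrict[OF ext_power_module fp, folded F_def]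
      by (simp add: gr_cochains_def image_subset_iff)
  qed
  have "f (p (?d2 w)) = \<zero>\<^bsub>?M\<^esub>" if w: "w \<in> carrier ?E3" for w
  proof (rule ext_power_3_eq_homogeneous[OF N.module_axioms linear_map_comp[OF d2 fp]
        linear_map_const_zero[OF N.module_axioms] _ w])
    fix i k l x y z assume xyz: "x \<in> grade L i" "y \<in> grade L k" "z \<in> grade L l"
    let ?w = "wedge R L [x, y, z]"
    have w: "?w \<in> ext_grade R L 3 (i + k + l)" by (rule wedge3_in_ext_grade[OF xyz refl])
    have dw: "?d2 ?w \<in> ext_grade R L 2 (i + k + l)" by (rule ext_delta_2_grade[OF w])
    show "f (p (?d2 ?w)) = \<zero>\<^bsub>?M\<^esub>"
    proof (cases "i + k + l = 0")
      case True
      then show ?thesis using p(2) dw w f(2) by simp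
    next
      case False
      then show ?thesis using p(3)[OF dw] f0 by simp
    qed
  qed
  then have "gr_coboundary R L 2 F = (\<lambda>x\<in>carrier ?E3. \<zero>\<^bsub>?M\<^esub>)"
    using linear_map_closed[OF d2]
    by (auto simp: gr_coboundary_def compose_def F_def fun_eq_iff numeral_2_eq_2 numeral_3_eq_3)
  moreover have "mgrade ?M 0 = carrier ?M" by (simp add: mg)
  ultimately obtain g where g: "g \<in> carrier (gr_cochains R L ?M 1)" "F = gr_coboundary R L 1 g"
    using H2[OF M] FC unfolding zero_module_H2_cohomology_iff[OF M] by blast
  have "linear_map R ?E1 ?M g" using g(1) by (auto simp: gr_cochains_def linear_hom_def)
  then have "g (?d1 c) = \<zero>\<^bsub>?M\<^esub>"
    using c(2) linear_map_zero[OF E1.module_axioms N.module_axioms] by simp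
  then have "F c = \<zero>\<^bsub>?M\<^esub>" using cc unfolding g(2) by (simp add: gr_coboundary_def compose_def numeral_2_eq_2)
  then show False using cc p(2)[OF c(1)] f(3) m1(2) by (simp add: F_def)
qed

section \<open>Central extensions given by relations\<close>

context abelian_group
begin

lemma minus_eq_minus_iff:
  assumes "a \<in> carrier G" "b \<in> carrier G" "c \<in> carrier G" "d \<in> carrier G"
  shows "a \<ominus> b = c \<ominus> d \<longleftrightarrow> a \<oplus> d = c \<oplus> b"
proof
  assume "a \<ominus> b = c \<ominus> d"
  then have "(a \<ominus> b) \<oplus> (b \<oplus> d) = (c \<ominus> d) \<oplus> (b \<oplus> d)" by simp
  moreover have "(a \<ominus> b) \<oplus> (b \<oplus> d) = a \<oplus> d" using assms by algebra
  moreover have "(c \<ominus> d) \<oplus> (b \<oplus> d) = c \<oplus> b" using assms by algebra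
  ultimately show "a \<oplus> d = c \<oplus> b" by simp
next
  assume "a \<oplus> d = c \<oplus> b"
  then have "(a \<oplus> d) \<ominus> (b \<oplus> d) = (c \<oplus> b) \<ominus> (b \<oplus> d)" by simp
  moreover have "(a \<oplus> d) \<ominus> (b \<oplus> d) = a \<ominus> b" using assms by algebra
  moreover have "(c \<oplus> b) \<ominus> (b \<oplus> d) = c \<ominus> d" using assms by algebra
  ultimately show "a \<ominus> b = c \<ominus> d" by simp
qed

end

context lie_algebra
begin

lemmas bracket_add1 = linear_map_add[OF bracket_linear1]
lemmas bracket_add2 = linear_map_add[OF bracket_linear2]
lemmas bracket_smult1 = linear_map_smult[OF bracket_linear1]
lemmas bracket_smult2 = linear_map_smult[OF bracket_linear2]
lemmas bracket_inv1 = linear_map_inv[OF module_axioms module_axioms bracket_linear1]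
lemmas bracket_inv2 = linear_map_inv[OF module_axioms module_axioms bracket_linear2]
lemmas bracket_zero1 = linear_map_zero[OF module_axioms module_axioms bracket_linear1]
lemmas bracket_zero2 = linear_map_zero[OF module_axioms module_axioms bracket_linear2]

lemma leibniz:
  assumes x: "x \<in> carrier L" and y: "y \<in> carrier L" and z: "z \<in> carrier L"
  shows "bracket L x (bracket L y z) = bracket L (bracket L x y) z \<oplus>\<^bsub>L\<^esub> bracket L y (bracket L x z)"
proof -
  have "bracket L y (bracket L z x) = \<ominus>\<^bsub>L\<^esub> bracket L y (bracket L x z)"
    using x y z by (simp add: bracket_antisym[of z x] bracket_inv2 bracket_closed)
  moreover have "bracket L z (bracket L x y) = \<ominus>\<^bsub>L\<^esub> bracket L (bracket L x y) z"
    using x y z by (simp add: bracket_antisym[of z] bracket_closed)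
  ultimately have "bracket L x (bracket L y z) \<oplus>\<^bsub>L\<^esub> \<ominus>\<^bsub>L\<^esub> bracket L y (bracket L x z)
      \<oplus>\<^bsub>L\<^esub> \<ominus>\<^bsub>L\<^esub> bracket L (bracket L x y) z = \<zero>\<^bsub>L\<^esub>" (is "?a \<oplus>\<^bsub>L\<^esub> \<ominus>\<^bsub>L\<^esub> ?b \<oplus>\<^bsub>L\<^esub> \<ominus>\<^bsub>L\<^esub> ?c = _")
    using jacobi[OF x y z] by simp
  moreover have c: "?a \<in> carrier L" "?b \<in> carrier L" "?c \<in> carrier L" using x y z by (simp_all add: bracket_closed)
  moreover have "?a \<oplus>\<^bsub>L\<^esub> \<ominus>\<^bsub>L\<^esub> ?b \<oplus>\<^bsub>L\<^esub> \<ominus>\<^bsub>L\<^esub> ?c = ?a \<ominus>\<^bsub>L\<^esub> (?c \<oplus>\<^bsub>L\<^esub> ?b)"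
    using c by (simp add: M.minus_eq M.minus_add M.a_ac)
  ultimately show ?thesis by (simp add: M.minus_zero_iff)
qed

end

text \<open>The relation \<open>E\<close> is a subalgebra of \<open>L \<times> N\<close> that projects onto \<open>L\<close> with central kernel. The bracket
  in \<open>N\<close> of two lifts does not depend on the lifts, because two lifts of the same element differ by a
  central one. The same independence shows that it is bilinear, although no choice \<open>s\<close> of lifts need
  be linear, and replaces \<open>s [x, y]\<close> by \<open>[s x, s y]\<close> inside brackets, so that the Jacobi identity of \<open>N\<close>
  yields the vanishing on boundaries.\<close>

lemma central_relation_cocycle:
  fixes L :: "('k, 'a, 'x) graded_lie_scheme" and N :: "('k, 'b, 'y) graded_lie_scheme"
    and E :: "'a \<Rightarrow> 'b \<Rightarrow> bool"
  assumes L: "lie_algebra R L" and N: "lie_algebra R N"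
    and dom: "\<And>x y. E x y \<Longrightarrow> x \<in> carrier L \<and> y \<in> carrier N"
    and total: "\<And>x. x \<in> carrier L \<Longrightarrow> \<exists>y. E x y"
    and add: "\<And>x y x' y'. \<lbrakk>E x y; E x' y'\<rbrakk> \<Longrightarrow> E (x \<oplus>\<^bsub>L\<^esub> x') (y \<oplus>\<^bsub>N\<^esub> y')"
    and smult: "\<And>a x y. \<lbrakk>a \<in> carrier R; E x y\<rbrakk> \<Longrightarrow> E (a \<odot>\<^bsub>L\<^esub> x) (a \<odot>\<^bsub>N\<^esub> y)"
    and br: "\<And>x y x' y'. \<lbrakk>E x y; E x' y'\<rbrakk> \<Longrightarrow> E (bracket L x x') (bracket N y y')"
    and central: "\<And>z x y. \<lbrakk>E \<zero>\<^bsub>L\<^esub> z; E x y\<rbrakk> \<Longrightarrow> bracket N z y = \<zero>\<^bsub>N\<^esub>"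
  obtains \<Phi> where "linear_map R (ext_power R L 2) N \<Phi>"
    "\<And>x y x' y'. \<lbrakk>E x y; E x' y'\<rbrakk> \<Longrightarrow> \<Phi> (wedge R L [x, x']) = bracket N y y'"
    "\<And>w. w \<in> carrier (ext_power R L 3) \<Longrightarrow> \<Phi> (ext_delta R L 2 w) = \<zero>\<^bsub>N\<^esub>"
proof -
  interpret L: lie_algebra R L by fact
  interpret N: lie_algebra R N by fact
  have diff: "E \<zero>\<^bsub>L\<^esub> (y \<ominus>\<^bsub>N\<^esub> y')" if "E x y" "E x y'" for x y y'
    using add[OF that(1) smult[OF _ that(2), of "\<ominus>\<^bsub>R\<^esub> \<one>\<^bsub>R\<^esub>"]] dom[OF that(1)] dom[OF that(2)]
    by (simp add: L.smult_l_minus N.smult_l_minus L.M.r_neg N.M.minus_eq)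
  have indep1: "bracket N y t = bracket N y' t" if h: "E x y" "E x y'" "E u t" for x y y' u t
  proof -
    have "bracket N (y \<ominus>\<^bsub>N\<^esub> y') t = \<zero>\<^bsub>N\<^esub>" by (rule central[OF diff[OF h(1,2)] h(3)])
    then show ?thesis using dom[OF h(1)] dom[OF h(2)] dom[OF h(3)]
      by (simp add: linear_map_minus[OF N.module_axioms N.module_axioms N.bracket_linear1]
          N.M.minus_zero_iff N.bracket_closed)
  qed
  have indep: "bracket N y t = bracket N y' t'" if h: "E x y" "E x y'" "E u t" "E u t'" for x y y' u t t'
  proof -
    have "bracket N y t = bracket N y' t" by (rule indep1[OF h(1-3)])
    also have "\<dots> = \<ominus>\<^bsub>N\<^esub> bracket N t y'" using dom h by (auto intro: N.bracket_antisym)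
    also have "bracket N t y' = bracket N t' y'" by (rule indep1[OF h(3,4,2)])
    also have "\<ominus>\<^bsub>N\<^esub> bracket N t' y' = bracket N y' t'" using dom h by (auto intro: N.bracket_antisym[symmetric])
    finally show ?thesis .
  qed
  define s where "s x = (SOME y. E x y)" for x
  have s: "E x (s x)" if "x \<in> carrier L" for x
    unfolding s_def using total[OF that] by (rule someI_ex)
  have sc: "s x \<in> carrier N" if "x \<in> carrier L" for x using dom s that by blast
  define \<phi> where "\<phi> x x' = bracket N (s x) (s x')" for x x'
  have \<phi>: "\<phi> x x' = bracket N y y'" if "E x y" "E x' y'" for x y x' y'
    unfolding \<phi>_def using dom that by (intro indep[OF s that(1) s that(2)]) auto
  have "bilinear_map R L L N \<phi>"
    unfolding bilinear_map_def
  proof (intro conjI ballI linear_mapI)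
    fix u x assume u: "u \<in> carrier L" and x: "x \<in> carrier L"
    show "\<phi> x u \<in> carrier N" "\<phi> u x \<in> carrier N"
      using u x sc by (simp_all add: \<phi>_def N.bracket_closed)
    fix y assume y: "y \<in> carrier L"
    show "\<phi> (x \<oplus>\<^bsub>L\<^esub> y) u = \<phi> x u \<oplus>\<^bsub>N\<^esub> \<phi> y u"
      using \<phi>[OF add[OF s[OF x] s[OF y]] s[OF u]] sc u x y by (simp add: \<phi>_def N.bracket_add1)
    show "\<phi> u (x \<oplus>\<^bsub>L\<^esub> y) = \<phi> u x \<oplus>\<^bsub>N\<^esub> \<phi> u y"
      using \<phi>[OF s[OF u] add[OF s[OF x] s[OF y]]] sc u x y by (simp add: \<phi>_def N.bracket_add2)
  next
    fix u a x assume u: "u \<in> carrier L" and a: "a \<in> carrier R" and x: "x \<in> carrier L"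
    show "\<phi> (a \<odot>\<^bsub>L\<^esub> x) u = a \<odot>\<^bsub>N\<^esub> \<phi> x u"
      using \<phi>[OF smult[OF a s[OF x]] s[OF u]] sc u x a by (simp add: \<phi>_def N.bracket_smult1)
    show "\<phi> u (a \<odot>\<^bsub>L\<^esub> x) = a \<odot>\<^bsub>N\<^esub> \<phi> u x"
      using \<phi>[OF s[OF u] smult[OF a s[OF x]]] sc u x a by (simp add: \<phi>_def N.bracket_smult2)
  qed
  moreover have "\<phi> x x = \<zero>\<^bsub>N\<^esub>" if "x \<in> carrier L" for x
    using sc[OF that] by (simp add: \<phi>_def N.bracket_alt)
  ultimately obtain \<Phi> where \<Phi>: "linear_map R (ext_power R L 2) N \<Phi>"
    "\<And>x y. \<lbrakk>x \<in> carrier L; y \<in> carrier L\<rbrakk> \<Longrightarrow> \<Phi> (wedge R L [x, y]) = \<phi> x y"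
    using L.ext_power_2_universal[OF N.module_axioms] by blast
  have \<Phi>E: "\<Phi> (wedge R L [x, x']) = bracket N y y'" if "E x y" "E x' y'" for x y x' y'
    using \<phi>[OF that] dom[OF that(1)] dom[OF that(2)] \<Phi>(2) by simp
  interpret E2: module R "ext_power R L 2" by (rule L.ext_power_module)
  have "\<Phi> (ext_delta R L 2 w) = \<zero>\<^bsub>N\<^esub>" if w: "w \<in> carrier (ext_power R L 3)" for w
  proof (rule L.ext_power_eqI[OF N.module_axioms linear_map_comp[OF L.ext_delta_2(1) \<Phi>(1)]
        linear_map_const_zero[OF N.module_axioms] _ w])
    fix xs assume "xs \<in> tuples L 3"
    then obtain x y z where xs: "xs = [x, y, z]" "x \<in> carrier L" "y \<in> carrier L" "z \<in> carrier L"
      by (auto simp: L.tuples_3)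
    let ?a = "s x" and ?b = "s y" and ?c = "s z"
    note c = sc[OF xs(2)] sc[OF xs(3)] sc[OF xs(4)]
    note e = s[OF xs(2)] s[OF xs(3)] s[OF xs(4)]
    have "\<Phi> (ext_delta R L 2 (wedge R L [x, y, z]))
      = \<ominus>\<^bsub>N\<^esub> \<Phi> (wedge R L [bracket L x y, z]) \<oplus>\<^bsub>N\<^esub> \<Phi> (wedge R L [bracket L x z, y])
        \<ominus>\<^bsub>N\<^esub> \<Phi> (wedge R L [bracket L y z, x])"
      using xs by (simp add: L.ext_delta_2(2) linear_map_add[OF \<Phi>(1)]
          linear_map_minus[OF E2.module_axioms N.module_axioms \<Phi>(1)]
          linear_map_inv[OF E2.module_axioms N.module_axioms \<Phi>(1)] L.wedge2_closed L.bracket_closed)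
    also have "\<dots> = \<ominus>\<^bsub>N\<^esub> bracket N (bracket N ?a ?b) ?c \<oplus>\<^bsub>N\<^esub> bracket N (bracket N ?a ?c) ?b
        \<ominus>\<^bsub>N\<^esub> bracket N (bracket N ?b ?c) ?a"
      using \<Phi>E[OF br[OF e(1,2)] e(3)] \<Phi>E[OF br[OF e(1,3)] e(2)] \<Phi>E[OF br[OF e(2,3)] e(1)] by simp
    also have "bracket N (bracket N ?a ?c) ?b = bracket N ?b (bracket N ?c ?a)"
      using c by (simp add: N.bracket_antisym[of _ ?b] N.bracket_antisym[of ?c ?a] N.bracket_inv2 N.bracket_closed)
    also have "\<ominus>\<^bsub>N\<^esub> bracket N (bracket N ?a ?b) ?c = bracket N ?c (bracket N ?a ?b)"
      using c by (simp add: N.bracket_antisym[of ?c] N.bracket_closed)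
    also have "bracket N ?c (bracket N ?a ?b) \<oplus>\<^bsub>N\<^esub> bracket N ?b (bracket N ?c ?a)
        \<ominus>\<^bsub>N\<^esub> bracket N (bracket N ?b ?c) ?a
      = bracket N ?a (bracket N ?b ?c) \<oplus>\<^bsub>N\<^esub> bracket N ?b (bracket N ?c ?a) \<oplus>\<^bsub>N\<^esub> bracket N ?c (bracket N ?a ?b)"
      using c by (simp add: N.bracket_antisym[of ?a "bracket N ?b ?c"] N.M.minus_eq N.bracket_closed N.M.a_ac)
    also have "\<dots> = \<zero>\<^bsub>N\<^esub>" by (rule N.jacobi[OF c])
    finally show "\<Phi> (ext_delta R L 2 (wedge R L xs)) = \<zero>\<^bsub>N\<^esub>" by (simp add: xs(1))
  qed
  then show ?thesis using that[OF \<Phi>(1) \<Phi>E] by blast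
qed

section \<open>From Lie algebras to Jordan triple systems\<close>

locale involutive_lie_algebra = three_graded_lie_algebra R L
  for R :: "('k, 'r) ring_scheme" and L :: "('k, 'a, 'x) inv_graded_lie_scheme" +
  assumes involution: "anti_graded_involution R L (invol L)"
begin

lemma invol_linear: "linear_map R L L (invol L)"
  using involution by (simp add: anti_graded_involution_def lie_hom_def)

lemma invol_bracket:
  "\<lbrakk>x \<in> carrier L; y \<in> carrier L\<rbrakk> \<Longrightarrow> invol L (bracket L x y) = bracket L (invol L x) (invol L y)"
  using involution by (simp add: anti_graded_involution_def lie_hom_def)

lemma invol_invol: "x \<in> carrier L \<Longrightarrow> invol L (invol L x) = x"
  using involution by (simp add: anti_graded_involution_def)

lemma invol_grade: "x \<in> grade L i \<Longrightarrow> invol L x \<in> grade L (- i)"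
  using involution by (auto simp: anti_graded_involution_def)

lemma invol_grade_m1: "x \<in> grade L (-1) \<Longrightarrow> invol L x \<in> grade L 1"
  and invol_grade_0: "x \<in> grade L 0 \<Longrightarrow> invol L x \<in> grade L 0"
  and invol_grade_1: "x \<in> grade L 1 \<Longrightarrow> invol L x \<in> grade L (-1)"
  using invol_grade[of x "-1"] invol_grade[of x 0] invol_grade[of x 1] by auto

lemmas invol_closed = linear_map_closed[OF invol_linear]
lemmas invol_add = linear_map_add[OF invol_linear]
lemmas invol_smult = linear_map_smult[OF invol_linear]
lemmas invol_zero = linear_map_zero[OF module_axioms module_axioms invol_linear]

lemma bracket_grade_0:
  "\<lbrakk>a \<in> grade L (-1); b \<in> grade L 1\<rbrakk> \<Longrightarrow> bracket L a b \<in> grade L 0"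
  "\<lbrakk>x \<in> grade L 0; y \<in> grade L i\<rbrakk> \<Longrightarrow> bracket L x y \<in> grade L i"
  using bracket_grade[of a "-1" b 1] bracket_grade[of x 0 y i] by auto

end

definition jts_of :: "('k, 'a, 'x) inv_graded_lie_scheme \<Rightarrow> ('k, 'a) jordan_triple" where
  "jts_of L = \<lparr>carrier = grade L (-1), mult = undefined, one = undefined, zero = zero L, add = add L,
     smult = smult L, triple = (\<lambda>a b c. bracket L (bracket L a (invol L b)) c)\<rparr>"

lemma jts_of_simps [simp]:
  "carrier (jts_of L) = grade L (-1)" "zero (jts_of L) = zero L" "add (jts_of L) = add L"
  "smult (jts_of L) = smult L" "triple (jts_of L) a b c = bracket L (bracket L a (invol L b)) c"
  by (simp_all add: jts_of_def)

context involutive_lie_algebra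
begin

lemma jts_of_module: "module R (jts_of L)"
proof (rule module_surjective_image(1)[where f = "\<lambda>x. x"])
  show "module R (L\<lparr>carrier := grade L (-1)\<rparr>)"
    by (rule submodule.submodule_is_module[OF grade_submodule module_axioms])
qed auto

text \<open>The product is symmetric in its outer arguments since \<open>[a, c]\<close> has degree \<open>-2\<close> and so vanishes. The
  commutator formula is the Leibniz rule for the derivation given by \<open>D = [a, \<epsilon> b]\<close>, because
  \<open>[D, \<epsilon> d] = - \<epsilon> {b, a, d}\<close>.\<close>

lemma jts_of_jordan_triple_system: "jordan_triple_system R (jts_of L)"
proof -
  let ?T = "jts_of L"
  interpret T: module R ?T by (rule jts_of_module)
  have D: "bracket L a (invol L b) \<in> grade L 0" if "a \<in> grade L (-1)" "b \<in> grade L (-1)" for a b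
    using that bracket_grade_0(1) invol_grade_m1 by blast
  have tr: "triple ?T a b c \<in> grade L (-1)"
    if "a \<in> grade L (-1)" "b \<in> grade L (-1)" "c \<in> grade L (-1)" for a b c
    using that D bracket_grade_0(2) by simp
  note gc = grade_closed[of _ "-1"] grade_closed[of _ 0] and bc = bracket_closed invol_closed
  show ?thesis
  proof
    fix b c assume bc': "b \<in> carrier ?T" "c \<in> carrier ?T"
    show "linear_map R ?T ?T (\<lambda>a. triple ?T a b c)" "linear_map R ?T ?T (\<lambda>a. triple ?T b a c)"
      "linear_map R ?T ?T (\<lambda>a. triple ?T b c a)"
      using bc' tr gc bc
      by (auto intro!: linear_mapI simp del: jts_of_simps(5),
          simp_all add: bracket_add1 bracket_add2 bracket_smult1 bracket_smult2 invol_add invol_smult)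
  next
    fix a b c assume abc: "a \<in> carrier ?T" "b \<in> carrier ?T" "c \<in> carrier ?T"
    then have c: "a \<in> carrier L" "invol L b \<in> carrier L" "c \<in> carrier L" using gc bc by auto
    have "bracket L c a \<in> grade L (-1 + -1)" using abc by (intro bracket_grade) auto
    then have ca: "bracket L c a = \<zero>\<^bsub>L\<^esub>" using three_graded[of "-2"] by simp
    have "bracket L c (bracket L a (invol L b)) = bracket L a (bracket L c (invol L b))"
      using leibniz[OF c(3,1,2)] ca c bc by (simp add: bracket_zero1)
    then show "triple ?T a b c = triple ?T c b a"
      using c bc by (simp add: bracket_antisym[of "bracket L a (invol L b)" c]
         bracket_antisym[of "bracket L c (invol L b)" a])
  next
    fix a b c d e
    assume m: "a \<in> carrier ?T" "b \<in> carrier ?T" "c \<in> carrier ?T" "d \<in> carrier ?T" "e \<in> carrier ?T"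
    then have mc: "a \<in> carrier L" "b \<in> carrier L" "c \<in> carrier L" "d \<in> carrier L" "e \<in> carrier L"
      using gc by auto
    let ?D = "bracket L a (invol L b)" and ?D' = "bracket L c (invol L d)"
    have Dc: "?D \<in> carrier L" "?D' \<in> carrier L" using mc bc by auto
    let ?u = "bracket L (bracket L b (invol L a)) d"
    have u: "?u \<in> carrier L" using mc bc by auto
    have "bracket L ?D (invol L d) = \<ominus>\<^bsub>L\<^esub> invol L ?u"
      using mc bc by (simp add: invol_bracket invol_invol bracket_antisym[of a "invol L b"] bracket_inv1)
    then have DD: "bracket L ?D ?D' = bracket L (bracket L ?D c) (invol L d) \<oplus>\<^bsub>L\<^esub> \<ominus>\<^bsub>L\<^esub> bracket L c (invol L ?u)"
      using leibniz[OF Dc(1) mc(3), of "invol L d"] mc bc u by (simp add: bracket_inv2)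
    have "bracket L ?D (bracket L ?D' e) = bracket L (bracket L ?D ?D') e \<oplus>\<^bsub>L\<^esub> bracket L ?D' (bracket L ?D e)"
      by (rule leibniz[OF Dc mc(5)])
    also have "bracket L (bracket L ?D ?D') e
      = bracket L (bracket L (bracket L ?D c) (invol L d)) e \<oplus>\<^bsub>L\<^esub> \<ominus>\<^bsub>L\<^esub> bracket L (bracket L c (invol L ?u)) e"
      unfolding DD using mc bc u by (simp add: bracket_add1 bracket_inv1)
    finally have "bracket L ?D (bracket L ?D' e) \<oplus>\<^bsub>L\<^esub> bracket L (bracket L c (invol L ?u)) e
      = bracket L (bracket L (bracket L ?D c) (invol L d)) e \<oplus>\<^bsub>L\<^esub> bracket L ?D' (bracket L ?D e)"
      using mc bc u by (simp add: M.a_assoc M.a_comm[of "bracket L ?D' (bracket L ?D e)"] M.r_neg1)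
    then show "V_op ?T a b (V_op ?T c d e) \<ominus>\<^bsub>?T\<^esub> V_op ?T c d (V_op ?T a b e)
         = V_op ?T (V_op ?T a b c) d e \<ominus>\<^bsub>?T\<^esub> V_op ?T c (V_op ?T b a d) e"
      using m tr by (subst T.M.minus_eq_minus_iff) (simp_all add: V_op_def)
  qed
qed

end

section \<open>Extending triple homomorphisms\<close>

lemma graded_involutary_hom_eqI:
  fixes X :: "('k, 'a, 'x) inv_graded_lie_scheme" and Y :: "('k, 'b, 'y) inv_graded_lie_scheme"
  assumes X: "involutive_lie_algebra R X" and Y: "involutive_lie_algebra R Y"
    and perfect: "zero_perfect R X"
    and f: "f \<in> graded_involutary_hom R X Y" and g: "g \<in> graded_involutary_hom R X Y"
    and eq: "\<And>x. x \<in> grade X (-1) \<Longrightarrow> f x = g x"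
  shows "f = g"
proof -
  interpret X: involutive_lie_algebra R X by fact
  interpret Y: involutive_lie_algebra R Y by fact
  have fl: "linear_map R X Y f" and gl: "linear_map R X Y g"
    and fb: "\<And>x y. \<lbrakk>x \<in> carrier X; y \<in> carrier X\<rbrakk> \<Longrightarrow> f (bracket X x y) = bracket Y (f x) (f y)"
    and gb: "\<And>x y. \<lbrakk>x \<in> carrier X; y \<in> carrier X\<rbrakk> \<Longrightarrow> g (bracket X x y) = bracket Y (g x) (g y)"
    and fi: "\<And>x. x \<in> carrier X \<Longrightarrow> f (invol X x) = invol Y (f x)"
    and gi: "\<And>x. x \<in> carrier X \<Longrightarrow> g (invol X x) = invol Y (g x)"
    and ext: "f \<in> extensional (carrier X)" "g \<in> extensional (carrier X)"
    using f g by (auto simp: graded_involutary_hom_def lie_hom_def)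
  have eq1: "f x = g x" if x: "x \<in> grade X 1" for x
  proof -
    have "f (invol X (invol X x)) = g (invol X (invol X x))"
      using fi gi X.invol_closed X.grade_closed[OF x] eq[OF X.invol_grade_1[OF x]] by simp
    then show ?thesis using X.invol_invol[OF X.grade_closed[OF x]] by simp
  qed
  have eq0: "f x = g x" if x: "x \<in> grade X 0" for x
    by (rule linear_map_eq_on_span[OF X.module_axioms Y.module_axioms fl gl _ _ X.zero_perfectD[OF perfect x]])
       (auto simp: fb gb eq eq1 X.grade_closed X.bracket_closed)
  show ?thesis
  proof (rule extensionalityI[OF ext])
    fix x assume x: "x \<in> carrier X"
    show "f x = g x"
    proof (rule X.linear_map_eq_homogeneous[OF Y.module_axioms fl gl _ x])
      fix i x assume xi: "x \<in> grade X i"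
      then show "f x = g x"
        using eq[of x] eq0[of x] eq1[of x] linear_map_zero[OF X.module_axioms Y.module_axioms fl]
          linear_map_zero[OF X.module_axioms Y.module_axioms gl]
        by (cases rule: X.degree_cases[OF xi]) auto
    qed
  qed
qed

text \<open>The part of degree \<open>0\<close> of the subalgebra of \<open>X \<times> Y\<close> generated by the graph of \<open>f\<close> and its image under
  the involutions. Scalars can be absorbed into \<open>a\<close>, so sums of generators suffice.\<close>

inductive middle_graph for X :: "('k, 'a, 'x) inv_graded_lie_scheme"
    and Y :: "('k, 'b, 'y) inv_graded_lie_scheme" and f :: "'a \<Rightarrow> 'b" where
  zero: "middle_graph X Y f \<zero>\<^bsub>X\<^esub> \<zero>\<^bsub>Y\<^esub>"
| step: "\<lbrakk>middle_graph X Y f h k; a \<in> grade X (-1); b \<in> grade X (-1)\<rbrakk> \<Longrightarrow>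
    middle_graph X Y f (h \<oplus>\<^bsub>X\<^esub> bracket X a (invol X b)) (k \<oplus>\<^bsub>Y\<^esub> bracket Y (f a) (invol Y (f b)))"

locale jts_hom_extension = X: involutive_lie_algebra R X + Y: involutive_lie_algebra R Y
  for R :: "('k, 'r) ring_scheme" and X :: "('k, 'a, 'x) inv_graded_lie_scheme"
    and Y :: "('k, 'b, 'y) inv_graded_lie_scheme" +
  fixes f :: "'a \<Rightarrow> 'b"
  assumes perfect: "zero_perfect R X" and H2: "zero_module (H2_gr_homology R X)"
    and f_hom: "f \<in> jts_hom R (jts_of X) (jts_of Y)"
begin

abbreviation (input) "T \<equiv> grade X (-1)"

lemma f_closed: "a \<in> T \<Longrightarrow> f a \<in> grade Y (-1)"
  and f_add: "\<lbrakk>a \<in> T; b \<in> T\<rbrakk> \<Longrightarrow> f (a \<oplus>\<^bsub>X\<^esub> b) = f a \<oplus>\<^bsub>Y\<^esub> f b"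
  and f_smult: "\<lbrakk>r \<in> carrier R; a \<in> T\<rbrakk> \<Longrightarrow> f (r \<odot>\<^bsub>X\<^esub> a) = r \<odot>\<^bsub>Y\<^esub> f a"
  and f_triple: "\<lbrakk>a \<in> T; b \<in> T; c \<in> T\<rbrakk> \<Longrightarrow>
    f (bracket X (bracket X a (invol X b)) c) = bracket Y (bracket Y (f a) (invol Y (f b))) (f c)"
  using f_hom by (auto simp: jts_hom_def linear_hom_def linear_map_def Pi_iff)

lemma T_sub: "a \<in> T \<Longrightarrow> a \<in> carrier X" "\<zero>\<^bsub>X\<^esub> \<in> T" "\<lbrakk>a \<in> T; b \<in> T\<rbrakk> \<Longrightarrow> a \<oplus>\<^bsub>X\<^esub> b \<in> T"
    "\<lbrakk>c \<in> carrier R; a \<in> T\<rbrakk> \<Longrightarrow> c \<odot>\<^bsub>X\<^esub> a \<in> T" "a \<in> T \<Longrightarrow> \<ominus>\<^bsub>X\<^esub> a \<in> T"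
  using submodule_closed[OF X.grade_submodule[of "-1"]] by blast+

lemma fT: "a \<in> T \<Longrightarrow> f a \<in> carrier Y"
  using f_closed Y.grade_closed by blast

lemma f_zero: "f \<zero>\<^bsub>X\<^esub> = \<zero>\<^bsub>Y\<^esub>"
proof -
  have "f (\<zero>\<^bsub>R\<^esub> \<odot>\<^bsub>X\<^esub> \<zero>\<^bsub>X\<^esub>) = \<zero>\<^bsub>R\<^esub> \<odot>\<^bsub>Y\<^esub> f \<zero>\<^bsub>X\<^esub>" by (rule f_smult) (auto simp: T_sub)
  then show ?thesis using fT[OF T_sub(2)] by simp
qed

lemma f_inv: "a \<in> T \<Longrightarrow> f (\<ominus>\<^bsub>X\<^esub> a) = \<ominus>\<^bsub>Y\<^esub> f a"
  using f_smult[of "\<ominus>\<^bsub>R\<^esub> \<one>\<^bsub>R\<^esub>" a] T_sub(1)[of a] fT[of a] by (simp add: X.smult_l_minus Y.smult_l_minus)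

abbreviation "G \<equiv> middle_graph X Y f"

lemma G_grade: "G h k \<Longrightarrow> h \<in> grade X 0 \<and> k \<in> grade Y 0"
proof (induct rule: middle_graph.induct)
  case zero
  then show ?case using submodule_closed(2)[OF X.grade_submodule] submodule_closed(2)[OF Y.grade_submodule] by blast
next
  case (step h k a b)
  then show ?case
    using submodule_closed(3)[OF X.grade_submodule] submodule_closed(3)[OF Y.grade_submodule]
      X.bracket_grade_0(1) Y.bracket_grade_0(1) X.invol_grade_m1 Y.invol_grade_m1 f_closed by simp
qed

lemma G_closed: "G h k \<Longrightarrow> h \<in> carrier X" "G h k \<Longrightarrow> k \<in> carrier Y"
  using G_grade X.grade_closed Y.grade_closed by blast+

lemmas carr = G_closed X.bracket_closed Y.bracket_closed X.invol_closed Y.invol_closed T_sub(1) fT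

lemma G_gen: "\<lbrakk>a \<in> T; b \<in> T\<rbrakk> \<Longrightarrow> G (bracket X a (invol X b)) (bracket Y (f a) (invol Y (f b)))"
  using middle_graph.step[OF middle_graph.zero, of a X b Y f] carr by simp

lemma G_add: "\<lbrakk>G h' k'; G h k\<rbrakk> \<Longrightarrow> G (h \<oplus>\<^bsub>X\<^esub> h') (k \<oplus>\<^bsub>Y\<^esub> k')"
proof (induct rule: middle_graph.induct)
  case zero
  then show ?case using carr by simp
next
  case (step h' k' a b)
  then show ?case
    using middle_graph.step[OF step(2)[OF step(5)] step(3,4)] carr by (simp add: X.M.a_assoc Y.M.a_assoc)
qed

lemma G_smult: "\<lbrakk>G h k; c \<in> carrier R\<rbrakk> \<Longrightarrow> G (c \<odot>\<^bsub>X\<^esub> h) (c \<odot>\<^bsub>Y\<^esub> k)"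
proof (induct rule: middle_graph.induct)
  case zero
  then show ?case using middle_graph.zero[of X Y f] by simp
next
  case (step h k a b)
  then show ?case
    using middle_graph.step[OF step(2)[OF step(5)] T_sub(4)[OF step(5,3)] step(4)] carr
    by (simp add: X.smult_r_distr Y.smult_r_distr X.bracket_smult1 Y.bracket_smult1 f_smult)
qed

lemma G_invol: "G h k \<Longrightarrow> G (invol X h) (invol Y k)"
proof (induct rule: middle_graph.induct)
  case zero
  then show ?case using middle_graph.zero[of X Y f] by (simp add: X.invol_zero Y.invol_zero)
next
  case (step h k a b)
  have "invol X (bracket X a (invol X b)) = bracket X (\<ominus>\<^bsub>X\<^esub> b) (invol X a)"
    using step carr X.bracket_antisym[of "invol X a" b] by (simp add: X.invol_bracket X.invol_invol X.bracket_inv1)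
  moreover have "invol Y (bracket Y (f a) (invol Y (f b))) = bracket Y (f (\<ominus>\<^bsub>X\<^esub> b)) (invol Y (f a))"
    using step carr Y.bracket_antisym[of "invol Y (f a)" "f b"]
    by (simp add: Y.invol_bracket Y.invol_invol Y.bracket_inv1 f_inv)
  ultimately show ?case
    using middle_graph.step[OF step(2) T_sub(5)[OF step(4)] step(3)] step carr
    by (simp add: X.invol_add Y.invol_add)
qed

text \<open>Here the assumption that \<open>f\<close> preserves triple products enters: the two components of a pair in the
  middle graph act compatibly on the graph of \<open>f\<close>.\<close>

lemma G_T: "\<lbrakk>G h k; c \<in> T\<rbrakk> \<Longrightarrow> bracket X h c \<in> T" "\<lbrakk>G h k; c \<in> T\<rbrakk> \<Longrightarrow> f (bracket X h c) = bracket Y k (f c)"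
proof -
  show "bracket X h c \<in> T" if "G h k" "c \<in> T" using that G_grade X.bracket_grade_0(2) by blast
  show "f (bracket X h c) = bracket Y k (f c)" if "G h k" "c \<in> T"
    using that
  proof (induct rule: middle_graph.induct)
    case zero
    then show ?case using carr by (simp add: X.bracket_zero1 Y.bracket_zero1 f_zero)
  next
    case (step h k a b)
    have 1: "bracket X h c \<in> T" "bracket X (bracket X a (invol X b)) c \<in> T"
      using step G_grade X.bracket_grade_0 X.invol_grade_m1 by blast+
    then show ?case using step carr
      by (simp add: X.bracket_add1 Y.bracket_add1 f_add f_triple)
  qed
qed

lemma G_invol_T:
  assumes "G h k" "c \<in> T"
  shows "bracket X h (invol X c) = invol X (bracket X (invol X h) c)"
    "bracket Y k (invol Y (f c)) = invol Y (f (bracket X (invol X h) c))"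
  using assms carr G_T(2)[OF G_invol[OF assms(1)] assms(2)]
  by (simp_all add: X.invol_bracket X.invol_invol Y.invol_bracket Y.invol_invol)

text \<open>By the Leibniz rule a pair acts on a generator by moving its two entries within the graph of \<open>f\<close>.\<close>

lemma G_bracket: "\<lbrakk>G h' k'; G h k\<rbrakk> \<Longrightarrow> G (bracket X h h') (bracket Y k k')"
proof (induct rule: middle_graph.induct)
  case zero
  then show ?case using carr middle_graph.zero[of X Y f] by (simp add: X.bracket_zero2 Y.bracket_zero2)
next
  case (step h' k' a b)
  note hk = step(5)
  note G1 = G_T[OF hk step(3)] and G2 = G_invol_T[OF hk step(4)] and G3 = G_T(1)[OF G_invol[OF hk] step(4)]
  have "bracket X h (bracket X a (invol X b))
    = bracket X (bracket X h a) (invol X b) \<oplus>\<^bsub>X\<^esub> bracket X a (invol X (bracket X (invol X h) b))"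
    using X.leibniz[of h a "invol X b"] carr step hk G2 by simp
  moreover have "bracket Y k (bracket Y (f a) (invol Y (f b)))
    = bracket Y (f (bracket X h a)) (invol Y (f b)) \<oplus>\<^bsub>Y\<^esub> bracket Y (f a) (invol Y (f (bracket X (invol X h) b)))"
    using Y.leibniz[of k "f a" "invol Y (f b)"] carr step hk G1 G2 by simp
  moreover note G_add[OF G_add[OF G_gen[OF step(3) G3] G_gen[OF G1(1) step(4)]] step(2)[OF hk]]
  ultimately show ?case using carr step hk by (simp add: X.bracket_add2 Y.bracket_add2)
qed

lemma G_total: "h \<in> grade X 0 \<Longrightarrow> \<exists>k. G h k"
proof -
  assume "h \<in> grade X 0"
  then have h: "h \<in> lin_span R X {bracket X x y | x y. x \<in> T \<and> y \<in> grade X 1}"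
    by (rule X.zero_perfectD[OF perfect])
  have c: "{bracket X x y | x y. x \<in> T \<and> y \<in> grade X 1} \<subseteq> carrier X"
    using X.bracket_closed X.grade_closed by blast
  show ?thesis using X.module_axioms c h
  proof (induct rule: lin_span_induct)
    case (incl x)
    then obtain a b where ab: "x = bracket X a b" "a \<in> T" "b \<in> grade X 1" by blast
    then have "b = invol X (invol X b)" using X.invol_invol X.grade_closed by simp
    then show ?case using G_gen[OF ab(2) X.invol_grade_1[OF ab(3)]] ab(1) by auto
  next
    case zero
    show ?case using middle_graph.zero by blast
  next
    case (add x y)
    then show ?case using G_add by blast
  next
    case (smult a x)
    then show ?case using G_smult by blast
  qed
qed

text \<open>The whole subalgebra, given by its homogeneous components.\<close>

definition graph :: "'a \<Rightarrow> 'b \<Rightarrow> bool" where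
  "graph x y \<longleftrightarrow> (\<exists>a h k b. a \<in> T \<and> G h k \<and> b \<in> T \<and>
     x = a \<oplus>\<^bsub>X\<^esub> h \<oplus>\<^bsub>X\<^esub> invol X b \<and> y = f a \<oplus>\<^bsub>Y\<^esub> k \<oplus>\<^bsub>Y\<^esub> invol Y (f b))"

lemma graphE:
  assumes "graph x y"
  obtains a h k b where "a \<in> T" "G h k" "b \<in> T" "x = a \<oplus>\<^bsub>X\<^esub> h \<oplus>\<^bsub>X\<^esub> invol X b"
    "y = f a \<oplus>\<^bsub>Y\<^esub> k \<oplus>\<^bsub>Y\<^esub> invol Y (f b)"
  using assms unfolding graph_def by blast

lemma graph_closed: "graph x y \<Longrightarrow> x \<in> carrier X \<and> y \<in> carrier Y"
  by (erule graphE) (simp add: carr)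

lemma graph_m1: "a \<in> T \<Longrightarrow> graph a (f a)"
  unfolding graph_def
  by (rule exI[of _ a], rule exI[of _ "\<zero>\<^bsub>X\<^esub>"], rule exI[of _ "\<zero>\<^bsub>Y\<^esub>"], rule exI[of _ "\<zero>\<^bsub>X\<^esub>"])
     (simp add: T_sub middle_graph.zero f_zero X.invol_zero Y.invol_zero carr)

lemma graph_0: "G h k \<Longrightarrow> graph h k"
  unfolding graph_def
  by (rule exI[of _ "\<zero>\<^bsub>X\<^esub>"], rule exI[of _ h], rule exI[of _ k], rule exI[of _ "\<zero>\<^bsub>X\<^esub>"])
     (simp add: T_sub f_zero X.invol_zero Y.invol_zero carr)

lemma graph_1: "b \<in> T \<Longrightarrow> graph (invol X b) (invol Y (f b))"
  unfolding graph_def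
  by (rule exI[of _ "\<zero>\<^bsub>X\<^esub>"], rule exI[of _ "\<zero>\<^bsub>X\<^esub>"], rule exI[of _ "\<zero>\<^bsub>Y\<^esub>"], rule exI[of _ b])
     (simp add: T_sub middle_graph.zero f_zero carr)

lemma graph_add: "\<lbrakk>graph x y; graph x' y'\<rbrakk> \<Longrightarrow> graph (x \<oplus>\<^bsub>X\<^esub> x') (y \<oplus>\<^bsub>Y\<^esub> y')"
proof (elim graphE)
  fix a h k b a' h' k' b'
  assume *: "a \<in> T" "G h k" "b \<in> T" "x = a \<oplus>\<^bsub>X\<^esub> h \<oplus>\<^bsub>X\<^esub> invol X b" "y = f a \<oplus>\<^bsub>Y\<^esub> k \<oplus>\<^bsub>Y\<^esub> invol Y (f b)"
    "a' \<in> T" "G h' k'" "b' \<in> T" "x' = a' \<oplus>\<^bsub>X\<^esub> h' \<oplus>\<^bsub>X\<^esub> invol X b'" "y' = f a' \<oplus>\<^bsub>Y\<^esub> k' \<oplus>\<^bsub>Y\<^esub> invol Y (f b')"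
  show ?thesis
    unfolding graph_def
    by (rule exI[of _ "a \<oplus>\<^bsub>X\<^esub> a'"], rule exI[of _ "h \<oplus>\<^bsub>X\<^esub> h'"], rule exI[of _ "k \<oplus>\<^bsub>Y\<^esub> k'"], rule exI[of _ "b \<oplus>\<^bsub>X\<^esub> b'"])
       (use * in \<open>simp add: T_sub G_add f_add X.invol_add Y.invol_add carr X.M.a_ac Y.M.a_ac\<close>)
qed

lemma graph_smult: "\<lbrakk>c \<in> carrier R; graph x y\<rbrakk> \<Longrightarrow> graph (c \<odot>\<^bsub>X\<^esub> x) (c \<odot>\<^bsub>Y\<^esub> y)"
proof (elim graphE)
  fix a h k b
  assume *: "c \<in> carrier R" "a \<in> T" "G h k" "b \<in> T" "x = a \<oplus>\<^bsub>X\<^esub> h \<oplus>\<^bsub>X\<^esub> invol X b" "y = f a \<oplus>\<^bsub>Y\<^esub> k \<oplus>\<^bsub>Y\<^esub> invol Y (f b)"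
  show ?thesis
    unfolding graph_def
    by (rule exI[of _ "c \<odot>\<^bsub>X\<^esub> a"], rule exI[of _ "c \<odot>\<^bsub>X\<^esub> h"], rule exI[of _ "c \<odot>\<^bsub>Y\<^esub> k"], rule exI[of _ "c \<odot>\<^bsub>X\<^esub> b"])
       (use * in \<open>simp add: T_sub G_smult f_smult X.invol_smult Y.invol_smult carr X.smult_r_distr Y.smult_r_distr\<close>)
qed

lemma graph_inv: "graph x y \<Longrightarrow> graph (\<ominus>\<^bsub>X\<^esub> x) (\<ominus>\<^bsub>Y\<^esub> y)"
  using graph_smult[of "\<ominus>\<^bsub>R\<^esub> \<one>\<^bsub>R\<^esub>" x y] graph_closed[of x y] by (simp add: X.smult_l_minus Y.smult_l_minus)

lemma graph_invol: "graph x y \<Longrightarrow> graph (invol X x) (invol Y y)"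
proof (elim graphE)
  fix a h k b
  assume *: "a \<in> T" "G h k" "b \<in> T" "x = a \<oplus>\<^bsub>X\<^esub> h \<oplus>\<^bsub>X\<^esub> invol X b" "y = f a \<oplus>\<^bsub>Y\<^esub> k \<oplus>\<^bsub>Y\<^esub> invol Y (f b)"
  show ?thesis
    using graph_add[OF graph_add[OF graph_1[OF *(1)] graph_0[OF G_invol[OF *(2)]]] graph_m1[OF *(3)]] *
    by (simp add: X.invol_add Y.invol_add X.invol_invol Y.invol_invol carr)
qed

lemma graph_total: "x \<in> carrier X \<Longrightarrow> \<exists>y. graph x y"
proof -
  assume x: "x \<in> carrier X"
  obtain k where k: "G (X.part 0 x) k" using G_total X.part_in_grade[OF x] by blast
  have "graph (X.part 1 x) (invol Y (f (invol X (X.part 1 x))))"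
    using graph_1[OF X.invol_grade_1[OF X.part_in_grade[OF x]]] X.invol_invol X.part_closed[OF x] by simp
  from graph_add[OF graph_add[OF graph_m1[OF X.part_in_grade[OF x]] graph_0[OF k]] this]
  show ?thesis using X.part_sum[OF x] by auto
qed

lemma grade_2_zero: "x \<in> grade X (-2) \<Longrightarrow> x = \<zero>\<^bsub>X\<^esub>" "x \<in> grade X 2 \<Longrightarrow> x = \<zero>\<^bsub>X\<^esub>"
   "y \<in> grade Y (-2) \<Longrightarrow> y = \<zero>\<^bsub>Y\<^esub>" "y \<in> grade Y 2 \<Longrightarrow> y = \<zero>\<^bsub>Y\<^esub>"
  using X.three_graded[of 2] X.three_graded[of "-2"] Y.three_graded[of 2] Y.three_graded[of "-2"] by auto

lemma graph_zero: "graph \<zero>\<^bsub>X\<^esub> \<zero>\<^bsub>Y\<^esub>"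
  by (rule graph_0[OF middle_graph.zero])

lemma graph_bracket_gens:
  assumes a: "a \<in> T" and b: "b \<in> T" and h: "G h k" and h': "G h' k'"
  shows "graph (bracket X a b) (bracket Y (f a) (f b))"
    "graph (bracket X a h) (bracket Y (f a) k)"
    "graph (bracket X a (invol X b)) (bracket Y (f a) (invol Y (f b)))"
    "graph (bracket X h a) (bracket Y k (f a))"
    "graph (bracket X h h') (bracket Y k k')"
    "graph (bracket X h (invol X a)) (bracket Y k (invol Y (f a)))"
    "graph (bracket X (invol X a) b) (bracket Y (invol Y (f a)) (f b))"
    "graph (bracket X (invol X a) h) (bracket Y (invol Y (f a)) k)"
    "graph (bracket X (invol X a) (invol X b)) (bracket Y (invol Y (f a)) (invol Y (f b)))"
proof -
  have z: "bracket X a b = \<zero>\<^bsub>X\<^esub>" "bracket Y (f a) (f b) = \<zero>\<^bsub>Y\<^esub>"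
    using grade_2_zero X.bracket_grade[OF a b] Y.bracket_grade[OF f_closed[OF a] f_closed[OF b]] by auto
  show 1: "graph (bracket X a b) (bracket Y (f a) (f b))" using z graph_zero by simp
  have swap: "graph (bracket X u v) (bracket Y u' v')" if "graph (bracket X v u) (bracket Y v' u')"
     "u \<in> carrier X" "v \<in> carrier X" "u' \<in> carrier Y" "v' \<in> carrier Y" for u v u' v'
    using graph_inv[OF that(1)] X.bracket_antisym[of u v] Y.bracket_antisym[of u' v'] that by simp
  show 2: "graph (bracket X h a) (bracket Y k (f a))"
    using graph_m1[OF G_T(1)[OF h a]] G_T(2)[OF h a] by simp
  then show "graph (bracket X a h) (bracket Y (f a) k)" by (rule swap) (use a h carr in auto)
  show "graph (bracket X a (invol X b)) (bracket Y (f a) (invol Y (f b)))" by (rule graph_0[OF G_gen[OF a b]])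
  show "graph (bracket X (invol X a) b) (bracket Y (invol Y (f a)) (f b))"
    by (rule swap[OF graph_0[OF G_gen[OF b a]]]) (use a b carr in auto)
  show "graph (bracket X h h') (bracket Y k k')" by (rule graph_0[OF G_bracket[OF h' h]])
  show 3: "graph (bracket X h (invol X a)) (bracket Y k (invol Y (f a)))"
    using G_invol_T[OF h a] graph_1[OF G_T(1)[OF G_invol[OF h] a]] by simp
  show "graph (bracket X (invol X a) h) (bracket Y (invol Y (f a)) k)"
    by (rule swap[OF 3]) (use a h carr in auto)
  show "graph (bracket X (invol X a) (invol X b)) (bracket Y (invol Y (f a)) (invol Y (f b)))"
    using graph_invol[OF 1] a b carr by (simp add: X.invol_bracket Y.invol_bracket)
qed

lemma graph_bracket: "\<lbrakk>graph x y; graph x' y'\<rbrakk> \<Longrightarrow> graph (bracket X x x') (bracket Y y y')"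
proof (elim graphE)
  fix a h k b a' h' k' b'
  assume *: "a \<in> T" "G h k" "b \<in> T" "x = a \<oplus>\<^bsub>X\<^esub> h \<oplus>\<^bsub>X\<^esub> invol X b" "y = f a \<oplus>\<^bsub>Y\<^esub> k \<oplus>\<^bsub>Y\<^esub> invol Y (f b)"
    "a' \<in> T" "G h' k'" "b' \<in> T" "x' = a' \<oplus>\<^bsub>X\<^esub> h' \<oplus>\<^bsub>X\<^esub> invol X b'" "y' = f a' \<oplus>\<^bsub>Y\<^esub> k' \<oplus>\<^bsub>Y\<^esub> invol Y (f b')"
  have gen: "graph (bracket X u x') (bracket Y v y')" if "graph (bracket X u a') (bracket Y v (f a'))"
    "graph (bracket X u h') (bracket Y v k')" "graph (bracket X u (invol X b')) (bracket Y v (invol Y (f b')))"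
    "u \<in> carrier X" "v \<in> carrier Y" for u v
    using graph_add[OF graph_add[OF that(1,2)] that(3)] that(4,5) * carr
    by (simp add: X.bracket_add2 Y.bracket_add2)
  have 1: "graph (bracket X a x') (bracket Y (f a) y')"
    by (rule gen[OF graph_bracket_gens(1)[OF *(1) *(6) *(7) *(7)] graph_bracket_gens(2)[OF *(1) *(6) *(7) *(7)]
            graph_bracket_gens(3)[OF *(1) *(8) *(7) *(7)]
            T_sub(1)[OF *(1)] fT[OF *(1)]])
  have 2: "graph (bracket X h x') (bracket Y k y')"
    by (rule gen[OF graph_bracket_gens(4)[OF *(6) *(6) *(2) *(2)] graph_bracket_gens(5)[OF *(6) *(6) *(2) *(7)]
            graph_bracket_gens(6)[OF *(8) *(8) *(2) *(2)]
            G_closed(1)[OF *(2)] G_closed(2)[OF *(2)]])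
  have 3: "graph (bracket X (invol X b) x') (bracket Y (invol Y (f b)) y')"
    by (rule gen[OF graph_bracket_gens(7)[OF *(3) *(6) *(7) *(7)] graph_bracket_gens(8)[OF *(3) *(3) *(7) *(7)]
            graph_bracket_gens(9)[OF *(3) *(8) *(7) *(7)]
            X.invol_closed[OF T_sub(1)[OF *(3)]] Y.invol_closed[OF fT[OF *(3)]]])
  have "x' \<in> carrier X" "y' \<in> carrier Y" using * carr by auto
  then show ?thesis
    using graph_add[OF graph_add[OF 1 2] 3] * carr by (simp add: X.bracket_add1 Y.bracket_add1)
qed

lemma graph_over_zero: "graph \<zero>\<^bsub>X\<^esub> z \<Longrightarrow> G \<zero>\<^bsub>X\<^esub> z"
proof (elim graphE)
  fix a h k b
  assume *: "a \<in> T" "G h k" "b \<in> T" "\<zero>\<^bsub>X\<^esub> = a \<oplus>\<^bsub>X\<^esub> h \<oplus>\<^bsub>X\<^esub> invol X b" "z = f a \<oplus>\<^bsub>Y\<^esub> k \<oplus>\<^bsub>Y\<^esub> invol Y (f b)"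
  have p: "X.part i \<zero>\<^bsub>X\<^esub> = \<zero>\<^bsub>X\<^esub>" for i
    using linear_map_zero[OF X.module_axioms X.module_axioms X.part_linear] .
  have z: "a = \<zero>\<^bsub>X\<^esub>" "h = \<zero>\<^bsub>X\<^esub>" "invol X b = \<zero>\<^bsub>X\<^esub>"
    using X.part_triple[OF *(1) _ X.invol_grade_m1[OF *(3)], of h] G_grade[OF *(2)] p *(4) by auto
  have "b = \<zero>\<^bsub>X\<^esub>" using z(3) X.invol_invol[OF T_sub(1)[OF *(3)]] X.invol_zero by simp
  then show ?thesis using z *(2,5) carr by (simp add: f_zero Y.invol_zero)
qed

text \<open>A pair \<open>(0, z)\<close> in the middle graph acts on the second components of all generators as \<open>0\<close> acts on
  the first ones.\<close>

lemma graph_central: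
  assumes z: "graph \<zero>\<^bsub>X\<^esub> z" and xy: "graph x y"
  shows "bracket Y z y = \<zero>\<^bsub>Y\<^esub>"
proof -
  have Gz: "G \<zero>\<^bsub>X\<^esub> z" by (rule graph_over_zero[OF z])
  have zc: "z \<in> carrier Y" using Gz carr by blast
  have 1: "bracket Y z (f a) = \<zero>\<^bsub>Y\<^esub>" if "a \<in> T" for a
    using G_T(2)[OF Gz that] that carr by (simp add: X.bracket_zero1 f_zero)
  have 2: "bracket Y z (invol Y (f a)) = \<zero>\<^bsub>Y\<^esub>" if "a \<in> T" for a
    using G_invol_T(2)[OF Gz that] that carr by (simp add: X.bracket_zero1 f_zero X.invol_zero Y.invol_zero)
  have 3: "bracket Y z k = \<zero>\<^bsub>Y\<^esub>" if "G h k" for h k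
    using that
  proof (induct rule: middle_graph.induct)
    case zero
    show ?case using zc by (simp add: Y.bracket_zero2)
  next
    case (step h k a b)
    have "bracket Y z (bracket Y (f a) (invol Y (f b))) = \<zero>\<^bsub>Y\<^esub>"
      using Y.leibniz[of z "f a" "invol Y (f b)"] step 1 2 carr zc by (simp add: Y.bracket_zero1 Y.bracket_zero2)
    then show ?case using step carr zc by (simp add: Y.bracket_add2)
  qed
  show ?thesis
    using xy
  proof (rule graphE)
    fix a h k b
    assume *: "a \<in> T" "G h k" "b \<in> T" "y = f a \<oplus>\<^bsub>Y\<^esub> k \<oplus>\<^bsub>Y\<^esub> invol Y (f b)"
    then show ?thesis using 1 2 3 carr zc by (simp add: Y.bracket_add2)
  qed
qed

text \<open>Every pair \<open>(h, k)\<close> of the middle graph comes from an element \<open>c\<close> of degree \<open>0\<close> in the exterior square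
  of \<open>X\<close> with boundary \<open>-h\<close> and \<open>\<Phi> c = k\<close>. For \<open>h = 0\<close> this \<open>c\<close> is a cycle, hence a boundary, and
  \<open>\<Phi>\<close> kills it.\<close>

lemma G_over_zero: "G \<zero>\<^bsub>X\<^esub> z \<Longrightarrow> z = \<zero>\<^bsub>Y\<^esub>"
proof -
  assume z: "G \<zero>\<^bsub>X\<^esub> z"
  let ?E2 = "ext_power R X 2" and ?E1 = "ext_power R X (Suc 0)" and ?d1 = "ext_delta R X (Suc 0)"
  interpret E1: module R ?E1 by (rule X.ext_power_module)
  interpret E2: module R ?E2 by (rule X.ext_power_module)
  note d1 = X.ext_delta_1[unfolded One_nat_def]
  obtain \<Phi> where \<Phi>: "linear_map R ?E2 Y \<Phi>"
    "\<And>x y x' y'. \<lbrakk>graph x y; graph x' y'\<rbrakk> \<Longrightarrow> \<Phi> (wedge R X [x, x']) = bracket Y y y'"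
    "\<And>w. w \<in> carrier (ext_power R X 3) \<Longrightarrow> \<Phi> (ext_delta R X 2 w) = \<zero>\<^bsub>Y\<^esub>"
    by (rule central_relation_cocycle[OF X.lie_algebra_axioms Y.lie_algebra_axioms, of graph])
       (assumption | rule graph_closed graph_total graph_add graph_smult graph_bracket graph_central | blast)+
  note sub = submodule_closed[OF X.ext_grade_submodule]
  have "\<exists>c\<in>ext_grade R X 2 0. ?d1 c = \<ominus>\<^bsub>?E1\<^esub> wedge R X [h] \<and> \<Phi> c = k" if "G h k" for h k
    using that
  proof (induct rule: middle_graph.induct)
    case zero
    show ?case
      by (rule bexI[OF _ sub(2)])
         (simp add: linear_map_zero[OF E2.module_axioms E1.module_axioms d1(1)]
          linear_map_zero[OF E2.module_axioms Y.module_axioms \<Phi>(1)]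
          linear_map_zero[OF X.module_axioms E1.module_axioms X.wedge1_linear])
  next
    case (step h k a b)
    then obtain c where c: "c \<in> ext_grade R X 2 0" "?d1 c = \<ominus>\<^bsub>?E1\<^esub> wedge R X [h]" "\<Phi> c = k" by blast
    let ?w = "wedge R X [a, invol X b]"
    have w: "?w \<in> ext_grade R X 2 0"
      by (rule X.wedge2_in_ext_grade[OF step(3) X.invol_grade_m1[OF step(4)]]) simp
    have cc: "c \<in> carrier ?E2" "?w \<in> carrier ?E2" using c w sub(1) by blast+
    have dw: "?d1 ?w = \<ominus>\<^bsub>?E1\<^esub> wedge R X [bracket X a (invol X b)]"
      by (rule d1(2)) (use step carr in auto)
    have wc: "wedge R X [u] \<in> carrier ?E1" if "u \<in> carrier X" for u
      by (rule linear_map_closed[OF X.wedge1_linear that])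
    show ?case
    proof (rule bexI[OF _ sub(3)[OF c(1) w]], rule conjI)
      show "?d1 (c \<oplus>\<^bsub>?E2\<^esub> ?w) = \<ominus>\<^bsub>?E1\<^esub> wedge R X [h \<oplus>\<^bsub>X\<^esub> bracket X a (invol X b)]"
        using step carr wc cc c(2) dw
        by (simp add: linear_map_add[OF d1(1)] linear_map_add[OF X.wedge1_linear] E1.minus_add)
      show "\<Phi> (c \<oplus>\<^bsub>?E2\<^esub> ?w) = k \<oplus>\<^bsub>Y\<^esub> bracket Y (f a) (invol Y (f b))"
        using step \<Phi>(2)[OF graph_m1[OF step(3)] graph_1[OF step(4)]] cc c(3)
        by (simp add: linear_map_add[OF \<Phi>(1)])
    qed
  qed
  from this[OF z] obtain c where c: "c \<in> ext_grade R X 2 0" "?d1 c = \<zero>\<^bsub>?E1\<^esub>" "\<Phi> c = z"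
    by (auto simp: linear_map_zero[OF X.module_axioms E1.module_axioms X.wedge1_linear])
  obtain w where "w \<in> ext_grade R X 3 0" "c = ext_delta R X 2 w"
    using H2 c(1,2) unfolding X.zero_module_H2_iff by blast
  then show ?thesis using \<Phi>(3) sub(1) c(3) by blast
qed

lemma graph_functional: "\<lbrakk>graph x y; graph x y'\<rbrakk> \<Longrightarrow> y = y'"
proof -
  assume "graph x y" "graph x y'"
  then have "graph (x \<oplus>\<^bsub>X\<^esub> \<ominus>\<^bsub>X\<^esub> x) (y \<oplus>\<^bsub>Y\<^esub> \<ominus>\<^bsub>Y\<^esub> y')" and c: "x \<in> carrier X" "y \<in> carrier Y" "y' \<in> carrier Y"
    using graph_add graph_inv graph_closed by blast+
  then have "y \<oplus>\<^bsub>Y\<^esub> \<ominus>\<^bsub>Y\<^esub> y' = \<zero>\<^bsub>Y\<^esub>"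
    using G_over_zero[OF graph_over_zero] by (simp add: X.M.r_neg)
  then show ?thesis using c by (metis Y.M.minus_eq Y.M.minus_zero_iff)
qed

theorem jts_hom_extends: "\<exists>g\<in>graded_involutary_hom R X Y. restrict g T = f"
proof
  define g where "g = (\<lambda>x\<in>carrier X. THE y. graph x y)"
  have g: "g x = y" if "graph x y" for x y
  proof -
    have "(THE y. graph x y) = y" by (rule the_equality, rule that, erule graph_functional, rule that)
    then show ?thesis using graph_closed[OF that] by (simp add: g_def)
  qed
  have gg: "graph x (g x)" if "x \<in> carrier X" for x using graph_total[OF that] g by metis
  have "f \<in> extensional T" using f_hom by (simp add: jts_hom_def linear_hom_def)
  then show "restrict g T = f"
    by (intro extensionalityI[OF restrict_extensional]) (auto simp: g[OF graph_m1])
  have "lie_hom R X Y g"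
    unfolding lie_hom_def
  proof (intro conjI linear_mapI ballI)
    fix x assume x: "x \<in> carrier X"
    show "g x \<in> carrier Y" using gg[OF x] graph_closed by blast
    show "g (a \<odot>\<^bsub>X\<^esub> x) = a \<odot>\<^bsub>Y\<^esub> g x" if "a \<in> carrier R" for a by (rule g[OF graph_smult[OF that gg[OF x]]])
    fix y assume y: "y \<in> carrier X"
    show "g (x \<oplus>\<^bsub>X\<^esub> y) = g x \<oplus>\<^bsub>Y\<^esub> g y" by (rule g[OF graph_add[OF gg[OF x] gg[OF y]]])
    show "g (bracket X x y) = bracket Y (g x) (g y)" by (rule g[OF graph_bracket[OF gg[OF x] gg[OF y]]])
  qed
  moreover have "g ` grade X i \<subseteq> grade Y i" for i
  proof
    fix y assume "y \<in> g ` grade X i"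
    then obtain x where x: "x \<in> grade X i" "y = g x" by blast
    show "y \<in> grade Y i" using X.degree_cases[OF x(1)]
    proof cases
      case 1
      then show ?thesis using x g[OF graph_m1] f_closed by simp
    next
      case 2
      then obtain k where "G x k" using x G_total by blast
      then show ?thesis using 2 x g[OF graph_0] G_grade by simp
    next
      case 3
      then have "invol X x \<in> T" using x X.invol_grade_1 by blast
      then show ?thesis using 3 x g[OF graph_1, of "invol X x"] Y.invol_grade_m1 f_closed
        by (simp add: X.invol_invol[OF X.grade_closed[OF x(1)]])
    next
      case 4
      then show ?thesis using x g[OF graph_zero] submodule_closed(2)[OF Y.grade_submodule] by simp
    qed
  qed
  moreover have "g (invol X x) = invol Y (g x)" if "x \<in> carrier X" for x
    by (rule g[OF graph_invol[OF gg[OF that]]])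
  ultimately show "g \<in> graded_involutary_hom R X Y"
    unfolding graded_involutary_hom_def g_def by auto
qed

end

section \<open>A criterion for vanishing homology\<close>

text \<open>The hypothesis says that \<open>L\<^sub>0\<close> is universal for the bilinear maps on \<open>L\<^sub>-\<^sub>1 \<times> L\<^sub>1\<close> that satisfy the
  displayed relation. Let \<open>Q\<close> be the exterior square modulo the boundaries of degree \<open>0\<close>. The boundary
  of \<open>h \<and> a \<and> b\<close> gives the identity \<open>act\<close>: in \<open>Q\<close>, the class of \<open>h \<and> [a, b]\<close> is that of
  \<open>[h, a] \<and> b + a \<and> [h, b]\<close>. Since the wedge is skew-symmetric, the relation holds for
  \<open>(a, b) \<mapsto> a \<and> b\<close> in \<open>Q\<close>. So there is a map \<open>\<psi>\<close> that recovers the class of an element of degree \<open>0\<close>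
  from its boundary, and cycles have class \<open>0\<close>.\<close>

lemma (in three_graded_lie_algebra) H2_zero_criterion:
  assumes perfect: "zero_perfect R L"
    and factor: "\<And>(N :: ('k, ('a list \<Rightarrow> 'k) set set) module) \<phi>.
      \<lbrakk>module R N; bilinear_map R (L\<lparr>carrier := grade L (-1)\<rparr>) (L\<lparr>carrier := grade L 1\<rparr>) N \<phi>;
       \<And>a b c d. \<lbrakk>a \<in> grade L (-1); b \<in> grade L 1; c \<in> grade L (-1); d \<in> grade L 1\<rbrakk> \<Longrightarrow>
         \<phi> (bracket L (bracket L a b) c) d \<oplus>\<^bsub>N\<^esub> \<phi> c (bracket L (bracket L a b) d)
         \<oplus>\<^bsub>N\<^esub> (\<phi> (bracket L (bracket L c d) a) b \<oplus>\<^bsub>N\<^esub> \<phi> a (bracket L (bracket L c d) b)) = \<zero>\<^bsub>N\<^esub>\<rbrakk>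
      \<Longrightarrow> \<exists>\<psi>. linear_map R L N \<psi> \<and>
        (\<forall>a\<in>grade L (-1). \<forall>b\<in>grade L 1. \<psi> (bracket L a b) = \<phi> a b)"
  shows "zero_module (H2_gr_homology R L)"
  unfolding zero_module_H2_iff
proof (intro ballI impI)
  let ?E1 = "ext_power R L (Suc 0)" and ?E2 = "ext_power R L 2" and ?E3 = "ext_power R L 3"
  let ?d1 = "ext_delta R L (Suc 0)" and ?d2 = "ext_delta R L 2" and ?B = "ext_delta R L 2 ` ext_grade R L 3 0"
  interpret E1: module R ?E1 by (rule ext_power_module)
  interpret E2: module R ?E2 by (rule ext_power_module)
  note d1 = ext_delta_1[unfolded One_nat_def] and d2 = ext_delta_2
  have B: "submodule ?B R ?E2"
    by (rule linear_map_image_submodule[OF ext_power_module E2.module_axioms d2(1) ext_grade_submodule])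
  let ?Q = "quot_module ?E2 ?B"
  define q where "q x = ?B +>\<^bsub>?E2\<^esub> x" for x
  have Q: "module R ?Q" and q: "linear_map R ?E2 ?Q q"
    using quot_module_module[OF E2.module_axioms B] by (simp_all add: q_def[abs_def])
  interpret Q: module R ?Q by (rule Q)
  have q0: "q x = \<zero>\<^bsub>?Q\<^esub> \<longleftrightarrow> x \<in> ?B" if "x \<in> carrier ?E2" for x
    using coset_eq_self_iff[OF E2.module_axioms B that] by (simp add: q_def quot_module_simps)
  define \<phi> where "\<phi> x y = q (wedge R L [x, y])" for x y
  note w = bilinear_mapD[OF wedge2_bilinear]
  have \<phi>1: "linear_map R L ?Q (\<lambda>x. \<phi> x y)" and \<phi>2: "linear_map R L ?Q (\<lambda>x. \<phi> y x)" if "y \<in> carrier L" for y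
    unfolding \<phi>_def using linear_map_comp[OF w(1)[OF that] q] linear_map_comp[OF w(2)[OF that] q] by auto
  have \<phi>c: "\<phi> x y \<in> carrier ?Q" if "x \<in> carrier L" "y \<in> carrier L" for x y
    using linear_map_closed[OF \<phi>1] that by blast
  have \<phi>anti: "\<phi> x y = \<ominus>\<^bsub>?Q\<^esub> \<phi> y x" if "x \<in> carrier L" "y \<in> carrier L" for x y
    unfolding \<phi>_def using wedge2_antisym[OF that] linear_map_inv[OF E2.module_axioms Q q] wedge2_closed that by simp
  have act: "\<phi> h (bracket L a b) = \<phi> (bracket L h a) b \<oplus>\<^bsub>?Q\<^esub> \<phi> a (bracket L h b)"
    if h: "h \<in> grade L 0" and a: "a \<in> grade L (-1)" and b: "b \<in> grade L 1" for h a b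
  proof -
    have c: "h \<in> carrier L" "a \<in> carrier L" "b \<in> carrier L" using that grade_closed by auto
    have bc: "bracket L x y \<in> carrier L" if "x \<in> carrier L" "y \<in> carrier L" for x y
      using bracket_closed that by blast
    have "wedge R L [h, a, b] \<in> ext_grade R L 3 0"
      by (rule wedge3_in_ext_grade[OF h a b]) simp
    then have "?d2 (wedge R L [h, a, b]) \<in> ?B" by blast
    moreover from this have "?d2 (wedge R L [h, a, b]) \<in> carrier ?E2" using submodule_closed(1)[OF B] by blast
    ultimately have "q (?d2 (wedge R L [h, a, b])) = \<zero>\<^bsub>?Q\<^esub>" using q0 by simp
    then have "\<ominus>\<^bsub>?Q\<^esub> \<phi> (bracket L h a) b \<oplus>\<^bsub>?Q\<^esub> \<phi> (bracket L h b) a \<ominus>\<^bsub>?Q\<^esub> \<phi> (bracket L a b) h = \<zero>\<^bsub>?Q\<^esub>"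
      unfolding \<phi>_def using c bc
      by (simp add: d2(2) linear_map_add[OF q] linear_map_minus[OF E2.module_axioms Q q]
          linear_map_inv[OF E2.module_axioms Q q] wedge2_closed)
    then have "\<ominus>\<^bsub>?Q\<^esub> \<phi> (bracket L h a) b \<oplus>\<^bsub>?Q\<^esub> \<phi> (bracket L h b) a = \<phi> (bracket L a b) h"
      using c bc \<phi>c by (simp add: Q.minus_zero_iff)
    moreover have "\<phi> (bracket L h b) a = \<ominus>\<^bsub>?Q\<^esub> \<phi> a (bracket L h b)"
      "\<phi> (bracket L a b) h = \<ominus>\<^bsub>?Q\<^esub> \<phi> h (bracket L a b)"
      using \<phi>anti c bc by blast+
    ultimately have "\<ominus>\<^bsub>?Q\<^esub> (\<phi> (bracket L h a) b \<oplus>\<^bsub>?Q\<^esub> \<phi> a (bracket L h b)) = \<ominus>\<^bsub>?Q\<^esub> \<phi> h (bracket L a b)"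
      using c bc \<phi>c by (simp add: Q.minus_add)
    then have "\<ominus>\<^bsub>?Q\<^esub> (\<ominus>\<^bsub>?Q\<^esub> (\<phi> (bracket L h a) b \<oplus>\<^bsub>?Q\<^esub> \<phi> a (bracket L h b))) = \<ominus>\<^bsub>?Q\<^esub> (\<ominus>\<^bsub>?Q\<^esub> \<phi> h (bracket L a b))"
      by simp
    then show ?thesis using c bc \<phi>c by simp
  qed
  have "\<exists>\<psi>. linear_map R L ?Q \<psi> \<and> (\<forall>a\<in>grade L (-1). \<forall>b\<in>grade L 1. \<psi> (bracket L a b) = \<phi> a b)"
  proof (rule factor[OF Q])
    show "bilinear_map R (L\<lparr>carrier := grade L (-1)\<rparr>) (L\<lparr>carrier := grade L 1\<rparr>) ?Q \<phi>"
      unfolding bilinear_map_def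
      using linear_map_on_submodule[OF grade_submodule \<phi>1] linear_map_on_submodule[OF grade_submodule \<phi>2]
      by (simp add: grade_closed)
    fix a b c d
    assume m: "a \<in> grade L (-1)" "b \<in> grade L 1" "c \<in> grade L (-1)" "d \<in> grade L 1"
    have D: "bracket L a b \<in> grade L 0" "bracket L c d \<in> grade L 0"
      using bracket_grade[OF m(1,2)] bracket_grade[OF m(3,4)] by auto
    have Dc: "bracket L a b \<in> carrier L" "bracket L c d \<in> carrier L" using D grade_closed by auto
    show "\<phi> (bracket L (bracket L a b) c) d \<oplus>\<^bsub>?Q\<^esub> \<phi> c (bracket L (bracket L a b) d)
         \<oplus>\<^bsub>?Q\<^esub> (\<phi> (bracket L (bracket L c d) a) b \<oplus>\<^bsub>?Q\<^esub> \<phi> a (bracket L (bracket L c d) b)) = \<zero>\<^bsub>?Q\<^esub>"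
      unfolding act[OF D(1) m(3,4), symmetric] act[OF D(2) m(1,2), symmetric] \<phi>anti[OF Dc]
      by (rule Q.l_neg[OF \<phi>c[OF Dc(2,1)]])
  qed
  then obtain \<psi> where \<psi>: "linear_map R L ?Q \<psi>"
    "\<And>a b. \<lbrakk>a \<in> grade L (-1); b \<in> grade L 1\<rbrakk> \<Longrightarrow> \<psi> (bracket L a b) = \<phi> a b" by blast
  note \<psi>_simps = linear_map_add[OF \<psi>(1)] linear_map_inv[OF module_axioms Q \<psi>(1)]
    linear_map_zero[OF module_axioms Q \<psi>(1)]
  have \<psi>00: "\<phi> x y = \<psi> (bracket L x y)" if x: "x \<in> grade L 0" and y: "y \<in> grade L 0" for x y
  proof (rule linear_map_eq_on_span[OF module_axioms Q \<phi>2 linear_map_comp[OF bracket_linear2 \<psi>(1)] _ _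
        zero_perfectD[OF perfect y]])
    fix z assume "z \<in> {bracket L x y |x y. x \<in> grade L (- 1) \<and> y \<in> grade L 1}"
    then obtain a b where z: "z = bracket L a b" "a \<in> grade L (-1)" "b \<in> grade L 1" by blast
    have c: "x \<in> carrier L" "a \<in> carrier L" "b \<in> carrier L" using x z grade_closed by auto
    have g: "bracket L x a \<in> grade L (-1)" "bracket L x b \<in> grade L 1"
      using bracket_grade[OF x z(2)] bracket_grade[OF x z(3)] by auto
    have "\<psi> (bracket L x (bracket L a b)) = \<psi> (bracket L (bracket L x a) b) \<oplus>\<^bsub>?Q\<^esub> \<psi> (bracket L a (bracket L x b))"
      using leibniz[OF c] c g grade_closed bracket_closed by (simp add: \<psi>_simps)
    then show "\<phi> x z = \<psi> (bracket L x z)" unfolding z(1) using act[OF x z(2,3)] \<psi>(2) g z by simp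
  qed (use x y grade_closed bracket_closed in auto)
  have \<psi>w: "q (wedge R L [x, y]) = \<psi> (bracket L x y)" if x: "x \<in> grade L i" and y: "y \<in> grade L j" and ij: "i + j = 0" for x y i j
  proof -
    have c: "x \<in> carrier L" "y \<in> carrier L" using that grade_closed by auto
    show ?thesis
      using degree_cases[OF x]
    proof cases
      case 1
      then show ?thesis using \<psi>(2) x y ij by (simp add: \<phi>_def)
    next
      case 2
      then show ?thesis using \<psi>00 x y ij by (simp add: \<phi>_def)
    next
      case 3
      then have "j = -1" using ij by simp
      then have "\<psi> (bracket L y x) = \<phi> y x" using \<psi>(2) 3 x y by simp
      then show ?thesis using \<phi>anti[OF c] bracket_antisym[OF c] bracket_closed c by (simp add: \<phi>_def \<psi>_simps)
    next
      case 4
      then show ?thesis using c linear_map_zero[OF module_axioms E2.module_axioms w(1)]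
          linear_map_zero[OF E2.module_axioms Q q] by (simp add: bracket_zero1 \<psi>_simps)
    qed
  qed
  obtain e where e: "linear_map R ?E1 L e" "\<And>x. x \<in> carrier L \<Longrightarrow> e (wedge R L [x]) = x"
    using ext_power_1_inverse by blast
  have eneg: "e (\<ominus>\<^bsub>?E1\<^esub> wedge R L [x]) = \<ominus>\<^bsub>L\<^esub> x" if "x \<in> carrier L" for x
    using linear_map_inv[OF E1.module_axioms module_axioms e(1)] linear_map_closed[OF wedge1_linear] e(2) that by simp
  have lin: "linear_map R ?E2 ?Q (\<lambda>c. q c \<oplus>\<^bsub>?Q\<^esub> \<psi> (e (?d1 c)))"
    by (rule linear_map_plus[OF E2.module_axioms Q q
        linear_map_comp[OF linear_map_comp[OF d1(1) e(1)] \<psi>(1)]])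
  have z: "submodule {\<zero>\<^bsub>?Q\<^esub>} R ?Q" by (rule Q.submoduleI2) auto
  fix c assume c: "c \<in> ext_grade R L 2 0" and dc: "?d1 c = \<zero>\<^bsub>?E1\<^esub>"
  have "q c \<oplus>\<^bsub>?Q\<^esub> \<psi> (e (?d1 c)) \<in> {\<zero>\<^bsub>?Q\<^esub>}"
  proof (rule ext_grade_2_span_subset[OF Q lin z _ c])
    fix x y i j assume xy: "x \<in> grade L i" "y \<in> grade L j" "i + j = (0::int)"
    have "x \<in> carrier L" "y \<in> carrier L" using xy grade_closed by auto
    then show "q (wedge R L [x, y]) \<oplus>\<^bsub>?Q\<^esub> \<psi> (e (?d1 (wedge R L [x, y]))) \<in> {\<zero>\<^bsub>?Q\<^esub>}"
      using \<psi>w[OF xy] bracket_closed linear_map_closed[OF \<psi>(1)] by (simp add: d1(2) eneg \<psi>_simps Q.r_neg)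
  qed
  then have "q c = \<zero>\<^bsub>?Q\<^esub>"
    using c submodule_closed(1)[OF ext_grade_submodule, of 2 0] linear_map_closed[OF q]
    by (auto simp: dc \<psi>_simps linear_map_zero[OF E1.module_axioms module_axioms e(1)] subset_iff)
  then show "c \<in> ?B" using q0 c submodule_closed(1)[OF ext_grade_submodule, of 2 0] by blast
qed

section \<open>The middle component of the universal Lie algebra\<close>

context jordan_triple_system
begin

text \<open>The first four families make \<open>(a, b)\<close> bilinear. If \<open>(a, b)\<close> is to become the bracket of \<open>a\<close> in degree
  \<open>-1\<close> with \<open>b\<close> in degree \<open>1\<close>, it must act on the generators as the derivation
  \<open>(c, d) \<mapsto> ({a, b, c}, d) - (c, {b, a, d})\<close>. The last family makes this bracket of generators
  skew-symmetric.\<close>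

definition middle_rels :: "('a \<times> 'a \<Rightarrow> 'k) set" where
  "middle_rels = (let F = free_module R (carrier T \<times> carrier T); v = (\<lambda>a b. basis_vec R (a, b)) in
     {v (a \<oplus>\<^bsub>T\<^esub> a') b \<ominus>\<^bsub>F\<^esub> (v a b \<oplus>\<^bsub>F\<^esub> v a' b) | a a' b. a \<in> carrier T \<and> a' \<in> carrier T \<and> b \<in> carrier T} \<union>
     {v a (b \<oplus>\<^bsub>T\<^esub> b') \<ominus>\<^bsub>F\<^esub> (v a b \<oplus>\<^bsub>F\<^esub> v a b') | a b b'. a \<in> carrier T \<and> b \<in> carrier T \<and> b' \<in> carrier T} \<union>
     {v (r \<odot>\<^bsub>T\<^esub> a) b \<ominus>\<^bsub>F\<^esub> (r \<odot>\<^bsub>F\<^esub> v a b) | r a b. r \<in> carrier R \<and> a \<in> carrier T \<and> b \<in> carrier T} \<union>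
     {v a (r \<odot>\<^bsub>T\<^esub> b) \<ominus>\<^bsub>F\<^esub> (r \<odot>\<^bsub>F\<^esub> v a b) | r a b. r \<in> carrier R \<and> a \<in> carrier T \<and> b \<in> carrier T} \<union>
     {(v (triple T a b c) d \<ominus>\<^bsub>F\<^esub> v c (triple T b a d)) \<oplus>\<^bsub>F\<^esub> (v (triple T c d a) b \<ominus>\<^bsub>F\<^esub> v a (triple T d c b))
       | a b c d. a \<in> carrier T \<and> b \<in> carrier T \<and> c \<in> carrier T \<and> d \<in> carrier T})"

definition middle :: "('k, ('a \<times> 'a \<Rightarrow> 'k) set) module" where
  "middle = presented_module R (carrier T \<times> carrier T) middle_rels"

definition tens :: "'a \<Rightarrow> 'a \<Rightarrow> ('a \<times> 'a \<Rightarrow> 'k) set" where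
  "tens a b = presented_gen R (carrier T \<times> carrier T) middle_rels (a, b)"

lemma triple_closed:
  "\<lbrakk>a \<in> carrier T; b \<in> carrier T; c \<in> carrier T\<rbrakk> \<Longrightarrow> triple T a b c \<in> carrier T"
  using linear_map_closed[OF triple_linear1] by blast

lemma middle_rels_closed: "middle_rels \<subseteq> carrier (free_module R (carrier T \<times> carrier T))"
proof -
  interpret F: module R "free_module R (carrier T \<times> carrier T)"
    by (rule free_module_module[OF R.is_cring])
  note b = basis_vec_in_free_module[OF R.is_cring, of _ "carrier T \<times> carrier T"]
  show ?thesis
    unfolding middle_rels_def Let_def
    by (auto intro!: F.minus_closed F.a_closed F.smult_closed b triple_closed)
qed

lemma middle_module: "module R middle"
  unfolding middle_def by (rule presented_module_module[OF R.is_cring middle_rels_closed])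

sublocale U: module R middle
  by (rule middle_module)

lemma tens_closed: "\<lbrakk>a \<in> carrier T; b \<in> carrier T\<rbrakk> \<Longrightarrow> tens a b \<in> carrier middle"
  unfolding tens_def middle_def
  by (rule presented_gen_closed[OF R.is_cring middle_rels_closed]) simp

lemma middle_universal:
  assumes "module R N" and bil: "bilinear_map R T T N \<phi>"
    and rel: "\<And>a b c d. \<lbrakk>a \<in> carrier T; b \<in> carrier T; c \<in> carrier T; d \<in> carrier T\<rbrakk> \<Longrightarrow>
      (\<phi> (triple T a b c) d \<ominus>\<^bsub>N\<^esub> \<phi> c (triple T b a d))
        \<oplus>\<^bsub>N\<^esub> (\<phi> (triple T c d a) b \<ominus>\<^bsub>N\<^esub> \<phi> a (triple T d c b)) = \<zero>\<^bsub>N\<^esub>"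
  shows "\<exists>h. linear_map R middle N h \<and> (\<forall>a\<in>carrier T. \<forall>b\<in>carrier T. h (tens a b) = \<phi> a b)"
proof -
  interpret N: module R N by fact
  let ?F = "free_module R (carrier T \<times> carrier T)"
  interpret F: module R ?F by (rule free_module_module[OF R.is_cring])
  note b = basis_vec_in_free_module[OF R.is_cring, of _ "carrier T \<times> carrier T"]
  note bl = bilinear_mapD[OF bil]
  have c: "\<phi> a b \<in> carrier N" if "a \<in> carrier T" "b \<in> carrier T" for a b
    using linear_map_closed[OF bl(1)] that by blast
  obtain h where h: "linear_map R middle N h"
    "\<And>p. p \<in> carrier T \<times> carrier T \<Longrightarrow>
       h (presented_gen R (carrier T \<times> carrier T) middle_rels p) = \<phi> (fst p) (snd p)"
    unfolding middle_def
  proof (rule presented_module_universal[OF R.is_cring middle_rels_closed assms(1), of "\<lambda>p. \<phi> (fst p) (snd p)"])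
    show "(\<lambda>p. \<phi> (fst p) (snd p)) \<in> carrier T \<times> carrier T \<rightarrow> carrier N" using c by auto
    fix h s
    assume h: "linear_map R ?F N h"
      and hb: "\<And>p. p \<in> carrier T \<times> carrier T \<Longrightarrow> h (basis_vec R p) = \<phi> (fst p) (snd p)"
      and s: "s \<in> middle_rels"
    note hs = linear_map_minus[OF F.module_axioms N.module_axioms h] linear_map_add[OF h]
      linear_map_smult[OF h] hb b c triple_closed
    from s show "h s = \<zero>\<^bsub>N\<^esub>"
      unfolding middle_rels_def Let_def
      by (auto simp: hs rel N.minus_zero_iff linear_map_add[OF bl(1)] linear_map_add[OF bl(2)]
          linear_map_smult[OF bl(1)] linear_map_smult[OF bl(2)])
  qed blast
  then show ?thesis by (intro exI[of _ h]) (auto simp: tens_def)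
qed

lemma middle_eqI:
  assumes "module R N" "linear_map R middle N f" "linear_map R middle N g"
    and "\<And>a b. \<lbrakk>a \<in> carrier T; b \<in> carrier T\<rbrakk> \<Longrightarrow> f (tens a b) = g (tens a b)"
    and "u \<in> carrier middle"
  shows "f u = g u"
proof (rule linear_map_eq_on_span[OF middle_module assms(1-3)])
  let ?S = "presented_gen R (carrier T \<times> carrier T) middle_rels ` (carrier T \<times> carrier T)"
  show "u \<in> lin_span R middle ?S"
    using presented_module_span[OF R.is_cring middle_rels_closed] assms(5) by (auto simp: middle_def)
  show "?S \<subseteq> carrier middle" using tens_closed by (auto simp: tens_def)
qed (use assms(4) in \<open>auto simp: tens_def\<close>)

lemma
  shows tens_bilinear: "bilinear_map R T T middle tens"
    and tens_rel: "\<And>a b c d. \<lbrakk>a \<in> carrier T; b \<in> carrier T; c \<in> carrier T; d \<in> carrier T\<rbrakk> \<Longrightarrow>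
      (tens (triple T a b c) d \<ominus>\<^bsub>middle\<^esub> tens c (triple T b a d))
        \<oplus>\<^bsub>middle\<^esub> (tens (triple T c d a) b \<ominus>\<^bsub>middle\<^esub> tens a (triple T d c b)) = \<zero>\<^bsub>middle\<^esub>"
proof -
  let ?B = "carrier T \<times> carrier T"
  let ?F = "free_module R ?B"
  interpret F: module R ?F by (rule free_module_module[OF R.is_cring])
  note b = basis_vec_in_free_module[OF R.is_cring, of _ ?B]
  note p = presented_proj_linear[OF R.is_cring middle_rels_closed, folded middle_def]
  define h where "h x = lin_span R ?F middle_rels +>\<^bsub>?F\<^esub> x" for x
  have h: "linear_map R ?F middle h" unfolding h_def by (rule p)
  have ht: "h (basis_vec R (a, b)) = tens a b" for a b
    by (simp add: h_def tens_def presented_gen_def)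
  have h0: "h s = \<zero>\<^bsub>middle\<^esub>" if "s \<in> middle_rels" for s
    unfolding middle_def h_def
    by (rule presented_relation[OF R.is_cring middle_rels_closed p[unfolded middle_def] _ that])
       (simp add: presented_gen_def)
  note hs = linear_map_minus[OF F.module_axioms U.module_axioms h] linear_map_add[OF h]
      linear_map_smult[OF h] ht b triple_closed tens_closed U.minus_zero_iff
  let ?v = "\<lambda>a b. basis_vec R (a, b)"
  have add1: "tens (a \<oplus>\<^bsub>T\<^esub> a') b = tens a b \<oplus>\<^bsub>middle\<^esub> tens a' b"
    if m: "a \<in> carrier T" "a' \<in> carrier T" "b \<in> carrier T" for a a' b
  proof -
    have "h (?v (a \<oplus>\<^bsub>T\<^esub> a') b \<ominus>\<^bsub>?F\<^esub> (?v a b \<oplus>\<^bsub>?F\<^esub> ?v a' b)) = \<zero>\<^bsub>middle\<^esub>"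
      by (rule h0) (use m in \<open>unfold middle_rels_def Let_def, blast\<close>)
    then show ?thesis using m by (simp add: hs)
  qed
  have add2: "tens a (b \<oplus>\<^bsub>T\<^esub> b') = tens a b \<oplus>\<^bsub>middle\<^esub> tens a b'"
    if m: "a \<in> carrier T" "b \<in> carrier T" "b' \<in> carrier T" for a b b'
  proof -
    have "h (?v a (b \<oplus>\<^bsub>T\<^esub> b') \<ominus>\<^bsub>?F\<^esub> (?v a b \<oplus>\<^bsub>?F\<^esub> ?v a b')) = \<zero>\<^bsub>middle\<^esub>"
      by (rule h0) (use m in \<open>unfold middle_rels_def Let_def, blast\<close>)
    then show ?thesis using m by (simp add: hs)
  qed
  have smult1: "tens (r \<odot>\<^bsub>T\<^esub> a) b = r \<odot>\<^bsub>middle\<^esub> tens a b"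
    if m: "r \<in> carrier R" "a \<in> carrier T" "b \<in> carrier T" for r a b
  proof -
    have "h (?v (r \<odot>\<^bsub>T\<^esub> a) b \<ominus>\<^bsub>?F\<^esub> (r \<odot>\<^bsub>?F\<^esub> ?v a b)) = \<zero>\<^bsub>middle\<^esub>"
      by (rule h0) (use m in \<open>unfold middle_rels_def Let_def, blast\<close>)
    then show ?thesis using m by (simp add: hs)
  qed
  have smult2: "tens a (r \<odot>\<^bsub>T\<^esub> b) = r \<odot>\<^bsub>middle\<^esub> tens a b"
    if m: "r \<in> carrier R" "a \<in> carrier T" "b \<in> carrier T" for r a b
  proof -
    have "h (?v a (r \<odot>\<^bsub>T\<^esub> b) \<ominus>\<^bsub>?F\<^esub> (r \<odot>\<^bsub>?F\<^esub> ?v a b)) = \<zero>\<^bsub>middle\<^esub>"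
      by (rule h0) (use m in \<open>unfold middle_rels_def Let_def, blast\<close>)
    then show ?thesis using m by (simp add: hs)
  qed
  show "bilinear_map R T T middle tens"
    unfolding bilinear_map_def
    by (intro conjI ballI linear_mapI; (rule tens_closed add1 add2 smult1 smult2); assumption)
  fix a b c d
  assume m: "a \<in> carrier T" "b \<in> carrier T" "c \<in> carrier T" "d \<in> carrier T"
  have "h ((?v (triple T a b c) d \<ominus>\<^bsub>?F\<^esub> ?v c (triple T b a d))
     \<oplus>\<^bsub>?F\<^esub> (?v (triple T c d a) b \<ominus>\<^bsub>?F\<^esub> ?v a (triple T d c b))) = \<zero>\<^bsub>middle\<^esub>"
    by (rule h0) (use m in \<open>unfold middle_rels_def Let_def, blast\<close>)
  then show "(tens (triple T a b c) d \<ominus>\<^bsub>middle\<^esub> tens c (triple T b a d))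
        \<oplus>\<^bsub>middle\<^esub> (tens (triple T c d a) b \<ominus>\<^bsub>middle\<^esub> tens a (triple T d c b)) = \<zero>\<^bsub>middle\<^esub>"
    using m by (simp add: hs)
qed

lemmas tens_lin1 = bilinear_mapD(1)[OF tens_bilinear]
lemmas tens_lin2 = bilinear_mapD(2)[OF tens_bilinear]
lemmas tens_add1 = linear_map_add[OF tens_lin1]
lemmas tens_add2 = linear_map_add[OF tens_lin2]
lemmas tens_inv1 = linear_map_inv[OF module_axioms U.module_axioms tens_lin1]
lemmas tens_inv2 = linear_map_inv[OF module_axioms U.module_axioms tens_lin2]

text \<open>The action of the middle component on degree \<open>-1\<close>, determined by \<open>(a, b) c = {a, b, c}\<close>. By the
  commutator formula, the last relation maps to \<open>[V a b, V c d] + [V c d, V a b] = 0\<close>.\<close>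

definition mact :: "('a \<times> 'a \<Rightarrow> 'k) set \<Rightarrow> 'a \<Rightarrow> 'a" where
  "mact u c = (SOME h. linear_map R middle T h \<and>
     (\<forall>a\<in>carrier T. \<forall>b\<in>carrier T. h (tens a b) = triple T a b c)) u"

lemma act_spec:
  assumes c: "c \<in> carrier T"
  shows "linear_map R middle T (\<lambda>u. mact u c) \<and>
     (\<forall>a\<in>carrier T. \<forall>b\<in>carrier T. mact (tens a b) c = triple T a b c)"
proof -
  have "\<exists>h. linear_map R middle T h \<and> (\<forall>a\<in>carrier T. \<forall>b\<in>carrier T. h (tens a b) = triple T a b c)"
  proof (rule middle_universal[OF module_axioms])
    show "bilinear_map R T T T (\<lambda>a b. triple T a b c)"
      unfolding bilinear_map_def using triple_linear1 triple_linear2 c by simp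
    fix a b x d
    assume m: "a \<in> carrier T" "b \<in> carrier T" "x \<in> carrier T" "d \<in> carrier T"
    let ?p = "triple T a b (triple T x d c)" and ?q = "triple T x d (triple T a b c)"
    have pq: "?p \<in> carrier T" "?q \<in> carrier T" using m c triple_closed by auto
    have "triple T (triple T a b x) d c \<ominus>\<^bsub>T\<^esub> triple T x (triple T b a d) c = ?p \<ominus>\<^bsub>T\<^esub> ?q"
      using V_commutator[OF m c] by (simp add: V_op_def)
    moreover have "triple T (triple T x d a) b c \<ominus>\<^bsub>T\<^esub> triple T a (triple T d x b) c = ?q \<ominus>\<^bsub>T\<^esub> ?p"
      using V_commutator[OF m(3,4,1,2) c] by (simp add: V_op_def)
    moreover have "(?p \<ominus>\<^bsub>T\<^esub> ?q) \<oplus>\<^bsub>T\<^esub> (?q \<ominus>\<^bsub>T\<^esub> ?p) = \<zero>\<^bsub>T\<^esub>" using pq by algebra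
    ultimately show "(triple T (triple T a b x) d c \<ominus>\<^bsub>T\<^esub> triple T x (triple T b a d) c)
        \<oplus>\<^bsub>T\<^esub> (triple T (triple T x d a) b c \<ominus>\<^bsub>T\<^esub> triple T a (triple T d x b) c) = \<zero>\<^bsub>T\<^esub>"
      by simp
  qed
  from someI_ex[OF this] show ?thesis unfolding mact_def .
qed

lemma act_lin1: "c \<in> carrier T \<Longrightarrow> linear_map R middle T (\<lambda>u. mact u c)"
  and act_tens: "\<lbrakk>a \<in> carrier T; b \<in> carrier T; c \<in> carrier T\<rbrakk> \<Longrightarrow> mact (tens a b) c = triple T a b c"
  using act_spec by blast+

lemma act_closed: "\<lbrakk>u \<in> carrier middle; c \<in> carrier T\<rbrakk> \<Longrightarrow> mact u c \<in> carrier T"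
  by (rule linear_map_closed[OF act_lin1])

lemma act_lin2:
  assumes u: "u \<in> carrier middle"
  shows "linear_map R T T (mact u)"
proof (rule linear_mapI)
  fix x assume x: "x \<in> carrier T"
  show "mact u x \<in> carrier T" by (rule act_closed[OF u x])
  show "mact u (x \<oplus>\<^bsub>T\<^esub> y) = mact u x \<oplus>\<^bsub>T\<^esub> mact u y" if y: "y \<in> carrier T" for y
    by (rule middle_eqI[OF module_axioms act_lin1 linear_map_plus[OF U.module_axioms module_axioms act_lin1 act_lin1] _ u])
       (use x y in \<open>simp_all add: act_tens linear_map_add[OF triple_linear3]\<close>)
  fix r assume r: "r \<in> carrier R"
  show "mact u (r \<odot>\<^bsub>T\<^esub> x) = r \<odot>\<^bsub>T\<^esub> mact u x"
  proof (rule middle_eqI[OF module_axioms act_lin1 _ _ u])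
    show "linear_map R middle T (\<lambda>u. r \<odot>\<^bsub>T\<^esub> mact u x)"
      using r x act_closed
      by (intro linear_mapI) (simp_all add: linear_map_add[OF act_lin1] linear_map_smult[OF act_lin1]
         smult_r_distr smult_assoc1[symmetric] R.m_comm)
  qed (use x r in \<open>simp_all add: act_tens linear_map_smult[OF triple_linear3]\<close>)
qed

text \<open>The exchange of the two entries; up to sign this is the involution on the middle component.\<close>

definition star :: "('a \<times> 'a \<Rightarrow> 'k) set \<Rightarrow> ('a \<times> 'a \<Rightarrow> 'k) set" where
  "star = (SOME h. linear_map R middle middle h \<and>
     (\<forall>a\<in>carrier T. \<forall>b\<in>carrier T. h (tens a b) = tens b a))"

lemma star_spec: "linear_map R middle middle star \<and>
   (\<forall>a\<in>carrier T. \<forall>b\<in>carrier T. star (tens a b) = tens b a)"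
proof -
  have "\<exists>h. linear_map R middle middle h \<and> (\<forall>a\<in>carrier T. \<forall>b\<in>carrier T. h (tens a b) = tens b a)"
  proof (rule middle_universal[OF U.module_axioms])
    show "bilinear_map R T T middle (\<lambda>a b. tens b a)"
      unfolding bilinear_map_def using tens_lin1 tens_lin2 by simp
    fix a b c d
    assume m: "a \<in> carrier T" "b \<in> carrier T" "c \<in> carrier T" "d \<in> carrier T"
    let ?p = "tens d (triple T a b c)" and ?q = "tens (triple T b a d) c"
      and ?r = "tens b (triple T c d a)" and ?s = "tens (triple T d c b) a"
    have c: "?p \<in> carrier middle" "?q \<in> carrier middle" "?r \<in> carrier middle" "?s \<in> carrier middle"
      using m tens_closed triple_closed by auto
    have "(?q \<ominus>\<^bsub>middle\<^esub> ?p) \<oplus>\<^bsub>middle\<^esub> (?s \<ominus>\<^bsub>middle\<^esub> ?r) = \<zero>\<^bsub>middle\<^esub>"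
      by (rule tens_rel[OF m(2,1,4,3)])
    then have "\<ominus>\<^bsub>middle\<^esub> ((?q \<ominus>\<^bsub>middle\<^esub> ?p) \<oplus>\<^bsub>middle\<^esub> (?s \<ominus>\<^bsub>middle\<^esub> ?r)) = \<zero>\<^bsub>middle\<^esub>" by simp
    moreover have "\<ominus>\<^bsub>middle\<^esub> ((?q \<ominus>\<^bsub>middle\<^esub> ?p) \<oplus>\<^bsub>middle\<^esub> (?s \<ominus>\<^bsub>middle\<^esub> ?r))
       = (?p \<ominus>\<^bsub>middle\<^esub> ?q) \<oplus>\<^bsub>middle\<^esub> (?r \<ominus>\<^bsub>middle\<^esub> ?s)" using c by algebra
    ultimately show "(?p \<ominus>\<^bsub>middle\<^esub> ?q) \<oplus>\<^bsub>middle\<^esub> (?r \<ominus>\<^bsub>middle\<^esub> ?s) = \<zero>\<^bsub>middle\<^esub>" by simp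
  qed
  from someI_ex[OF this] show ?thesis unfolding star_def .
qed

lemma star_lin: "linear_map R middle middle star"
  and star_tens: "\<lbrakk>a \<in> carrier T; b \<in> carrier T\<rbrakk> \<Longrightarrow> star (tens a b) = tens b a"
  using star_spec by blast+

lemmas star_closed = linear_map_closed[OF star_lin]

lemma star_star: "u \<in> carrier middle \<Longrightarrow> star (star u) = u"
  by (rule middle_eqI[OF U.module_axioms linear_map_comp[OF star_lin star_lin]])
     (auto simp: linear_map_def star_tens)

text \<open>The action of the middle component on degree \<open>1\<close>, which the involution forces.\<close>

definition coact :: "('a \<times> 'a \<Rightarrow> 'k) set \<Rightarrow> 'a \<Rightarrow> 'a" where
  "coact u d = \<ominus>\<^bsub>T\<^esub> mact (star u) d"

lemma coact_lin1: "d \<in> carrier T \<Longrightarrow> linear_map R middle T (\<lambda>u. coact u d)"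
  unfolding coact_def
  by (rule linear_map_uminus[OF U.module_axioms module_axioms linear_map_comp[OF star_lin act_lin1]])

lemma coact_lin2: "u \<in> carrier middle \<Longrightarrow> linear_map R T T (coact u)"
  using linear_map_uminus[OF module_axioms module_axioms act_lin2[OF star_closed]]
  unfolding coact_def[abs_def] by blast

lemma coact_closed: "\<lbrakk>u \<in> carrier middle; d \<in> carrier T\<rbrakk> \<Longrightarrow> coact u d \<in> carrier T"
  by (rule linear_map_closed[OF coact_lin1])

lemma coact_tens: "\<lbrakk>a \<in> carrier T; b \<in> carrier T; d \<in> carrier T\<rbrakk> \<Longrightarrow>
    coact (tens a b) d = \<ominus>\<^bsub>T\<^esub> triple T b a d"
  by (simp add: coact_def star_tens act_tens)

text \<open>The value at the generator \<open>(a, b)\<close> of the derivation that \<open>v\<close> induces.\<close>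

definition tens_act :: "('a \<times> 'a \<Rightarrow> 'k) set \<Rightarrow> 'a \<Rightarrow> 'a \<Rightarrow> ('a \<times> 'a \<Rightarrow> 'k) set" where
  "tens_act v a b = tens (mact v a) b \<oplus>\<^bsub>middle\<^esub> tens a (coact v b)"

lemma tens_act_lin:
  "\<lbrakk>a \<in> carrier T; b \<in> carrier T\<rbrakk> \<Longrightarrow> linear_map R middle middle (\<lambda>v. tens_act v a b)"
  "\<lbrakk>v \<in> carrier middle; b \<in> carrier T\<rbrakk> \<Longrightarrow> linear_map R T middle (\<lambda>a. tens_act v a b)"
  "\<lbrakk>v \<in> carrier middle; a \<in> carrier T\<rbrakk> \<Longrightarrow> linear_map R T middle (\<lambda>b. tens_act v a b)"
  unfolding tens_act_def
  using linear_map_plus[OF U.module_axioms U.module_axioms linear_map_comp[OF act_lin1 tens_lin1]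
      linear_map_comp[OF coact_lin1 tens_lin2]]
    linear_map_plus[OF module_axioms U.module_axioms linear_map_comp[OF act_lin2 tens_lin1] tens_lin1]
    linear_map_plus[OF module_axioms U.module_axioms tens_lin2 linear_map_comp[OF coact_lin2 tens_lin2]]
  by (simp_all add: act_closed coact_closed)

text \<open>This is the last defining relation of the middle component.\<close>

lemma tens_act_antisym:
  assumes m: "a \<in> carrier T" "b \<in> carrier T" "c \<in> carrier T" "d \<in> carrier T"
  shows "tens_act (tens a b) c d = \<ominus>\<^bsub>middle\<^esub> tens_act (tens c d) a b"
proof -
  have *: "tens_act (tens a b) c d = tens (triple T a b c) d \<ominus>\<^bsub>middle\<^esub> tens c (triple T b a d)"
    if "a \<in> carrier T" "b \<in> carrier T" "c \<in> carrier T" "d \<in> carrier T" for a b c d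
    using that by (simp add: tens_act_def act_tens coact_tens tens_inv2 triple_closed a_minus_def)
  have c: "tens_act (tens a b) c d \<in> carrier middle" if "a \<in> carrier T" "b \<in> carrier T" "c \<in> carrier T" "d \<in> carrier T" for a b c d
    using linear_map_closed[OF tens_act_lin(1)] that tens_closed by blast
  have "tens_act (tens a b) c d \<oplus>\<^bsub>middle\<^esub> tens_act (tens c d) a b = \<zero>\<^bsub>middle\<^esub>"
    unfolding *[OF m] *[OF m(3,4,1,2)] by (rule tens_rel[OF m])
  then show ?thesis using c[OF m] c[OF m(3,4,1,2)] by (simp add: U.minus_equality)
qed

text \<open>For the derivation by \<open>v\<close> to respect the relations of the middle component, it suffices by linearity
  that \<open>v\<close> is a generator. Then skew-symmetry rewrites \<open>v\<close> acting on a generator \<open>u\<close> as \<open>- u\<close> acting on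
  the generator \<open>v\<close>, and the latter expression is already a linear function of the class of \<open>u\<close>.\<close>

definition mbracket :: "('a \<times> 'a \<Rightarrow> 'k) set \<Rightarrow> ('a \<times> 'a \<Rightarrow> 'k) set \<Rightarrow> ('a \<times> 'a \<Rightarrow> 'k) set" where
  "mbracket v = (SOME h. linear_map R middle middle h \<and>
     (\<forall>a\<in>carrier T. \<forall>b\<in>carrier T. h (tens a b) = tens_act v a b))"

lemma mbracket_spec:
  assumes v: "v \<in> carrier middle"
  shows "linear_map R middle middle (mbracket v) \<and>
   (\<forall>a\<in>carrier T. \<forall>b\<in>carrier T. mbracket v (tens a b) = tens_act v a b)"
proof -
  have "\<exists>h. linear_map R middle middle h \<and> (\<forall>a\<in>carrier T. \<forall>b\<in>carrier T. h (tens a b) = tens_act v a b)"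
  proof (rule middle_universal[OF U.module_axioms])
    show "bilinear_map R T T middle (tens_act v)"
      unfolding bilinear_map_def using tens_act_lin v by simp
    fix a b c d
    assume m: "a \<in> carrier T" "b \<in> carrier T" "c \<in> carrier T" "d \<in> carrier T"
    let ?rel = "\<lambda>\<phi>. (\<phi> (triple T a b c) d \<ominus>\<^bsub>middle\<^esub> \<phi> c (triple T b a d))
        \<oplus>\<^bsub>middle\<^esub> (\<phi> (triple T c d a) b \<ominus>\<^bsub>middle\<^esub> \<phi> a (triple T d c b))"
    have t: "triple T a b c \<in> carrier T" "triple T b a d \<in> carrier T"
      "triple T c d a \<in> carrier T" "triple T d c b \<in> carrier T"
      using m triple_closed by auto
    show "?rel (tens_act v) = \<zero>\<^bsub>middle\<^esub>"
    proof (rule middle_eqI[OF U.module_axioms _ linear_map_const_zero[OF U.module_axioms] _ v])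
      show "linear_map R middle middle (\<lambda>v. ?rel (tens_act v))"
        by (intro linear_map_plus linear_map_diff U.module_axioms tens_act_lin m t)
      fix e g assume eg: "e \<in> carrier T" "g \<in> carrier T"
      have G: "linear_map R middle middle (\<lambda>u. \<ominus>\<^bsub>middle\<^esub> tens_act u e g)"
        by (rule linear_map_uminus[OF U.module_axioms U.module_axioms tens_act_lin(1)[OF eg]])
      have "?rel (\<lambda>x y. \<ominus>\<^bsub>middle\<^esub> tens_act (tens x y) e g) = \<ominus>\<^bsub>middle\<^esub> tens_act (?rel tens) e g"
        using m t tens_closed
        by (simp add: linear_map_add[OF G] linear_map_minus[OF U.module_axioms U.module_axioms G])
      also have "\<dots> = \<zero>\<^bsub>middle\<^esub>"
        unfolding tens_rel[OF m] by (rule linear_map_zero[OF U.module_axioms U.module_axioms G])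
      finally show "?rel (tens_act (tens e g)) = \<zero>\<^bsub>middle\<^esub>"
        using m t by (simp add: tens_act_antisym[OF eg])
    qed
  qed
  from someI_ex[OF this] show ?thesis unfolding mbracket_def .
qed

lemma mbracket_tens_act: "\<lbrakk>v \<in> carrier middle; a \<in> carrier T; b \<in> carrier T\<rbrakk> \<Longrightarrow>
    mbracket v (tens a b) = tens_act v a b"
  using mbracket_spec by blast

lemma mbracket_lin2: "v \<in> carrier middle \<Longrightarrow> linear_map R middle middle (mbracket v)"
  and mbracket_tens: "\<lbrakk>v \<in> carrier middle; a \<in> carrier T; b \<in> carrier T\<rbrakk> \<Longrightarrow>
    mbracket v (tens a b) = tens (mact v a) b \<oplus>\<^bsub>middle\<^esub> tens a (coact v b)"
  using mbracket_spec unfolding tens_act_def by blast+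

lemma mbracket_closed: "\<lbrakk>u \<in> carrier middle; v \<in> carrier middle\<rbrakk> \<Longrightarrow> mbracket u v \<in> carrier middle"
  by (rule linear_map_closed[OF mbracket_lin2])

lemma mbracket_lin1:
  assumes v: "v \<in> carrier middle"
  shows "linear_map R middle middle (\<lambda>u. mbracket u v)"
proof (rule linear_mapI)
  fix x assume x: "x \<in> carrier middle"
  show "mbracket x v \<in> carrier middle" by (rule mbracket_closed[OF x v])
  show "mbracket (x \<oplus>\<^bsub>middle\<^esub> y) v = mbracket x v \<oplus>\<^bsub>middle\<^esub> mbracket y v" if y: "y \<in> carrier middle" for y
  proof (rule middle_eqI[OF U.module_axioms mbracket_lin2 linear_map_plus[OF U.module_axioms U.module_axioms
        mbracket_lin2 mbracket_lin2] _ v])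
    fix a b assume "a \<in> carrier T" "b \<in> carrier T"
    then show "mbracket (x \<oplus>\<^bsub>middle\<^esub> y) (tens a b) = mbracket x (tens a b) \<oplus>\<^bsub>middle\<^esub> mbracket y (tens a b)"
      using x y linear_map_add[OF tens_act_lin(1)] mbracket_spec by simp
  qed (use x y in auto)
  fix r assume r: "r \<in> carrier R"
  show "mbracket (r \<odot>\<^bsub>middle\<^esub> x) v = r \<odot>\<^bsub>middle\<^esub> mbracket x v"
  proof (rule middle_eqI[OF U.module_axioms mbracket_lin2 _ _ v])
    show "linear_map R middle middle (\<lambda>v. r \<odot>\<^bsub>middle\<^esub> mbracket x v)"
      using r x mbracket_closed
      by (intro linear_mapI) (simp_all add: linear_map_add[OF mbracket_lin2] linear_map_smult[OF mbracket_lin2]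
         U.smult_r_distr U.smult_assoc1[symmetric] R.m_comm)
    fix a b assume "a \<in> carrier T" "b \<in> carrier T"
    then show "mbracket (r \<odot>\<^bsub>middle\<^esub> x) (tens a b) = r \<odot>\<^bsub>middle\<^esub> mbracket x (tens a b)"
      using x r linear_map_smult[OF tens_act_lin(1)] mbracket_spec by simp
  qed (use x r in auto)
qed

lemmas carr = act_closed coact_closed star_closed mbracket_closed tens_closed triple_closed

lemma mbracket_antisym:
  assumes u: "u \<in> carrier middle" and v: "v \<in> carrier middle"
  shows "mbracket u v = \<ominus>\<^bsub>middle\<^esub> mbracket v u"
proof (rule middle_eqI[OF U.module_axioms mbracket_lin1[OF v]
      linear_map_uminus[OF U.module_axioms U.module_axioms mbracket_lin2[OF v]] _ u])
  fix a b assume ab: "a \<in> carrier T" "b \<in> carrier T"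
  show "mbracket (tens a b) v = \<ominus>\<^bsub>middle\<^esub> mbracket v (tens a b)"
  proof (rule middle_eqI[OF U.module_axioms mbracket_lin2
        linear_map_uminus[OF U.module_axioms U.module_axioms mbracket_lin1] _ v])
    fix c d assume cd: "c \<in> carrier T" "d \<in> carrier T"
    show "mbracket (tens a b) (tens c d) = \<ominus>\<^bsub>middle\<^esub> mbracket (tens c d) (tens a b)"
      unfolding mbracket_tens_act[OF tens_closed[OF ab] cd] mbracket_tens_act[OF tens_closed[OF cd] ab]
      by (rule tens_act_antisym[OF ab cd])
  qed (rule tens_closed[OF ab])+
qed

text \<open>On generators this is the commutator formula of the triple system. It says that the middle component
  acts on degree \<open>-1\<close> by a representation; the next two lemmas transfer this to degree \<open>1\<close>.\<close>

lemma act_mbracket: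
  assumes u: "u \<in> carrier middle" and v: "v \<in> carrier middle" and c: "c \<in> carrier T"
  shows "mact (mbracket u v) c \<oplus>\<^bsub>T\<^esub> mact v (mact u c) = mact u (mact v c)"
proof (rule middle_eqI[OF module_axioms linear_map_plus[OF U.module_axioms module_axioms
      linear_map_comp[OF mbracket_lin1[OF v] act_lin1[OF c]] linear_map_comp[OF act_lin1[OF c] act_lin2[OF v]]]
      act_lin1 _ u])
  show "mact v c \<in> carrier T" using carr v c by simp
  fix d e assume de: "d \<in> carrier T" "e \<in> carrier T"
  have w: "tens d e \<in> carrier middle" using de carr by simp
  show "mact (mbracket (tens d e) v) c \<oplus>\<^bsub>T\<^esub> mact v (mact (tens d e) c) = mact (tens d e) (mact v c)"
  proof (rule middle_eqI[OF module_axioms linear_map_plus[OF U.module_axioms module_axioms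
      linear_map_comp[OF mbracket_lin2[OF w] act_lin1[OF c]] act_lin1]
      linear_map_comp[OF act_lin1[OF c] act_lin2[OF w]] _ v])
    show "mact (tens d e) c \<in> carrier T" using carr w c by simp
    fix a b assume ab: "a \<in> carrier T" "b \<in> carrier T"
    let ?p = "triple T d e (triple T a b c)" and ?q = "triple T a b (triple T d e c)"
      and ?r = "triple T (triple T d e a) b c" and ?s = "triple T a (triple T e d b) c"
    have cl: "?p \<in> carrier T" "?q \<in> carrier T" "?r \<in> carrier T" "?s \<in> carrier T"
      using ab de c carr by auto
    have "?p \<ominus>\<^bsub>T\<^esub> ?q = ?r \<ominus>\<^bsub>T\<^esub> ?s" using V_commutator[OF de ab c] by (simp add: V_op_def)
    then have "(?r \<ominus>\<^bsub>T\<^esub> ?s) \<oplus>\<^bsub>T\<^esub> ?q = (?p \<ominus>\<^bsub>T\<^esub> ?q) \<oplus>\<^bsub>T\<^esub> ?q" by simp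
    also have "\<dots> = ?p" using cl by algebra
    finally have *: "(?r \<ominus>\<^bsub>T\<^esub> ?s) \<oplus>\<^bsub>T\<^esub> ?q = ?p" .
    have "mact (mbracket (tens d e) (tens a b)) c = ?r \<ominus>\<^bsub>T\<^esub> ?s"
      using ab de c carr
      by (simp add: mbracket_tens act_tens coact_tens linear_map_add[OF act_lin1] tens_inv2
          linear_map_inv[OF U.module_axioms module_axioms act_lin1] a_minus_def)
    then show "mact (mbracket (tens d e) (tens a b)) c \<oplus>\<^bsub>T\<^esub> mact (tens a b) (mact (tens d e) c)
      = mact (tens d e) (mact (tens a b) c)"
      using * ab de c carr by (simp add: act_tens)
  qed
qed

lemma star_mbracket:
  assumes u: "u \<in> carrier middle" and v: "v \<in> carrier middle"
  shows "star (mbracket u v) = \<ominus>\<^bsub>middle\<^esub> mbracket (star u) (star v)"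
proof (rule middle_eqI[OF U.module_axioms linear_map_comp[OF mbracket_lin2[OF u] star_lin]
      linear_map_uminus[OF U.module_axioms U.module_axioms linear_map_comp[OF star_lin mbracket_lin2]] _ v])
  show "star u \<in> carrier middle" using carr u by simp
  fix a b assume ab: "a \<in> carrier T" "b \<in> carrier T"
  then show "star (mbracket u (tens a b)) = \<ominus>\<^bsub>middle\<^esub> mbracket (star u) (star (tens a b))"
    using u carr
    by (simp add: mbracket_tens star_tens linear_map_add[OF star_lin] coact_def star_star tens_inv1 tens_inv2
       linear_map_inv[OF U.module_axioms U.module_axioms star_lin] U.minus_add U.a_comm)
qed

lemma coact_mbracket:
  assumes u: "u \<in> carrier middle" and v: "v \<in> carrier middle" and d: "d \<in> carrier T"
  shows "coact (mbracket u v) d \<oplus>\<^bsub>T\<^esub> coact v (coact u d) = coact u (coact v d)"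
  using act_mbracket[OF star_closed[OF u] star_closed[OF v] d] u v d carr
  by (simp add: coact_def star_mbracket linear_map_inv[OF U.module_axioms module_axioms act_lin1]
     linear_map_inv[OF module_axioms module_axioms act_lin2])

lemma mbracket_mbracket:
  assumes u: "u \<in> carrier middle" and v: "v \<in> carrier middle" and w: "w \<in> carrier middle"
  shows "mbracket (mbracket u v) w \<oplus>\<^bsub>middle\<^esub> mbracket v (mbracket u w) = mbracket u (mbracket v w)"
proof (rule middle_eqI[OF U.module_axioms linear_map_plus[OF U.module_axioms U.module_axioms
      mbracket_lin2 linear_map_comp[OF mbracket_lin2 mbracket_lin2]] linear_map_comp[OF mbracket_lin2 mbracket_lin2] _ w])
  fix a b assume ab: "a \<in> carrier T" "b \<in> carrier T"
  let ?W = "mbracket u v"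
  have W: "?W \<in> carrier middle" using u v carr by simp
  let ?p = "tens (mact ?W a) b" and ?q = "tens a (coact ?W b)" and ?r = "tens (mact v (mact u a)) b"
    and ?s = "tens (mact u a) (coact v b)" and ?t = "tens (mact v a) (coact u b)" and ?x = "tens a (coact v (coact u b))"
  have c: "?p \<in> carrier middle" "?q \<in> carrier middle" "?r \<in> carrier middle" "?s \<in> carrier middle"
     "?t \<in> carrier middle" "?x \<in> carrier middle"
    using u v W ab carr by auto
  have "tens (mact u (mact v a)) b = ?p \<oplus>\<^bsub>middle\<^esub> ?r"
    using act_mbracket[OF u v ab(1)] u v W ab carr by (simp add: tens_add1[symmetric])
  moreover have "tens a (coact u (coact v b)) = ?q \<oplus>\<^bsub>middle\<^esub> ?x"
    using coact_mbracket[OF u v ab(2)] u v W ab carr by (simp add: tens_add2[symmetric])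
  ultimately have R: "mbracket u (mbracket v (tens a b)) = ((?p \<oplus>\<^bsub>middle\<^esub> ?r) \<oplus>\<^bsub>middle\<^esub> ?t) \<oplus>\<^bsub>middle\<^esub> (?s \<oplus>\<^bsub>middle\<^esub> (?q \<oplus>\<^bsub>middle\<^esub> ?x))"
    using u v ab carr by (simp add: mbracket_tens linear_map_add[OF mbracket_lin2])
  have "mbracket ?W (tens a b) \<oplus>\<^bsub>middle\<^esub> mbracket v (mbracket u (tens a b))
    = (?p \<oplus>\<^bsub>middle\<^esub> ?q) \<oplus>\<^bsub>middle\<^esub> ((?r \<oplus>\<^bsub>middle\<^esub> ?s) \<oplus>\<^bsub>middle\<^esub> (?t \<oplus>\<^bsub>middle\<^esub> ?x))"
    using u v W ab carr by (simp add: mbracket_tens linear_map_add[OF mbracket_lin2])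
  also have "\<dots> = mbracket u (mbracket v (tens a b))" unfolding R using c by algebra
  finally show "mbracket ?W (tens a b) \<oplus>\<^bsub>middle\<^esub> mbracket v (mbracket u (tens a b)) = mbracket u (mbracket v (tens a b))" .
qed (use u v carr in auto)

lemma mbracket_jacobi:
  assumes u: "u \<in> carrier middle" and v: "v \<in> carrier middle" and w: "w \<in> carrier middle"
  shows "mbracket u (mbracket v w) \<oplus>\<^bsub>middle\<^esub> mbracket v (mbracket w u) \<oplus>\<^bsub>middle\<^esub> mbracket w (mbracket u v) = \<zero>\<^bsub>middle\<^esub>"
proof -
  let ?p = "mbracket (mbracket u v) w" and ?q = "mbracket v (mbracket u w)"
  have c: "?p \<in> carrier middle" "?q \<in> carrier middle" using u v w carr by auto
  have 1: "mbracket u (mbracket v w) = ?p \<oplus>\<^bsub>middle\<^esub> ?q" using mbracket_mbracket[OF u v w] by simp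
  have 2: "mbracket v (mbracket w u) = \<ominus>\<^bsub>middle\<^esub> ?q"
    using mbracket_antisym[OF w u] u v w carr
    by (simp add: linear_map_inv[OF U.module_axioms U.module_axioms mbracket_lin2])
  have 3: "mbracket w (mbracket u v) = \<ominus>\<^bsub>middle\<^esub> ?p" by (rule mbracket_antisym[OF w mbracket_closed[OF u v]])
  show ?thesis unfolding 1 2 3 using c by algebra
qed

lemma act_tens_sym: "\<lbrakk>a \<in> carrier T; b \<in> carrier T; c \<in> carrier T\<rbrakk> \<Longrightarrow> mact (tens a b) c = mact (tens c b) a"
  by (simp add: act_tens triple_sym)

lemma coact_tens_sym: "\<lbrakk>a \<in> carrier T; b \<in> carrier T; d \<in> carrier T\<rbrakk> \<Longrightarrow> coact (tens a b) d = coact (tens a d) b"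
  using triple_sym[of b a d] by (simp add: coact_tens)

end

section \<open>The universal Lie algebra of a Jordan triple system\<close>

context abelian_group
begin

text \<open>These rules collect a sum into one difference \<open>p - n\<close> of sums without signs, and turn an equation
  between such differences into one that holds by commutativity.\<close>

lemma difference_simps:
  assumes "x \<in> carrier G" "y \<in> carrier G" "z \<in> carrier G"
  shows "x \<oplus> (y \<ominus> z) = (x \<oplus> y) \<ominus> z" "(x \<ominus> y) \<oplus> z = (x \<oplus> z) \<ominus> y"
    "x \<ominus> (y \<ominus> z) = (x \<oplus> z) \<ominus> y" "(x \<ominus> y) \<ominus> z = x \<ominus> (y \<oplus> z)"
    "x \<ominus> y = z \<longleftrightarrow> x = z \<oplus> y" "z = x \<ominus> y \<longleftrightarrow> z \<oplus> y = x"
proof -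
  show "x \<oplus> (y \<ominus> z) = (x \<oplus> y) \<ominus> z" "(x \<ominus> y) \<oplus> z = (x \<oplus> z) \<ominus> y"
    "x \<ominus> (y \<ominus> z) = (x \<oplus> z) \<ominus> y" "(x \<ominus> y) \<ominus> z = x \<ominus> (y \<oplus> z)"
    using assms by algebra+
  have "x \<ominus> y = z \<longleftrightarrow> x \<ominus> y = z \<ominus> \<zero>" using assms by (simp add: minus_eq)
  also have "\<dots> \<longleftrightarrow> x = z \<oplus> y" using assms by (subst minus_eq_minus_iff) simp_all
  finally show "x \<ominus> y = z \<longleftrightarrow> x = z \<oplus> y" .
  then show "z = x \<ominus> y \<longleftrightarrow> z \<oplus> y = x" by auto
qed

end

text \<open>The Lie algebra \<open>T \<oplus> U \<oplus> T\<close> is built directly on the image of an injection \<open>j\<close>, so that it can live on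
  the type of \<open>T\<close>. Elements are handled through \<open>mk\<close> and the three projections \<open>pm\<close>, \<open>pz\<close>, \<open>pp\<close> onto
  the degrees \<open>-1\<close>, \<open>0\<close> and \<open>1\<close>.\<close>

locale universal_lie_algebra = jordan_triple_system R T
  for R :: "('k, 'r) ring_scheme" and T :: "('k, 'a, 'x) jordan_triple_scheme" +
  fixes j :: "'a \<times> ('a \<times> 'a \<Rightarrow> 'k) set \<times> 'a \<Rightarrow> 'b"
  assumes two_unit: "\<one>\<^bsub>R\<^esub> \<oplus>\<^bsub>R\<^esub> \<one>\<^bsub>R\<^esub> \<in> Units R"
    and j_inj: "inj_on j (carrier T \<times> carrier middle \<times> carrier T)"
begin

definition prj :: "'b \<Rightarrow> 'a \<times> ('a \<times> 'a \<Rightarrow> 'k) set \<times> 'a" where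
  "prj = inv_into (carrier T \<times> carrier middle \<times> carrier T) j"

definition "pm x = fst (prj x)"
definition "pz x = fst (snd (prj x))"
definition "pp x = snd (snd (prj x))"
definition "mk a u b = j (a, u, b)"

definition lie :: "('k, 'b) inv_graded_lie" where
  "lie = \<lparr>carrier = j ` (carrier T \<times> carrier middle \<times> carrier T), mult = undefined, one = undefined,
     zero = mk \<zero>\<^bsub>T\<^esub> \<zero>\<^bsub>middle\<^esub> \<zero>\<^bsub>T\<^esub>,
     add = (\<lambda>x y. mk (pm x \<oplus>\<^bsub>T\<^esub> pm y) (pz x \<oplus>\<^bsub>middle\<^esub> pz y) (pp x \<oplus>\<^bsub>T\<^esub> pp y)),
     smult = (\<lambda>r x. mk (r \<odot>\<^bsub>T\<^esub> pm x) (r \<odot>\<^bsub>middle\<^esub> pz x) (r \<odot>\<^bsub>T\<^esub> pp x)),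
     bracket = (\<lambda>x y. mk (mact (pz x) (pm y) \<ominus>\<^bsub>T\<^esub> mact (pz y) (pm x))
       (mbracket (pz x) (pz y) \<oplus>\<^bsub>middle\<^esub> (tens (pm x) (pp y) \<ominus>\<^bsub>middle\<^esub> tens (pm y) (pp x)))
       (coact (pz x) (pp y) \<ominus>\<^bsub>T\<^esub> coact (pz y) (pp x))),
     grade = (\<lambda>i. if i = -1 then {mk a \<zero>\<^bsub>middle\<^esub> \<zero>\<^bsub>T\<^esub> | a. a \<in> carrier T}
       else if i = 0 then {mk \<zero>\<^bsub>T\<^esub> u \<zero>\<^bsub>T\<^esub> | u. u \<in> carrier middle}
       else if i = 1 then {mk \<zero>\<^bsub>T\<^esub> \<zero>\<^bsub>middle\<^esub> b | b. b \<in> carrier T}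
       else {mk \<zero>\<^bsub>T\<^esub> \<zero>\<^bsub>middle\<^esub> \<zero>\<^bsub>T\<^esub>}),
     invol = (\<lambda>x. mk (pp x) (\<ominus>\<^bsub>middle\<^esub> star (pz x)) (pm x))\<rparr>"

lemma lie_simps:
  "zero lie = mk \<zero>\<^bsub>T\<^esub> \<zero>\<^bsub>middle\<^esub> \<zero>\<^bsub>T\<^esub>"
  "x \<oplus>\<^bsub>lie\<^esub> y = mk (pm x \<oplus>\<^bsub>T\<^esub> pm y) (pz x \<oplus>\<^bsub>middle\<^esub> pz y) (pp x \<oplus>\<^bsub>T\<^esub> pp y)"
  "r \<odot>\<^bsub>lie\<^esub> x = mk (r \<odot>\<^bsub>T\<^esub> pm x) (r \<odot>\<^bsub>middle\<^esub> pz x) (r \<odot>\<^bsub>T\<^esub> pp x)"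
  "bracket lie x y = mk (mact (pz x) (pm y) \<ominus>\<^bsub>T\<^esub> mact (pz y) (pm x))
       (mbracket (pz x) (pz y) \<oplus>\<^bsub>middle\<^esub> (tens (pm x) (pp y) \<ominus>\<^bsub>middle\<^esub> tens (pm y) (pp x)))
       (coact (pz x) (pp y) \<ominus>\<^bsub>T\<^esub> coact (pz y) (pp x))"
  "invol lie x = mk (pp x) (\<ominus>\<^bsub>middle\<^esub> star (pz x)) (pm x)"
  by (simp_all add: lie_def)

lemma grade_lie:
  "grade lie (-1) = {mk a \<zero>\<^bsub>middle\<^esub> \<zero>\<^bsub>T\<^esub> | a. a \<in> carrier T}"
  "grade lie 0 = {mk \<zero>\<^bsub>T\<^esub> u \<zero>\<^bsub>T\<^esub> | u. u \<in> carrier middle}"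
  "grade lie 1 = {mk \<zero>\<^bsub>T\<^esub> \<zero>\<^bsub>middle\<^esub> b | b. b \<in> carrier T}"
  "\<bar>i\<bar> > 1 \<Longrightarrow> grade lie i = {mk \<zero>\<^bsub>T\<^esub> \<zero>\<^bsub>middle\<^esub> \<zero>\<^bsub>T\<^esub>}"
  by (auto simp: lie_def)

lemma gradeI:
  "a \<in> carrier T \<Longrightarrow> mk a \<zero>\<^bsub>middle\<^esub> \<zero>\<^bsub>T\<^esub> \<in> grade lie (-1)"
  "u \<in> carrier middle \<Longrightarrow> mk \<zero>\<^bsub>T\<^esub> u \<zero>\<^bsub>T\<^esub> \<in> grade lie 0"
  "b \<in> carrier T \<Longrightarrow> mk \<zero>\<^bsub>T\<^esub> \<zero>\<^bsub>middle\<^esub> b \<in> grade lie 1"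
  "mk \<zero>\<^bsub>T\<^esub> \<zero>\<^bsub>middle\<^esub> \<zero>\<^bsub>T\<^esub> \<in> grade lie i"
proof -
  show "a \<in> carrier T \<Longrightarrow> mk a \<zero>\<^bsub>middle\<^esub> \<zero>\<^bsub>T\<^esub> \<in> grade lie (-1)"
    and "u \<in> carrier middle \<Longrightarrow> mk \<zero>\<^bsub>T\<^esub> u \<zero>\<^bsub>T\<^esub> \<in> grade lie 0"
    and "b \<in> carrier T \<Longrightarrow> mk \<zero>\<^bsub>T\<^esub> \<zero>\<^bsub>middle\<^esub> b \<in> grade lie 1"
    for a u b unfolding grade_lie by blast+
  note zero = this(1)[OF M.zero_closed] this(2)[OF U.zero_closed] this(3)[OF M.zero_closed]
  have "i = -1 \<or> i = 0 \<or> i = 1 \<or> \<bar>i\<bar> > 1" by linarith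
  then show "mk \<zero>\<^bsub>T\<^esub> \<zero>\<^bsub>middle\<^esub> \<zero>\<^bsub>T\<^esub> \<in> grade lie i"
    using zero grade_lie(4) by (elim disjE) simp_all
qed

lemma gradeE:
  assumes "x \<in> grade lie i"
  obtains (minus) a where "i = -1" "a \<in> carrier T" "x = mk a \<zero>\<^bsub>middle\<^esub> \<zero>\<^bsub>T\<^esub>"
    | (middle) u where "i = 0" "u \<in> carrier middle" "x = mk \<zero>\<^bsub>T\<^esub> u \<zero>\<^bsub>T\<^esub>"
    | (plus) b where "i = 1" "b \<in> carrier T" "x = mk \<zero>\<^bsub>T\<^esub> \<zero>\<^bsub>middle\<^esub> b"
    | (trivial) "\<bar>i\<bar> > 1" "x = mk \<zero>\<^bsub>T\<^esub> \<zero>\<^bsub>middle\<^esub> \<zero>\<^bsub>T\<^esub>"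
proof -
  have "i = -1 \<or> i = 0 \<or> i = 1 \<or> \<bar>i\<bar> > 1" by linarith
  then show ?thesis using assms that by (elim disjE) (auto simp: grade_lie)
qed

lemma proj_mk:
  assumes "a \<in> carrier T" "u \<in> carrier middle" "b \<in> carrier T"
  shows "pm (mk a u b) = a" "pz (mk a u b) = u" "pp (mk a u b) = b"
  using assms inv_into_f_f[OF j_inj, of "(a, u, b)"] by (simp_all add: pm_def pz_def pp_def prj_def mk_def)

lemma mk_closed: "\<lbrakk>a \<in> carrier T; u \<in> carrier middle; b \<in> carrier T\<rbrakk> \<Longrightarrow> mk a u b \<in> carrier lie"
  by (simp add: lie_def mk_def)

lemma lie_cases:
  assumes "x \<in> carrier lie"
  obtains a u b where "a \<in> carrier T" "u \<in> carrier middle" "b \<in> carrier T" "x = mk a u b"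
  using assms by (auto simp: lie_def mk_def)

lemma proj_closed:
  assumes "x \<in> carrier lie"
  shows "pm x \<in> carrier T" "pz x \<in> carrier middle" "pp x \<in> carrier T"
  using lie_cases[OF assms] proj_mk by metis+

lemma mk_proj: "x \<in> carrier lie \<Longrightarrow> mk (pm x) (pz x) (pp x) = x"
  by (erule lie_cases) (simp add: proj_mk)

lemma lie_module: "module R lie"
proof (rule moduleI[OF R.is_cring])
  show "abelian_group lie"
  proof (rule abelian_groupI)
    fix x assume x: "x \<in> carrier lie"
    then show "\<exists>y\<in>carrier lie. y \<oplus>\<^bsub>lie\<^esub> x = \<zero>\<^bsub>lie\<^esub>"
      using proj_closed[OF x]
      by (intro bexI[of _ "mk (\<ominus>\<^bsub>T\<^esub> pm x) (\<ominus>\<^bsub>middle\<^esub> pz x) (\<ominus>\<^bsub>T\<^esub> pp x)"])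
         (simp_all add: lie_simps proj_mk mk_closed M.l_neg U.l_neg)
  qed (simp_all add: lie_simps proj_closed proj_mk mk_closed mk_proj M.a_ac U.a_ac)
qed (simp_all add: lie_simps proj_closed proj_mk mk_closed mk_proj smult_l_distr smult_r_distr
      U.smult_l_distr U.smult_r_distr smult_assoc1 U.smult_assoc1)

sublocale Lie: module R lie
  by (rule lie_module)

lemma proj_lin: "linear_map R lie T pm" "linear_map R lie middle pz" "linear_map R lie T pp"
  by (auto intro!: linear_mapI simp: lie_simps proj_closed proj_mk)

lemma mk_lin:
  assumes "linear_map R N T f" "linear_map R N middle g" "linear_map R N T h"
  shows "linear_map R N lie (\<lambda>x. mk (f x) (g x) (h x))"
  using linear_map_closed[OF assms(1)] linear_map_closed[OF assms(2)] linear_map_closed[OF assms(3)]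
  by (intro linear_mapI)
     (simp_all add: lie_simps proj_mk mk_closed linear_map_add[OF assms(1)] linear_map_add[OF assms(2)]
       linear_map_add[OF assms(3)] linear_map_smult[OF assms(1)] linear_map_smult[OF assms(2)]
       linear_map_smult[OF assms(3)])

text \<open>Skew-symmetry gives \<open>2 [u, u] = 0\<close>; this is where the characteristic must differ from \<open>2\<close>.\<close>

lemma mbracket_self: "u \<in> carrier middle \<Longrightarrow> mbracket u u = \<zero>\<^bsub>middle\<^esub>"
proof -
  assume u: "u \<in> carrier middle"
  let ?x = "mbracket u u" and ?two = "\<one>\<^bsub>R\<^esub> \<oplus>\<^bsub>R\<^esub> \<one>\<^bsub>R\<^esub>"
  have x: "?x \<in> carrier middle" using carr u by simp
  have "?two \<odot>\<^bsub>middle\<^esub> ?x = ?x \<oplus>\<^bsub>middle\<^esub> ?x" using x by (simp add: U.smult_l_distr)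
  also have "\<dots> = \<ominus>\<^bsub>middle\<^esub> ?x \<oplus>\<^bsub>middle\<^esub> ?x" using mbracket_antisym[OF u u] by simp
  finally have "?two \<odot>\<^bsub>middle\<^esub> ?x = \<zero>\<^bsub>middle\<^esub>" using x by (simp add: U.l_neg)
  then have "inv\<^bsub>R\<^esub> ?two \<odot>\<^bsub>middle\<^esub> (?two \<odot>\<^bsub>middle\<^esub> ?x) = \<zero>\<^bsub>middle\<^esub>" using two_unit by simp
  then show ?thesis using x two_unit by (simp add: U.smult_assoc1[symmetric] R.Units_l_inv)
qed

lemma lie_jacobi:
  assumes "x \<in> carrier lie" "y \<in> carrier lie" "z \<in> carrier lie"
  shows "bracket lie x (bracket lie y z) \<oplus>\<^bsub>lie\<^esub> bracket lie y (bracket lie z x)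
          \<oplus>\<^bsub>lie\<^esub> bracket lie z (bracket lie x y) = \<zero>\<^bsub>lie\<^esub>"
  using assms
proof (elim lie_cases)
  fix a1 u1 b1 a2 u2 b2 a3 u3 b3
  assume *: "x = mk a1 u1 b1" "y = mk a2 u2 b2" "z = mk a3 u3 b3"
  assume a: "a1 \<in> carrier T" "a2 \<in> carrier T" "a3 \<in> carrier T"
    and u: "u1 \<in> carrier middle" "u2 \<in> carrier middle" "u3 \<in> carrier middle"
    and b: "b1 \<in> carrier T" "b2 \<in> carrier T" "b3 \<in> carrier T"
  note cl = a u b carr M.minus_closed U.minus_closed U.a_closed
  \<comment> \<open>\<open>P\<close>, \<open>S\<close> and \<open>Q\<close> are the parts of a double bracket in degrees \<open>-1\<close>, \<open>0\<close> and \<open>1\<close>, expanded until every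
    term of their cyclic sums has a partner of opposite sign. The only terms of another kind are
    the double brackets in \<open>S\<close>, which cancel by the Jacobi identity of the middle component.\<close>
  define P where "P u v w a b c b' c' = (mact u (mact v c) \<ominus>\<^bsub>T\<^esub> mact u (mact w b))
     \<ominus>\<^bsub>T\<^esub> ((mact v (mact w a) \<ominus>\<^bsub>T\<^esub> mact w (mact v a)) \<oplus>\<^bsub>T\<^esub> (mact (tens b c') a \<ominus>\<^bsub>T\<^esub> mact (tens c b') a))"
    for u v w a b c b' c'
  define Q where "Q u v w a b c b' c' = (coact u (coact v c') \<ominus>\<^bsub>T\<^esub> coact u (coact w b'))
     \<ominus>\<^bsub>T\<^esub> ((coact v (coact w a) \<ominus>\<^bsub>T\<^esub> coact w (coact v a)) \<oplus>\<^bsub>T\<^esub> (coact (tens b c') a \<ominus>\<^bsub>T\<^esub> coact (tens c b') a))"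
    for u v w a b c b' c'
  define S where "S u v w a b c a' b' c' = mbracket u (mbracket v w)
     \<oplus>\<^bsub>middle\<^esub> (((tens (mact u b) c' \<oplus>\<^bsub>middle\<^esub> tens b (coact u c'))
        \<ominus>\<^bsub>middle\<^esub> (tens (mact u c) b' \<oplus>\<^bsub>middle\<^esub> tens c (coact u b')))
     \<oplus>\<^bsub>middle\<^esub> ((tens a (coact v c') \<ominus>\<^bsub>middle\<^esub> tens a (coact w b'))
        \<ominus>\<^bsub>middle\<^esub> (tens (mact v c) a' \<ominus>\<^bsub>middle\<^esub> tens (mact w b) a')))"
    for u v w a b c a' b' c'
  have mact_br: "mact (mbracket v w) a = mact v (mact w a) \<ominus>\<^bsub>T\<^esub> mact w (mact v a)"
    if m: "v \<in> carrier middle" "w \<in> carrier middle" "a \<in> carrier T" for v w a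
  proof -
    have "mact v (mact w a) \<ominus>\<^bsub>T\<^esub> mact w (mact v a) = (mact (mbracket v w) a \<oplus>\<^bsub>T\<^esub> mact w (mact v a)) \<ominus>\<^bsub>T\<^esub> mact w (mact v a)"
      using act_mbracket[OF m] by simp
    also have "\<dots> = mact (mbracket v w) a" using m carr by (simp add: M.minus_eq M.a_assoc M.r_neg)
    finally show ?thesis by simp
  qed
  have coact_br: "coact (mbracket v w) a = coact v (coact w a) \<ominus>\<^bsub>T\<^esub> coact w (coact v a)"
    if m: "v \<in> carrier middle" "w \<in> carrier middle" "a \<in> carrier T" for v w a
  proof -
    have "coact v (coact w a) \<ominus>\<^bsub>T\<^esub> coact w (coact v a) = (coact (mbracket v w) a \<oplus>\<^bsub>T\<^esub> coact w (coact v a)) \<ominus>\<^bsub>T\<^esub> coact w (coact v a)"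
      using coact_mbracket[OF m] by simp
    also have "\<dots> = coact (mbracket v w) a" using m carr by (simp add: M.minus_eq M.a_assoc M.r_neg)
    finally show ?thesis by simp
  qed
  have dbl: "bracket lie (mk a u a') (bracket lie (mk b v b') (mk c w c'))
    = mk (P u v w a b c b' c') (S u v w a b c a' b' c') (Q u v w a' b c b' c')"
    if "a \<in> carrier T" "b \<in> carrier T" "c \<in> carrier T" "a' \<in> carrier T" "b' \<in> carrier T" "c' \<in> carrier T"
      "u \<in> carrier middle" "v \<in> carrier middle" "w \<in> carrier middle" for a b c a' b' c' u v w
    using that carr unfolding lie_simps(4) P_def Q_def S_def
    by (simp add: proj_mk linear_map_add[OF act_lin1] linear_map_add[OF coact_lin1] linear_map_add[OF mbracket_lin2]
       linear_map_minus[OF module_axioms module_axioms act_lin2] linear_map_minus[OF U.module_axioms module_axioms act_lin1]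
       linear_map_minus[OF module_axioms module_axioms coact_lin2] linear_map_minus[OF U.module_axioms module_axioms coact_lin1]
       linear_map_minus[OF U.module_axioms U.module_axioms mbracket_lin2]
       linear_map_minus[OF module_axioms U.module_axioms tens_lin1] linear_map_minus[OF module_axioms U.module_axioms tens_lin2]
       mact_br coact_br mbracket_tens U.a_assoc)
  have Pc: "P u v w a b c b' c' \<in> carrier T" "Q u v w a b c b' c' \<in> carrier T"
    if "a \<in> carrier T" "b \<in> carrier T" "c \<in> carrier T" "b' \<in> carrier T" "c' \<in> carrier T"
      "u \<in> carrier middle" "v \<in> carrier middle" "w \<in> carrier middle" for a b c b' c' u v w
    unfolding P_def Q_def using that carr by simp_all
  have Sc: "S u v w a b c a' b' c' \<in> carrier middle"
    if "a \<in> carrier T" "b \<in> carrier T" "c \<in> carrier T" "a' \<in> carrier T" "b' \<in> carrier T" "c' \<in> carrier T"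
      "u \<in> carrier middle" "v \<in> carrier middle" "w \<in> carrier middle" for a b c a' b' c' u v w
    unfolding S_def using that carr by simp
  have abel9: "((A \<ominus>\<^bsub>T\<^esub> B) \<ominus>\<^bsub>T\<^esub> ((C \<ominus>\<^bsub>T\<^esub> D) \<oplus>\<^bsub>T\<^esub> (X \<ominus>\<^bsub>T\<^esub> Y))) \<oplus>\<^bsub>T\<^esub>
     ((C \<ominus>\<^bsub>T\<^esub> E) \<ominus>\<^bsub>T\<^esub> ((F \<ominus>\<^bsub>T\<^esub> B) \<oplus>\<^bsub>T\<^esub> (Z \<ominus>\<^bsub>T\<^esub> X))) \<oplus>\<^bsub>T\<^esub>
     ((F \<ominus>\<^bsub>T\<^esub> D) \<ominus>\<^bsub>T\<^esub> ((A \<ominus>\<^bsub>T\<^esub> E) \<oplus>\<^bsub>T\<^esub> (Y \<ominus>\<^bsub>T\<^esub> Z))) = \<zero>\<^bsub>T\<^esub>"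
    if "A \<in> carrier T" "B \<in> carrier T" "C \<in> carrier T" "D \<in> carrier T" "E \<in> carrier T" "F \<in> carrier T"
      "X \<in> carrier T" "Y \<in> carrier T" "Z \<in> carrier T" for A B C D E F X Y Z
    using that by (simp add: M.difference_simps M.a_ac)
  have abel9': "((A \<ominus>\<^bsub>T\<^esub> B) \<ominus>\<^bsub>T\<^esub> ((C \<ominus>\<^bsub>T\<^esub> D) \<oplus>\<^bsub>T\<^esub> (X \<ominus>\<^bsub>T\<^esub> Y))) \<oplus>\<^bsub>T\<^esub>
     ((C \<ominus>\<^bsub>T\<^esub> E) \<ominus>\<^bsub>T\<^esub> ((F \<ominus>\<^bsub>T\<^esub> B) \<oplus>\<^bsub>T\<^esub> (Y \<ominus>\<^bsub>T\<^esub> Z))) \<oplus>\<^bsub>T\<^esub>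
     ((F \<ominus>\<^bsub>T\<^esub> D) \<ominus>\<^bsub>T\<^esub> ((A \<ominus>\<^bsub>T\<^esub> E) \<oplus>\<^bsub>T\<^esub> (Z \<ominus>\<^bsub>T\<^esub> X))) = \<zero>\<^bsub>T\<^esub>"
    if "A \<in> carrier T" "B \<in> carrier T" "C \<in> carrier T" "D \<in> carrier T" "E \<in> carrier T" "F \<in> carrier T"
      "X \<in> carrier T" "Y \<in> carrier T" "Z \<in> carrier T" for A B C D E F X Y Z
    using that by (simp add: M.difference_simps M.a_ac)
  have P0: "P u1 u2 u3 a1 a2 a3 b2 b3 \<oplus>\<^bsub>T\<^esub> P u2 u3 u1 a2 a3 a1 b3 b1 \<oplus>\<^bsub>T\<^esub> P u3 u1 u2 a3 a1 a2 b1 b2 = \<zero>\<^bsub>T\<^esub>"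
    unfolding P_def act_tens_sym[OF a(1) b(3) a(2)] act_tens_sym[OF a(3) b(2) a(1)] act_tens_sym[OF a(2) b(1) a(3)]
    by (rule abel9) (use a u b carr in simp_all)
  have Q0: "Q u1 u2 u3 b1 a2 a3 b2 b3 \<oplus>\<^bsub>T\<^esub> Q u2 u3 u1 b2 a3 a1 b3 b1 \<oplus>\<^bsub>T\<^esub> Q u3 u1 u2 b3 a1 a2 b1 b2 = \<zero>\<^bsub>T\<^esub>"
    unfolding Q_def coact_tens_sym[OF a(2) b(3) b(1)] coact_tens_sym[OF a(3) b(1) b(2)] coact_tens_sym[OF a(1) b(2) b(3)]
    by (rule abel9') (use a u b carr in simp_all)
  have S0: "S u1 u2 u3 a1 a2 a3 b1 b2 b3 \<oplus>\<^bsub>middle\<^esub> S u2 u3 u1 a2 a3 a1 b2 b3 b1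
      \<oplus>\<^bsub>middle\<^esub> S u3 u1 u2 a3 a1 a2 b3 b1 b2 = \<zero>\<^bsub>middle\<^esub>"
  proof -
    have gen: "(D1 \<oplus>\<^bsub>middle\<^esub> (((p1 \<oplus>\<^bsub>middle\<^esub> q1) \<ominus>\<^bsub>middle\<^esub> (p2 \<oplus>\<^bsub>middle\<^esub> q2)) \<oplus>\<^bsub>middle\<^esub> ((q3 \<ominus>\<^bsub>middle\<^esub> q4) \<ominus>\<^bsub>middle\<^esub> (p3 \<ominus>\<^bsub>middle\<^esub> p4))))
      \<oplus>\<^bsub>middle\<^esub> (D2 \<oplus>\<^bsub>middle\<^esub> (((p3 \<oplus>\<^bsub>middle\<^esub> q5) \<ominus>\<^bsub>middle\<^esub> (p5 \<oplus>\<^bsub>middle\<^esub> q3)) \<oplus>\<^bsub>middle\<^esub> ((q6 \<ominus>\<^bsub>middle\<^esub> q1) \<ominus>\<^bsub>middle\<^esub> (p6 \<ominus>\<^bsub>middle\<^esub> p2))))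
      \<oplus>\<^bsub>middle\<^esub> (D3 \<oplus>\<^bsub>middle\<^esub> (((p6 \<oplus>\<^bsub>middle\<^esub> q4) \<ominus>\<^bsub>middle\<^esub> (p4 \<oplus>\<^bsub>middle\<^esub> q6)) \<oplus>\<^bsub>middle\<^esub> ((q2 \<ominus>\<^bsub>middle\<^esub> q5) \<ominus>\<^bsub>middle\<^esub> (p1 \<ominus>\<^bsub>middle\<^esub> p5))))
      = D1 \<oplus>\<^bsub>middle\<^esub> D2 \<oplus>\<^bsub>middle\<^esub> D3"
      if "D1 \<in> carrier middle" "D2 \<in> carrier middle" "D3 \<in> carrier middle"
        "p1 \<in> carrier middle" "p2 \<in> carrier middle" "p3 \<in> carrier middle"
        "p4 \<in> carrier middle" "p5 \<in> carrier middle" "p6 \<in> carrier middle"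
        "q1 \<in> carrier middle" "q2 \<in> carrier middle" "q3 \<in> carrier middle"
        "q4 \<in> carrier middle" "q5 \<in> carrier middle" "q6 \<in> carrier middle"
      for D1 D2 D3 p1 p2 p3 p4 p5 p6 q1 q2 q3 q4 q5 q6
      using that by (simp add: U.difference_simps U.a_ac)
    show ?thesis
      unfolding S_def mbracket_jacobi[OF u, symmetric]
      by (rule gen) (use a u b carr in simp_all)
  qed
  show ?thesis
    unfolding * dbl[OF a b u] dbl[OF a(2,3,1) b(2,3,1) u(2,3,1)] dbl[OF a(3,1,2) b(3,1,2) u(3,1,2)]
    using Pc Sc a b u P0 Q0 S0 by (simp add: lie_simps(1,2) proj_mk)
qed

lemma lie_lie_algebra: "lie_algebra R lie"
proof
  fix y assume y: "y \<in> carrier lie"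
  note p = proj_closed[OF y]
  show "linear_map R lie lie (\<lambda>x. bracket lie x y)" "linear_map R lie lie (bracket lie y)"
    unfolding lie_simps(4)
    by (intro mk_lin linear_map_diff linear_map_plus lie_module module_axioms U.module_axioms
        linear_map_comp[OF proj_lin(2) act_lin1] linear_map_comp[OF proj_lin(1) act_lin2]
        linear_map_comp[OF proj_lin(2) coact_lin1] linear_map_comp[OF proj_lin(3) coact_lin2]
        linear_map_comp[OF proj_lin(2) mbracket_lin1] linear_map_comp[OF proj_lin(2) mbracket_lin2]
        linear_map_comp[OF proj_lin(1) tens_lin1] linear_map_comp[OF proj_lin(3) tens_lin2] p)+
  show "bracket lie y y = \<zero>\<^bsub>lie\<^esub>"
    using p carr by (simp add: lie_simps mbracket_self M.minus_eq U.minus_eq M.r_neg U.r_neg)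
qed (rule lie_jacobi)

lemma mk_inject:
  assumes "a \<in> carrier T" "u \<in> carrier middle" "b \<in> carrier T"
    "a' \<in> carrier T" "u' \<in> carrier middle" "b' \<in> carrier T"
  shows "mk a u b = mk a' u' b' \<longleftrightarrow> a = a' \<and> u = u' \<and> b = b'"
  using proj_mk[OF assms(1-3)] proj_mk[OF assms(4-6)] by metis

lemma act_zeros:
  "a \<in> carrier T \<Longrightarrow> mact \<zero>\<^bsub>middle\<^esub> a = \<zero>\<^bsub>T\<^esub>" "u \<in> carrier middle \<Longrightarrow> mact u \<zero>\<^bsub>T\<^esub> = \<zero>\<^bsub>T\<^esub>"
  "a \<in> carrier T \<Longrightarrow> coact \<zero>\<^bsub>middle\<^esub> a = \<zero>\<^bsub>T\<^esub>" "u \<in> carrier middle \<Longrightarrow> coact u \<zero>\<^bsub>T\<^esub> = \<zero>\<^bsub>T\<^esub>"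
  "u \<in> carrier middle \<Longrightarrow> mbracket u \<zero>\<^bsub>middle\<^esub> = \<zero>\<^bsub>middle\<^esub>"
  "u \<in> carrier middle \<Longrightarrow> mbracket \<zero>\<^bsub>middle\<^esub> u = \<zero>\<^bsub>middle\<^esub>"
  "a \<in> carrier T \<Longrightarrow> tens a \<zero>\<^bsub>T\<^esub> = \<zero>\<^bsub>middle\<^esub>" "a \<in> carrier T \<Longrightarrow> tens \<zero>\<^bsub>T\<^esub> a = \<zero>\<^bsub>middle\<^esub>"
  "star \<zero>\<^bsub>middle\<^esub> = \<zero>\<^bsub>middle\<^esub>"
  using linear_map_zero[OF U.module_axioms module_axioms act_lin1] linear_map_zero[OF module_axioms module_axioms act_lin2]
    linear_map_zero[OF U.module_axioms module_axioms coact_lin1] linear_map_zero[OF module_axioms module_axioms coact_lin2]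
    linear_map_zero[OF U.module_axioms U.module_axioms mbracket_lin1] linear_map_zero[OF U.module_axioms U.module_axioms mbracket_lin2]
    linear_map_zero[OF module_axioms U.module_axioms tens_lin1] linear_map_zero[OF module_axioms U.module_axioms tens_lin2]
    linear_map_zero[OF U.module_axioms U.module_axioms star_lin]
  by auto

lemmas lie_eval = lie_simps proj_mk act_zeros carr M.minus_eq U.minus_eq

lemma lie_graded: "graded_module R lie (grade lie)"
proof (rule graded_module_threeI[OF lie_module])
  fix i :: int
  show "submodule (grade lie i) R lie"
  proof (rule Lie.submoduleI2)
    show "grade lie i \<subseteq> carrier lie" by (auto elim!: gradeE simp: mk_closed)
    show "\<zero>\<^bsub>lie\<^esub> \<in> grade lie i" by (simp add: lie_simps(1) gradeI)
    show "x \<oplus>\<^bsub>lie\<^esub> y \<in> grade lie i" if "x \<in> grade lie i" "y \<in> grade lie i" for x y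
      using that by (elim gradeE) (simp_all add: lie_simps(2) proj_mk gradeI)
    show "r \<odot>\<^bsub>lie\<^esub> x \<in> grade lie i" if "r \<in> carrier R" "x \<in> grade lie i" for r x
      using that by (elim gradeE) (simp_all add: lie_simps(3) proj_mk gradeI)
  qed
  show "grade lie i = {\<zero>\<^bsub>lie\<^esub>}" if "\<bar>i\<bar> > 1" using that by (simp add: grade_lie lie_simps)
next
  fix x assume "x \<in> carrier lie"
  then show "\<exists>a\<in>grade lie (-1). \<exists>b\<in>grade lie 0. \<exists>c\<in>grade lie 1. x = a \<oplus>\<^bsub>lie\<^esub> b \<oplus>\<^bsub>lie\<^esub> c"
  proof (rule lie_cases)
    fix a u b assume *: "a \<in> carrier T" "u \<in> carrier middle" "b \<in> carrier T" "x = mk a u b"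
    show ?thesis
    proof (intro bexI)
      show "x = mk a \<zero>\<^bsub>middle\<^esub> \<zero>\<^bsub>T\<^esub> \<oplus>\<^bsub>lie\<^esub> mk \<zero>\<^bsub>T\<^esub> u \<zero>\<^bsub>T\<^esub> \<oplus>\<^bsub>lie\<^esub> mk \<zero>\<^bsub>T\<^esub> \<zero>\<^bsub>middle\<^esub> b"
        using * by (simp add: lie_simps proj_mk)
    qed (use * in \<open>auto simp: grade_lie\<close>)
  qed
next
  fix a b c a' b' c'
  assume "a \<in> grade lie (-1)" "b \<in> grade lie 0" "c \<in> grade lie 1" "a' \<in> grade lie (-1)" "b' \<in> grade lie 0"
    "c' \<in> grade lie 1" "a \<oplus>\<^bsub>lie\<^esub> b \<oplus>\<^bsub>lie\<^esub> c = a' \<oplus>\<^bsub>lie\<^esub> b' \<oplus>\<^bsub>lie\<^esub> c'"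
  then show "a = a' \<and> b = b' \<and> c = c'"
    by (auto simp: grade_lie lie_simps proj_mk mk_inject)
qed

lemma lie_three_graded: "three_graded_lie_algebra R lie"
proof (intro three_graded_lie_algebra.intro three_graded_lie_algebra_axioms.intro lie_lie_algebra lie_graded)
  fix x y i k assume x: "x \<in> grade lie i" and y: "y \<in> grade lie k"
  show "bracket lie x y \<in> grade lie (i + k)"
    using x y by (elim gradeE) (simp_all add: lie_eval gradeI)
next
  show "\<bar>i\<bar> > 1 \<Longrightarrow> grade lie i = {\<zero>\<^bsub>lie\<^esub>}" for i by (simp add: grade_lie lie_simps)
qed

lemma lie_involution: "anti_graded_involution R lie (invol lie)"
  unfolding anti_graded_involution_def lie_hom_def
proof (intro conjI ballI allI)
  have "linear_map R lie lie (\<lambda>x. mk (pp x) (\<ominus>\<^bsub>middle\<^esub> star (pz x)) (pm x))"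
    by (intro mk_lin proj_lin linear_map_uminus[OF lie_module U.module_axioms] linear_map_comp[OF proj_lin(2) star_lin])
  then show "linear_map R lie lie (invol lie)" by (simp add: lie_def)
next
  fix x y assume "x \<in> carrier lie" "y \<in> carrier lie"
  then show "invol lie (bracket lie x y) = bracket lie (invol lie x) (invol lie y)"
  proof (elim lie_cases)
    fix a u b c v d
    assume *: "a \<in> carrier T" "u \<in> carrier middle" "b \<in> carrier T" "x = mk a u b"
      "c \<in> carrier T" "v \<in> carrier middle" "d \<in> carrier T" "y = mk c v d"
    have ax: "\<ominus>\<^bsub>middle\<^esub> (\<ominus>\<^bsub>middle\<^esub> m \<oplus>\<^bsub>middle\<^esub> (p \<ominus>\<^bsub>middle\<^esub> q)) = m \<oplus>\<^bsub>middle\<^esub> (q \<ominus>\<^bsub>middle\<^esub> p)"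
      if "m \<in> carrier middle" "p \<in> carrier middle" "q \<in> carrier middle" for m p q
      using that by algebra
    have ma: "mact (\<ominus>\<^bsub>middle\<^esub> star w) e = coact w e" "coact (\<ominus>\<^bsub>middle\<^esub> star w) e = mact w e"
      if "w \<in> carrier middle" "e \<in> carrier T" for w e
      using that carr linear_map_inv[OF U.module_axioms module_axioms act_lin1]
        linear_map_inv[OF U.module_axioms module_axioms coact_lin1]
      by (simp_all add: coact_def star_star)
    have mm: "mbracket (\<ominus>\<^bsub>middle\<^esub> star u) (\<ominus>\<^bsub>middle\<^esub> star v) = mbracket (star u) (star v)"
      using * carr linear_map_inv[OF U.module_axioms U.module_axioms mbracket_lin1]
        linear_map_inv[OF U.module_axioms U.module_axioms mbracket_lin2] by simp
    have st: "star (mbracket u v \<oplus>\<^bsub>middle\<^esub> (tens a d \<ominus>\<^bsub>middle\<^esub> tens c b))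
      = \<ominus>\<^bsub>middle\<^esub> mbracket (star u) (star v) \<oplus>\<^bsub>middle\<^esub> (tens d a \<ominus>\<^bsub>middle\<^esub> tens b c)"
      using * carr by (simp add: linear_map_add[OF star_lin] linear_map_minus[OF U.module_axioms U.module_axioms star_lin]
          star_mbracket star_tens)
    show ?thesis
      using * carr by (simp add: lie_simps proj_mk ma mm st ax)
  qed
next
  fix x assume "x \<in> carrier lie"
  then show "invol lie (invol lie x) = x"
    by (elim lie_cases) (simp add: lie_simps proj_mk star_closed star_star
      linear_map_inv[OF U.module_axioms U.module_axioms star_lin])
next
  fix i :: int
  show "invol lie ` grade lie i \<subseteq> grade lie (- i)"
    by (auto elim!: gradeE simp: lie_simps(5) proj_mk act_zeros star_closed gradeI)
qed

lemma lie_bracket_pm: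
  "\<lbrakk>a \<in> carrier T; b \<in> carrier T\<rbrakk> \<Longrightarrow>
    bracket lie (mk a \<zero>\<^bsub>middle\<^esub> \<zero>\<^bsub>T\<^esub>) (mk \<zero>\<^bsub>T\<^esub> \<zero>\<^bsub>middle\<^esub> b) = mk \<zero>\<^bsub>T\<^esub> (tens a b) \<zero>\<^bsub>T\<^esub>"
  by (simp add: lie_eval)

lemma lie_bracket_0m:
  "\<lbrakk>u \<in> carrier middle; a \<in> carrier T\<rbrakk> \<Longrightarrow>
    bracket lie (mk \<zero>\<^bsub>T\<^esub> u \<zero>\<^bsub>T\<^esub>) (mk a \<zero>\<^bsub>middle\<^esub> \<zero>\<^bsub>T\<^esub>) = mk (mact u a) \<zero>\<^bsub>middle\<^esub> \<zero>\<^bsub>T\<^esub>"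
  by (simp add: lie_eval)

lemma lie_bracket_0p:
  "\<lbrakk>u \<in> carrier middle; b \<in> carrier T\<rbrakk> \<Longrightarrow>
    bracket lie (mk \<zero>\<^bsub>T\<^esub> u \<zero>\<^bsub>T\<^esub>) (mk \<zero>\<^bsub>T\<^esub> \<zero>\<^bsub>middle\<^esub> b) = mk \<zero>\<^bsub>T\<^esub> \<zero>\<^bsub>middle\<^esub> (coact u b)"
  by (simp add: lie_eval)

lemma mk_zero_lin:
  "linear_map R T lie (\<lambda>a. mk a \<zero>\<^bsub>middle\<^esub> \<zero>\<^bsub>T\<^esub>)" "linear_map R middle lie (\<lambda>u. mk \<zero>\<^bsub>T\<^esub> u \<zero>\<^bsub>T\<^esub>)"
  "linear_map R T lie (\<lambda>b. mk \<zero>\<^bsub>T\<^esub> \<zero>\<^bsub>middle\<^esub> b)"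
  by (intro mk_lin linear_map_const_zero U.module_axioms module_axioms; simp add: linear_map_def)+

lemma lie_zero_perfect: "zero_perfect R lie"
  unfolding zero_perfect_def
proof
  let ?S = "{bracket lie x y | x y. x \<in> grade lie (- 1) \<and> y \<in> grade lie 1}"
  have S: "?S = {mk \<zero>\<^bsub>T\<^esub> (tens a b) \<zero>\<^bsub>T\<^esub> | a b. a \<in> carrier T \<and> b \<in> carrier T}"
    by (auto simp: grade_lie lie_bracket_pm; metis lie_bracket_pm)
  have Sc: "?S \<subseteq> grade lie 0" unfolding S by (auto simp: grade_lie tens_closed)
  then have Scc: "?S \<subseteq> carrier lie" using grade_subset[OF lie_graded] by blast
  show "lin_span R lie ?S \<subseteq> grade lie 0"
    by (rule lin_span_least[OF graded_submodule[OF lie_graded] Sc])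
  show "grade lie 0 \<subseteq> lin_span R lie ?S"
  proof
    fix x assume "x \<in> grade lie 0"
    then obtain u where u: "x = mk \<zero>\<^bsub>T\<^esub> u \<zero>\<^bsub>T\<^esub>" "u \<in> carrier middle" by (auto simp: grade_lie)
    let ?G = "presented_gen R (carrier T \<times> carrier T) middle_rels ` (carrier T \<times> carrier T)"
    have "mk \<zero>\<^bsub>T\<^esub> u \<zero>\<^bsub>T\<^esub> \<in> lin_span R lie ?S"
    proof (rule linear_map_span_subset[OF U.module_axioms lie_module mk_zero_lin(2) lin_span_submodule[OF lie_module Scc]])
      show "?G \<subseteq> carrier middle" using tens_closed by (auto simp: tens_def)
      show "u \<in> lin_span R middle ?G"
        using presented_module_span[OF R.is_cring middle_rels_closed] u(2) by (auto simp: middle_def)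
      fix g assume "g \<in> ?G"
      then obtain a b where "g = tens a b" "a \<in> carrier T" "b \<in> carrier T" by (auto simp: tens_def)
      then show "mk \<zero>\<^bsub>T\<^esub> g \<zero>\<^bsub>T\<^esub> \<in> lin_span R lie ?S" unfolding S by (auto intro!: lin_span_incl)
    qed
    then show "x \<in> lin_span R lie ?S" by (simp add: u(1))
  qed
qed

text \<open>The relation of the criterion, written for the generators, is the last defining relation of the
  middle component, which is therefore universal in the required sense.\<close>

lemma lie_H2: "zero_module (H2_gr_homology R lie)"
proof -
  interpret L: three_graded_lie_algebra R lie by (rule lie_three_graded)
  show ?thesis
  proof (rule L.H2_zero_criterion[OF lie_zero_perfect])
    fix N :: "('k, ('b list \<Rightarrow> 'k) set set) module" and \<phi>
    assume N: "module R N"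
      and bil: "bilinear_map R (lie\<lparr>carrier := grade lie (-1)\<rparr>) (lie\<lparr>carrier := grade lie 1\<rparr>) N \<phi>"
      and rel: "\<And>a b c d. \<lbrakk>a \<in> grade lie (-1); b \<in> grade lie 1; c \<in> grade lie (-1); d \<in> grade lie 1\<rbrakk> \<Longrightarrow>
         \<phi> (bracket lie (bracket lie a b) c) d \<oplus>\<^bsub>N\<^esub> \<phi> c (bracket lie (bracket lie a b) d)
         \<oplus>\<^bsub>N\<^esub> (\<phi> (bracket lie (bracket lie c d) a) b \<oplus>\<^bsub>N\<^esub> \<phi> a (bracket lie (bracket lie c d) b)) = \<zero>\<^bsub>N\<^esub>"
    let ?m = "\<lambda>a. mk a \<zero>\<^bsub>middle\<^esub> \<zero>\<^bsub>T\<^esub>" and ?p = "\<lambda>b. mk \<zero>\<^bsub>T\<^esub> \<zero>\<^bsub>middle\<^esub> b"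
    have gm: "?m a \<in> grade lie (-1)" "?p a \<in> grade lie 1" if "a \<in> carrier T" for a
      using that by (auto simp: grade_lie)
    have ml: "linear_map R T (lie\<lparr>carrier := grade lie (-1)\<rparr>) ?m" "linear_map R T (lie\<lparr>carrier := grade lie 1\<rparr>) ?p"
      using linear_map_into_submodule[OF mk_zero_lin(1)] linear_map_into_submodule[OF mk_zero_lin(3)] gm by auto
    define \<theta> where "\<theta> a b = \<phi> (?m a) (?p b)" for a b
    have \<theta>: "bilinear_map R T T N \<theta>"
      unfolding bilinear_map_def \<theta>_def
      using linear_map_comp[OF ml(1) bilinear_mapD(1)[OF bil]] linear_map_comp[OF ml(2) bilinear_mapD(2)[OF bil]] gm
      by simp
    interpret N: module R N by (rule N)
    have neg: "\<theta> a (\<ominus>\<^bsub>T\<^esub> b) = \<ominus>\<^bsub>N\<^esub> \<theta> a b" if "a \<in> carrier T" "b \<in> carrier T" for a b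
      using linear_map_inv[OF module_axioms N bilinear_mapD(2)[OF \<theta>]] that by blast
    have "\<exists>h. linear_map R middle N h \<and> (\<forall>a\<in>carrier T. \<forall>b\<in>carrier T. h (tens a b) = \<theta> a b)"
    proof (rule middle_universal[OF N \<theta>])
      fix a b c d
      assume m: "a \<in> carrier T" "b \<in> carrier T" "c \<in> carrier T" "d \<in> carrier T"
      show "(\<theta> (triple T a b c) d \<ominus>\<^bsub>N\<^esub> \<theta> c (triple T b a d))
        \<oplus>\<^bsub>N\<^esub> (\<theta> (triple T c d a) b \<ominus>\<^bsub>N\<^esub> \<theta> a (triple T d c b)) = \<zero>\<^bsub>N\<^esub>"
        using rel[OF gm(1)[OF m(1)] gm(2)[OF m(2)] gm(1)[OF m(3)] gm(2)[OF m(4)]] m carr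
        by (simp add: lie_bracket_pm lie_bracket_0m lie_bracket_0p act_tens coact_tens \<theta>_def[symmetric] neg a_minus_def)
    qed
    then obtain h where h: "linear_map R middle N h" "\<And>a b. \<lbrakk>a \<in> carrier T; b \<in> carrier T\<rbrakk> \<Longrightarrow> h (tens a b) = \<theta> a b"
      by blast
    show "\<exists>\<psi>. linear_map R lie N \<psi> \<and>
        (\<forall>a\<in>grade lie (-1). \<forall>b\<in>grade lie 1. \<psi> (bracket lie a b) = \<phi> a b)"
      using linear_map_comp[OF proj_lin(2) h(1)] h(2) carr
      by (intro exI[of _ "\<lambda>x. h (pz x)"]) (auto simp: grade_lie lie_bracket_pm proj_mk \<theta>_def)
  qed
qed

lemma lie_triple:
  assumes "a \<in> carrier T" "b \<in> carrier T" "c \<in> carrier T"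
  shows "triple (jts_of lie) (mk a \<zero>\<^bsub>middle\<^esub> \<zero>\<^bsub>T\<^esub>) (mk b \<zero>\<^bsub>middle\<^esub> \<zero>\<^bsub>T\<^esub>) (mk c \<zero>\<^bsub>middle\<^esub> \<zero>\<^bsub>T\<^esub>)
    = mk (triple T a b c) \<zero>\<^bsub>middle\<^esub> \<zero>\<^bsub>T\<^esub>"
proof -
  have "invol lie (mk b \<zero>\<^bsub>middle\<^esub> \<zero>\<^bsub>T\<^esub>) = mk \<zero>\<^bsub>T\<^esub> \<zero>\<^bsub>middle\<^esub> b"
    using assms by (simp add: lie_simps(5) proj_mk act_zeros)
  then show ?thesis
    using assms by (simp add: lie_bracket_pm lie_bracket_0m act_tens tens_closed)
qed

lemma jts_iso:
  shows "(\<lambda>a\<in>carrier T. mk a \<zero>\<^bsub>middle\<^esub> \<zero>\<^bsub>T\<^esub>) \<in> jts_hom R T (jts_of lie)"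
    and "(\<lambda>x\<in>carrier (jts_of lie). pm x) \<in> jts_hom R (jts_of lie) T"
proof -
  have "linear_map R T (jts_of lie) (\<lambda>a. mk a \<zero>\<^bsub>middle\<^esub> \<zero>\<^bsub>T\<^esub>)"
    using mk_zero_lin(1) by (auto simp: linear_map_def grade_lie)
  then show "(\<lambda>a\<in>carrier T. mk a \<zero>\<^bsub>middle\<^esub> \<zero>\<^bsub>T\<^esub>) \<in> jts_hom R T (jts_of lie)"
    using linear_map_restrict[OF module_axioms] lie_triple carr by (auto simp: jts_hom_def simp del: jts_of_simps(5))
  interpret I: involutive_lie_algebra R lie
    by (intro involutive_lie_algebra.intro involutive_lie_algebra_axioms.intro lie_three_graded lie_involution)
  have "linear_map R (jts_of lie) T pm"
    using proj_lin(1) grade_subset[OF lie_graded] by (auto simp: linear_map_def)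
  from linear_map_restrict[OF I.jts_of_module this]
  show "(\<lambda>x\<in>carrier (jts_of lie). pm x) \<in> jts_hom R (jts_of lie) T"
    using lie_triple triple_closed
    by (auto simp: jts_hom_def grade_lie proj_mk jts_of_simps(1) mk_inject simp del: jts_of_simps(5))
qed

end

section \<open>The equivalence of categories\<close>

text \<open>Choose for each object \<open>S\<close> of \<open>C\<close> an isomorphism \<open>s S\<close> from \<open>S\<close> to the image of some object of \<open>D\<close>,
  with inverse \<open>s' S\<close>. The inverse functor sends \<open>f\<close> to the unique lift of \<open>s T \<circ> f \<circ> s' S\<close>. All laws
  are checked after applying the faithful functor.\<close>

lemma equivalent_categories_if_fully_faithful:
  fixes C :: "('o, 'f) category" and D :: "('p, 'g) category"
  assumes C: "is_category C" and D: "is_category D" and G: "cat_functor D C G_ob G_mor"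
    and full: "\<And>X Y f. \<lbrakk>X \<in> Obj D; Y \<in> Obj D; f \<in> Hom C (G_ob X) (G_ob Y)\<rbrakk> \<Longrightarrow> \<exists>g\<in>Hom D X Y. G_mor X Y g = f"
    and faithful: "\<And>X Y f g. \<lbrakk>X \<in> Obj D; Y \<in> Obj D; f \<in> Hom D X Y; g \<in> Hom D X Y; G_mor X Y f = G_mor X Y g\<rbrakk> \<Longrightarrow> f = g"
    and surj: "\<And>S. S \<in> Obj C \<Longrightarrow> \<exists>X\<in>Obj D. \<exists>f. is_iso C S (G_ob X) f"
  shows "equivalent_categories C D"
proof -
  interpret C: is_category C by fact
  interpret D: is_category D by fact
  interpret G: cat_functor D C G_ob G_mor by fact
  define inverse_pair where "inverse_pair S X f g \<longleftrightarrow> X \<in> Obj D \<and> f \<in> Hom C S (G_ob X) \<and> g \<in> Hom C (G_ob X) S \<and>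
     Comp C S (G_ob X) S g f = Ident C S \<and> Comp C (G_ob X) S (G_ob X) f g = Ident C (G_ob X)" for S X f g
  have ex: "\<exists>X f g. inverse_pair S X f g" if "S \<in> Obj C" for S
    using surj[OF that] unfolding is_iso_def inverse_pair_def by blast
  define F_ob where "F_ob S = (SOME X. \<exists>f g. inverse_pair S X f g)" for S
  define s where "s S = (SOME f. \<exists>g. inverse_pair S (F_ob S) f g)" for S
  define s' where "s' S = (SOME g. inverse_pair S (F_ob S) (s S) g)" for S
  have p: "inverse_pair S (F_ob S) (s S) (s' S)" if "S \<in> Obj C" for S
  proof -
    have "\<exists>f g. inverse_pair S (F_ob S) f g" unfolding F_ob_def by (rule someI_ex[OF ex[OF that]])
    then have "\<exists>g. inverse_pair S (F_ob S) (s S) g" unfolding s_def by (rule someI_ex)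
    then show ?thesis unfolding s'_def by (rule someI_ex)
  qed
  have FO: "F_ob S \<in> Obj D" and sH: "s S \<in> Hom C S (G_ob (F_ob S))" and s'H: "s' S \<in> Hom C (G_ob (F_ob S)) S"
    and s's: "Comp C S (G_ob (F_ob S)) S (s' S) (s S) = Ident C S"
    and ss': "Comp C (G_ob (F_ob S)) S (G_ob (F_ob S)) (s S) (s' S) = Ident C (G_ob (F_ob S))"
    if "S \<in> Obj C" for S
    using p[OF that] by (simp_all add: inverse_pair_def)
  note GO = G.F_Obj and GH = G.F_Hom
  define lift where "lift X Y f = (THE g. g \<in> Hom D X Y \<and> G_mor X Y g = f)" for X Y f
  have lift: "lift X Y f \<in> Hom D X Y \<and> G_mor X Y (lift X Y f) = f"
    if h: "X \<in> Obj D" "Y \<in> Obj D" "f \<in> Hom C (G_ob X) (G_ob Y)" for X Y f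
  proof -
    obtain g where g: "g \<in> Hom D X Y" "G_mor X Y g = f" using full[OF h] by blast
    show ?thesis unfolding lift_def
      by (rule theI[of _ g]) (use g faithful[OF h(1,2)] in auto)
  qed
  have lift_eq: "lift X Y f = g" if "X \<in> Obj D" "Y \<in> Obj D" "g \<in> Hom D X Y" "G_mor X Y g = f" for X Y f g
    using lift[OF that(1,2), of f] that GH[OF that(1,2,3)] faithful[OF that(1,2)] by auto
  define F_mor where "F_mor S T f = lift (F_ob S) (F_ob T)
     (Comp C (G_ob (F_ob S)) T (G_ob (F_ob T)) (s T) (Comp C (G_ob (F_ob S)) S T f (s' S)))" for S T f
  define t where "t X = lift (F_ob (G_ob X)) X (s' (G_ob X))" for X
  have conjH: "Comp C (G_ob (F_ob S)) T (G_ob (F_ob T)) (s T) (Comp C (G_ob (F_ob S)) S T f (s' S))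
      \<in> Hom C (G_ob (F_ob S)) (G_ob (F_ob T))" if "S \<in> Obj C" "T \<in> Obj C" "f \<in> Hom C S T" for S T f
    by (intro C.Comp_in_Hom sH s'H GO FO that)
  have F: "F_mor S T f \<in> Hom D (F_ob S) (F_ob T)"
    "G_mor (F_ob S) (F_ob T) (F_mor S T f)
      = Comp C (G_ob (F_ob S)) T (G_ob (F_ob T)) (s T) (Comp C (G_ob (F_ob S)) S T f (s' S))"
    if "S \<in> Obj C" "T \<in> Obj C" "f \<in> Hom C S T" for S T f
    using lift[OF FO[OF that(1)] FO[OF that(2)] conjH[OF that]] unfolding F_mor_def by blast+
  have tH: "t X \<in> Hom D (F_ob (G_ob X)) X" "G_mor (F_ob (G_ob X)) X (t X) = s' (G_ob X)" if "X \<in> Obj D" for X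
    using lift[OF FO[OF GO[OF that]] that s'H[OF GO[OF that]]] unfolding t_def by blast+
  have Gs: "Comp C S (G_ob (F_ob S)) (G_ob (F_ob T)) (G_mor (F_ob S) (F_ob T) (F_mor S T f)) (s S)
      = Comp C S T (G_ob (F_ob T)) (s T) f" if h: "S \<in> Obj C" "T \<in> Obj C" "f \<in> Hom C S T" for S T f
  proof -
    note o = GO[OF FO[OF h(1)]] GO[OF FO[OF h(2)]]
    have 1: "Comp C (G_ob (F_ob S)) S T f (s' S) \<in> Hom C (G_ob (F_ob S)) T"
      by (rule C.Comp_in_Hom[OF o(1) h(1,2) s'H[OF h(1)] h(3)])
    show ?thesis
      unfolding F(2)[OF h] C.Comp_assoc[OF h(1) o(1) h(2) o(2) sH[OF h(1)] 1 sH[OF h(2)], symmetric]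
        C.Comp_assoc[OF h(1) o(1) h(1,2) sH[OF h(1)] s'H[OF h(1)] h(3), symmetric] s's[OF h(1)]
        C.Comp_Ident_right[OF h] ..
  qed
  have s'G: "Comp C (G_ob (F_ob S)) (G_ob (F_ob T)) T (s' T) (G_mor (F_ob S) (F_ob T) (F_mor S T f))
      = Comp C (G_ob (F_ob S)) S T f (s' S)" if h: "S \<in> Obj C" "T \<in> Obj C" "f \<in> Hom C S T" for S T f
  proof -
    note o = GO[OF FO[OF h(1)]] GO[OF FO[OF h(2)]]
    have 1: "Comp C (G_ob (F_ob S)) S T f (s' S) \<in> Hom C (G_ob (F_ob S)) T"
      by (rule C.Comp_in_Hom[OF o(1) h(1,2) s'H[OF h(1)] h(3)])
    show ?thesis
      unfolding F(2)[OF h] C.Comp_assoc[OF o(1) h(2) o(2) h(2) 1 sH[OF h(2)] s'H[OF h(2)]]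
        s's[OF h(2)] C.Comp_Ident_left[OF o(1) h(2) 1] ..
  qed
  have "cat_functor C D F_ob F_mor"
  proof
    fix S assume S: "S \<in> Obj C"
    note o = GO[OF FO[OF S]]
    show "F_ob S \<in> Obj D" by (rule FO[OF S])
    show "F_mor S S (Ident C S) = Ident D (F_ob S)"
      unfolding F_mor_def
      by (rule lift_eq[OF FO[OF S] FO[OF S] D.Ident_in_Hom[OF FO[OF S]]])
         (simp add: G.F_Ident[OF FO[OF S]] C.Comp_Ident_left[OF o S s'H[OF S]] ss'[OF S])
    fix T f assume T: "T \<in> Obj C" and f: "f \<in> Hom C S T"
    show "F_mor S T f \<in> Hom D (F_ob S) (F_ob T)" by (rule F(1)[OF S T f])
    fix V g assume V: "V \<in> Obj C" and g: "g \<in> Hom C T V"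
    have gf: "Comp C S T V g f \<in> Hom C S V" by (rule C.Comp_in_Hom[OF S T V f g])
    note oT = GO[OF FO[OF T]] and oV = GO[OF FO[OF V]]
    show "F_mor S V (Comp C S T V g f) = Comp D (F_ob S) (F_ob T) (F_ob V) (F_mor T V g) (F_mor S T f)"
      unfolding F_mor_def[of S V]
    proof (rule lift_eq[OF FO[OF S] FO[OF V] D.Comp_in_Hom[OF FO[OF S] FO[OF T] FO[OF V] F(1)[OF S T f] F(1)[OF T V g]]])
      let ?fs = "Comp C (G_ob (F_ob S)) S T f (s' S)"
      have 1: "?fs \<in> Hom C (G_ob (F_ob S)) T" by (rule C.Comp_in_Hom[OF o S T s'H[OF S] f])
      have GF: "G_mor (F_ob T) (F_ob V) (F_mor T V g) \<in> Hom C (G_ob (F_ob T)) (G_ob (F_ob V))"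
        by (rule GH[OF FO[OF T] FO[OF V] F(1)[OF T V g]])
      have "G_mor (F_ob S) (F_ob V) (Comp D (F_ob S) (F_ob T) (F_ob V) (F_mor T V g) (F_mor S T f))
        = Comp C (G_ob (F_ob S)) (G_ob (F_ob T)) (G_ob (F_ob V)) (G_mor (F_ob T) (F_ob V) (F_mor T V g))
            (Comp C (G_ob (F_ob S)) T (G_ob (F_ob T)) (s T) ?fs)"
        by (simp add: G.F_Comp[OF FO[OF S] FO[OF T] FO[OF V] F(1)[OF S T f] F(1)[OF T V g]] F(2)[OF S T f])
      also have "\<dots> = Comp C (G_ob (F_ob S)) T (G_ob (F_ob V)) (Comp C T V (G_ob (F_ob V)) (s V) g) ?fs"
        by (simp add: C.Comp_assoc[OF o T oT oV 1 sH[OF T] GF] Gs[OF T V g])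
      also have "\<dots> = Comp C (G_ob (F_ob S)) V (G_ob (F_ob V)) (s V) (Comp C (G_ob (F_ob S)) T V g ?fs)"
        by (rule C.Comp_assoc[OF o T V oV 1 g sH[OF V], symmetric])
      also have "Comp C (G_ob (F_ob S)) T V g ?fs = Comp C (G_ob (F_ob S)) S V (Comp C S T V g f) (s' S)"
        by (rule C.Comp_assoc[OF o S T V s'H[OF S] f g])
      finally show "G_mor (F_ob S) (F_ob V) (Comp D (F_ob S) (F_ob T) (F_ob V) (F_mor T V g) (F_mor S T f))
        = Comp C (G_ob (F_ob S)) V (G_ob (F_ob V)) (s V) (Comp C (G_ob (F_ob S)) S V (Comp C S T V g f) (s' S))" .
    qed
  qed
  moreover have "natural_iso C C (\<lambda>X. X) (\<lambda>X Y f. f) (\<lambda>X. G_ob (F_ob X))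
      (\<lambda>X Y f. G_mor (F_ob X) (F_ob Y) (F_mor X Y f)) s"
  proof
    show "is_iso C X (G_ob (F_ob X)) (s X)" if "X \<in> Obj C" for X
      unfolding is_iso_def using sH[OF that] s'H[OF that] s's[OF that] ss'[OF that] by blast
    show "Comp C X Y (G_ob (F_ob Y)) (s Y) f
       = Comp C X (G_ob (F_ob X)) (G_ob (F_ob Y)) (G_mor (F_ob X) (F_ob Y) (F_mor X Y f)) (s X)"
      if "X \<in> Obj C" "Y \<in> Obj C" "f \<in> Hom C X Y" for X Y f by (rule Gs[OF that, symmetric])
  qed
  moreover have "natural_iso D D (\<lambda>X. F_ob (G_ob X)) (\<lambda>X Y f. F_mor (G_ob X) (G_ob Y) (G_mor X Y f))
      (\<lambda>X. X) (\<lambda>X Y f. f) t"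
  proof
    fix X assume X: "X \<in> Obj D"
    let ?FG = "F_ob (G_ob X)"
    note o = GO[OF X] and FG = FO[OF GO[OF X]]
    have r: "lift X ?FG (s (G_ob X)) \<in> Hom D X ?FG" "G_mor X ?FG (lift X ?FG (s (G_ob X))) = s (G_ob X)"
      using lift[OF X FG sH[OF o]] by auto
    have "Comp D ?FG X ?FG (lift X ?FG (s (G_ob X))) (t X) = Ident D ?FG"
      by (rule faithful[OF FG FG D.Comp_in_Hom[OF FG X FG tH(1)[OF X] r(1)] D.Ident_in_Hom[OF FG]])
         (simp add: G.F_Comp[OF FG X FG tH(1)[OF X] r(1)] tH(2)[OF X] r(2) ss'[OF o] G.F_Ident[OF FG])
    moreover have "Comp D X ?FG X (t X) (lift X ?FG (s (G_ob X))) = Ident D X"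
      by (rule faithful[OF X X D.Comp_in_Hom[OF X FG X r(1) tH(1)[OF X]] D.Ident_in_Hom[OF X]])
         (simp add: G.F_Comp[OF X FG X r(1) tH(1)[OF X]] tH(2)[OF X] r(2) s's[OF o] G.F_Ident[OF X])
    ultimately show "is_iso D ?FG X (t X)" unfolding is_iso_def using r(1) tH(1)[OF X] by blast
    fix Y f assume Y: "Y \<in> Obj D" and f: "f \<in> Hom D X Y"
    let ?FGY = "F_ob (G_ob Y)"
    note oY = GO[OF Y] and FGY = FO[OF GO[OF Y]] and Gf = GH[OF X Y f]
    note Ff = F(1)[OF o oY Gf]
    show "Comp D ?FG ?FGY Y (t Y) (F_mor (G_ob X) (G_ob Y) (G_mor X Y f)) = Comp D ?FG X Y f (t X)"
      by (rule faithful[OF FG Y D.Comp_in_Hom[OF FG FGY Y Ff tH(1)[OF Y]] D.Comp_in_Hom[OF FG X Y tH(1)[OF X] f]])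
         (simp add: G.F_Comp[OF FG FGY Y Ff tH(1)[OF Y]] G.F_Comp[OF FG X Y tH(1)[OF X] f] tH(2)[OF X] tH(2)[OF Y]
            s'G[OF o oY Gf])
  qed
  ultimately show ?thesis unfolding equivalent_categories_def using C D G by blast
qed

lemma lie_category_objectD:
  assumes "X \<in> Obj (lie_category R)"
  shows "involutive_lie_algebra R X" "zero_perfect R X" "zero_module (H2_gr_homology R X)"
  using assms by (auto simp: lie_category_def involutive_lie_algebra_def involutive_lie_algebra_axioms_def)

lemma linear_hom_compose:
  assumes "f \<in> linear_hom R S T" "g \<in> linear_hom R T U" "module R S"
  shows "compose (carrier S) g f \<in> linear_hom R S U"
proof -
  have "linear_map R S U (\<lambda>x. g (f x))"
    by (rule linear_map_comp[OF linear_homD[OF assms(1)] linear_homD[OF assms(2)]])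
  from linear_map_restrict[OF assms(3) this] show ?thesis unfolding compose_def .
qed

lemma linear_hom_ident:
  assumes "module R S"
  shows "(\<lambda>x\<in>carrier S. x) \<in> linear_hom R S S"
  by (rule linear_map_restrict[OF assms]) (simp add: linear_map_def)

lemma extensional_compose_ident:
  assumes "f \<in> extensional A" "f \<in> A \<rightarrow> B"
  shows "compose A f (\<lambda>x\<in>A. x) = f" "compose A (\<lambda>x\<in>B. x) f = f"
  using assms by (auto simp: compose_def extensional_def fun_eq_iff Pi_iff)

lemma jts_homD:
  assumes "f \<in> jts_hom R S T"
  shows "f \<in> linear_hom R S T" "f \<in> extensional (carrier S)" "f \<in> carrier S \<rightarrow> carrier T"
    "\<And>a b c. \<lbrakk>a \<in> carrier S; b \<in> carrier S; c \<in> carrier S\<rbrakk> \<Longrightarrow> f (triple S a b c) = triple T (f a) (f b) (f c)"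
  using assms by (auto simp: jts_hom_def linear_hom_def linear_map_def)

lemma jts_category: "is_category (jts_category R)"
proof
  fix X assume "X \<in> Obj (jts_category R)"
  then interpret X: jordan_triple_system R X by (simp add: jts_category_def)
  show "Ident (jts_category R) X \<in> Hom (jts_category R) X X"
    using linear_hom_ident[OF X.module_axioms] X.triple_closed by (simp add: jts_category_def jts_hom_def)
next
  fix X Y Z f g
  assume X: "X \<in> Obj (jts_category R)" and Z: "Z \<in> Obj (jts_category R)"
    and f: "f \<in> Hom (jts_category R) X Y" and g: "g \<in> Hom (jts_category R) Y Z"
  interpret X: jordan_triple_system R X using X by (simp add: jts_category_def)
  have f': "f \<in> jts_hom R X Y" and g': "g \<in> jts_hom R Y Z" using f g by (simp_all add: jts_category_def)
  have "compose (carrier X) g f \<in> jts_hom R X Z"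
    using linear_hom_compose[OF jts_homD(1)[OF f'] jts_homD(1)[OF g'] X.module_axioms]
      jts_homD(3,4)[OF f'] jts_homD(4)[OF g'] X.triple_closed
    by (auto simp: jts_hom_def compose_def Pi_iff)
  then show "Comp (jts_category R) X Y Z g f \<in> Hom (jts_category R) X Z" by (simp add: jts_category_def)
next
  fix X Y f assume "f \<in> Hom (jts_category R) X Y"
  then have f: "f \<in> jts_hom R X Y" by (simp add: jts_category_def)
  show "Comp (jts_category R) X X Y f (Ident (jts_category R) X) = f"
    "Comp (jts_category R) X Y Y (Ident (jts_category R) Y) f = f"
    using extensional_compose_ident[OF jts_homD(2,3)[OF f]] by (simp_all add: jts_category_def)
next
  fix W X Y Z f g h assume "f \<in> Hom (jts_category R) W X"
  then have f: "f \<in> jts_hom R W X" by (simp add: jts_category_def)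
  show "Comp (jts_category R) W Y Z h (Comp (jts_category R) W X Y g f)
     = Comp (jts_category R) W X Z (Comp (jts_category R) X Y Z h g) f"
    using jts_homD(3)[OF f] by (auto simp: jts_category_def compose_def fun_eq_iff Pi_iff)
qed

lemma graded_involutary_homD:
  assumes "f \<in> graded_involutary_hom R X Y"
  shows "f \<in> linear_hom R X Y" "f \<in> extensional (carrier X)" "f \<in> carrier X \<rightarrow> carrier Y"
    "\<And>x y. \<lbrakk>x \<in> carrier X; y \<in> carrier X\<rbrakk> \<Longrightarrow> f (bracket X x y) = bracket Y (f x) (f y)"
    "\<And>x i. x \<in> grade X i \<Longrightarrow> f x \<in> grade Y i"
    "\<And>x. x \<in> carrier X \<Longrightarrow> f (invol X x) = invol Y (f x)"
  using assms by (auto simp: graded_involutary_hom_def lie_hom_def linear_hom_def linear_map_def image_subset_iff)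

lemma lie_category: "is_category (lie_category R)"
proof
  fix X assume "X \<in> Obj (lie_category R)"
  then interpret X: involutive_lie_algebra R X by (rule lie_category_objectD)
  show "Ident (lie_category R) X \<in> Hom (lie_category R) X X"
    using linear_hom_ident[OF X.module_axioms] X.bracket_closed X.invol_closed X.grade_closed
    by (auto simp: lie_category_def graded_involutary_hom_def lie_hom_def linear_hom_def)
next
  fix X Y Z f g
  assume X: "X \<in> Obj (lie_category R)" and Z: "Z \<in> Obj (lie_category R)"
    and f: "f \<in> Hom (lie_category R) X Y" and g: "g \<in> Hom (lie_category R) Y Z"
  interpret X: involutive_lie_algebra R X using X by (rule lie_category_objectD)
  have f': "f \<in> graded_involutary_hom R X Y" and g': "g \<in> graded_involutary_hom R Y Z"
    using f g by (simp_all add: lie_category_def)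
  note F = graded_involutary_homD[OF f'] and G = graded_involutary_homD[OF g']
  have "compose (carrier X) g f \<in> graded_involutary_hom R X Z"
    using linear_hom_compose[OF F(1) G(1) X.module_axioms] F(3-6) G(4-6)
      X.bracket_closed X.invol_closed X.grade_closed
    unfolding graded_involutary_hom_def lie_hom_def
    by (auto simp: compose_def Pi_iff linear_hom_def)
  then show "Comp (lie_category R) X Y Z g f \<in> Hom (lie_category R) X Z" by (simp add: lie_category_def)
next
  fix X Y f assume "f \<in> Hom (lie_category R) X Y"
  then have f: "f \<in> graded_involutary_hom R X Y" by (simp add: lie_category_def)
  show "Comp (lie_category R) X X Y f (Ident (lie_category R) X) = f"
    "Comp (lie_category R) X Y Y (Ident (lie_category R) Y) f = f"
    using extensional_compose_ident[OF graded_involutary_homD(2,3)[OF f]] by (simp_all add: lie_category_def)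
next
  fix W X Y Z f g h assume "f \<in> Hom (lie_category R) W X"
  then have f: "f \<in> graded_involutary_hom R W X" by (simp add: lie_category_def)
  show "Comp (lie_category R) W Y Z h (Comp (lie_category R) W X Y g f)
     = Comp (lie_category R) W X Z (Comp (lie_category R) X Y Z h g) f"
    using graded_involutary_homD(3)[OF f] by (auto simp: lie_category_def compose_def fun_eq_iff Pi_iff)
qed

lemma jts_functor: "cat_functor (lie_category R) (jts_category R) jts_of (\<lambda>X Y f. restrict f (grade X (-1)))"
proof
  fix X assume X: "X \<in> Obj (lie_category R)"
  interpret X: involutive_lie_algebra R X using X by (rule lie_category_objectD)
  show "jts_of X \<in> Obj (jts_category R)" using X.jts_of_jordan_triple_system by (simp add: jts_category_def)
  show "restrict (Ident (lie_category R) X) (grade X (-1)) = Ident (jts_category R) (jts_of X)"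
    using X.grade_closed by (auto simp: lie_category_def jts_category_def)
  fix Y f assume Y: "Y \<in> Obj (lie_category R)" and "f \<in> Hom (lie_category R) X Y"
  then have f: "f \<in> graded_involutary_hom R X Y" by (simp add: lie_category_def)
  note F = graded_involutary_homD[OF f]
  have "linear_map R (jts_of X) (jts_of Y) f"
    using linear_homD[OF F(1)] F(5) X.grade_closed by (auto simp: linear_map_def)
  from linear_map_restrict[OF X.jts_of_module this]
  have "restrict f (grade X (-1)) \<in> linear_hom R (jts_of X) (jts_of Y)" by simp
  moreover have "f (bracket X (bracket X a (invol X b)) c) = bracket Y (bracket Y (f a) (invol Y (f b))) (f c)"
    if "a \<in> grade X (-1)" "b \<in> grade X (-1)" "c \<in> grade X (-1)" for a b c
    using that X.grade_closed X.bracket_closed X.invol_closed by (simp add: F)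
  moreover have "bracket X (bracket X a (invol X b)) c \<in> grade X (-1)"
    if "a \<in> grade X (-1)" "b \<in> grade X (-1)" "c \<in> grade X (-1)" for a b c
    using that X.bracket_grade_0 X.invol_grade_m1 by blast
  ultimately have h: "restrict f (grade X (-1)) \<in> jts_hom R (jts_of X) (jts_of Y)"
    by (simp add: jts_hom_def)
  then show "restrict f (grade X (-1)) \<in> Hom (jts_category R) (jts_of X) (jts_of Y)"
    by (simp add: jts_category_def)
  fix Z g assume "g \<in> Hom (lie_category R) Y Z"
  show "restrict (Comp (lie_category R) X Y Z g f) (grade X (-1))
    = Comp (jts_category R) (jts_of X) (jts_of Y) (jts_of Z) (restrict g (grade Y (-1))) (restrict f (grade X (-1)))"
    using F(5) X.grade_closed by (auto simp: lie_category_def jts_category_def compose_def fun_eq_iff)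
qed

lemma infinite_times_self_eqpoll:
  assumes "infinite A"
  shows "A \<times> A \<approx> A"
  using card_of_Times_same_infinite[OF assms] by (simp add: eqpoll_iff_card_of_ordIso)

text \<open>With a pairing function a list can be folded into one element; the length is recorded as well, to
  make the folding injective.\<close>

lemma infinite_lists_lepoll:
  assumes inf: "infinite (UNIV :: 'u set)"
  shows "(UNIV :: 'u list set) \<lesssim> (UNIV :: 'u set)"
proof -
  have "(UNIV :: ('u \<times> 'u) set) \<lesssim> (UNIV :: 'u set)"
    using infinite_times_self_eqpoll[OF inf] eqpoll_imp_lepoll by (metis UNIV_Times_UNIV)
  then obtain p :: "'u \<times> 'u \<Rightarrow> 'u" where p: "inj p" by (auto simp: lepoll_def)
  have "(UNIV :: nat set) \<lesssim> (UNIV :: 'u set)" using inf by (simp add: infinite_le_lepoll)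
  then obtain n :: "nat \<Rightarrow> 'u" where n: "inj n" by (auto simp: lepoll_def)
  define e where "e xs = foldr (\<lambda>x y. p (x, y)) xs undefined" for xs
  have e: "xs = ys" if "length xs = length ys" "e xs = e ys" for xs ys
    using that by (induct rule: list_induct2) (auto simp: e_def dest: injD[OF p])
  have "inj (\<lambda>xs. p (n (length xs), e xs))"
  proof (rule injI)
    fix xs ys assume "p (n (length xs), e xs) = p (n (length ys), e ys)"
    then have "n (length xs) = n (length ys)" "e xs = e ys" using injD[OF p] by auto
    then show "xs = ys" using e injD[OF n] by blast
  qed
  then show ?thesis by (auto simp: lepoll_def)
qed

lemma free_module_lepoll:
  fixes R :: "('k, 'r) ring_scheme" and B :: "'b set"
  assumes inf: "infinite (UNIV :: 'u set)" and "B \<lesssim> (UNIV :: 'u set)" and "carrier R \<lesssim> (UNIV :: 'u set)"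
  shows "carrier (free_module R B) \<lesssim> (UNIV :: 'u set)"
proof -
  define dec where "dec xs = (\<lambda>b. case map_of xs b of None \<Rightarrow> \<zero>\<^bsub>R\<^esub> | Some r \<Rightarrow> r)" for xs :: "('b \<times> 'k) list"
  have "carrier (free_module R B) \<subseteq> dec ` lists (B \<times> carrier R)"
  proof
    fix f assume f: "f \<in> carrier (free_module R B)"
    then have "finite {b. f b \<noteq> \<zero>\<^bsub>R\<^esub>}" by (simp add: free_module_simps)
    then obtain bs where bs: "set bs = {b. f b \<noteq> \<zero>\<^bsub>R\<^esub>}" using finite_list by blast
    have "map_of (map (\<lambda>b. (b, f b)) bs) b = (if b \<in> set bs then Some (f b) else None)" for b
      by (induct bs) auto
    then have "f = dec (map (\<lambda>b. (b, f b)) bs)" using bs by (auto simp: dec_def fun_eq_iff)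
    moreover have "map (\<lambda>b. (b, f b)) bs \<in> lists (B \<times> carrier R)" using f bs by (auto simp: free_module_simps)
    ultimately show "f \<in> dec ` lists (B \<times> carrier R)" by (rule image_eqI)
  qed
  then have "carrier (free_module R B) \<lesssim> lists (B \<times> carrier R)" by (rule subset_image_lepoll)
  also have "\<dots> \<lesssim> lists (UNIV :: 'u set)"
  proof (rule lists_lepoll_mono)
    have "B \<times> carrier R \<lesssim> (UNIV :: 'u set) \<times> (UNIV :: 'u set)" by (rule times_lepoll_mono[OF assms(2,3)])
    then show "B \<times> carrier R \<lesssim> (UNIV :: 'u set)"
      using infinite_times_self_eqpoll[OF inf] lepoll_trans2 by blast
  qed
  also have "\<dots> \<lesssim> (UNIV :: 'u set)" using infinite_lists_lepoll[OF inf] by (simp add: lists_UNIV)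
  finally show ?thesis .
qed

lemma two_unit_of_characteristic:
  assumes "field K" "characteristic K \<noteq> 2"
  shows "\<one>\<^bsub>K\<^esub> \<oplus>\<^bsub>K\<^esub> \<one>\<^bsub>K\<^esub> \<in> Units K"
proof -
  interpret K: field K by fact
  have "\<one>\<^bsub>K\<^esub> \<oplus>\<^bsub>K\<^esub> \<one>\<^bsub>K\<^esub> \<noteq> \<zero>\<^bsub>K\<^esub>"
  proof
    assume two: "\<one>\<^bsub>K\<^esub> \<oplus>\<^bsub>K\<^esub> \<one>\<^bsub>K\<^esub> = \<zero>\<^bsub>K\<^esub>"
    let ?ord = "group.ord (add_monoid K) \<one>\<^bsub>K\<^esub>"
    note monoid = group.is_monoid[OF K.a_group]
    have "\<one>\<^bsub>K\<^esub> [^]\<^bsub>add_monoid K\<^esub> (2::nat) = \<one>\<^bsub>add_monoid K\<^esub>"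
      using two by (simp add: numeral_2_eq_2 monoid.nat_pow_Suc[OF monoid] monoid.nat_pow_0[OF monoid])
    then have d: "?ord dvd 2" using group.pow_eq_id[OF K.a_group, of "\<one>\<^bsub>K\<^esub>" 2] by simp
    have "?ord \<noteq> 1" using group.ord_eq_1[OF K.a_group, of "\<one>\<^bsub>K\<^esub>"] by simp
    moreover have "?ord \<le> 2" using dvd_imp_le[OF d] by simp
    moreover have "?ord \<noteq> 0" by (rule notI) (use d in simp)
    ultimately have "?ord = 2" by linarith
    then show False using assms(2) by (simp add: characteristic_def)
  qed
  then show ?thesis by (simp add: K.field_Units)
qed

text \<open>An element of \<open>T \<oplus> U \<oplus> T\<close> is given by finitely many elements of \<open>T\<close> and scalars, so an infinite
  universe that contains \<open>T\<close> and is at least as large as the field has room for all of them.\<close>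

lemma jordan_triple_system_from_lie:
  fixes K :: "('k, 'r) ring_scheme" and T :: "('k, 'u) jordan_triple"
  assumes "field K" "characteristic K \<noteq> 2" "infinite (UNIV :: 'u set)" "carrier K \<lesssim> (UNIV :: 'u set)"
    and T: "jordan_triple_system K T"
  shows "\<exists>X\<in>Obj (lie_category K :: (('k, 'u) inv_graded_lie, 'u \<Rightarrow> 'u) category).
    \<exists>f. is_iso (jts_category K) T (jts_of X) f"
proof -
  interpret T: jordan_triple_system K T by fact
  have TT: "carrier T \<times> carrier T \<lesssim> (UNIV :: 'u set)"
    using times_lepoll_mono[of "carrier T" "UNIV :: 'u set" "carrier T" "UNIV :: 'u set"]
      infinite_times_self_eqpoll[OF assms(3)] lepoll_trans2 subset_imp_lepoll[OF subset_UNIV] by blast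
  have "carrier T.middle \<lesssim> carrier (free_module K (carrier T \<times> carrier T))"
    unfolding T.middle_def presented_module_def quot_module_simps by (rule image_lepoll)
  also have "\<dots> \<lesssim> (UNIV :: 'u set)" by (rule free_module_lepoll[OF assms(3) TT assms(4)])
  finally have "carrier T.middle \<times> carrier T \<lesssim> (UNIV :: 'u set) \<times> (UNIV :: 'u set)"
    by (rule times_lepoll_mono) (rule subset_imp_lepoll[OF subset_UNIV])
  then have "carrier T.middle \<times> carrier T \<lesssim> (UNIV :: 'u set)"
    using infinite_times_self_eqpoll[OF assms(3)] lepoll_trans2 by blast
  then have "carrier T \<times> carrier T.middle \<times> carrier T \<lesssim> (UNIV :: 'u set) \<times> (UNIV :: 'u set)"
    by (rule times_lepoll_mono[OF subset_imp_lepoll[OF subset_UNIV]])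
  then have "carrier T \<times> carrier T.middle \<times> carrier T \<lesssim> (UNIV :: 'u set)"
    using infinite_times_self_eqpoll[OF assms(3)] lepoll_trans2 by blast
  then obtain j :: "'u \<times> ('u \<times> 'u \<Rightarrow> 'k) set \<times> 'u \<Rightarrow> 'u"
    where j: "inj_on j (carrier T \<times> carrier T.middle \<times> carrier T)" by (auto simp: lepoll_def)
  interpret L: universal_lie_algebra K T j
    using two_unit_of_characteristic[OF assms(1,2)] j by unfold_locales
  let ?C = "jts_category K :: (('k, 'u) jordan_triple, 'u \<Rightarrow> 'u) category"
  let ?f = "\<lambda>a\<in>carrier T. L.mk a \<zero>\<^bsub>T.middle\<^esub> \<zero>\<^bsub>T\<^esub>" and ?g = "\<lambda>x\<in>carrier (jts_of L.lie). L.pm x"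
  have "compose (carrier T) ?g ?f = (\<lambda>a\<in>carrier T. a)"
    by (auto simp: compose_def fun_eq_iff L.gradeI L.proj_mk)
  moreover have "compose (carrier (jts_of L.lie)) ?f ?g = (\<lambda>x\<in>carrier (jts_of L.lie). x)"
    by (auto simp: compose_def fun_eq_iff L.grade_lie L.proj_mk)
  ultimately have "is_iso ?C T (jts_of L.lie) ?f"
    unfolding is_iso_def using L.jts_iso by (auto simp: jts_category_def intro!: bexI[of _ ?g])
  moreover have "L.lie \<in> Obj (lie_category K)"
    using L.lie_three_graded L.lie_involution L.lie_zero_perfect L.lie_H2 by (simp add: lie_category_def)
  ultimately show ?thesis by blast
qed

theorem theoremB:
  fixes K :: "('k, 'r) ring_scheme"
  assumes "field K" and "characteristic K \<noteq> 2" and "characteristic K \<noteq> 3"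
    and "carrier K \<lesssim> (UNIV :: 'm set)"
    and "infinite (UNIV :: 'u set)" and "carrier K \<lesssim> (UNIV :: 'u set)"
  shows
    "(\<forall>L :: ('k, 'a) inv_graded_lie.
        three_graded_lie_algebra K L \<and> anti_graded_involution K L (invol L) \<and> zero_perfect K L \<longrightarrow>
          (zero_module (H2_gr_homology K L) \<longleftrightarrow>
           (\<forall>M :: ('k, 'a, 'm) graded_lie_mod.
              graded_lie_module K L M \<and> mgrade M 0 = carrier M \<longrightarrow>
                zero_module (H2_gr_cohomology K L M)))) \<and>
     equivalent_categories
       (jts_category K :: (('k, 'u) jordan_triple, 'u \<Rightarrow> 'u) category)
       (lie_category K :: (('k, 'u) inv_graded_lie, 'u \<Rightarrow> 'u) category)"
proof (intro conjI allI impI)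
  fix L :: "('k, 'a) inv_graded_lie"
  assume L: "three_graded_lie_algebra K L \<and> anti_graded_involution K L (invol L) \<and> zero_perfect K L"
  then interpret L: three_graded_lie_algebra K L by blast
  obtain j :: "'k \<Rightarrow> 'm" where j: "inj_on j (carrier K)" using assms(4) by (auto simp: lepoll_def)
  show "zero_module (H2_gr_homology K L) \<longleftrightarrow>
           (\<forall>M :: ('k, 'a, 'm) graded_lie_mod.
              graded_lie_module K L M \<and> mgrade M 0 = carrier M \<longrightarrow>
                zero_module (H2_gr_cohomology K L M))"
  proof (intro iffI allI impI)
    fix M :: "('k, 'a, 'm) graded_lie_mod"
    assume "zero_module (H2_gr_homology K L)" "graded_lie_module K L M \<and> mgrade M 0 = carrier M"
    then show "zero_module (H2_gr_cohomology K L M)"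
      using L by (intro L.H2_cohomology_vanishes) auto
  next
    assume *: "\<forall>M :: ('k, 'a, 'm) graded_lie_mod. graded_lie_module K L M \<and> mgrade M 0 = carrier M \<longrightarrow>
      zero_module (H2_gr_cohomology K L M)"
    show "zero_module (H2_gr_homology K L)"
      by (rule L.H2_homology_vanishes[OF assms(1) j]) (use * in blast)
  qed
next
  let ?D = "lie_category K :: (('k, 'u) inv_graded_lie, 'u \<Rightarrow> 'u) category"
  show "equivalent_categories (jts_category K :: (('k, 'u) jordan_triple, 'u \<Rightarrow> 'u) category) ?D"
  proof (rule equivalent_categories_if_fully_faithful[OF jts_category lie_category jts_functor])
    fix X Y :: "('k, 'u) inv_graded_lie" and f
    assume X: "X \<in> Obj ?D" and Y: "Y \<in> Obj ?D" and f: "f \<in> Hom (jts_category K) (jts_of X) (jts_of Y)"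
    interpret jts_hom_extension K X Y f
      using lie_category_objectD[OF X] lie_category_objectD[OF Y] f
      by (intro jts_hom_extension.intro jts_hom_extension_axioms.intro) (simp_all add: jts_category_def)
    show "\<exists>g\<in>Hom ?D X Y. restrict g (grade X (-1)) = f"
      using jts_hom_extends by (simp add: lie_category_def)
  next
    fix X Y :: "('k, 'u) inv_graded_lie" and f g
    assume X: "X \<in> Obj ?D" and Y: "Y \<in> Obj ?D" and f: "f \<in> Hom ?D X Y" and g: "g \<in> Hom ?D X Y"
      and eq: "restrict f (grade X (-1)) = restrict g (grade X (-1))"
    show "f = g"
    proof (rule graded_involutary_hom_eqI[OF lie_category_objectD(1)[OF X] lie_category_objectD(1)[OF Y]
          lie_category_objectD(2)[OF X]])
      show "f x = g x" if "x \<in> grade X (-1)" for x using fun_cong[OF eq, of x] that by simp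
    qed (use f g in \<open>simp_all add: lie_category_def\<close>)
  next
    fix T :: "('k, 'u) jordan_triple"
    assume "T \<in> Obj (jts_category K)"
    then show "\<exists>X\<in>Obj ?D. \<exists>f. is_iso (jts_category K) T (jts_of X) f"
      using jordan_triple_system_from_lie[OF assms(1,2,5,6)] by (simp add: jts_category_def)
  qed
qed

end
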